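(* Up to isomorphism, $C(\Gamma)$ is the only homogeneous 3-graph $(M;R,S,T)$ such that: the theory of $M$ is simple and unstable; the reflexive closure of $R$ is a nontrivial proper equivalence relation on $M$ all of whose classes are finite; and all three predicates $R,S,T$ are realised in the union of any two distinct $R$-classes.
   Context: A 3-graph is a structure $(M;R,S,T)$ in which $R,S,T$ are binary, irreflexive and symmetric, and for all distinct $x,y\in M$ exactly one of $R(x,y),S(x,y),T(x,y)$ holds. It is homogeneous if $M$ is countable and every isomorphism between finite substructures of $M$ extends to an automorphism of $M$. For a homogeneous 3-graph it is assumed that each of $R,S,T$ is realised in $M$. The 3-graph $C(\Gamma)$ is defined as follows. Let $\Gamma$ be the random (Rado) graph with edge relation $E$ and vertices enumerated as $\{w_i:i\in\omega\}$. The vertex set of $C(\Gamma)$ is $\{v_i:i\in\omega\}$. The relation $R$ holds exactly between $v_{2n}$ and $v_{2n+1}$ for each $n$. For $m\neq n$ and $\varepsilon,\delta\in\{0,1\}$, $S(v_{2m+\varepsilon},v_{2n+\delta})$ holds if either $\varepsilon=\delta$ and $E(w_m,w_n)$, or $\varepsilon\neq\delta$ and $\neg E(w_m,w_n)$. All other pairs of distinct vertices satisfy $T$. *)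

theory Defs
  imports Main "HOL-Library.Countable_Set" "HOL-Library.Infinite_Typeclass"
begin

datatype pred = Rp | Sp | Tp

text \<open>
  The values of \<open>rel\<close> outside the carrier are junk: every notion below looks
  at the relations on the carrier only.
\<close>
record 'a struc =
  carrier :: "'a set"
  rel :: "pred \<Rightarrow> 'a \<Rightarrow> 'a \<Rightarrow> bool"

definition iso :: "('a \<Rightarrow> 'b) \<Rightarrow> 'a struc \<Rightarrow> 'b struc \<Rightarrow> bool" where
  "iso f M N \<longleftrightarrow> bij_betw f (carrier M) (carrier N) \<and>
     (\<forall>p. \<forall>x\<in>carrier M. \<forall>y\<in>carrier M. rel M p x y \<longleftrightarrow> rel N p (f x) (f y))"

definition isomorphic :: "'a struc \<Rightarrow> 'b struc \<Rightarrow> bool" where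
  "isomorphic M N \<longleftrightarrow> (\<exists>f. iso f M N)"

definition substructure :: "'a struc \<Rightarrow> 'a set \<Rightarrow> 'a struc" where
  "substructure M A = M\<lparr>carrier := A\<rparr>"

definition three_graph :: "'a struc \<Rightarrow> bool" where
  "three_graph M \<longleftrightarrow>
     (\<forall>p. \<forall>x\<in>carrier M. \<not> rel M p x x) \<and>
     (\<forall>p. \<forall>x\<in>carrier M. \<forall>y\<in>carrier M. rel M p x y \<longrightarrow> rel M p y x) \<and>
     (\<forall>x\<in>carrier M. \<forall>y\<in>carrier M. x \<noteq> y \<longrightarrow> (\<exists>!p. rel M p x y))"

definition homogeneous :: "'a struc \<Rightarrow> bool" where
  "homogeneous M \<longleftrightarrow> countable (carrier M) \<and>
     (\<forall>A B f. finite A \<and> A \<subseteq> carrier M \<and> finite B \<and> B \<subseteq> carrier M \<and>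
        iso f (substructure M A) (substructure M B) \<longrightarrow>
        (\<exists>g. iso g M M \<and> (\<forall>x\<in>A. g x = f x)))"

definition realised_in :: "'a struc \<Rightarrow> pred \<Rightarrow> 'a set \<Rightarrow> bool" where
  "realised_in M p A \<longleftrightarrow> (\<exists>x\<in>A. \<exists>y\<in>A. rel M p x y)"

definition homogeneous_three_graph :: "'a struc \<Rightarrow> bool" where
  "homogeneous_three_graph M \<longleftrightarrow>
     three_graph M \<and> homogeneous M \<and> (\<forall>p. realised_in M p (carrier M))"

datatype fm =
    Eq nat nat
  | Atom pred nat nat
  | Neg fm
  | Conj fm fm
  | Ex nat fm

primrec fv :: "fm \<Rightarrow> nat set" where
  "fv (Eq i j) = {i, j}"
| "fv (Atom p i j) = {i, j}"
| "fv (Neg \<phi>) = fv \<phi>"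
| "fv (Conj \<phi> \<psi>) = fv \<phi> \<union> fv \<psi>"
| "fv (Ex i \<phi>) = fv \<phi> - {i}"

primrec sat :: "'a struc \<Rightarrow> (nat \<Rightarrow> 'a) \<Rightarrow> fm \<Rightarrow> bool" where
  "sat M e (Eq i j) \<longleftrightarrow> e i = e j"
| "sat M e (Atom p i j) \<longleftrightarrow> rel M p (e i) (e j)"
| "sat M e (Neg \<phi>) \<longleftrightarrow> \<not> sat M e \<phi>"
| "sat M e (Conj \<phi> \<psi>) \<longleftrightarrow> sat M e \<phi> \<and> sat M e \<psi>"
| "sat M e (Ex i \<phi>) \<longleftrightarrow> (\<exists>x\<in>carrier M. sat M (e(i := x)) \<phi>)"

definition true_in :: "'a struc \<Rightarrow> fm \<Rightarrow> bool" where
  "true_in M \<phi> \<longleftrightarrow> (\<forall>e. range e \<subseteq> carrier M \<longrightarrow> sat M e \<phi>)"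

definition theory_of :: "'a struc \<Rightarrow> fm set" where
  "theory_of M = {\<phi>. fv \<phi> = {} \<and> true_in M \<phi>}"

definition model_of :: "'a struc \<Rightarrow> fm set \<Rightarrow> bool" where
  "model_of N Th \<longleftrightarrow> carrier N \<noteq> {} \<and> (\<forall>\<phi>\<in>Th. true_in N \<phi>)"

definition tuples :: "'a struc \<Rightarrow> nat \<Rightarrow> 'a list set" where
  "tuples N n = {xs. length xs = n \<and> set xs \<subseteq> carrier N}"

text \<open>
  A partitioned formula \<open>\<phi>(x;y)\<close>, with \<open>x\<close> an \<open>n\<close>-tuple and \<open>y\<close> an \<open>m\<close>-tuple of
  variables, is a formula with free variables below \<open>n + m\<close>; the first \<open>n\<close>
  variables form \<open>x\<close> and the remaining ones form \<open>y\<close>.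
\<close>
definition partitioned :: "fm \<Rightarrow> nat \<Rightarrow> nat \<Rightarrow> bool" where
  "partitioned \<phi> n m \<longleftrightarrow> fv \<phi> \<subseteq> {..<n + m}"

definition holds :: "'a struc \<Rightarrow> fm \<Rightarrow> 'a list \<Rightarrow> 'a list \<Rightarrow> bool" where
  "holds N \<phi> a b \<longleftrightarrow> sat N (\<lambda>i. (a @ b) ! i) \<phi>"

text \<open>
  The tree property of \<open>\<phi>(x;y)\<close>, witnessed in \<open>N\<close> by parameters \<open>c\<^sub>s\<close> indexed by
  the nonempty finite sequences \<open>s\<close> of naturals: for some \<open>k \<ge> 2\<close>, the formulas
  \<open>\<phi>(x;c\<^sub>t)\<close> with \<open>t\<close> ranging over the immediate successors of any fixed \<open>s\<close> are
  \<open>k\<close>-inconsistent, while the formulas along each infinite branch \<open>\<sigma>\<close> are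
  consistent, that is, finitely satisfiable in \<open>N\<close>.
\<close>
definition tree_property :: "'u struc \<Rightarrow> fm \<Rightarrow> nat \<Rightarrow> nat \<Rightarrow> bool" where
  "tree_property N \<phi> n m \<longleftrightarrow>
     (\<exists>k\<ge>2. \<exists>c :: nat list \<Rightarrow> 'u list.
        (\<forall>s. c s \<in> tuples N m) \<and>
        (\<forall>s I. finite I \<and> card I = k \<longrightarrow>
           \<not> (\<exists>a\<in>tuples N n. \<forall>i\<in>I. holds N \<phi> a (c (s @ [i])))) \<and>
        (\<forall>\<sigma> :: nat \<Rightarrow> nat. \<forall>l.
           \<exists>a\<in>tuples N n. \<forall>j\<in>{1..l}. holds N \<phi> a (c (map \<sigma> [0..<j]))))"

definition order_property :: "'u struc \<Rightarrow> fm \<Rightarrow> nat \<Rightarrow> nat \<Rightarrow> bool" where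
  "order_property N \<phi> n m \<longleftrightarrow>
     (\<exists>a b :: nat \<Rightarrow> 'u list.
        (\<forall>i. a i \<in> tuples N n \<and> b i \<in> tuples N m) \<and>
        (\<forall>i j. holds N \<phi> (a i) (b j) \<longleftrightarrow> i < j))"

text \<open>
  Both notions quantify over all models of the theory.  In HOL such a quantifier
  ranges over the models whose elements are drawn from one type \<open>'u\<close>, which is
  therefore a parameter.  It is kept arbitrary apart from being infinite, so that
  every theory of interest here has models over it; by the theorem of Loewenheim
  and Skolem the choice of \<open>'u\<close> makes no difference.
\<close>
definition simple_theory :: "'u::infinite itself \<Rightarrow> fm set \<Rightarrow> bool" where
  "simple_theory U Th \<longleftrightarrow>
     (\<forall>(N :: 'u struc) \<phi> n m.
        model_of N Th \<and> partitioned \<phi> n m \<longrightarrow> \<not> tree_property N \<phi> n m)"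

definition stable_theory :: "'u::infinite itself \<Rightarrow> fm set \<Rightarrow> bool" where
  "stable_theory U Th \<longleftrightarrow>
     (\<forall>(N :: 'u struc) \<phi> n m.
        model_of N Th \<and> partitioned \<phi> n m \<longrightarrow> \<not> order_property N \<phi> n m)"

definition R_refl :: "'a struc \<Rightarrow> ('a \<times> 'a) set" where
  "R_refl M = {(x, y). x \<in> carrier M \<and> y \<in> carrier M \<and> (x = y \<or> rel M Rp x y)}"

definition nontrivial_proper_equiv :: "'a set \<Rightarrow> ('a \<times> 'a) set \<Rightarrow> bool" where
  "nontrivial_proper_equiv A r \<longleftrightarrow> equiv A r \<and> r \<noteq> Id_on A \<and> r \<noteq> A \<times> A"

definition simple_unstable_finite_classes :: "'u::infinite itself \<Rightarrow> 'a struc \<Rightarrow> bool" where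
  "simple_unstable_finite_classes U M \<longleftrightarrow>
     homogeneous_three_graph M \<and>
     simple_theory U (theory_of M) \<and> \<not> stable_theory U (theory_of M) \<and>
     nontrivial_proper_equiv (carrier M) (R_refl M) \<and>
     (\<forall>X \<in> carrier M // R_refl M. finite X) \<and>
     (\<forall>X \<in> carrier M // R_refl M. \<forall>Y \<in> carrier M // R_refl M.
        X \<noteq> Y \<longrightarrow> (\<forall>p. realised_in M p (X \<union> Y)))"

text \<open>
  \<open>E\<close> is the edge relation transported to the index set along the enumeration
  of the vertices, so that \<open>E m n\<close> says that \<open>w\<^sub>m\<close> and \<open>w\<^sub>n\<close> are adjacent.
\<close>
definition random_graph :: "(nat \<Rightarrow> nat \<Rightarrow> bool) \<Rightarrow> bool" where
  "random_graph E \<longleftrightarrow>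
     (\<forall>x. \<not> E x x) \<and> (\<forall>x y. E x y \<longrightarrow> E y x) \<and>
     (\<forall>A B. finite A \<and> finite B \<and> A \<inter> B = {} \<longrightarrow>
        (\<exists>z. z \<notin> A \<union> B \<and> (\<forall>x\<in>A. E z x) \<and> (\<forall>x\<in>B. \<not> E z x)))"

definition C_R :: "nat \<Rightarrow> nat \<Rightarrow> bool" where
  "C_R i j \<longleftrightarrow> (\<exists>n. {i, j} = {2 * n, 2 * n + 1})"

definition C_S :: "(nat \<Rightarrow> nat \<Rightarrow> bool) \<Rightarrow> nat \<Rightarrow> nat \<Rightarrow> bool" where
  "C_S E i j \<longleftrightarrow>
     (\<exists>m n \<epsilon> \<delta>. m \<noteq> n \<and> \<epsilon> \<in> {0, 1} \<and> \<delta> \<in> {0, 1} \<and>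
        i = 2 * m + \<epsilon> \<and> j = 2 * n + \<delta> \<and>
        (\<epsilon> = \<delta> \<and> E m n \<or> \<epsilon> \<noteq> \<delta> \<and> \<not> E m n))"

definition C_T :: "(nat \<Rightarrow> nat \<Rightarrow> bool) \<Rightarrow> nat \<Rightarrow> nat \<Rightarrow> bool" where
  "C_T E i j \<longleftrightarrow> i \<noteq> j \<and> \<not> C_R i j \<and> \<not> C_S E i j"

definition C_graph :: "(nat \<Rightarrow> nat \<Rightarrow> bool) \<Rightarrow> nat struc" where
  "C_graph E =
     \<lparr>carrier = UNIV,
      rel = (\<lambda>p. case p of Rp \<Rightarrow> C_R | Sp \<Rightarrow> C_S E | Tp \<Rightarrow> C_T E)\<rparr>"

text \<open>The hypothesis \<open>random_graph E\<close> is satisfiable: Rado's binary-digit graph.\<close>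
lemma random_graph_exists: "\<exists>E. random_graph E"
proof -
  define E :: "nat \<Rightarrow> nat \<Rightarrow> bool" where
    "E = (\<lambda>x y. x \<noteq> y \<and> (bit x y \<or> bit y x))"
  have nb: "\<not> bit x y" if "x < y" for x y :: nat
  proof -
    have "x < 2 ^ y" using that less_exp[of y] by (rule less_trans)
    then show ?thesis by (simp add: bit_iff_odd)
  qed
  have "\<exists>z. z \<notin> A \<union> B \<and> (\<forall>x\<in>A. E z x) \<and> (\<forall>x\<in>B. \<not> E z x)"
    if fin: "finite A" "finite B" and disj: "A \<inter> B = {}" for A B :: "nat set"
  proof -
    obtain m where m: "\<And>x. x \<in> A \<union> B \<Longrightarrow> x < m"
      using fin finite_nat_set_iff_bounded[of "A \<union> B"] by auto
    have ex: "\<exists>z::nat. \<forall>i. bit z i \<longleftrightarrow> i \<in> C" if "finite C" for C :: "nat set"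
      using that
    proof (induction C)
      case empty
      have "\<forall>i. bit (0::nat) i \<longleftrightarrow> i \<in> {}" by simp
      then show ?case by blast
    next
      case (insert c C)
      then obtain z :: nat where z: "\<forall>i. bit z i \<longleftrightarrow> i \<in> C" by blast
      have "\<forall>i. bit (set_bit c z) i \<longleftrightarrow> i \<in> insert c C"
        using z by (auto simp: bit_simps)
      then show ?case by blast
    qed
    obtain z :: nat where z: "\<forall>i. bit z i \<longleftrightarrow> i \<in> insert m A"
      using ex[of "insert m A"] fin by blast
    have "m \<le> z" using z nb[of z m] by (meson insertI1 not_less)
    then have big: "x < z" if "x \<in> A \<union> B" for x using m[OF that] by simp
    have "z \<notin> A \<union> B" using big by blast
    moreover have "\<forall>x\<in>A. E z x" using z big by (auto simp: E_def)
    moreover have "\<forall>x\<in>B. \<not> E z x"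
      using z big m disj nb by (auto simp: E_def)
    ultimately show ?thesis by blast
  qed
  then have "random_graph E" by (auto simp: random_graph_def E_def)
  then show ?thesis by blast
qed

end

theory Submission
  imports Defs "HOL-Library.Ramsey"
begin

text \<open>
  Call \<open>M\<close> a random cover if each point has a unique \<open>R\<close>-partner (its mate), a point outside a
  pair is \<open>S\<close>-related to exactly one of its two members, and every \<open>S\<close>/\<open>T\<close>-pattern over a finite
  set without mates is realised.  The graph \<open>C(\<Gamma>)\<close> is a random cover, and a back-and-forth
  argument makes countable random covers isomorphic and homogeneous.  The theorem
  therefore has two halves: a random cover has a simple unstable theory, and every structure
  with the listed properties is a random cover (\<open>is_random_cover\<close>).

  Uniqueness.  Homogeneity gives quantifier elimination in all models of the theory
  (\<open>quantifier_elimination\<close>), so Ramsey's theorem turns the order property into arbitrarily long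
  half graphs between single points (\<open>long_kind_half_graphs\<close>); as \<open>R\<close>-closeness is an equivalence
  relation, the two relations of these half graphs are \<open>S\<close> and \<open>T\<close>.  Consider next the \<open>S\<close>-neighbours
  of a point in another class.  Transpositions of two equally coloured points of the class extend
  to automorphisms fixing the outside point; a count shows that either one of the two colours
  occurs just once, or all points of the other class induce the same partition of this class into
  two halves (\<open>thin_or_halves\<close>).  If classes have three or more points, the first case makes a
  cross relation transitive, which rules out half graphs (\<open>matching_small\<close>), and the second
  contradicts homogeneity (\<open>no_halves\<close>).  Thus classes are pairs.

  It remains to see that every finite graph arises as the \<open>S\<close>-graph on a set of points from
  different pairs.  Passing to mates switches such a graph at a vertex, so these graphs form a
  class closed under switching and embeddings; it has amalgamation for vertices that are neither
  twins nor antitwins, since these are the vertices that cannot be forced to be equal or mates.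
  The half graphs, by Ramsey's theorem again, put a vertex together with an arbitrarily long
  clique on which it splits in both colours, so for some colour \<open>c\<close> the class contains all
  extensions of one vertex by \<open>c\<close>-coloured cliques, the crossing edges being arbitrary.  The
  induction of \<open>switching_class_universal\<close> now runs over all such classes at once: the graphs all
  of whose clique extensions lie in the class form again such a class, even with unrestricted
  amalgamation (\<open>star_strong\<close>), and the point is to show that for a suitable colour this derived
  class satisfies the hypothesis once more (\<open>both_parities\<close>, \<open>stars_exist\<close>).

  Simplicity.  Let a tree of parameters witness the tree property.  Below each node the siblings
  contain an infinite sunflower: some coordinates are constant and the others meet each pair only
  finitely often.  Follow a branch that at each node picks a member of the sunflower away from all
  earlier parameters.  A tuple of length \<open>n\<close> can be close to new parameters on at most \<open>n\<close> levels, so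
  on some level the solution of the branch is related to the varying coordinates by \<open>S\<close> and \<open>T\<close>
  only.  Random extension copies this solution to one that serves any number of siblings, against
  inconsistency.  Instability is an infinite half graph built by the extension property.
\<close>

section \<open>Classes of finite graphs closed under switching\<close>

text \<open>
  Graphs on a vertex set are arbitrary binary functions whose diagonal is junk, so equality of two
  graphs on \<open>V\<close> is this relation.
\<close>
definition agree :: "nat set \<Rightarrow> (nat \<Rightarrow> nat \<Rightarrow> bool) \<Rightarrow> (nat \<Rightarrow> nat \<Rightarrow> bool) \<Rightarrow> bool" where
  "agree V E F \<longleftrightarrow> (\<forall>x\<in>V. \<forall>y\<in>V. x \<noteq> y \<longrightarrow> E x y = F x y)"

definition symm :: "nat set \<Rightarrow> (nat \<Rightarrow> nat \<Rightarrow> bool) \<Rightarrow> bool" where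
  "symm V E \<longleftrightarrow> (\<forall>x\<in>V. \<forall>y\<in>V. E x y = E y x)"

text \<open>
  Neither twins nor antitwins over \<open>A\<close>, and hence not twins over \<open>A\<close> after any switching.
\<close>
definition untwinned :: "nat set \<Rightarrow> (nat \<Rightarrow> nat \<Rightarrow> bool) \<Rightarrow> nat \<Rightarrow> nat \<Rightarrow> bool" where
  "untwinned A E b c \<longleftrightarrow> (\<exists>x\<in>A. E b x \<noteq> E c x) \<and> (\<exists>x\<in>A. E b x = E c x)"

lemma symmD: "\<lbrakk>symm V E; x \<in> V; y \<in> V\<rbrakk> \<Longrightarrow> E x y = E y x"
  by (simp add: symm_def)

lemma symmI: "(\<And>x y. \<lbrakk>x \<in> V; y \<in> V\<rbrakk> \<Longrightarrow> E x y = E y x) \<Longrightarrow> symm V E"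
  by (simp add: symm_def)

lemma symm_subset: "\<lbrakk>symm V E; W \<subseteq> V\<rbrakk> \<Longrightarrow> symm W E"
  unfolding symm_def by blast

lemma agreeD: "\<lbrakk>agree V E F; x \<in> V; y \<in> V; x \<noteq> y\<rbrakk> \<Longrightarrow> E x y = F x y"
  by (simp add: agree_def)

lemma agreeI: "(\<And>x y. \<lbrakk>x \<in> V; y \<in> V; x \<noteq> y\<rbrakk> \<Longrightarrow> E x y = F x y) \<Longrightarrow> agree V E F"
  by (simp add: agree_def)

text \<open>
  The motivating instance is the class of finite \<open>S\<close>-graphs on transversals of a homogeneous structure
  whose \<open>R\<close>-classes are pairs: replacing a point by its mate switches the graph at a vertex, and two
  amalgamated points can only collapse into one pair if they are twins or antitwins over the base.
\<close>
locale switching_class =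
  fixes G :: "nat set \<Rightarrow> (nat \<Rightarrow> nat \<Rightarrow> bool) \<Rightarrow> bool"
  assumes G_finite: "G V E \<Longrightarrow> finite V"
    and G_symm: "G V E \<Longrightarrow> symm V E"
    and embed: "\<lbrakk>G V E; inj_on f W; f ` W \<subseteq> V;
        \<And>x y. \<lbrakk>x \<in> W; y \<in> W; x \<noteq> y\<rbrakk> \<Longrightarrow> F x y = (E (f x) (f y) \<noteq> ((s :: nat \<Rightarrow> bool) x \<noteq> s y))\<rbrakk> \<Longrightarrow> G W F"
    and amalg: "\<lbrakk>G (insert b A) E; G (insert c A) E; b \<notin> A; c \<notin> A; b \<noteq> c; untwinned A E b c\<rbrakk> \<Longrightarrow>
        \<exists>E'. agree (insert b A) E E' \<and> agree (insert c A) E E' \<and> G (insert b (insert c A)) E'"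

locale strong_switching_class = switching_class +
  assumes strong_amalg: "\<lbrakk>G (insert b A) E; G (insert c A) E; b \<notin> A; c \<notin> A; b \<noteq> c\<rbrakk> \<Longrightarrow>
        \<exists>E'. agree (insert b A) E E' \<and> agree (insert c A) E E' \<and> G (insert b (insert c A)) E'"

definition clq :: "bool \<Rightarrow> nat set \<Rightarrow> (nat \<Rightarrow> nat \<Rightarrow> bool) \<Rightarrow> bool" where
  "clq c J E \<longleftrightarrow> (\<forall>x\<in>J. \<forall>y\<in>J. x \<noteq> y \<longrightarrow> E x y = c)"

text \<open>
  The parity of the number of edges of a triple, which is the invariant of a triple under
  switching.
\<close>
definition par :: "(nat \<Rightarrow> nat \<Rightarrow> bool) \<Rightarrow> nat \<Rightarrow> nat \<Rightarrow> nat \<Rightarrow> bool" where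
  "par E x y z \<longleftrightarrow> (E x y \<noteq> (E y z \<noteq> E x z))"

text \<open>
  A vertex that is \<open>M\<close>-mixed over a clique meets any \<open>M\<close> prescribed adjacencies at suitable members
  of the clique.
\<close>
definition mixed :: "nat \<Rightarrow> (nat \<Rightarrow> nat \<Rightarrow> bool) \<Rightarrow> nat \<Rightarrow> nat set \<Rightarrow> bool" where
  "mixed M E v J \<longleftrightarrow> M \<le> card {j\<in>J. E v j} \<and> M \<le> card {j\<in>J. \<not> E v j}"

text \<open>
  The derived class that drives the induction: all extensions of \<open>E\<close> by a clique of colour \<open>c\<close>
  belong to \<open>G\<close>, whatever the edges between \<open>A\<close> and the clique.
\<close>
definition star :: "(nat set \<Rightarrow> (nat \<Rightarrow> nat \<Rightarrow> bool) \<Rightarrow> bool) \<Rightarrow> bool \<Rightarrow> nat set \<Rightarrow> (nat \<Rightarrow> nat \<Rightarrow> bool) \<Rightarrow> bool" where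
  "star G c A E \<longleftrightarrow> finite A \<and> symm A E \<and>
     (\<forall>J F. finite J \<and> J \<inter> A = {} \<and> symm (A \<union> J) F \<and> agree A E F \<and> clq c J F \<longrightarrow> G (A \<union> J) F)"

lemma starD: "\<lbrakk>star G c A E; finite J; J \<inter> A = {}; symm (A \<union> J) F; agree A E F; clq c J F\<rbrakk> \<Longrightarrow> G (A \<union> J) F"
  unfolding star_def by blast

lemma fresh_copy:
  assumes "finite (J::nat set)" "finite (B::nat set)"
  obtains g where "inj_on g J" "g ` J \<inter> B = {}"
proof -
  obtain m where m: "\<forall>x\<in>B. x < m" using assms(2) finite_nat_set_iff_bounded by blast
  have "inj_on (\<lambda>x. x + m) J" by (auto simp: inj_on_def)
  moreover have "(\<lambda>x. x + m) ` J \<inter> B = {}" using m by fastforce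
  ultimately show ?thesis using that by blast
qed

context switching_class begin

lemma embed_id: "\<lbrakk>G V E; W \<subseteq> V; agree W E F\<rbrakk> \<Longrightarrow> G W F"
  by (rule embed[of V E "\<lambda>x. x" W F "\<lambda>_. False"]) (auto simp: agree_def)

lemma subset: "\<lbrakk>G V E; W \<subseteq> V\<rbrakk> \<Longrightarrow> G W E"
  by (rule embed_id) (auto simp: agree_def)

text \<open>
  The points of \<open>K\<close> are amalgamated with \<open>k\<close> one after the other, which leaves only the edges between
  \<open>k\<close> and \<open>K\<close> undetermined.
\<close>
lemma amalg_point:
  assumes "finite K" "G (B \<union> K) E" "G (insert k B) E" "k \<notin> B \<union> K" "K \<inter> B = {}"
    and "\<forall>x\<in>K. untwinned B E x k \<or> strong_switching_class G"
  shows "\<exists>E'. agree (B \<union> K) E E' \<and> agree (insert k B) E E' \<and> G (insert k (B \<union> K)) E'"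
  using assms
proof (induction K)
  case empty
  then show ?case by (intro exI[of _ E]) (auto simp: agree_def)
next
  case (insert x K)
  have "G (B \<union> K) E" by (rule subset[OF insert.prems(1)]) blast
  then have "\<exists>E'. agree (B \<union> K) E E' \<and> agree (insert k B) E E' \<and> G (insert k (B \<union> K)) E'"
  proof (rule insert.IH)
    show "G (insert k B) E" by (rule insert.prems(2))
    show "k \<notin> B \<union> K" "K \<inter> B = {}" using insert.prems(3,4) by auto
    show "\<forall>x\<in>K. untwinned B E x k \<or> strong_switching_class G" using insert.prems(5) by blast
  qed
  then obtain E1 where E1: "agree (B \<union> K) E E1" "agree (insert k B) E E1" "G (insert k (B \<union> K)) E1"
    by blast
  define E2 where "E2 = (\<lambda>y z. if y = k \<or> z = k then E1 y z else E y z)"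
  have a: "G (insert k (B \<union> K)) E2"
  proof (rule embed_id[OF E1(3) order.refl])
    show "agree (insert k (B \<union> K)) E1 E2" unfolding agree_def
    proof (intro ballI impI)
      fix y z assume yz: "y \<in> insert k (B \<union> K)" "z \<in> insert k (B \<union> K)" "y \<noteq> z"
      show "E1 y z = E2 y z"
      proof (cases "y = k \<or> z = k")
        case False
        then have "E y z = E1 y z" using E1(1) yz by (simp add: agree_def)
        then show ?thesis using False by (simp add: E2_def)
      qed (auto simp: E2_def)
    qed
  qed
  have kx: "k \<noteq> x" "x \<notin> B \<union> K" using insert by auto
  have b: "G (insert x (B \<union> K)) E2"
  proof (rule embed_id[OF insert.prems(1)])
    show "agree (insert x (B \<union> K)) E E2"
    proof (rule agreeI)
      fix y z assume "y \<in> insert x (B \<union> K)" "z \<in> insert x (B \<union> K)"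
      then have "y \<noteq> k" "z \<noteq> k" using kx insert.prems(3) by blast+
      then show "E y z = E2 y z" by (simp add: E2_def)
    qed
  qed simp
  have "\<exists>E'. agree (insert x (B \<union> K)) E2 E' \<and> agree (insert k (B \<union> K)) E2 E' \<and> G (insert x (insert k (B \<union> K))) E'"
  proof (cases "strong_switching_class G")
    case True
    interpret S: strong_switching_class G by fact
    show ?thesis by (rule S.strong_amalg[OF b a]) (use kx insert.prems(3) in auto)
  next
    case False
    then have "untwinned B E x k" using insert.prems(5) by blast
    moreover have "E2 x y = E x y" "E2 k y = E k y" if "y \<in> B" for y
    proof -
      have "y \<noteq> k" using that insert.prems(3) by blast
      then show "E2 x y = E x y" "E2 k y = E k y" using that kx E1(2) by (simp_all add: E2_def agree_def)
    qed
    ultimately have "untwinned (B \<union> K) E2 x k" unfolding untwinned_def by blast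
    show ?thesis by (rule amalg[OF b a]) (use kx insert.prems(3) \<open>untwinned (B \<union> K) E2 x k\<close> in auto)
  qed
  then obtain E' where E': "agree (insert x (B \<union> K)) E2 E'" "agree (insert k (B \<union> K)) E2 E'"
     "G (insert x (insert k (B \<union> K))) E'" by blast
  have "agree (B \<union> insert x K) E E'"
  proof (rule agreeI)
    fix y z assume yz: "y \<in> B \<union> insert x K" "z \<in> B \<union> insert x K" "y \<noteq> z"
    have "E2 y z = E' y z" by (rule agreeD[OF E'(1)]) (use yz in blast)+
    moreover have "y \<noteq> k" "z \<noteq> k" using yz kx insert.prems(3) by blast+
    ultimately show "E y z = E' y z" by (simp add: E2_def)
  qed
  moreover have "agree (insert k B) E E'" unfolding agree_def
  proof (intro ballI impI)
    fix y z assume yz: "y \<in> insert k B" "z \<in> insert k B" "y \<noteq> z"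
    have "E2 y z = E' y z" by (rule agreeD[OF E'(2)]) (use yz in blast)+
    moreover have "E y z = E1 y z" by (rule agreeD[OF E1(2) yz])
    ultimately show "E y z = E' y z" by (simp add: E2_def split: if_splits)
  qed
  moreover have "insert k (B \<union> insert x K) = insert x (insert k (B \<union> K))" by blast
  then have "G (insert k (B \<union> insert x K)) E'" using E'(3) by simp
  ultimately show ?case by blast
qed

lemma star_G: "star G c A E \<Longrightarrow> G A E"
  using starD[of G c A E "{}" E] by (auto simp: star_def agree_def clq_def)

lemma star_embed:
  assumes "star G c V E" "inj_on f W" "f ` W \<subseteq> V"
     "\<And>x y. \<lbrakk>x \<in> W; y \<in> W; x \<noteq> y\<rbrakk> \<Longrightarrow> F x y = (E (f x) (f y) \<noteq> ((s :: nat \<Rightarrow> bool) x \<noteq> s y))"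
  shows "star G c W F"
proof -
  have fV: "finite V" "symm V E" using assms(1) by (auto simp: star_def)
  then have fW: "finite W" using assms(2,3) by (meson finite_imageD finite_subset)
  have "G (W \<union> J) F'" if J: "finite J" "J \<inter> W = {}" "symm (W \<union> J) F'" "agree W F F'" "clq c J F'" for J F'
  proof -
    obtain g where g: "inj_on g J" "g ` J \<inter> V = {}" using fresh_copy[OF J(1) fV(1)] .
    define h where "h = (\<lambda>x. if x \<in> J then g x else f x)"
    define iv where "iv = the_inv_into (W \<union> J) h"
    have hinj: "inj_on h (W \<union> J)"
    proof -
      have "inj_on h W" using assms(2) J(2) by (auto simp: h_def inj_on_def)
      moreover have "inj_on h J" using g by (auto simp: h_def inj_on_def)
      moreover have "h ` (W - J) \<subseteq> V" using assms(3) by (auto simp: h_def)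
      moreover have "h ` (J - W) \<inter> V = {}" using g(2) by (auto simp: h_def)
      ultimately show ?thesis by (auto simp: inj_on_Un)
    qed
    have iv: "\<And>x. x \<in> W \<union> J \<Longrightarrow> iv (h x) = x" unfolding iv_def using the_inv_into_f_f[OF hinj] by auto
    define s' where "s' = (\<lambda>x. x \<in> W \<and> s x)"
    define E' where "E' = (\<lambda>x y. if x \<in> V \<and> y \<in> V then E x y else
        if x \<in> h ` (W \<union> J) \<and> y \<in> h ` (W \<union> J) then F' (iv x) (iv y) \<noteq> (s' (iv x) \<noteq> s' (iv y)) else False)"
    have hJ: "\<And>x. x \<in> J \<Longrightarrow> h x = g x \<and> h x \<notin> V" using g by (auto simp: h_def)
    have hW: "\<And>x. x \<in> W \<Longrightarrow> h x = f x \<and> h x \<in> V" using J(2) assms(3) by (auto simp: h_def)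
    have "G (V \<union> g ` J) E'"
    proof (rule starD[OF assms(1)])
      have E'sym: "E' x y = E' y x" for x y
      proof -
        have "E x y = E y x" if "x \<in> V" "y \<in> V" using symmD[OF fV(2)] that by blast
        moreover have "F' (iv x) (iv y) = F' (iv y) (iv x)" if "x \<in> h ` (W \<union> J)" "y \<in> h ` (W \<union> J)"
        proof -
          have "iv x \<in> W \<union> J" "iv y \<in> W \<union> J" using that iv by force+
          then show ?thesis by (rule symmD[OF J(3)])
        qed
        ultimately show ?thesis unfolding E'_def by (cases "x \<in> V \<and> y \<in> V") auto
      qed
      show "symm (V \<union> g ` J) E'" by (rule symmI) (rule E'sym)
      show "agree V E E'" by (auto simp: agree_def E'_def)
      show "clq c (g ` J) E'" unfolding clq_def
      proof (intro ballI impI)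
        fix x y assume "x \<in> g ` J" "y \<in> g ` J" "x \<noteq> y"
        then obtain i j where ij: "i \<in> J" "j \<in> J" "x = h i" "y = h j" "i \<noteq> j" using hJ by auto
        have "iv x = i" "iv y = j" using ij iv by auto
        moreover have "x \<notin> V" "i \<notin> W" "j \<notin> W" using ij(1-3) hJ J(2) by blast+
        ultimately show "E' x y = c" using J(5) ij by (auto simp: E'_def clq_def s'_def)
      qed
    qed (use J g in auto)
    then show ?thesis
    proof (rule embed[where f=h and s=s'])
      show "h ` (W \<union> J) \<subseteq> V \<union> g ` J" using hJ hW by auto
      fix x y assume xy: "x \<in> W \<union> J" "y \<in> W \<union> J" "x \<noteq> y"
      show "F' x y = (E' (h x) (h y) \<noteq> (s' x \<noteq> s' y))"
      proof (cases "x \<in> W \<and> y \<in> W")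
        case True
        then have "E' (h x) (h y) = E (f x) (f y)" using hW[of x] hW[of y] unfolding E'_def by metis
        moreover have "F' x y = F x y" using J(4) True xy by (auto simp: agree_def)
        ultimately show ?thesis using True assms(4) xy by (auto simp: s'_def)
      next
        case False
        then have "\<not> (h x \<in> V \<and> h y \<in> V)" using hJ xy by auto
        then show ?thesis using xy iv unfolding E'_def by auto
      qed
    qed (rule hinj)
  qed
  moreover have "symm W F"
  proof (rule symmI)
    fix x y assume xy: "x \<in> W" "y \<in> W"
    then have "E (f x) (f y) = E (f y) (f x)" using symmD[OF fV(2)] assms(3) by blast
    then show "F x y = F y x" using assms(4)[OF xy] assms(4)[OF xy(2,1)] by (cases "x = y") auto
  qed
  ultimately show ?thesis using fW by (auto simp: star_def)
qed

end

lemma agree_Un: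
  assumes "symm (A \<union> B) E" "symm (A \<union> B) F" "agree A E F" "agree B E F"
    and c: "\<And>a b. \<lbrakk>a \<in> A; b \<in> B; a \<noteq> b\<rbrakk> \<Longrightarrow> E a b = F a b"
  shows "agree (A \<union> B) E F"
proof (rule agreeI)
  fix x y assume xy: "x \<in> A \<union> B" "y \<in> A \<union> B" "x \<noteq> y"
  have s: "E x y = E y x" "F x y = F y x" using symmD[OF assms(1)] symmD[OF assms(2)] xy by blast+
  consider "x \<in> A" "y \<in> A" | "x \<in> B" "y \<in> B" | "x \<in> A" "y \<in> B" | "y \<in> A" "x \<in> B" using xy by blast
  then show "E x y = F x y"
  proof cases
    case 1 then show ?thesis by (rule agreeD[OF assms(3)]) (rule xy(3))
  next
    case 2 then show ?thesis by (rule agreeD[OF assms(4)]) (rule xy(3))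
  next
    case 3 then show ?thesis by (rule c) (rule xy(3))
  next
    case 4
    then have "E y x = F y x" by (rule c) (use xy in auto)
    then show ?thesis using s by simp
  qed
qed

lemma clqD: "\<lbrakk>clq c J E; x \<in> J; y \<in> J; x \<noteq> y\<rbrakk> \<Longrightarrow> E x y = c"
  by (simp add: clq_def)

lemma clqI: "(\<And>x y. \<lbrakk>x \<in> J; y \<in> J; x \<noteq> y\<rbrakk> \<Longrightarrow> E x y = c) \<Longrightarrow> clq c J E"
  by (simp add: clq_def)

text \<open>
  Hall's condition holds trivially, so a greedy choice works.
\<close>
lemma inj_choice:
  assumes "finite L" "\<And>l. l \<in> L \<Longrightarrow> finite (A l) \<and> card L \<le> card (A l)"
  shows "\<exists>e. inj_on e L \<and> (\<forall>l\<in>L. e l \<in> A l)"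
  using assms
proof (induction L)
  case (insert x L)
  have "\<exists>e. inj_on e L \<and> (\<forall>l\<in>L. e l \<in> A l)"
  proof (rule insert.IH)
    fix l assume "l \<in> L"
    then show "finite (A l) \<and> card L \<le> card (A l)" using insert.prems[of l] insert.hyps by simp
  qed
  then obtain e where e: "inj_on e L" "\<forall>l\<in>L. e l \<in> A l" by blast
  have "card (e ` L) < card (A x)" using insert.prems[of x] insert.hyps card_image_le[of L e] by simp
  then have "\<not> A x \<subseteq> e ` L" using insert.hyps card_mono[of "e ` L" "A x"] by auto
  then obtain y where y: "y \<in> A x" "y \<notin> e ` L" by blast
  have "inj_on (e(x := y)) (insert x L)" using e(1) y(2) insert.hyps by (auto simp: inj_on_def)
  moreover have "\<forall>l\<in>insert x L. (e(x := y)) l \<in> A l" using e(2) y(1) by auto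
  ultimately show ?case by blast
qed auto

lemma mixedD: "mixed M E v J \<Longrightarrow> M \<le> card {j\<in>J. E v j = b}"
  by (cases b) (auto simp: mixed_def)

lemma fresh_vertex: "finite (V :: nat set) \<Longrightarrow> \<exists>v. v \<notin> V"
  using ex_new_if_finite infinite_UNIV_nat by blast

definition has_parity :: "(nat set \<Rightarrow> (nat \<Rightarrow> nat \<Rightarrow> bool) \<Rightarrow> bool) \<Rightarrow> bool \<Rightarrow> bool" where
  "has_parity G d \<longleftrightarrow> (\<exists>u v w E. distinct [u, v, w] \<and> par E u v w = d \<and> G {u, v, w} E)"

context switching_class begin

lemma relabel: "\<lbrakk>G V E; inj_on f W; f ` W \<subseteq> V\<rbrakk> \<Longrightarrow> G W (\<lambda>x y. E (f x) (f y))"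
  by (rule embed[of V E f W _ "\<lambda>_. False"]) auto

lemma switch: "G V E \<Longrightarrow> G V (\<lambda>x y. E x y \<noteq> ((s :: nat \<Rightarrow> bool) x \<noteq> s y))"
  by (rule embed[of V E "\<lambda>x. x" V _ s]) auto

text \<open>
  Up to switching there are only two graphs on three vertices, distinguished by their parity.
\<close>
lemma triple:
  assumes "has_parity G d" "distinct [a, b, c]" "symm {a, b, c} F" "par F a b c = d"
  shows "G {a, b, c} F"
proof -
  obtain u v w E where E: "distinct [u, v, w]" "par E u v w = d" "G {u, v, w} E"
    using assms(1) by (auto simp: has_parity_def)
  define f where "f = (\<lambda>x. if x = a then u else if x = b then v else w)"
  define s where "s = (\<lambda>x. if x = a then False else if x = b then F a b \<noteq> E u v else F a c \<noteq> E u w)"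
  have sE: "E v u = E u v" "E w u = E u w" "E w v = E v w" using symmD[OF G_symm[OF E(3)]] by blast+
  have sF: "F b a = F a b" "F c a = F a c" "F c b = F b c" using symmD[OF assms(3)] by blast+
  have d: "a \<noteq> b" "a \<noteq> c" "b \<noteq> c" using assms(2) by auto
  have bc: "F b c = (E v w \<noteq> (s b \<noteq> s c))" using d E(2) assms(4) by (auto simp: s_def par_def)
  have ab: "F a b = (E u v \<noteq> (s a \<noteq> s b))" "F a c = (E u w \<noteq> (s a \<noteq> s c))" using d by (auto simp: s_def)
  have f: "f a = u" "f b = v" "f c = w" using d by (auto simp: f_def)
  show ?thesis
  proof (rule embed[OF E(3), of f _ _ s])
    show "inj_on f {a, b, c}" using E(1) f by (auto simp: inj_on_def)
    show "f ` {a, b, c} \<subseteq> {u, v, w}" using f by auto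
    fix x y assume "x \<in> {a, b, c}" "y \<in> {a, b, c}" "x \<noteq> y"
    then show "F x y = (E (f x) (f y) \<noteq> (s x \<noteq> s y))"
      using f sE sF ab bc by (elim insertE emptyE; hypsubst) (simp_all, blast+)
  qed
qed

text \<open>
  This is Lachlan's trick.  If neither colour of the edge \<open>bd\<close> gives a member of the derived class,
  then each colour has an extension by a clique that is not in \<open>G\<close>.  Putting the two cliques
  side by side makes one clique, over which \<open>b\<close> and \<open>d\<close> can be extended separately; amalgamating
  in \<open>G\<close> decides the colour of \<open>bd\<close>, and the result contains one of the two excluded graphs.  Two
  further clique members keep \<open>b\<close> and \<open>d\<close> from being twins or antitwins, so the
  amalgamation is available without any assumption on \<open>b\<close> and \<open>d\<close>.
\<close>
lemma star_strong: "strong_switching_class (star G c)"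
proof -
  have am: "\<exists>E'. agree (insert b A) E E' \<and> agree (insert d A) E E' \<and> star G c (insert b (insert d A)) E'"
    if st: "star G c (insert b A) E" "star G c (insert d A) E" and nin: "b \<notin> A" "d \<notin> A" "b \<noteq> d" for b d A E
  proof (rule ccontr)
    assume no: "\<not> ?thesis"
    define V where "V = insert b (insert d A)"
    define Ev where "Ev = (\<lambda>val x y. if (x = b \<and> y = d) \<or> (x = d \<and> y = b) then val else E x y)"
    have fV: "finite V" using st by (auto simp: V_def star_def)
    have sb: "symm (insert b A) E" "symm (insert d A) E" using st by (auto simp: star_def)
    have sV: "symm V (Ev val)" for val
    proof (rule symmI)
      fix x y assume xy: "x \<in> V" "y \<in> V"
      show "Ev val x y = Ev val y x"
      proof (cases "(x = b \<and> y = d) \<or> (x = d \<and> y = b)")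
        case False
        then have "(x \<in> insert b A \<and> y \<in> insert b A) \<or> (x \<in> insert d A \<and> y \<in> insert d A)"
          using xy by (auto simp: V_def)
        then have "E x y = E y x" using symmD[OF sb(1)] symmD[OF sb(2)] by blast
        then show ?thesis using False by (auto simp: Ev_def)
      qed (auto simp: Ev_def)
    qed
    have agb: "agree (insert b A) E (Ev val)" "agree (insert d A) E (Ev val)" for val
      using nin by (auto simp: agree_def Ev_def)
    have "\<exists>J F. finite J \<and> J \<inter> V = {} \<and> symm (V \<union> J) F \<and> agree V (Ev val) F \<and> clq c J F \<and> \<not> G (V \<union> J) F" for val
    proof -
      have "\<not> star G c V (Ev val)" using no agb[of val] unfolding V_def by blast
      then show ?thesis using fV sV by (auto simp: star_def)
    qed
    then obtain JJ FF where JF: "\<And>val. finite (JJ val) \<and> JJ val \<inter> V = {} \<and> symm (V \<union> JJ val) (FF val) \<and>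
         agree V (Ev val) (FF val) \<and> clq c (JJ val) (FF val) \<and> \<not> G (V \<union> JJ val) (FF val)" by metis
    define J0 F0 J1 F1 where "J0 = JJ False" "F0 = FF False" "J1 = JJ True" "F1 = FF True"
    note D = J0_F0_J1_F1_def
    have J0: "finite J0" "J0 \<inter> V = {}" "symm (V \<union> J0) F0" "agree V (Ev False) F0" "clq c J0 F0" "\<not> G (V \<union> J0) F0"
      using JF[of False] by (auto simp: D)
    have J1: "finite J1" "J1 \<inter> V = {}" "symm (V \<union> J1) F1" "agree V (Ev True) F1" "clq c J1 F1" "\<not> G (V \<union> J1) F1"
      using JF[of True] by (auto simp: D)
    obtain g where g: "inj_on g J1" "g ` J1 \<inter> (V \<union> J0) = {}" using fresh_copy[OF J1(1), of "V \<union> J0"] fV J0 by auto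
    \<comment> \<open>The edges to \<open>p\<close> agree and those to \<open>q\<close> differ, so \<open>b\<close> and \<open>d\<close> are neither twins nor antitwins.\<close>
    obtain p where p: "p \<notin> V \<union> J0 \<union> g ` J1" using fresh_vertex[of "V \<union> J0 \<union> g ` J1"] fV J0 J1 by auto
    obtain q where q: "q \<notin> insert p (V \<union> J0 \<union> g ` J1)" using fresh_vertex[of "insert p (V \<union> J0 \<union> g ` J1)"] fV J0 J1 by auto
    define J where "J = insert p (insert q (J0 \<union> g ` J1))"
    define cr where "cr = (\<lambda>a j. if j \<in> J0 then F0 a j else if j \<in> g ` J1 then F1 a (the_inv_into J1 g j) else j = q \<and> a = b)"
    define F where "F = (\<lambda>x y. if x \<in> J \<and> y \<in> J then c else if x \<in> J then cr y x else if y \<in> J then cr x y else E x y)"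
    have JV: "J \<inter> V = {}" using p q g J0(2) by (auto simp: J_def)
    have fJ: "finite J" using J0 J1 by (auto simp: J_def)
    have Fcl: "clq c J F" by (auto simp: clq_def F_def)
    have FV: "F x y = E x y" if "x \<in> V" "y \<in> V" for x y using that JV by (auto simp: F_def)
    have FJ: "F x j = cr x j" "F j x = cr x j" if "x \<in> V" "j \<in> J" for x j using that JV by (auto simp: F_def)
    have ext: "G (insert z A \<union> J) F" if "z = b \<or> z = d" for z
    proof -
      have zV: "insert z A \<subseteq> V" using that by (auto simp: V_def)
      have stz: "star G c (insert z A) E" using that st by auto
      have s: "symm (insert z A) E" using stz by (auto simp: star_def)
      show ?thesis
      proof (rule starD[OF stz fJ])
        show "J \<inter> insert z A = {}" using zV JV by auto
        show "symm (insert z A \<union> J) F"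
        proof (rule symmI)
          fix x y assume "x \<in> insert z A \<union> J" "y \<in> insert z A \<union> J"
          then consider "x \<in> insert z A" "y \<in> insert z A" | "x \<in> V" "y \<in> J" | "y \<in> V" "x \<in> J" | "x \<in> J" "y \<in> J"
            using zV by blast
          then show "F x y = F y x"
          proof cases
            case 1 then show ?thesis using symmD[OF s, of x y] FV zV by (metis subsetD)
          next
            case 2 then show ?thesis using FJ by simp
          next
            case 3 then show ?thesis using FJ by simp
          next
            case 4 then show ?thesis by (simp add: F_def)
          qed
        qed
        show "agree (insert z A) E F" using FV zV by (auto simp: agree_def)
      qed (rule Fcl)
    qed
    have "\<exists>E'. agree (insert b (A \<union> J)) F E' \<and> agree (insert d (A \<union> J)) F E' \<and> G (insert b (insert d (A \<union> J))) E'"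
    proof (rule amalg)
      show "G (insert b (A \<union> J)) F" "G (insert d (A \<union> J)) F" using ext[of b] ext[of d] by auto
      show "b \<notin> A \<union> J" "d \<notin> A \<union> J" "b \<noteq> d" using nin JV by (auto simp: V_def)
      have pq: "p \<in> J" "q \<in> J" "p \<notin> J0" "p \<notin> g ` J1" "q \<notin> J0" "q \<notin> g ` J1" "p \<noteq> q" using p q by (auto simp: J_def)
      have bd: "b \<in> V" "d \<in> V" by (auto simp: V_def)
      have "F b p = F d p" using pq FJ bd by (simp add: cr_def)
      moreover have "F b q \<noteq> F d q" using pq FJ bd nin(3) by (simp add: cr_def)
      ultimately show "untwinned (A \<union> J) F b d" using pq(1,2) unfolding untwinned_def by blast
    qed
    then obtain E' where E': "agree (insert b (A \<union> J)) F E'" "agree (insert d (A \<union> J)) F E'" "G (insert b (insert d (A \<union> J))) E'" by blast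
    have sE': "E' d b = E' b d" using symmD[OF G_symm[OF E'(3)]] by blast
    have E'V: "E' x y = Ev (E' b d) x y" if "x \<in> V" "y \<in> V" "x \<noteq> y" for x y
    proof (cases "(x = b \<and> y = d) \<or> (x = d \<and> y = b)")
      case False
      then have "(x \<in> insert b (A \<union> J) \<and> y \<in> insert b (A \<union> J)) \<or> (x \<in> insert d (A \<union> J) \<and> y \<in> insert d (A \<union> J))"
        using that by (auto simp: V_def)
      then have "F x y = E' x y" using agreeD[OF E'(1)] agreeD[OF E'(2)] that(3) by blast
      then show ?thesis using FV that False by (auto simp: Ev_def)
    qed (auto simp: Ev_def sE')
    have E'J: "E' x j = cr x j" if "x \<in> V" "j \<in> J" for x j
    proof -
      have "x \<noteq> j" using that JV by auto
      moreover have "x \<in> insert b (A \<union> J) \<or> x \<in> insert d (A \<union> J)" using that by (auto simp: V_def)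
      ultimately have "F x j = E' x j" using agreeD[OF E'(1), of x j] agreeD[OF E'(2), of x j] that(2) by blast
      then show ?thesis using FJ that by simp
    qed
    have E'JJ: "E' x y = c" if "x \<in> J" "y \<in> J" "x \<noteq> y" for x y
      using agreeD[OF E'(1), of x y] that by (auto simp: F_def)
    have GV: "G (V \<union> J) E'" using E'(3) by (simp add: V_def)
    show False
    proof (cases "E' b d")
      case False
      have "agree (V \<union> J0) E' F0"
      proof (rule agree_Un)
        show "symm (V \<union> J0) E'" by (rule symm_subset[OF G_symm[OF GV]]) (auto simp: J_def)
        show "agree V E' F0" using E'V False J0(4) by (auto simp: agree_def)
        show "agree J0 E' F0" using E'JJ clqD[OF J0(5)] by (auto simp: agree_def J_def)
        show "E' a j = F0 a j" if "a \<in> V" "j \<in> J0" for a j using E'J[of a j] that by (simp add: J_def cr_def)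
      qed (rule J0(3))
      then have "G (V \<union> J0) F0" by (intro embed_id[OF GV]) (auto simp: J_def)
      then show False using J0(6) by simp
    next
      case True
      define h where "h = (\<lambda>x. if x \<in> J1 then g x else x)"
      have hV: "h x = x" if "x \<in> V" for x using that J1(2) by (auto simp: h_def)
      have hJ: "h x = g x" if "x \<in> J1" for x using that by (auto simp: h_def)
      have gJ: "g x \<in> J" "g x \<notin> J0" if "x \<in> J1" for x using that g by (auto simp: J_def)
      have "inj_on h (V \<union> J1)"
      proof -
        have "inj_on h V" using hV by (auto simp: inj_on_def)
        moreover have "inj_on h J1" using hJ g(1) by (auto simp: inj_on_def)
        moreover have "h ` (V - J1) \<subseteq> V" using hV by auto
        moreover have "h ` (J1 - V) \<inter> V = {}" using hJ g(2) by auto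
        ultimately show ?thesis by (auto simp: inj_on_Un)
      qed
      then have G1: "G (V \<union> J1) (\<lambda>x y. E' (h x) (h y))"
        by (rule relabel[OF GV]) (use hV hJ gJ in auto)
      have "agree (V \<union> J1) (\<lambda>x y. E' (h x) (h y)) F1"
      proof (rule agree_Un)
        show "symm (V \<union> J1) (\<lambda>x y. E' (h x) (h y))" by (rule G_symm[OF G1])
        show "agree V (\<lambda>x y. E' (h x) (h y)) F1" using E'V True J1(4) hV by (auto simp: agree_def)
        show "agree J1 (\<lambda>x y. E' (h x) (h y)) F1"
        proof (rule agreeI)
          fix x y assume xy: "x \<in> J1" "y \<in> J1" "x \<noteq> y"
          then have "g x \<noteq> g y" using g(1) by (auto dest: inj_onD)
          then show "E' (h x) (h y) = F1 x y" using xy hJ gJ E'JJ clqD[OF J1(5)] by simp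
        qed
        show "E' (h a) (h j) = F1 a j" if "a \<in> V" "j \<in> J1" for a j
          using E'J[of a "g j"] that gJ[of j] hV hJ the_inv_into_f_f[OF g(1)] by (simp add: cr_def)
      qed (rule J1(3))
      then have "G (V \<union> J1) F1" by (intro embed_id[OF G1]) auto
      then show False using J1(6) by simp
    qed
  qed
  show ?thesis
  proof (rule strong_switching_class.intro[OF switching_class.intro strong_switching_class_axioms.intro])
    show "finite V" if "star G c V E" for V E using that by (simp add: star_def)
    show "symm V E" if "star G c V E" for V E using that by (simp add: star_def)
    show "star G c W F" if "star G c V E" "inj_on f W" "f ` W \<subseteq> V"
      "\<And>x y. \<lbrakk>x \<in> W; y \<in> W; x \<noteq> y\<rbrakk> \<Longrightarrow> F x y = (E (f x) (f y) \<noteq> (s x \<noteq> s y))" for V E f W F and s :: "nat \<Rightarrow> bool"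
      by (rule star_embed[where f=f and s=s, OF that(1-3)]) (rule that(4))
    show "\<exists>E'. agree (insert b A) E E' \<and> agree (insert d A) E E' \<and> star G c (insert b (insert d A)) E'"
      if "star G c (insert b A) E" "star G c (insert d A) E" "b \<notin> A" "d \<notin> A" "b \<noteq> d" for b A E d
      by (rule am[OF that])
    show "\<exists>E'. agree (insert b A) E E' \<and> agree (insert d A) E E' \<and> star G c (insert b (insert d A)) E'"
      if "star G c (insert b A) E" "star G c (insert d A) E" "b \<notin> A" "d \<notin> A" "b \<noteq> d" for b A E d
      by (rule am[OF that])
  qed
qed

end

section \<open>Triples over long cliques\<close>

lemma has_parityI:
  assumes "distinct [u, v, w]" "G {u, v, w} E" "par E u v w = d"
  shows "has_parity G d"
proof -
  have "distinct [u, v, w] \<and> par E u v w = d \<and> G {u, v, w} E" using assms by simp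
  then show ?thesis unfolding has_parity_def by fast
qed

context switching_class begin

text \<open>
  A vertex that is mixed over long cliques embeds any prescribed pattern on a shorter clique.
\<close>
lemma stars_if_mixed:
  assumes "\<And>M. \<exists>J v E. v \<notin> J \<and> G (insert v J) E \<and> clq c J E \<and> mixed M E v J"
  shows "star G c {v} E"
proof -
  have "G ({v} \<union> J) F" if J: "finite J" "J \<inter> {v} = {}" "symm ({v} \<union> J) F" "clq c J F" for J F
  proof -
    obtain J' v' E' where E': "v' \<notin> J'" "G (insert v' J') E'" "clq c J' E'" "mixed (card J) E' v' J'"
      using assms[of "card J"] by blast
    have fJ': "finite J'" using G_finite[OF E'(2)] by simp
    have "\<exists>e. inj_on e J \<and> (\<forall>j\<in>J. e j \<in> {x\<in>J'. E' v' x = F v j})"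
    proof (rule inj_choice[OF J(1)])
      fix j
      show "finite {x\<in>J'. E' v' x = F v j} \<and> card J \<le> card {x\<in>J'. E' v' x = F v j}"
        using fJ' mixedD[OF E'(4), of "F v j"] by simp
    qed
    then obtain e where e: "inj_on e J" "\<forall>j\<in>J. e j \<in> J' \<and> E' v' (e j) = F v j" by blast
    define h where "h = e(v := v')"
    have h: "h v = v'" "\<And>j. j \<in> J \<Longrightarrow> h j = e j" using J(2) by (auto simp: h_def)
    have eJ: "e j \<in> J'" if "j \<in> J" for j using e(2) that by blast
    have "inj_on h J" using e(1) h(2) by (simp cong: inj_on_cong)
    moreover have "h v \<notin> h ` J" using E'(1) eJ h by auto
    ultimately have "inj_on h (insert v J)" using J(2) by simp
    moreover have "h ` insert v J \<subseteq> insert v' J'" using eJ h by auto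
    ultimately have G1: "G (insert v J) (\<lambda>x y. E' (h x) (h y))"
      by (rule relabel[OF E'(2)])
    have "agree ({v} \<union> J) (\<lambda>x y. E' (h x) (h y)) F"
    proof (rule agree_Un)
      show "symm ({v} \<union> J) (\<lambda>x y. E' (h x) (h y))" using G_symm[OF G1] by simp
      show "agree J (\<lambda>x y. E' (h x) (h y)) F"
      proof (rule agreeI)
        fix x y assume xy: "x \<in> J" "y \<in> J" "x \<noteq> y"
        then have "e x \<noteq> e y" using e(1) by (auto dest: inj_onD)
        then show "E' (h x) (h y) = F x y" using xy h e(2) clqD[OF E'(3)] clqD[OF J(4)] by simp
      qed
      show "E' (h a) (h j) = F a j" if "a \<in> {v}" "j \<in> J" for a j using that h e(2) by simp
    qed (use J(3) in \<open>simp_all add: agree_def\<close>)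
    then show ?thesis using embed_id[OF G1] by simp
  qed
  then show ?thesis unfolding star_def by (intro conjI) (simp, simp add: symm_def, blast)
qed

end

context strong_switching_class begin

text \<open>
  If all triples have parity \<open>c\<close>, then the graph is a \<open>c\<close>-clique up to switching; switching at the
  added vertex adjusts the only freedom.
\<close>
lemma clique_if_no_parity:
  assumes "\<And>v E. G {v} E" "\<not> has_parity G (\<not> c)" "finite K" "clq c K E" "symm K E" "K \<noteq> {}"
  shows "G K E"
  using assms(3,4,5,6)
proof (induction K)
  case (insert k K)
  show ?case
  proof (cases "K = {}")
    case True then show ?thesis using assms(1) by simp
  next
    case False
    have GK: "G K E"
      using insert.IH False insert.prems by (auto simp: clq_def intro: symm_subset)
    have "\<exists>E'. agree ({} \<union> K) E E' \<and> agree (insert k {}) E E' \<and> G (insert k ({} \<union> K)) E'"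
      by (rule amalg_point) (use insert.hyps GK assms(1) strong_switching_class_axioms in auto)
    then obtain E' where E': "agree K E E'" "G (insert k K) E'" by auto
    obtain z where z: "z \<in> K" using False by blast
    have kz: "E' k x = E' k z" if x: "x \<in> K" for x
    proof (cases "x = z")
      case False
      have t: "G {k, x, z} E'" by (rule subset[OF E'(2)]) (use x z in auto)
      have "E' x z = c" using agreeD[OF E'(1), of x z] clqD[OF insert.prems(1), of x z] x z False by auto
      moreover have "par E' k x z = c"
      proof (rule ccontr)
        assume "par E' k x z \<noteq> c"
        then have p: "par E' k x z = (\<not> c)" by auto
        have "has_parity G (\<not> c)"
          by (rule has_parityI[of k x z G E', OF _ t p]) (use x z False insert.hyps in auto)
        then show False using assms(2) by simp
      qed
      ultimately show ?thesis by (auto simp: par_def)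
    qed simp
    have G2: "G (insert k K) (\<lambda>x y. E' x y \<noteq> ((x = k \<and> E' k z \<noteq> c) \<noteq> (y = k \<and> E' k z \<noteq> c)))"
      by (rule switch[OF E'(2), of "\<lambda>x. x = k \<and> E' k z \<noteq> c"])
    have "agree ({k} \<union> K) (\<lambda>x y. E' x y \<noteq> ((x = k \<and> E' k z \<noteq> c) \<noteq> (y = k \<and> E' k z \<noteq> c))) E"
    proof (rule agree_Un)
      show "symm ({k} \<union> K) (\<lambda>x y. E' x y \<noteq> ((x = k \<and> E' k z \<noteq> c) \<noteq> (y = k \<and> E' k z \<noteq> c)))"
        using G_symm[OF G2] by simp
      show "agree K (\<lambda>x y. E' x y \<noteq> ((x = k \<and> E' k z \<noteq> c) \<noteq> (y = k \<and> E' k z \<noteq> c))) E"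
        using agreeD[OF E'(1)] insert.hyps by (auto simp: agree_def)
      fix a b assume "a \<in> {k}" "b \<in> K" "a \<noteq> b"
      then show "(E' a b \<noteq> ((a = k \<and> E' k z \<noteq> c) \<noteq> (b = k \<and> E' k z \<noteq> c))) = E a b"
        using kz[of b] clqD[OF insert.prems(1), of k b] by auto
    qed (use insert.prems in \<open>auto simp: agree_def\<close>)
    then show ?thesis using embed_id[OF G2] by simp
  qed
qed simp

lemma some_of_each_size:
  assumes "\<And>v E. G {v} E"
  shows "\<exists>E. G {..n} E"
proof (induction n)
  case 0 then show ?case using assms[of 0] by (simp add: atMost_0)
next
  case (Suc n)
  then obtain E where E: "G {..n} E" by blast
  have "\<exists>E'. agree ({} \<union> {..n}) E E' \<and> agree (insert (Suc n) {}) E E' \<and> G (insert (Suc n) ({} \<union> {..n})) E'"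
    by (rule amalg_point) (use E assms strong_switching_class_axioms in auto)
  then show ?case by (auto simp: atMost_Suc)
qed

lemma some_parity:
  assumes "\<And>v E. G {v} E"
  shows "has_parity G d \<or> has_parity G (\<not> d)"
proof -
  obtain E where E: "G {..2} E" using some_of_each_size[OF assms] by blast
  have "{..2::nat} = {0, 1, 2}" by auto
  then have "G {0, 1, 2} E" using E by simp
  then have "has_parity G (par E 0 1 2)" by (rule has_parityI[of 0 1 2 G E, rotated]) simp_all
  then show ?thesis by (cases "par E 0 1 2 = d") auto
qed

end

text \<open>
  A configuration that \<open>G\<close> omits: three vertices with prescribed edges outside a clique, and, for
  labels \<open>l\<close> of clique members, prescribed edges from \<open>u\<close>, \<open>v\<close>, \<open>w\<close> to the member labelled \<open>l\<close>, for
  \<open>l\<close> in \<open>Lu\<close>, \<open>Lv\<close>, \<open>Lw\<close> respectively.  The fewer labels carry conditions for several of the three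
  vertices at once, the stronger the omission.
\<close>
definition forb :: "(nat set \<Rightarrow> (nat \<Rightarrow> nat \<Rightarrow> bool) \<Rightarrow> bool) \<Rightarrow> bool \<Rightarrow> 'l set \<Rightarrow> 'l set \<Rightarrow> 'l set \<Rightarrow> 'l set \<Rightarrow>
    ('l \<Rightarrow> bool) \<Rightarrow> ('l \<Rightarrow> bool) \<Rightarrow> ('l \<Rightarrow> bool) \<Rightarrow> bool \<Rightarrow> bool \<Rightarrow> bool \<Rightarrow> bool" where
  "forb G c L Lu Lv Lw p q r \<alpha> \<beta> \<gamma> \<longleftrightarrow>
     (\<forall>F J u v w e. clq c J F \<and> distinct [u, v, w] \<and> {u, v, w} \<inter> J = {} \<and> inj_on e L \<and> e ` L \<subseteq> J \<and>
        F u v = \<alpha> \<and> F v w = \<beta> \<and> F u w = \<gamma> \<and>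
        (\<forall>l\<in>Lu. F u (e l) = p l) \<and> (\<forall>l\<in>Lv. F v (e l) = q l) \<and> (\<forall>l\<in>Lw. F w (e l) = r l)
        \<longrightarrow> \<not> G ({u, v, w} \<union> J) F)"

lemma forbD:
  "\<lbrakk>forb G c L Lu Lv Lw p q r \<alpha> \<beta> \<gamma>; G ({u, v, w} \<union> J) F; clq c J F; distinct [u, v, w]; {u, v, w} \<inter> J = {};
    inj_on e L; e ` L \<subseteq> J; F u v = \<alpha>; F v w = \<beta>; F u w = \<gamma>;
    \<And>l. l \<in> Lu \<Longrightarrow> F u (e l) = p l; \<And>l. l \<in> Lv \<Longrightarrow> F v (e l) = q l; \<And>l. l \<in> Lw \<Longrightarrow> F w (e l) = r l\<rbrakk> \<Longrightarrow> False"
proof -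
  assume f: "forb G c L Lu Lv Lw p q r \<alpha> \<beta> \<gamma>" and g: "G ({u, v, w} \<union> J) F"
    and h: "clq c J F" "distinct [u, v, w]" "{u, v, w} \<inter> J = {}" "inj_on e L" "e ` L \<subseteq> J"
    "F u v = \<alpha>" "F v w = \<beta>" "F u w = \<gamma>"
    "\<And>l. l \<in> Lu \<Longrightarrow> F u (e l) = p l" "\<And>l. l \<in> Lv \<Longrightarrow> F v (e l) = q l" "\<And>l. l \<in> Lw \<Longrightarrow> F w (e l) = r l"
  note f' = f[unfolded forb_def, THEN spec[of _ F], THEN spec[of _ J], THEN spec[of _ u], THEN spec[of _ v],
      THEN spec[of _ w], THEN spec[of _ e]]
  have "\<not> G ({u, v, w} \<union> J) F"
    by (rule f'[THEN mp]) (intro conjI ballI h, assumption+)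
  then show False using g by simp
qed

context switching_class begin

lemma forb_swap:
  assumes "forb G c L Lu Lv Lw p q r \<alpha> \<beta> \<gamma>"
  shows "forb G c L Lv Lu Lw q p r \<alpha> \<gamma> \<beta>"
  unfolding forb_def
proof (intro allI impI notI, elim conjE)
  fix F J u v w e
  assume h: "clq c J F" "distinct [u, v, w]" "{u, v, w} \<inter> J = {}" "inj_on e L" "e ` L \<subseteq> J"
    "F u v = \<alpha>" "F v w = \<gamma>" "F u w = \<beta>" "\<forall>l\<in>Lv. F u (e l) = q l" "\<forall>l\<in>Lu. F v (e l) = p l" "\<forall>l\<in>Lw. F w (e l) = r l"
    and g: "G ({u, v, w} \<union> J) F"
  have "F v u = F u v" using symmD[OF G_symm[OF g]] by blast
  moreover have "{v, u, w} = {u, v, w}" by blast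
  ultimately have g': "G ({v, u, w} \<union> J) F" and vu: "F v u = \<alpha>" using g h(6) by simp_all
  show False
  proof (rule forbD[OF assms g' h(1)])
    show "distinct [v, u, w]" "{v, u, w} \<inter> J = {}" using h(2,3) by auto
  qed (use h vu in blast)+
qed

text \<open>
  The middle vertex of an omitted configuration is traded for a second copy of the last one.
  Suppose that \<open>u\<close>, \<open>w0\<close>, \<open>w1\<close> satisfy the new configuration.  Add \<open>v\<close> which on the first copy of the
  labels and on \<open>w0\<close> behaves as the middle vertex should, and oppositely on the second copy and on
  \<open>w1\<close>.  The triple \<open>v\<close>, \<open>w0\<close>, \<open>w1\<close> has the parity that is allowed, so \<open>v\<close> exists over
  the clique, and amalgamation over \<open>w0\<close>, \<open>w1\<close> and the clique decides the edge \<open>uv\<close>.  For one of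
  its values \<open>u\<close>, \<open>v\<close>, \<open>w0\<close> are the omitted configuration, for the other one \<open>u\<close>, \<open>v\<close>, \<open>w1\<close> are,
  after switching at \<open>v\<close>.
\<close>
lemma doubling:
  assumes T: "\<And>u v w F. \<lbrakk>distinct [u, v, w]; symm {u, v, w} F; par F u v w = (\<not> d)\<rbrakk> \<Longrightarrow> star G c {u, v, w} F"
    and fb: "forb G c L Lu Lv Lw p q r \<alpha> \<beta> \<gamma>"
    and d: "(\<alpha> \<noteq> (\<beta> \<noteq> \<gamma>)) = d" and sub: "Lu \<subseteq> L" "Lv \<subseteq> L" "Lw \<subseteq> L"
  shows "forb G c (L <+> L) (Lu <+> Lu) (Lw <+> {}) ({} <+> Lw) (case_sum p p) (case_sum r r) (case_sum r r) \<gamma> d \<gamma>"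
  unfolding forb_def
proof (intro allI impI notI, elim conjE)
  fix F J u w0 w1 e
  assume h: "clq c J F" "distinct [u, w0, w1]" "{u, w0, w1} \<inter> J = {}" "inj_on e (L <+> L)" "e ` (L <+> L) \<subseteq> J"
    "F u w0 = \<gamma>" "F w0 w1 = d" "F u w1 = \<gamma>" "\<forall>l\<in>Lu <+> Lu. F u (e l) = case_sum p p l"
    "\<forall>l\<in>Lw <+> {}. F w0 (e l) = case_sum r r l" "\<forall>l\<in>{} <+> Lw. F w1 (e l) = case_sum r r l"
    and g: "G ({u, w0, w1} \<union> J) F"
  define e1 where "e1 = (\<lambda>l. e (Inl l))"
  define e2 where "e2 = (\<lambda>l. e (Inr l))"
  have e: "inj_on e1 L" "inj_on e2 L" "e1 ` L \<inter> e2 ` L = {}" "e1 ` L \<subseteq> J" "e2 ` L \<subseteq> J"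
  proof -
    show "inj_on e1 L" unfolding e1_def by (rule inj_onI, drule inj_onD[OF h(4)]) auto
    show "inj_on e2 L" unfolding e2_def by (rule inj_onI, drule inj_onD[OF h(4)]) auto
    have "e (Inl l) \<noteq> e (Inr l')" if "l \<in> L" "l' \<in> L" for l l'
      using inj_onD[OF h(4), of "Inl l" "Inr l'"] that by auto
    then show "e1 ` L \<inter> e2 ` L = {}" unfolding e1_def e2_def by blast
    show "e1 ` L \<subseteq> J" "e2 ` L \<subseteq> J" using h(5) unfolding e1_def e2_def by blast+
  qed
  have rows: "F u (e1 l) = p l" "F u (e2 l) = p l" if "l \<in> Lu" for l
    using bspec[OF h(9), of "Inl l"] bspec[OF h(9), of "Inr l"] that by (simp_all add: e1_def e2_def InlI InrI)
  have rows': "F w0 (e1 l) = r l" "F w1 (e2 l) = r l" if "l \<in> Lw" for l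
    using bspec[OF h(10), of "Inl l"] bspec[OF h(11), of "Inr l"] that by (simp_all add: e1_def e2_def InlI InrI)
  have fV: "finite ({u, w0, w1} \<union> J)" by (rule G_finite[OF g])
  obtain v where v: "v \<notin> {u, w0, w1} \<union> J" using fresh_vertex[OF fV] by blast
  \<comment> \<open>The row of the new vertex: the middle vertex on the first copy, its negation on the second.\<close>
  define k where "k = (\<lambda>y. if y = w0 then \<beta> else if y = w1 then \<not> \<beta> else if y \<in> e1 ` L then q (the_inv_into L e1 y)
      else if y \<in> e2 ` L then \<not> q (the_inv_into L e2 y) else False)"
  define F' where "F' = (\<lambda>x y. if x = v then k y else if y = v then k x else F x y)"
  have nw: "w0 \<notin> J" "w1 \<notin> J" "u \<notin> J" "v \<notin> J" "w0 \<noteq> w1" "u \<noteq> w0" "u \<noteq> w1" "v \<noteq> u" "v \<noteq> w0" "v \<noteq> w1" using h v by auto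
  have k1: "k (e1 l) = q l" "k (e2 l) = (\<not> q l)" if "l \<in> L" for l
  proof -
    have "e1 l \<in> J" "e2 l \<in> J" "e2 l \<notin> e1 ` L" "e1 l \<in> e1 ` L" "e2 l \<in> e2 ` L" using e that by auto
    moreover from this have "e1 l \<noteq> w0" "e1 l \<noteq> w1" "e2 l \<noteq> w0" "e2 l \<noteq> w1" using nw by auto
    ultimately show "k (e1 l) = q l" "k (e2 l) = (\<not> q l)"
      using the_inv_into_f_f[OF e(1) that] the_inv_into_f_f[OF e(2) that] by (simp_all add: k_def)
  qed
  have Fs: "F x y = F y x" if "x \<in> {u, w0, w1} \<union> J" "y \<in> {u, w0, w1} \<union> J" for x y
    by (rule symmD[OF G_symm[OF g] that])
  have sF': "symm (insert v ({u, w0, w1} \<union> J)) F'"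
  proof (rule symmI)
    fix x y assume "x \<in> insert v ({u, w0, w1} \<union> J)" "y \<in> insert v ({u, w0, w1} \<union> J)"
    then show "F' x y = F' y x" using Fs[of x y] by (cases "x = v"; cases "y = v") (simp_all add: F'_def)
  qed
  have FF: "F' x y = F x y" if "x \<noteq> v" "y \<noteq> v" for x y using that by (simp add: F'_def)
  have st: "star G c {v, w0, w1} F'"
  proof (rule T)
    show "distinct [v, w0, w1]" using nw by auto
    show "symm {v, w0, w1} F'" by (rule symm_subset[OF sF']) auto
    show "par F' v w0 w1 = (\<not> d)" using nw h(7) by (auto simp: par_def F'_def k_def)
  qed
  have Gv: "G ({v, w0, w1} \<union> J) F'"
  proof (rule starD[OF st])
    show "finite J" using fV by simp
    show "J \<inter> {v, w0, w1} = {}" using nw by auto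
    show "symm ({v, w0, w1} \<union> J) F'" by (rule symm_subset[OF sF']) auto
    show "agree {v, w0, w1} F' F'" by (simp add: agree_def)
    show "clq c J F'"
    proof (rule clqI)
      fix x y assume xy: "x \<in> J" "y \<in> J" "x \<noteq> y"
      then have "x \<noteq> v" "y \<noteq> v" using nw by auto
      then show "F' x y = c" using FF clqD[OF h(1)] xy by simp
    qed
  qed
  have Gu: "G ({u, w0, w1} \<union> J) F'"
  proof (rule embed_id[OF g order.refl], rule agreeI)
    fix x y assume "x \<in> {u, w0, w1} \<union> J" "y \<in> {u, w0, w1} \<union> J"
    then have "x \<noteq> v" "y \<noteq> v" using v by blast+
    then show "F x y = F' x y" using FF by simp
  qed
  define A where "A = {w0, w1} \<union> J"
  have "\<exists>E'. agree (insert u A) F' E' \<and> agree (insert v A) F' E' \<and> G (insert u (insert v A)) E'"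
  proof (rule amalg)
    show "G (insert u A) F'" "G (insert v A) F'" using Gu Gv by (auto simp: A_def)
    show "u \<notin> A" "v \<notin> A" "u \<noteq> v" using nw by (auto simp: A_def)
    have "F' u w0 = F' u w1" using h nw by (simp add: F'_def)
    moreover have "F' v w0 \<noteq> F' v w1" using nw by (simp add: F'_def k_def)
    moreover have "w0 \<in> A" "w1 \<in> A" by (auto simp: A_def)
    ultimately show "untwinned A F' u v" unfolding untwinned_def by metis
  qed
  then obtain E' where E': "agree (insert u A) F' E'" "agree (insert v A) F' E'" "G (insert u (insert v A)) E'" by blast
  have nA: "u \<notin> A" "v \<notin> A" using nw by (auto simp: A_def)
  have Eu: "E' u y = F u y" if "y \<in> A" for y
  proof -
    have "y \<noteq> u" "y \<noteq> v" using that nA by blast+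
    moreover from this have "F' u y = E' u y" by (intro agreeD[OF E'(1)]) (use that in simp_all)
    ultimately show ?thesis using FF nw(8) by simp
  qed
  have Ev: "E' v y = k y" if "y \<in> A" for y
  proof -
    have "y \<noteq> v" using that nA by blast
    then have "F' v y = E' v y" by (intro agreeD[OF E'(2)]) (use that in simp_all)
    then show ?thesis by (simp add: F'_def)
  qed
  have EA: "E' x y = F x y" if "x \<in> A" "y \<in> A" "x \<noteq> y" for x y
  proof -
    have "x \<noteq> v" "y \<noteq> v" using that nA by blast+
    moreover have "F' x y = E' x y" by (intro agreeD[OF E'(1)]) (use that in simp_all)
    ultimately show ?thesis using FF by simp
  qed
  have sub1: "{u, v, w0} \<union> J \<subseteq> insert u (insert v A)" "{u, v, w1} \<union> J \<subseteq> insert u (insert v A)" by (auto simp: A_def)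
  have JA: "x \<in> A" if "x \<in> J" for x using that by (simp add: A_def)
  have wA: "w0 \<in> A" "w1 \<in> A" by (auto simp: A_def)
  have eJ: "e1 l \<in> J" "e2 l \<in> J" if "l \<in> L" for l using e that by auto
  have cl: "clq c J E'"
  proof (rule clqI)
    fix x y assume xy: "x \<in> J" "y \<in> J" "x \<noteq> y"
    then show "E' x y = c" using EA[OF JA JA] clqD[OF h(1)] by simp
  qed
  show False
  proof (cases "E' u v = \<alpha>")
    case True
    show False
    proof (rule forbD[OF fb subset[OF E'(3) sub1(1)] cl])
      show "distinct [u, v, w0]" "{u, v, w0} \<inter> J = {}" using nw by auto
      show "inj_on e1 L" "e1 ` L \<subseteq> J" by (fact e)+
      show "E' u v = \<alpha>" by fact
      show "E' v w0 = \<beta>" "E' u w0 = \<gamma>" using Ev[OF wA(1)] Eu[OF wA(1)] h(6) by (auto simp: k_def)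
      show "E' u (e1 l) = p l" if "l \<in> Lu" for l
        using Eu[OF JA[OF eJ(1)[OF subsetD[OF sub(1) that]]]] rows(1)[OF that] by simp
      show "E' v (e1 l) = q l" if "l \<in> Lv" for l
        using Ev[OF JA[OF eJ(1)[OF subsetD[OF sub(2) that]]]] k1(1)[OF subsetD[OF sub(2) that]] by simp
      show "E' w0 (e1 l) = r l" if "l \<in> Lw" for l
      proof -
        have j: "e1 l \<in> J" by (rule eJ(1)[OF subsetD[OF sub(3) that]])
        then have "w0 \<noteq> e1 l" using nw by auto
        then show ?thesis using EA[OF wA(1) JA[OF j]] rows'(1)[OF that] by simp
      qed
    qed
  next
    case False
    define E2 where "E2 = (\<lambda>x y. E' x y \<noteq> ((x = v) \<noteq> (y = v)))"
    have G2: "G (insert u (insert v A)) E2" unfolding E2_def by (rule switch[OF E'(3), of "\<lambda>x. x = v"])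
    have cl2: "clq c J E2"
    proof (rule clqI)
      fix x y assume xy: "x \<in> J" "y \<in> J" "x \<noteq> y"
      then have "x \<noteq> v" "y \<noteq> v" using nw by auto
      then show "E2 x y = c" using clqD[OF cl xy] by (simp add: E2_def)
    qed
    show False
    proof (rule forbD[OF fb subset[OF G2 sub1(2)] cl2])
      show "distinct [u, v, w1]" "{u, v, w1} \<inter> J = {}" using nw by auto
      show "inj_on e2 L" "e2 ` L \<subseteq> J" by (fact e)+
      show "E2 u v = \<alpha>" using False nw by (auto simp: E2_def)
      show "E2 v w1 = \<beta>" using Ev[OF wA(2)] nw by (auto simp: k_def E2_def)
      show "E2 u w1 = \<gamma>" using Eu[OF wA(2)] h(8) nw by (auto simp: E2_def)
      have ev: "e2 l \<noteq> v" if "l \<in> L" for l using eJ(2)[OF that] nw by auto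
      show "E2 u (e2 l) = p l" if "l \<in> Lu" for l
        using Eu[OF JA[OF eJ(2)[OF subsetD[OF sub(1) that]]]] rows(2)[OF that] ev[OF subsetD[OF sub(1) that]] nw(8)
        by (simp add: E2_def)
      show "E2 v (e2 l) = q l" if "l \<in> Lv" for l
        using Ev[OF JA[OF eJ(2)[OF subsetD[OF sub(2) that]]]] k1(2)[OF subsetD[OF sub(2) that]] ev[OF subsetD[OF sub(2) that]]
        by (simp add: E2_def)
      show "E2 w1 (e2 l) = r l" if "l \<in> Lw" for l
      proof -
        have j: "e2 l \<in> J" by (rule eJ(2)[OF subsetD[OF sub(3) that]])
        then have "w1 \<noteq> e2 l" "e2 l \<noteq> v" using nw by auto
        then show ?thesis using EA[OF wA(2) JA[OF j]] rows'(2)[OF that] nw by (simp add: E2_def)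
      qed
    qed
  qed
qed

end

lemma mixedI:
  assumes "finite J" "X \<subseteq> J" "Y \<subseteq> J" "M \<le> card X" "M \<le> card Y"
    "\<And>x. x \<in> X \<Longrightarrow> E v x = t" "\<And>y. y \<in> Y \<Longrightarrow> E v y = (\<not> t)"
  shows "mixed M E v J"
proof -
  have "card X \<le> card {j\<in>J. E v j = t}" using assms by (intro card_mono) auto
  moreover have "card Y \<le> card {j\<in>J. E v j = (\<not> t)}" using assms by (intro card_mono) auto
  ultimately show ?thesis using assms(4,5) unfolding mixed_def by (cases t) auto
qed

lemma mixed_mono: "\<lbrakk>mixed M E v J; M' \<le> M\<rbrakk> \<Longrightarrow> mixed M' E v J"
  by (auto simp: mixed_def)

context switching_class begin

text \<open>
  Failure of the parity \<open>d\<close> in the derived class yields one omitted configuration in which each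
  label may carry conditions for all three vertices.  Two applications of \<open>doubling\<close> separate the
  conditions, and three vertices that are sufficiently mixed over a clique satisfy separated
  conditions automatically.
\<close>
lemma no_mixed_triple:
  assumes stars: "\<And>v E. star G c {v} E" and no: "\<not> has_parity (star G c) d"
  shows "\<exists>M. \<forall>J F u v w. clq c J F \<longrightarrow> distinct [u, v, w] \<longrightarrow> {u, v, w} \<inter> J = {} \<longrightarrow> mixed M F u J \<longrightarrow>
     mixed M F v J \<longrightarrow> mixed M F w J \<longrightarrow> par F u v w = d \<longrightarrow> \<not> G ({u, v, w} \<union> J) F"
proof -
  interpret S: strong_switching_class "star G c" by (rule star_strong)
  have hp: "has_parity (star G c) (\<not> d)" using S.some_parity[OF stars, of d] no by blast
  have T: "star G c {u, v, w} F" if "distinct [u, v, w]" "symm {u, v, w} F" "par F u v w = (\<not> d)" for u v w F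
    by (rule S.triple[OF hp that])
  have "\<not> star G c {0, 1, 2} (\<lambda>_ _. d)"
  proof
    assume "star G c {0, 1, 2} (\<lambda>_ _. d)"
    then have "has_parity (star G c) d"
      by (rule has_parityI[of 0 1 2 "star G c" "\<lambda>_ _. d", rotated]) (simp_all add: par_def)
    then show False using no by simp
  qed
  moreover have "symm {0, 1, 2} (\<lambda>_ _. d)" by (simp add: symm_def)
  ultimately obtain J0 F0 where J0: "finite J0" "J0 \<inter> {0, 1, 2} = {}" "symm ({0, 1, 2} \<union> J0) F0"
      "agree {0, 1, 2} (\<lambda>_ _. d) F0" "clq c J0 F0" "\<not> G ({0, 1, 2} \<union> J0) F0"
    unfolding star_def by (metis finite.emptyI finite_insert)
  define p where "p = F0 0"
  define r where "r = F0 2"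
  have f0: "forb G c J0 J0 J0 J0 p (F0 1) r d d d"
    unfolding forb_def
  proof (intro allI impI notI, elim conjE)
    fix F J u v w e
    assume h: "clq c J F" "distinct [u, v, w]" "{u, v, w} \<inter> J = {}" "inj_on e J0" "e ` J0 \<subseteq> J"
      "F u v = d" "F v w = d" "F u w = d" "\<forall>l\<in>J0. F u (e l) = p l" "\<forall>l\<in>J0. F v (e l) = F0 1 l" "\<forall>l\<in>J0. F w (e l) = r l"
      and g: "G ({u, v, w} \<union> J) F"
    define f where "f = (\<lambda>x. if x = 0 then u else if x = 1 then v else if x = 2 then w else e x)"
    have f: "f 0 = u" "f 1 = v" "f 2 = w" by (auto simp: f_def)
    have fJ: "f j = e j" if "j \<in> J0" for j using that J0(2) by (auto simp: f_def)
    have eJ: "e j \<in> J" if "j \<in> J0" for j using h(5) that by blast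
    have "inj_on f J0" using h(4) fJ by (simp cong: inj_on_cong)
    moreover have "u \<notin> f ` J0" "v \<notin> f ` J0" "w \<notin> f ` J0" using fJ eJ h(3) by auto
    ultimately have "inj_on f ({0, 1, 2} \<union> J0)" using h(2) f J0(2) by (simp add: inj_on_Un)
    moreover have "f ` ({0, 1, 2} \<union> J0) \<subseteq> {u, v, w} \<union> J" using f fJ eJ by auto
    ultimately have G1: "G ({0, 1, 2} \<union> J0) (\<lambda>x y. F (f x) (f y))" by (rule relabel[OF g])
    have s: "F v u = d" "F w v = d" "F w u = d" using symmD[OF G_symm[OF g]] h(6-8) by blast+
    have "agree ({0, 1, 2} \<union> J0) (\<lambda>x y. F (f x) (f y)) F0"
    proof (rule agree_Un)
      show "symm ({0, 1, 2} \<union> J0) (\<lambda>x y. F (f x) (f y))" by (rule G_symm[OF G1])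
      show "symm ({0, 1, 2} \<union> J0) F0" by (rule J0(3))
      have "agree {0, 1, 2} (\<lambda>x y. F (f x) (f y)) (\<lambda>_ _. d)" using f h(6-8) s by (simp add: agree_def)
      then show "agree {0, 1, 2} (\<lambda>x y. F (f x) (f y)) F0" using J0(4) unfolding agree_def by blast
      show "agree J0 (\<lambda>x y. F (f x) (f y)) F0"
      proof (rule agreeI)
        fix x y assume xy: "x \<in> J0" "y \<in> J0" "x \<noteq> y"
        then have "e x \<noteq> e y" using h(4) by (auto dest: inj_onD)
        then show "F (f x) (f y) = F0 x y" using xy fJ eJ clqD[OF h(1)] clqD[OF J0(5)] by simp
      qed
      fix a b :: nat assume ab: "a \<in> {0, 1, 2}" "b \<in> J0"
      have "F u (e b) = F0 0 b" "F v (e b) = F0 1 b" "F w (e b) = F0 2 b"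
        using h(9-11) ab(2) by (auto simp: p_def r_def)
      then show "F (f a) (f b) = F0 a b" using ab f fJ[OF ab(2)] by auto
    qed
    then have "G ({0, 1, 2} \<union> J0) F0" by (rule embed_id[OF G1 order.refl])
    then show False using J0(6) by simp
  qed
  \<comment> \<open>After the second doubling each label carries a condition for only one of the three vertices.\<close>
  have f1: "forb G c (J0 <+> J0) (J0 <+> J0) (J0 <+> {}) ({} <+> J0) (case_sum p p) (case_sum r r) (case_sum r r) d d d"
    by (rule doubling[OF T f0]) auto
  have f2: "forb G c (J0 <+> J0) (J0 <+> {}) (J0 <+> J0) ({} <+> J0) (case_sum r r) (case_sum p p) (case_sum r r) d d d"
    by (rule forb_swap[OF f1])
  define R where "R = case_sum r r"
  have f3: "forb G c ((J0 <+> J0) <+> (J0 <+> J0)) ((J0 <+> {}) <+> (J0 <+> {})) (({} <+> J0) <+> {}) ({} <+> ({} <+> J0))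
      (case_sum R R) (case_sum R R) (case_sum R R) d d d"
    unfolding R_def by (rule doubling[OF T f2]) auto
  define L where "L = (J0 <+> J0) <+> (J0 <+> J0)"
  have fL: "finite L" using J0(1) by (simp add: L_def)
  show ?thesis
  proof (intro exI[of _ "card L"] allI impI notI)
    fix J F u v w
    assume h: "clq c J F" "distinct [u, v, w]" "{u, v, w} \<inter> J = {}" "mixed (card L) F u J" "mixed (card L) F v J"
      "mixed (card L) F w J" "par F u v w = d" and g: "G ({u, v, w} \<union> J) F"
    have fJ: "finite J" using G_finite[OF g] by simp
    \<comment> \<open>Switching at \<open>u\<close> and \<open>w\<close> gives all three edges the colour \<open>d\<close>.\<close>
    define s where "s = (\<lambda>x. (x = u \<and> F u v \<noteq> d) \<or> (x = w \<and> F v w \<noteq> d))"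
    define F' where "F' = (\<lambda>x y. F x y \<noteq> (s x \<noteq> s y))"
    have g': "G ({u, v, w} \<union> J) F'" unfolding F'_def by (rule switch[OF g])
    have sJ: "\<not> s x" if "x \<in> J" for x using that h(3) by (auto simp: s_def)
    have uvw: "F' u v = d" "F' v w = d" "F' u w = d" using h(2,7) by (auto simp: F'_def s_def par_def)
    define X where "X = (\<lambda>l :: (nat + nat) + (nat + nat). case l of Inl (Inl _) \<Rightarrow> u | Inl (Inr _) \<Rightarrow> v | Inr (Inl _) \<Rightarrow> u | Inr (Inr _) \<Rightarrow> w)"
    have big: "card L \<le> card {x\<in>J. F' y x = b}" if "y \<in> {u, v, w}" for y b
    proof -
      have "{x\<in>J. F' y x = b} = {x\<in>J. F y x = (b \<noteq> s y)}" using sJ by (auto simp: F'_def)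
      moreover have "mixed (card L) F y J" using that h(4-6) by auto
      ultimately show ?thesis using mixedD by metis
    qed
    have "\<exists>e. inj_on e L \<and> (\<forall>l\<in>L. e l \<in> {x\<in>J. F' (X l) x = case_sum R R l})"
    proof (rule inj_choice[OF fL])
      fix l
      have "X l \<in> {u, v, w}" by (auto simp: X_def split: sum.split)
      then show "finite {x\<in>J. F' (X l) x = case_sum R R l} \<and> card L \<le> card {x\<in>J. F' (X l) x = case_sum R R l}"
        using fJ big by simp
    qed
    then obtain e where e: "inj_on e L" "\<And>l. l \<in> L \<Longrightarrow> e l \<in> J \<and> F' (X l) (e l) = case_sum R R l" by blast
    have cl: "clq c J F'" using clqD[OF h(1)] sJ by (simp add: clq_def F'_def)
    show False
    proof (rule forbD[OF f3 g' cl h(2,3)])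
      show "inj_on e ((J0 <+> J0) <+> (J0 <+> J0))" using e(1) by (simp add: L_def)
      show "e ` ((J0 <+> J0) <+> (J0 <+> J0)) \<subseteq> J" using e(2) unfolding L_def by blast
      show "F' u v = d" "F' v w = d" "F' u w = d" by (fact uvw)+
      have eL: "F' (X l) (e l) = case_sum R R l" if "l \<in> (J0 <+> J0) <+> (J0 <+> J0)" for l using e(2) that unfolding L_def by blast
      show "F' u (e l) = case_sum R R l" if "l \<in> (J0 <+> {}) <+> (J0 <+> {})" for l
      proof -
        have "X l = u" "l \<in> (J0 <+> J0) <+> (J0 <+> J0)" using that by (auto simp: X_def)
        then show ?thesis using eL[of l] by simp
      qed
      show "F' v (e l) = case_sum R R l" if "l \<in> ({} <+> J0) <+> {}" for l
      proof -
        have "X l = v" "l \<in> (J0 <+> J0) <+> (J0 <+> J0)" using that by (auto simp: X_def)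
        then show ?thesis using eL[of l] by simp
      qed
      show "F' w (e l) = case_sum R R l" if "l \<in> {} <+> ({} <+> J0)" for l
      proof -
        have "X l = w" "l \<in> (J0 <+> J0) <+> (J0 <+> J0)" using that by (auto simp: X_def)
        then show ?thesis using eL[of l] by simp
      qed
    qed
  qed
qed

text \<open>
  Otherwise the derived class contains the \<open>c\<close>-cliques but \<open>no_mixed_triple\<close> applies to parity
  \<open>\<not> c\<close>.  Regard a \<open>c\<close>-clique consisting of two vertices and half of a long clique as a member of the
  derived class, and the third vertex with the other half as the clique attached to it: all edges
  between the two are free, which produces the excluded mixed triple.
\<close>
lemma parity_of_clique_colour:
  assumes stars: "\<And>v E. star G c {v} E" and hc: "has_parity (star G c) c"
  shows "has_parity (star G c) (\<not> c)"
proof (rule ccontr)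
  assume no: "\<not> has_parity (star G c) (\<not> c)"
  interpret S: strong_switching_class "star G c" by (rule star_strong)
  obtain M where M: "\<And>J F u v w. \<lbrakk>clq c J F; distinct [u, v, w]; {u, v, w} \<inter> J = {}; mixed M F u J; mixed M F v J;
      mixed M F w J; par F u v w = (\<not> c)\<rbrakk> \<Longrightarrow> \<not> G ({u, v, w} \<union> J) F"
    using no_mixed_triple[OF stars no] by blast
  define I1 where "I1 = {3..<3+M}"
  define I2 where "I2 = {3+M..<3+2*M}"
  \<comment> \<open>The edges of the colour other than \<open>c\<close>.\<close>
  define P where "P = (\<lambda>x y. ((x = 0 \<or> x = (1::nat)) \<and> y \<in> I2) \<or> (x = 2 \<and> y \<in> I1) \<or> (x = 0 \<and> y = (2::nat)))"
  define F where "F = (\<lambda>x y. c \<noteq> (P x y \<or> P y x))"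
  have sF: "symm V F" for V by (auto simp: symm_def F_def)
  have I: "0 \<notin> I1" "1 \<notin> I1" "2 \<notin> I1" "0 \<notin> I2" "1 \<notin> I2" "2 \<notin> I2" "I1 \<inter> I2 = {}" by (auto simp: I1_def I2_def)
  have "star G c ({0, 1} \<union> I1) F"
  proof (rule S.clique_if_no_parity[OF stars no])
    show "clq c ({0, 1} \<union> I1) F"
    proof (rule clqI)
      fix x y assume "x \<in> {0, 1} \<union> I1" "y \<in> {0, 1} \<union> I1"
      then have "\<not> P x y" "\<not> P y x" using I unfolding P_def by auto
      then show "F x y = c" by (simp add: F_def)
    qed
  qed (auto simp: I1_def sF)
  then have "G (({0, 1} \<union> I1) \<union> insert 2 I2) F"
  proof (rule starD)
    show "clq c (insert 2 I2) F"
    proof (rule clqI)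
      fix x y assume "x \<in> insert 2 I2" "y \<in> insert 2 I2"
      then have "\<not> P x y" "\<not> P y x" using I unfolding P_def by auto
      then show "F x y = c" by (simp add: F_def)
    qed
    show "insert 2 I2 \<inter> ({0, 1} \<union> I1) = {}" using I by auto
  qed (auto simp: I2_def sF agree_def)
  moreover have "({0, 1} \<union> I1) \<union> insert 2 I2 = {0, 1, 2} \<union> (I1 \<union> I2)" by auto
  ultimately have g: "G ({0, 1, 2} \<union> (I1 \<union> I2)) F" by simp
  have fI: "finite (I1 \<union> I2)" by (auto simp: I1_def I2_def)
  have cd: "M \<le> card I1" "M \<le> card I2" by (auto simp: I1_def I2_def)
  have "\<not> G ({0, 1, 2} \<union> (I1 \<union> I2)) F"
  proof (rule M)
    show "clq c (I1 \<union> I2) F"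
    proof (rule clqI)
      fix x y assume "x \<in> I1 \<union> I2" "y \<in> I1 \<union> I2"
      then have "\<not> P x y" "\<not> P y x" using I unfolding P_def by auto
      then show "F x y = c" by (simp add: F_def)
    qed
    show "{0, 1, 2} \<inter> (I1 \<union> I2) = {}" using I by auto
    show "distinct [0, 1, 2::nat]" by simp
    have mx: "mixed M F x (I1 \<union> I2)" if "x = 0 \<or> x = 1" for x
    proof (rule mixedI[OF fI Un_upper1 Un_upper2 cd])
      show "F x y = c" if "y \<in> I1" for y
      proof -
        have "\<not> P x y" "\<not> P y x" using that \<open>x = 0 \<or> x = 1\<close> I unfolding P_def by auto
        then show ?thesis by (simp add: F_def)
      qed
      show "F x y = (\<not> c)" if "y \<in> I2" for y
        using that \<open>x = 0 \<or> x = 1\<close> by (auto simp: F_def P_def)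
    qed
    show "mixed M F 0 (I1 \<union> I2)" "mixed M F 1 (I1 \<union> I2)" using mx by blast+
    show "mixed M F 2 (I1 \<union> I2)"
    proof (rule mixedI[OF fI Un_upper2 Un_upper1 cd(2,1)])
      show "F 2 y = c" if "y \<in> I2" for y
      proof -
        have "\<not> P 2 y" "\<not> P y 2" using that I unfolding P_def by auto
        then show ?thesis by (simp add: F_def)
      qed
      show "F 2 y = (\<not> c)" if "y \<in> I1" for y using that by (auto simp: F_def P_def)
    qed
    show "par F 0 1 2 = (\<not> c)" using I by (auto simp: par_def F_def P_def)
  qed
  then show False using g by simp
qed

text \<open>
  If parity \<open>c\<close> fails in the derived class, then this class contains every clique of colour \<open>\<not> c\<close>;
  read as an extension of that clique by the single vertex \<open>v\<close>, which is a clique of any colour,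
  its membership says that all extensions of \<open>v\<close> by that clique lie in \<open>G\<close>.
\<close>
lemma stars_opposite:
  assumes stars: "\<And>v E. star G c {v} E" and no: "\<not> has_parity (star G c) c"
  shows "star G (\<not> c) {v} E"
proof -
  interpret S: strong_switching_class "star G c" by (rule star_strong)
  have "G ({v} \<union> J) F" if J: "finite J" "J \<inter> {v} = {}" "symm ({v} \<union> J) F" "clq (\<not> c) J F" for J F
  proof (cases "J = {}")
    case True then show ?thesis using star_G[OF stars] by simp
  next
    case False
    have "star G c J F"
      by (rule S.clique_if_no_parity[OF stars _ J(1,4) symm_subset[OF J(3)] False]) (use no in auto)
    then have "G (J \<union> {v}) F"
    proof (rule starD)
      show "symm (J \<union> {v}) F" using J(3) by (simp add: Un_commute)
    qed (use J(2) in \<open>auto simp: agree_def clq_def\<close>)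
    then show ?thesis by (simp add: Un_commute)
  qed
  then show ?thesis unfolding star_def by (intro conjI) (simp, simp add: symm_def, blast)
qed

end

section \<open>Triples of both parities\<close>

context switching_class begin

text \<open>
  Both derived classes omit a parity, so by \<open>no_mixed_triple\<close> mixed triples over long cliques of
  colour \<open>c\<close> have parity \<open>\<not> c\<close>, and those over cliques of colour \<open>\<not> c\<close> have parity \<open>c\<close>.  Amalgamate many
  vertices \<open>k\<close>, all mixed over a \<open>c\<close>-clique and joined to one more such vertex in colour \<open>\<not> c\<close>.  The
  first restriction makes these vertices a clique of colour \<open>\<not> c\<close>, over which three vertices of
  the base are mixed and violate the second restriction.
\<close>
lemma not_both_bad:
  assumes st: "\<And>v E. star G c {v} E" and st': "\<And>v E. star G (\<not> c) {v} E"
    and no: "\<not> has_parity (star G c) c" and no': "\<not> has_parity (star G (\<not> c)) (\<not> c)"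
  shows False
proof -
  interpret S: strong_switching_class "star G c" by (rule star_strong)
  have hp: "has_parity (star G c) (\<not> c)" using S.some_parity[OF st, of c] no by blast
  obtain M1 where M1: "\<And>J F u v w. \<lbrakk>clq c J F; distinct [u, v, w]; {u, v, w} \<inter> J = {}; mixed M1 F u J; mixed M1 F v J;
      mixed M1 F w J; par F u v w = c\<rbrakk> \<Longrightarrow> \<not> G ({u, v, w} \<union> J) F"
    using no_mixed_triple[OF st no] by blast
  obtain M2 where M2: "\<And>J F u v w. \<lbrakk>clq (\<not> c) J F; distinct [u, v, w]; {u, v, w} \<inter> J = {}; mixed M2 F u J; mixed M2 F v J;
      mixed M2 F w J; par F u v w = (\<not> c)\<rbrakk> \<Longrightarrow> \<not> G ({u, v, w} \<union> J) F"
    using no_mixed_triple[OF st' no'] by blast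
  define M where "M = Suc (max M1 M2)"
  (* Vertices 0, 1 and 3 form the mixed triple for the second restriction, with the edge 01 of
     the colour other than c; vertex 2 and the set g are mixed over the c-clique I because they are
     joined to ms and not to ns.  The point k + 2 * M of mk is joined to k alone and ms to all of g,
     so no two points of g are twins or antitwins. *)
  define ms where "ms = {4..<4+M}"
  define ns where "ns = {4+M..<4+2*M}"
  define g1 where "g1 = {4+2*M..<4+3*M}"
  define g2 where "g2 = {4+3*M..<4+4*M}"
  define mk where "mk = {4+4*M..<4+6*M}"
  define I where "I = {3} \<union> ms \<union> ns \<union> mk"
  define K0 where "K0 = insert 2 (g1 \<union> g2)"
  define P where "P = (\<lambda>k x. k \<in> K0 \<and> x \<notin> K0 \<and> (x \<in> ms \<or> (k \<in> g1 \<and> (x = 0 \<or> x = 3)) \<or> (k \<in> g2 \<and> x = (1::nat)) \<or>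
      (k \<in> g1 \<union> g2 \<and> x = k + 2*M)))"
  define F where "F = (\<lambda>x y. if x \<in> K0 \<and> y \<in> K0 then \<not> c else if x \<in> K0 \<or> y \<in> K0 then P x y \<or> P y x
      else c \<noteq> ((x = 0 \<and> y = 1) \<or> (x = 1 \<and> y = (0::nat))))"
  have sF: "symm V F" for V by (rule symmI) (auto simp: F_def)
  note sets = ms_def ns_def g1_def g2_def mk_def
  have Mpos: "M \<ge> 1" "M1 \<le> M" "M2 \<le> M" by (auto simp: M_def)
  have dI: "I \<inter> K0 = {}" "0 \<notin> I" "1 \<notin> I" "2 \<notin> I" "3 \<in> I" "0 \<notin> K0" "1 \<notin> K0" "3 \<notin> K0"
    by (auto simp: I_def K0_def sets)
  have fI: "finite I" "finite K0" "finite g1" "finite g2" by (auto simp: I_def K0_def sets)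
  have FK: "F k x = P k x" if "k \<in> K0" "x \<notin> K0" for k x using that by (auto simp: F_def P_def)
  have FI: "F x y = c" if "x \<in> insert z I" "y \<in> insert z I" "z = 0 \<or> z = 1" for x y z
  proof -
    have "x \<notin> K0" "y \<notin> K0" "\<not> ((x = 0 \<and> y = 1) \<or> (x = 1 \<and> y = 0))" using that dI by auto
    then show ?thesis by (simp add: F_def)
  qed
  define B where "B = {0, 1, 2} \<union> I"
  have fB: "finite B" using fI by (simp add: B_def)
  define g where "g = g1 \<union> g2"
  have gB: "g \<inter> B = {}" "2 \<notin> g" "g \<subseteq> K0" by (auto simp: g_def B_def I_def K0_def sets)
  have P2: "P 2 x \<longleftrightarrow> x \<in> ms" if "x \<notin> K0" for x using that by (auto simp: P_def K0_def sets)
  have one: "G (insert k B) F" if k: "k \<in> g" for k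
  proof -
    \<comment> \<open>Of \<open>0\<close> and \<open>1\<close>, the vertex \<open>z\<close> completes \<open>2\<close> and \<open>k\<close> to a triple of the allowed parity; the other one joins the clique \<open>I\<close>.\<close>
    define z z' where "z = (if k \<in> g1 then 1 else 0::nat)" and "z' = (if k \<in> g1 then 0 else 1::nat)"
    have zz: "z = 0 \<or> z = 1" "z' = 0 \<or> z' = 1" "{z, z'} = {0, 1}" "z \<noteq> z'" by (auto simp: z_def z'_def)
    have zK: "z \<notin> K0" "z \<notin> I" "z' \<notin> I" "z' \<notin> K0" using zz dI by auto
    have kK: "k \<in> K0" "k \<noteq> 2" using k gB by auto
    have "\<not> P k z" using k by (auto simp: z_def P_def g_def sets)
    moreover have "\<not> P 2 z" using P2[OF zK(1)] by (auto simp: z_def sets)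
    moreover have "F 2 k = (\<not> c)" using kK by (auto simp: F_def K0_def)
    ultimately have pr: "par F 2 k z = (\<not> c)" using FK[OF kK(1) zK(1)] FK[of 2 z] zK(1) by (auto simp: par_def K0_def)
    have "star G c {2, k, z} F"
    proof (rule S.triple[OF hp, of 2 k z F])
      have "k \<noteq> z" using kK(1) zK(1) by blast
      then show "distinct [2, k, z]" using kK(2) zz(1) by auto
    qed (fact sF, fact pr)
    then have "G ({2, k, z} \<union> insert z' I) F"
    proof (rule starD)
      show "finite (insert z' I)" using fI by simp
      have "2 \<noteq> z'" "k \<noteq> z'" "k \<notin> I" using zz(2) kK(1) zK(4) dI(1) by (simp_all, auto)
      then show "insert z' I \<inter> {2, k, z} = {}" using zz(4) dI(4) zK(2) by simp
      show "symm ({2, k, z} \<union> insert z' I) F" by (rule sF)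
      show "agree {2, k, z} F F" by (simp add: agree_def)
      show "clq c (insert z' I) F" by (rule clqI) (rule FI[OF _ _ zz(2)])
    qed
    moreover have "B = {z, z'} \<union> insert 2 I" unfolding B_def zz(3) by blast
    then have "{2, k, z} \<union> insert z' I = insert k B" by blast
    ultimately show ?thesis by simp
  qed
  have tw: "untwinned B F x k" if "x \<in> g" "k \<in> g" "x \<noteq> k" for x k
  proof -
    have m: "y + 2*M \<in> mk" "y + 2 * M \<notin> ms" if "y \<in> g" for y using that by (auto simp: g_def sets)
    have nK: "y \<notin> K0" if "y \<in> I" for y using that dI by auto
    have mI: "x + 2*M \<in> I" "4 \<in> I" using m[OF that(1)] Mpos by (auto simp: I_def ms_def)
    have K: "x \<in> K0" "k \<in> K0" using that gB by auto
    have "P x (x + 2*M)" using that(1) K nK[OF mI(1)] by (simp add: P_def g_def)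
    moreover have "\<not> P k (x + 2*M)" using that m[OF that(1)] by (auto simp: P_def g_def sets)
    moreover have "P x 4" "P k 4" using K nK[OF mI(2)] Mpos by (auto simp: P_def ms_def)
    ultimately have "F x (x + 2*M) \<noteq> F k (x + 2*M)" "F x 4 = F k 4"
      using FK K nK mI by simp_all
    moreover have "x + 2*M \<in> B" "4 \<in> B" using mI by (auto simp: B_def)
    ultimately show ?thesis unfolding untwinned_def by blast
  qed
  have GB: "G B F"
  proof -
    have "4+2*M \<in> g" using Mpos by (auto simp: g_def sets)
    from subset[OF one[OF this]] show ?thesis by blast
  qed
  have ex: "\<exists>E'. G (B \<union> K) E' \<and> agree B F E' \<and> (\<forall>k\<in>K. agree (insert k B) F E')" if "finite K" "K \<subseteq> g" for K
    using that
  proof (induction K)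
    case empty
    have "agree B F F" by (simp add: agree_def)
    then show ?case using GB by auto
  next
    case (insert k K)
    then obtain E1 where E1: "G (B \<union> K) E1" "agree B F E1" "\<And>k. k \<in> K \<Longrightarrow> agree (insert k B) F E1" by blast
    have k: "k \<in> g" "k \<notin> B" "k \<notin> K" "K \<subseteq> g" using insert gB by auto
    define E2 where "E2 = (\<lambda>x y. if x = k \<or> y = k then F x y else E1 x y)"
    have E21: "agree (B \<union> K) E1 E2"
    proof (rule agreeI)
      fix x y assume "x \<in> B \<union> K" "y \<in> B \<union> K"
      then have "x \<noteq> k" "y \<noteq> k" using k by blast+
      then show "E1 x y = E2 x y" by (simp add: E2_def)
    qed
    have E2F: "agree (insert k B) F E2"
    proof (rule agreeI)
      fix x y assume xy: "x \<in> insert k B" "y \<in> insert k B" "x \<noteq> y"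
      show "F x y = E2 x y"
      proof (cases "x = k \<or> y = k")
        case False
        then have "F x y = E1 x y" using agreeD[OF E1(2)] xy by blast
        then show ?thesis using False by (simp add: E2_def)
      qed (simp add: E2_def)
    qed
    have "\<exists>E'. agree (B \<union> K) E2 E' \<and> agree (insert k B) E2 E' \<and> G (insert k (B \<union> K)) E'"
    proof (rule amalg_point[OF insert.hyps(1)])
      show "G (B \<union> K) E2" by (rule embed_id[OF E1(1) order.refl E21])
      show "G (insert k B) E2" by (rule embed_id[OF one[OF k(1)] order.refl E2F])
      show "k \<notin> B \<union> K" using k by blast
      show "K \<inter> B = {}" using gB k by blast
      show "\<forall>x\<in>K. untwinned B E2 x k \<or> strong_switching_class G"
      proof
        fix x assume x: "x \<in> K"
        then have xk: "x \<in> g" "x \<noteq> k" "x \<notin> B" using k gB by blast+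
        have "E2 x z = F x z" "E2 k z = F k z" if z: "z \<in> B" for z
        proof -
          have "z \<noteq> k" "z \<noteq> x" using z k xk by blast+
          then have "F x z = E1 x z" using agreeD[OF E1(3)[OF x], of x z] z by blast
          then show "E2 x z = F x z" using \<open>z \<noteq> k\<close> xk by (simp add: E2_def)
          show "E2 k z = F k z" by (simp add: E2_def)
        qed
        then have "untwinned B E2 x k" using tw[OF xk(1) k(1) xk(2)] unfolding untwinned_def by metis
        then show "untwinned B E2 x k \<or> strong_switching_class G" by blast
      qed
    qed
    then obtain E' where E': "agree (B \<union> K) E2 E'" "agree (insert k B) E2 E'" "G (insert k (B \<union> K)) E'" by blast
    have tr: "agree V X Z" if "agree V X Y" "agree V Y Z" for V X Y Z using that by (auto simp: agree_def)
    have sb: "agree W X Y" if "agree V X Y" "W \<subseteq> V" for V W X Y using that unfolding agree_def by blast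
    have kF: "agree (insert k B) F E'" by (rule tr[OF E2F E'(2)])
    have xF: "agree (insert x B) F E'" if x: "x \<in> K" for x
      by (rule tr[OF E1(3)[OF x]], rule sb[OF tr[OF E21 E'(1)]]) (use x in blast)
    have "G (B \<union> insert k K) E'" using E'(3) by simp
    moreover have "agree B F E'" by (rule sb[OF kF]) blast
    ultimately show ?case using kF xF by blast
  qed
  have "finite g" using fI by (simp add: g_def)
  from ex[OF this order.refl]
  obtain E' where E'0: "G (B \<union> g) E' \<and> agree B F E' \<and> (\<forall>k\<in>g. agree (insert k B) F E')" by (elim exE)
  have E': "G (B \<union> g) E'" "agree B F E'" using E'0 by simp_all
  have E'3: "agree (insert k B) F E'" if "k \<in> g" for k using E'0 that by simp
  have EF: "E' k x = F k x" "E' x k = F k x" if "k \<in> insert 2 g" "x \<in> {0, 1} \<union> I" for k x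
  proof -
    have xB: "x \<in> B" "x \<noteq> k" using that gB dI by (auto simp: B_def)
    show e: "E' k x = F k x"
    proof (cases "k = 2")
      case True
      then show ?thesis using agreeD[OF E'(2), of 2 x] xB by (auto simp: B_def)
    next
      case False
      then show ?thesis using agreeD[OF E'3, of k k x] xB that by auto
    qed
    have "E' x k = E' k x" by (rule symmD[OF G_symm[OF E'(1)]]) (use that xB in \<open>auto simp: B_def\<close>)
    then show "E' x k = F k x" using e by simp
  qed
  have EB: "E' x y = F x y" if "x \<in> B" "y \<in> B" "x \<noteq> y" for x y using agreeD[OF E'(2)] that by simp
  have mixI: "mixed M1 E' k I" if k: "k \<in> insert 2 g" for k
  proof (rule mixed_mono[OF _ Mpos(2)], rule mixedI[OF fI(1), of ms ns])
    have kK: "k \<in> K0" using k gB by (auto simp: K0_def)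
    have nK: "y \<notin> K0" if "y \<in> I" for y using that dI by auto
    show "ms \<subseteq> I" "ns \<subseteq> I" by (auto simp: I_def)
    show "M \<le> card ms" "M \<le> card ns" by (auto simp: sets)
    show "E' k x = True" if "x \<in> ms" for x
    proof -
      have xI: "x \<in> I" using that by (simp add: I_def)
      then show ?thesis using EF(1)[OF k] FK[OF kK nK[OF xI]] that kK nK[OF xI] by (auto simp: P_def)
    qed
    show "E' k x = (\<not> True)" if "x \<in> ns" for x
    proof -
      have xI: "x \<in> I" using that by (simp add: I_def)
      have "\<not> P k x" using that k by (auto simp: P_def g_def sets)
      then show ?thesis using EF(1)[OF k] FK[OF kK nK[OF xI]] xI by auto
    qed
  qed
  have k2: "E' 2 k = (\<not> c)" if "k \<in> g" for k
  proof -
    have kk: "k \<in> K0" "k \<noteq> 2" "2 \<in> K0" "2 \<in> B" using that gB by (auto simp: K0_def B_def)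
    have "F k 2 = E' k 2" by (rule agreeD[OF E'3[OF that]]) (use kk in auto)
    moreover have "F k 2 = (\<not> c)" using kk by (simp add: F_def)
    moreover have "E' 2 k = E' k 2" by (rule symmD[OF G_symm[OF E'(1)]]) (use that kk in auto)
    ultimately show ?thesis by simp
  qed
  have clI: "clq c I E'"
  proof (rule clqI)
    fix x y assume xy: "x \<in> I" "y \<in> I" "x \<noteq> y"
    then show "E' x y = c" using EB[of x y] FI[of x 0 y] by (auto simp: B_def)
  qed
  have clg: "clq (\<not> c) g E'"
  proof (rule clqI)
    fix k l assume kl: "k \<in> g" "l \<in> g" "k \<noteq> l"
    have gi: "G ({2, k, l} \<union> I) E'" by (rule subset[OF E'(1)]) (use kl in \<open>auto simp: B_def\<close>)
    have d: "distinct [2, k, l]" "{2, k, l} \<inter> I = {}" using kl gB dI by (auto simp: B_def)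
    have "par E' 2 k l \<noteq> c"
    proof
      assume "par E' 2 k l = c"
      then have "\<not> G ({2, k, l} \<union> I) E'"
        by (intro M1[OF clI d] mixI) (use kl in simp_all)
      then show False using gi by simp
    qed
    then show "E' k l = (\<not> c)" using k2 kl by (auto simp: par_def)
  qed
  have gg: "G ({0, 1, 3} \<union> g) E'" by (rule subset[OF E'(1)]) (use dI in \<open>auto simp: B_def\<close>)
  have "\<not> G ({0, 1, 3} \<union> g) E'"
  proof (rule M2[OF clg])
    show "distinct [0, 1, 3::nat]" by simp
    show "{0, 1, 3} \<inter> g = {}" using gB dI by (auto simp: B_def)
    have kg: "k \<in> insert 2 g" "k \<in> K0" if "k \<in> g" for k using that gB by auto
    have v: "E' x k = P k x" if "k \<in> g" "x \<in> {0, 1, 3}" for k x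
    proof -
      have "x \<in> {0, 1} \<union> I" "x \<notin> K0" using that dI by auto
      then show ?thesis using EF(2)[OF kg(1)[OF that(1)]] FK[OF kg(2)[OF that(1)]] by simp
    qed
    have fg: "finite g" using fI by (simp add: g_def)
    have sg: "g1 \<subseteq> g" "g2 \<subseteq> g" by (auto simp: g_def)
    have cg: "M2 \<le> card g1" "M2 \<le> card g2" using Mpos by (auto simp: sets)
    have q: "P k 0 \<longleftrightarrow> k \<in> g1" "P k 3 \<longleftrightarrow> k \<in> g1" "P k 1 \<longleftrightarrow> k \<in> g2" if "k \<in> g" for k
      using that dI kg(2)[OF that] by (auto simp: P_def sets)
    have g12: "g1 \<inter> g2 = {}" by (auto simp: sets)
    have vq: "E' 0 k = (k \<in> g1)" "E' 3 k = (k \<in> g1)" "E' 1 k = (k \<in> g2)" if "k \<in> g" for k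
      using v[OF that] q[OF that] by simp_all
    have n12: "k \<notin> g2" if "k \<in> g1" for k using that g12 by blast
    have n21: "k \<notin> g1" if "k \<in> g2" for k using that g12 by blast
    show "mixed M2 E' 0 g" by (rule mixedI[OF fg sg cg, of _ _ True]) (use vq sg n21 in blast)+
    show "mixed M2 E' 3 g" by (rule mixedI[OF fg sg cg, of _ _ True]) (use vq sg n21 in blast)+
    show "mixed M2 E' 1 g" by (rule mixedI[OF fg sg(2,1) cg(2,1), of _ _ True]) (use vq sg n12 in blast)+
    have "F 0 1 = (\<not> c)" "F 1 3 = c" "F 0 3 = c" using dI by (auto simp: F_def)
    then show "par E' 0 1 3 = (\<not> c)" using EB[of 0 1] EB[of 1 3] EB[of 0 3] dI by (auto simp: par_def B_def)
  qed
  then show False using gg by simp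
qed

text \<open>
  If the colour \<open>c\<close> does not do, then its complement does.
\<close>
lemma both_parities:
  assumes stars: "\<And>v E. star G c {v} E"
  shows "\<exists>c'. (\<forall>v E. star G c' {v} E) \<and> (\<forall>d. has_parity (star G c') d)"
proof (cases "has_parity (star G c) c")
  case True
  then have "has_parity (star G c) d" for d
    using parity_of_clique_colour[OF stars True] True by (cases d; cases c; simp)
  then show ?thesis using stars by blast
next
  case False
  have st: "\<And>v E. star G (\<not> c) {v} E" by (rule stars_opposite[OF stars False])
  have t: "has_parity (star G (\<not> c)) (\<not> c)" using not_both_bad[OF stars st False] by blast
  then have "has_parity (star G (\<not> c)) d" for d
    using parity_of_clique_colour[OF st t] t by (cases d; cases c; simp)
  then show ?thesis using st by blast
qed

end

section \<open>Universality of switching classes with amalgamation\<close>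

lemma big_fibre:
  assumes "finite S" "finite T" "f ` S \<subseteq> T" "card T * M < card S"
  shows "\<exists>t\<in>T. M < card {x\<in>S. f x = t} + (1::nat)"
proof (rule ccontr)
  assume "\<not> ?thesis"
  then have le: "card {x\<in>S. f x = t} \<le> M" if "t \<in> T" for t using that by force
  have "S = (\<Union>t\<in>T. {x\<in>S. f x = t})" using assms(3) by auto
  then have "card S \<le> (\<Sum>t\<in>T. card {x\<in>S. f x = t})" using card_UN_le[OF assms(2)] by metis
  also have "\<dots> \<le> (\<Sum>t\<in>T. M)" by (rule sum_mono) (rule le)
  finally show False using assms(4) by simp
qed

context strong_switching_class begin

text \<open>
  Unrestricted amalgamation gives members of all sizes, in which Ramsey's theorem finds long
  cliques.
\<close>
lemma cliques_of_some_colour: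
  assumes single: "\<And>v E. G {v} E"
  shows "\<exists>c. \<forall>K E. finite K \<and> clq c K E \<and> symm K E \<longrightarrow> G K E"
proof -
  have ex: "\<exists>c E K. finite K \<and> card K = n \<and> clq c K E \<and> G K E" for n
  proof -
    obtain r where r: "\<And>V (E :: nat set set). \<lbrakk>finite V; card V \<ge> r\<rbrakk> \<Longrightarrow>
        \<exists>R\<subseteq>V. card R = n \<and> clique R E \<or> card R = n \<and> indep R E"
      using ramsey2[of n n] by blast
    obtain E where E: "G {..r} E" using some_of_each_size[OF single] by blast
    define ES where "ES = {{x, y} |x y. x \<le> r \<and> y \<le> r \<and> E x y}"
    obtain R where R: "R \<subseteq> {..r}" "card R = n" "clique R ES \<or> indep R ES"
      using r[of "{..r}" "ES"] by auto
    have GR: "G R E" by (rule subset[OF E R(1)])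
    have mem: "{x, y} \<in> ES \<longleftrightarrow> E x y" if "x \<in> R" "y \<in> R" for x y
    proof -
      have "E y x = E x y" using symmD[OF G_symm[OF GR]] that by blast
      moreover have "x \<le> r" "y \<le> r" using that R(1) by auto
      ultimately show ?thesis by (auto simp: ES_def doubleton_eq_iff)
    qed
    from R(3) show ?thesis
    proof
      assume "clique R ES"
      then have "clq True R E" unfolding clique_def using mem by (simp add: clq_def)
      then have "finite R \<and> card R = n \<and> clq True R E \<and> G R E" using GR R(2) G_finite[OF GR] by simp
      then show ?thesis by (intro exI)
    next
      assume "indep R ES"
      then have "clq False R E" unfolding indep_def using mem by (simp add: clq_def)
      then have "finite R \<and> card R = n \<and> clq False R E \<and> G R E" using GR R(2) G_finite[OF GR] by simp
      then show ?thesis by (intro exI)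
    qed
  qed
  have all: "G K E" if n: "finite K" "card K \<le> card K'" and K': "finite K'" "clq c K' E'" "G K' E'" and K: "clq c K E" "symm K E" for K K' c E E'
  proof -
    obtain f where f: "inj_on f K" "f ` K \<subseteq> K'" using n K'(1) by (meson card_le_inj)
    have "agree K (\<lambda>x y. E' (f x) (f y)) E"
    proof (rule agreeI)
      fix x y assume xy: "x \<in> K" "y \<in> K" "x \<noteq> y"
      then have "f x \<noteq> f y" using f(1) by (auto dest: inj_onD)
      moreover have "f x \<in> K'" "f y \<in> K'" using f(2) xy by blast+
      ultimately show "E' (f x) (f y) = E x y" using clqD[OF K'(2)] clqD[OF K(1)] xy by simp
    qed
    then show ?thesis by (rule embed_id[OF relabel[OF K'(3) f] order.refl])
  qed
  show ?thesis
  proof (cases "\<forall>n. \<exists>E K. finite K \<and> n \<le> card K \<and> clq True K E \<and> G K E")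
    case True
    have "G K E" if "finite K" "clq True K E" "symm K E" for K E
    proof -
      obtain E' K' where "finite K'" "card K \<le> card K'" "clq True K' E'" "G K' E'" using True by blast
      then show ?thesis using all that by blast
    qed
    then show ?thesis by blast
  next
    case False
    then obtain n0 where n0: "\<not> (\<exists>E K. finite K \<and> n0 \<le> card K \<and> clq True K E \<and> G K E)" by blast
    have "G K E" if "finite K" "clq False K E" "symm K E" for K E
    proof -
      obtain c E' K' where h: "finite K'" "card K' = max n0 (card K)" "clq c K' E'" "G K' E'" using ex by blast
      have "n0 \<le> card K'" "card K \<le> card K'" using h(2) by auto
      then have "\<not> c" using n0 h by (cases c) auto
      then have "clq False K' E'" using h(3) by simp
      from all[OF that(1) \<open>card K \<le> card K'\<close> h(1) this h(4) that(2,3)] show ?thesis .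
    qed
    then show ?thesis by blast
  qed
qed

text \<open>
  By \<open>stars_if_mixed\<close> it suffices to find vertices that are mixed over long cliques of a colour
  \<open>c\<close> all of whose cliques are in \<open>G\<close>.  Suppose that there are none beyond \<open>M\<close>.  A triple of the
  parity \<open>\<not> c\<close> placed on a long clique gives a vertex \<open>2\<close> that has, up to switching, colour \<open>c\<close> to
  most of the clique and colour \<open>\<not> c\<close> to some \<open>u\<close> in it.  A second long clique that is
  joined to \<open>u\<close> in colour \<open>c\<close> and to \<open>2\<close> in colour \<open>\<not> c\<close> is amalgamated with this graph and thinned out until its
  members look alike from the first clique.  Whatever they look like, the two cliques then
  combine, perhaps after switching, into a clique over which some vertex is mixed.
\<close>
lemma stars_exist:
  assumes single: "\<And>v E. G {v} E" and par: "\<And>d. has_parity G d"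
  shows "\<exists>c. \<forall>v E. star G c {v} E"
proof -
  obtain c where cl: "\<And>K E. \<lbrakk>finite K; clq c K E; symm K E\<rbrakk> \<Longrightarrow> G K E"
    using cliques_of_some_colour[OF single] by blast
  have "star G c {v} E" for v E
  proof (rule stars_if_mixed, rule ccontr)
    fix M0
    assume bad0: "\<not> (\<exists>J v E. v \<notin> J \<and> G (insert v J) E \<and> clq c J E \<and> mixed M0 E v J)"
    define M where "M = Suc M0"
    have bad: False if "G V E" "insert v J \<subseteq> V" "v \<notin> J" "clq c J E" "mixed M E v J" for V J v E
      using bad0 that subset[OF that(1,2)] mixed_mono[OF that(5), of M0] unfolding M_def by auto
    define L where "L = 3 + 3 * M"
    define I0 where "I0 = {0, 1} \<union> {3..<L}"
    define E0 where "E0 = (\<lambda>(x::nat) (y::nat). c \<noteq> ((x = 1 \<and> y = 2) \<or> (x = 2 \<and> y = (1::nat))))"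
    have sE0: "symm V E0" for V by (rule symmI) (auto simp: E0_def)
    have fI0: "finite I0" and cI0: "card I0 = 3 * M + 2" by (auto simp: I0_def L_def)
    have "2 \<notin> I0" by (auto simp: I0_def)
    have cE0: "clq c I0 E0" by (rule clqI) (auto simp: I0_def E0_def)
    have "\<exists>E'. agree ({0, 1} \<union> {3..<L}) E0 E' \<and> agree (insert 2 {0, 1}) E0 E' \<and> G (insert 2 ({0, 1} \<union> {3..<L})) E'"
    proof (rule amalg_point)
      show "G ({0, 1} \<union> {3..<L}) E0" using cl[OF fI0 cE0 sE0] by (simp add: I0_def)
      have "G {0, 1, 2} E0"
      proof (rule triple[OF par[of "\<not> c"]])
        show "par E0 0 1 2 = (\<not> c)" by (auto simp: par_def E0_def)
      qed (simp, rule sE0)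
      moreover have "insert 2 {0, 1} = {0, 1, 2::nat}" by blast
      ultimately show "G (insert 2 {0, 1}) E0" by simp
      show "\<forall>x\<in>{3..<L}. untwinned {0, 1} E0 x 2 \<or> strong_switching_class G" using strong_switching_class_axioms by blast
    qed auto
    then obtain E1 where E1: "agree I0 E0 E1" "agree (insert 2 {0, 1}) E0 E1" "G (insert 2 I0) E1"
      unfolding I0_def by blast
    have E1v: "E1 2 0 = c" "E1 2 1 = (\<not> c)"
      using agreeD[OF E1(2), of 2 0] agreeD[OF E1(2), of 2 1] by (auto simp: E0_def)
    have c1: "clq c I0 E1"
    proof (rule clqI)
      fix x y assume "x \<in> I0" "y \<in> I0" "x \<noteq> y"
      then show "E1 x y = c" using agreeD[OF E1(1)] clqD[OF cE0] by simp
    qed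
    have "\<not> mixed M E1 2 I0" using bad[OF E1(3) order.refl \<open>2 \<notin> I0\<close> c1] by blast
    then have "card {j\<in>I0. E1 2 j = True} < M \<or> card {j\<in>I0. E1 2 j = False} < M" by (simp add: mixed_def not_le)
    then obtain t where t: "card {j\<in>I0. E1 2 j = t} < M" by (elim disjE)
    define E2 where "E2 = (\<lambda>x y. E1 x y \<noteq> ((x = 2 \<and> t = c) \<noteq> (y = 2 \<and> t = c)))"
    have G2: "G (insert 2 I0) E2" unfolding E2_def by (rule switch[OF E1(3), of "\<lambda>x. x = 2 \<and> t = c"])
    have E2I: "E2 x y = E1 x y" if "x \<in> I0" "y \<in> I0" for x y
    proof -
      have "x \<noteq> 2" "y \<noteq> 2" using that \<open>2 \<notin> I0\<close> by auto
      then show ?thesis by (simp add: E2_def)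
    qed
    have E22: "E2 2 j = (\<not> c) \<longleftrightarrow> E1 2 j = t" if "j \<in> I0" for j
    proof -
      have "j \<noteq> 2" using that \<open>2 \<notin> I0\<close> by auto
      then show ?thesis by (cases c; cases t) (simp_all add: E2_def)
    qed
    define u :: nat where "u = (if t = c then 0 else 1)"
    have u: "u \<in> I0" "u \<noteq> 2" by (auto simp: u_def I0_def)
    have u2: "E2 2 u = (\<not> c)" using E22[OF u(1)] E1v by (auto simp: u_def)
    define small where "small = {j\<in>I0. E2 2 j = (\<not> c)}"
    have "small = {j\<in>I0. E1 2 j = t}" unfolding small_def using E22 by blast
    then have sm: "card small < M" using t by simp
    have c2: "clq c I0 E2"
    proof (rule clqI)
      fix x y assume "x \<in> I0" "y \<in> I0" "x \<noteq> y"
      then show "E2 x y = c" using E2I clqD[OF c1] by simp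
    qed
    \<comment> \<open>Enough new vertices for \<open>M\<close> of them to have the same neighbours in \<open>I0\<close>.\<close>
    define N where "N = Suc (card (Pow I0) * M)"
    define H where "H = (\<lambda>(x::nat) (y::nat). c \<noteq> (x = 2 \<or> y = (2::nat)))"
    have GH: "G V H" if "finite V" for V
    proof -
      have "G V (\<lambda>_ _. c)" by (rule cl[OF that]) (auto simp: clq_def symm_def)
      then have "G V (\<lambda>x y. c \<noteq> ((x = 2) \<noteq> (y = 2)))" by (rule switch)
      then show ?thesis by (rule embed_id[OF _ order.refl]) (auto simp: agree_def H_def)
    qed
    have "\<exists>E3. agree (insert 2 I0) E2 E3 \<and> agree ({u, 2} \<union> {L..<L+m}) H E3 \<and> G (insert 2 I0 \<union> {L..<L+m}) E3" for m
    proof (induction m)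
      case 0
      have "E2 u 2 = E2 2 u" by (rule symmD[OF G_symm[OF G2]]) (use u in auto)
      then have "agree {u, 2} H E2" using u2 u by (auto simp: agree_def H_def)
      moreover have "agree (insert 2 I0) E2 E2" by (simp add: agree_def)
      ultimately show ?case using G2 by (intro exI[of _ E2]) simp
    next
      case (Suc m)
      then obtain E3 where E3: "agree (insert 2 I0) E2 E3" "agree ({u, 2} \<union> {L..<L+m}) H E3" "G (insert 2 I0 \<union> {L..<L+m}) E3" by blast
      define k where "k = L + m"
      define E4 where "E4 = (\<lambda>x y. if x = k \<or> y = k then H x y else E3 x y)"
      define B where "B = {u, 2} \<union> {L..<L+m}"
      define K where "K = I0 - {u}"
      have BK: "B \<union> K = insert 2 I0 \<union> {L..<L+m}" using u by (auto simp: B_def K_def)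
      have kn: "k \<notin> B \<union> K" using u by (auto simp: B_def K_def k_def I0_def L_def u_def)
      have E34: "agree (B \<union> K) E3 E4"
      proof (rule agreeI)
        fix x y assume "x \<in> B \<union> K" "y \<in> B \<union> K"
        then have "x \<noteq> k" "y \<noteq> k" using kn by blast+
        then show "E3 x y = E4 x y" by (simp add: E4_def)
      qed
      have HE4: "agree (insert k B) H E4"
      proof (rule agreeI)
        fix x y assume xy: "x \<in> insert k B" "y \<in> insert k B" "x \<noteq> y"
        show "H x y = E4 x y"
        proof (cases "x = k \<or> y = k")
          case False
          then have "H x y = E3 x y" using agreeD[OF E3(2), of x y] xy unfolding B_def by blast
          then show ?thesis using False by (simp add: E4_def)
        qed (simp add: E4_def)
      qed
      have "\<exists>E'. agree (B \<union> K) E4 E' \<and> agree (insert k B) E4 E' \<and> G (insert k (B \<union> K)) E'"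
      proof (rule amalg_point)
        show "finite K" using fI0 by (simp add: K_def)
        have "G (B \<union> K) E3" using E3(3) BK by simp
        then show "G (B \<union> K) E4" by (rule embed_id[OF _ order.refl E34])
        have "finite (insert k B)" by (simp add: B_def)
        then show "G (insert k B) E4" by (intro embed_id[OF GH order.refl HE4])
        show "K \<inter> B = {}" using \<open>2 \<notin> I0\<close> by (auto simp: K_def B_def I0_def L_def)
        show "\<forall>x\<in>K. untwinned B E4 x k \<or> strong_switching_class G" using strong_switching_class_axioms by blast
      qed (rule kn)
      then obtain E' where E': "agree (B \<union> K) E4 E'" "agree (insert k B) E4 E'" "G (insert k (B \<union> K)) E'" by blast
      have tr: "agree V X Z" if "agree V X Y" "agree V Y Z" for V X Y Z using that by (auto simp: agree_def)
      have sb: "agree W X Y" if "agree V X Y" "W \<subseteq> V" for V W X Y using that unfolding agree_def by blast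
      have "agree (insert 2 I0) E2 E'"
        by (rule tr[OF E3(1)], rule sb[OF tr[OF E34 E'(1)]]) (auto simp: BK)
      moreover have eq: "{L..<L+Suc m} = insert k {L..<L+m}" by (auto simp: k_def)
      have "agree ({u, 2} \<union> {L..<L+Suc m}) H E'"
        by (rule sb[OF tr[OF HE4 E'(2)]]) (unfold eq B_def, blast)
      moreover have "G (insert 2 I0 \<union> {L..<L+Suc m}) E'" using E'(3) unfolding BK eq by simp
      ultimately show ?case by blast
    qed
    then obtain E3 where E3: "agree (insert 2 I0) E2 E3" "agree ({u, 2} \<union> {L..<L+N}) H E3" "G (insert 2 I0 \<union> {L..<L+N}) E3" by blast
    define W where "W = insert 2 I0 \<union> {L..<L+N}"
    have GW: "G W E3" using E3(3) by (simp add: W_def)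
    define pat where "pat = (\<lambda>i. {j\<in>I0. E3 i j})"
    have "\<exists>p\<in>Pow I0. M < card {i\<in>{L..<L+N}. pat i = p} + 1"
      by (rule big_fibre) (use fI0 in \<open>auto simp: pat_def N_def\<close>)
    then obtain p where p: "p \<subseteq> I0" "M \<le> card {i\<in>{L..<L+N}. pat i = p}" by auto
    define I1 where "I1 = {i\<in>{L..<L+N}. pat i = p}"
    have fI1: "finite I1" and cI1: "M \<le> card I1" using p by (auto simp: I1_def)
    have I1L: "I1 \<subseteq> {L..<L+N}" by (auto simp: I1_def)
    have disj: "I1 \<inter> I0 = {}" "2 \<notin> I1" using I1L by (auto simp: I0_def L_def)
    have E3p: "E3 i j = (j \<in> p)" if "i \<in> I1" "j \<in> I0" for i j
    proof -
      have "pat i = p" using that(1) by (simp add: I1_def)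
      then show ?thesis using that(2) by (auto simp: pat_def)
    qed
    have E3p': "E3 j i = (j \<in> p)" if "i \<in> I1" "j \<in> I0" for i j
    proof -
      have "E3 j i = E3 i j" by (rule symmD[OF G_symm[OF GW]]) (use that I1L in \<open>auto simp: W_def\<close>)
      then show ?thesis using E3p[OF that] by simp
    qed
    have c3: "clq c I0 E3"
    proof (rule clqI)
      fix x y assume "x \<in> I0" "y \<in> I0" "x \<noteq> y"
      then show "E3 x y = c" using agreeD[OF E3(1), of x y] clqD[OF c2] by simp
    qed
    have c31: "clq c I1 E3"
    proof (rule clqI)
      fix x y assume xy: "x \<in> I1" "y \<in> I1" "x \<noteq> y"
      then have "H x y = E3 x y" using agreeD[OF E3(2), of x y] I1L by blast
      moreover have "x \<noteq> 2" "y \<noteq> 2" using xy disj by auto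
      ultimately show "E3 x y = c" by (simp add: H_def)
    qed
    have "I1 \<noteq> {}" using cI1 by (auto simp: M_def)
    then obtain i0 where i0: "i0 \<in> I1" by blast
    have up: "(u \<in> p) = c"
    proof -
      have "H i0 u = E3 i0 u" by (rule agreeD[OF E3(2)]) (use i0 I1L disj u in auto)
      moreover have "i0 \<noteq> 2" using i0 disj by auto
      ultimately show ?thesis using E3p[OF i0 u(1)] u by (simp add: H_def)
    qed
    have W2: "E3 2 i = (\<not> c)" if "i \<in> I1" for i
    proof -
      have "H 2 i = E3 2 i" by (rule agreeD[OF E3(2)]) (use that I1L disj in auto)
      then show ?thesis by (simp add: H_def)
    qed
    define A where "A = (\<lambda>b. {j\<in>I0. (j \<in> p) = b})"
    have fA: "finite (A b)" "A b \<subseteq> I0" for b using fI0 by (auto simp: A_def)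
    have cA: "card (A c) + card (A (\<not> c)) = 3 * M + 2"
    proof -
      have "A c \<union> A (\<not> c) = I0" "A c \<inter> A (\<not> c) = {}" by (auto simp: A_def)
      then show ?thesis using card_Un_disjoint[OF fA(1) fA(1), of c "\<not> c"] cI0 by simp
    qed
    have notboth: "\<not> (M \<le> card (A c) \<and> M \<le> card (A (\<not> c)))"
    proof
      assume m: "M \<le> card (A c) \<and> M \<le> card (A (\<not> c))"
      have "mixed M E3 i0 I0"
        by (rule mixedI[OF fI0 fA(2) fA(2), of M c "\<not> c" _ _ c]) (use m E3p[OF i0] in \<open>auto simp: A_def\<close>)
      moreover have "i0 \<notin> I0" "insert i0 I0 \<subseteq> W" using i0 I1L disj by (auto simp: W_def)
      ultimately show False using bad[OF GW _ _ c3] by blast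
    qed
    have cross: "clq c (I1 \<union> A b) X" if "clq c I1 X" "clq c I0 X" "\<And>i j. \<lbrakk>i \<in> I1; j \<in> A b\<rbrakk> \<Longrightarrow> X i j = c \<and> X j i = c" for b X
    proof (rule clqI)
      fix x y assume xy: "x \<in> I1 \<union> A b" "y \<in> I1 \<union> A b" "x \<noteq> y"
      show "X x y = c"
        using xy that(3) clqD[OF that(1), of x y] clqD[OF that(2), of x y] fA(2)[of b] by blast
    qed
    have fU: "finite (I1 \<union> A b)" for b using fI1 fA by simp
    show False
    proof (cases "M \<le> card (A c)")
      case True
      have cl3: "clq c (I1 \<union> A c) E3"
        by (rule cross[OF c31 c3]) (use E3p E3p' in \<open>auto simp: A_def\<close>)
      show False
      proof (cases "A (\<not> c) = {}")
        case True
        then have AI: "A c = I0" by (auto simp: A_def)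
        have ca: "M \<le> card (I0 - small)"
          using sm cI0 fI0 card_Diff_subset[of small I0] by (simp add: small_def)
        have "mixed M E3 2 (I1 \<union> A c)"
        proof (rule mixedI[OF fU, where X=I1 and Y="I0 - small" and t="\<not> c"])
          show "E3 2 y = (\<not> (\<not> c))" if "y \<in> I0 - small" for y
          proof -
            have "2 \<noteq> y" using that \<open>2 \<notin> I0\<close> by auto
            then have "E2 2 y = E3 2 y" using agreeD[OF E3(1), of 2 y] that by simp
            then show ?thesis using that by (auto simp: small_def)
          qed
        qed (use cI1 ca W2 AI in auto)
        then show False using bad[OF GW _ _ cl3, of 2] disj \<open>2 \<notin> I0\<close> I1L AI by (auto simp: W_def)
      next
        case False
        then obtain b where b: "b \<in> A (\<not> c)" by blast
        then have bI: "b \<in> I0" "b \<notin> I1" "b \<notin> A c" using disj by (auto simp: A_def)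
        have "mixed M E3 b (I1 \<union> A c)"
        proof (rule mixedI[OF fU, where X=I1 and Y="A c" and t="\<not> c"])
          show "E3 b i = (\<not> c)" if "i \<in> I1" for i using E3p'[OF that bI(1)] b by (simp add: A_def)
          show "E3 b j = (\<not> (\<not> c))" if "j \<in> A c" for j using clqD[OF c3 bI(1), of j] that bI fA(2) by auto
        qed (use cI1 True in auto)
        then show False using bad[OF GW _ _ cl3, of b] bI I1L fA(2)[of c] by (auto simp: W_def)
      qed
    next
      case False
      then have big: "M \<le> card (A (\<not> c))" using cA by linarith
      define E4 where "E4 = (\<lambda>x y. E3 x y \<noteq> ((x \<in> I1) \<noteq> (y \<in> I1)))"
      have G4: "G W E4" unfolding E4_def by (rule switch[OF GW, of "\<lambda>x. x \<in> I1"])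
      have nI: "j \<notin> I1" if "j \<in> I0" for j using that disj by blast
      have 1: "clq c I1 E4" using clqD[OF c31] by (auto simp: clq_def E4_def)
      have 2: "clq c I0 E4" using clqD[OF c3] nI by (auto simp: clq_def E4_def)
      have cl4: "clq c (I1 \<union> A (\<not> c)) E4"
        by (rule cross[OF 1 2]) (use E3p E3p' nI in \<open>auto simp: A_def E4_def\<close>)
      have uA: "u \<notin> A (\<not> c)" using up by (auto simp: A_def)
      have "mixed M E4 u (I1 \<union> A (\<not> c))"
      proof (rule mixedI[OF fU, where X=I1 and Y="A (\<not> c)" and t="\<not> c"])
        show "E4 u i = (\<not> c)" if "i \<in> I1" for i using E3p'[OF that u(1)] up that nI[OF u(1)] by (simp add: E4_def)
        show "E4 u j = (\<not> (\<not> c))" if "j \<in> A (\<not> c)" for j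
          using clqD[OF 2 u(1), of j] that uA fA(2)[of "\<not> c"] by auto
      qed (use cI1 big in auto)
      then show False using bad[OF G4 _ _ cl4, of u] u uA nI[OF u(1)] I1L fA(2)[of "\<not> c"] by (auto simp: W_def)
    qed
  qed
  then show ?thesis by blast
qed

end

text \<open>
  Induction on the number of vertices, over all classes \<open>G\<close> simultaneously: to put \<open>V\<close> with one more
  vertex into \<open>G\<close>, put \<open>V\<close> into the derived class and regard the vertex as a clique.
\<close>
theorem switching_class_universal:
  assumes "switching_class G" "\<exists>c. \<forall>v E. star G c {v} E" "finite V" "symm V E"
  shows "G V E"
  using assms(3,1,2,4)
proof (induction V arbitrary: G rule: finite_induct)
  case empty
  interpret switching_class G by fact
  obtain c where "\<And>v E. star G c {v} E" using empty by blast
  then show ?case using subset[OF star_G, of c "{0}" E "{}"] by blast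
next
  case (insert v V)
  interpret switching_class G by fact
  obtain c where c: "\<And>v E. star G c {v} E" using insert.prems by blast
  obtain c' where c': "\<And>v E. star G c' {v} E" "\<And>d. has_parity (star G c') d" using both_parities[OF c] by blast
  interpret S: strong_switching_class "star G c'" by (rule star_strong)
  have "star G c' V E"
    by (rule insert.IH[OF S.switching_class_axioms S.stars_exist[OF c']])
      (rule symm_subset[OF insert.prems(3)], blast)
  then have "G (V \<union> {v}) E"
    by (rule starD) (use insert in \<open>auto simp: agree_def clq_def\<close>)
  then show ?case by simp
qed

section \<open>Quantifier elimination and half graphs\<close>

definition Truth :: fm where "Truth = Neg (Ex 0 (Neg (Eq 0 0)))"

definition conjs :: "fm list \<Rightarrow> fm" where "conjs \<phi>s = foldr Conj \<phi>s Truth"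

definition Exs :: "nat list \<Rightarrow> fm \<Rightarrow> fm" where "Exs is \<phi> = foldr Ex is \<phi>"

definition literal :: "bool \<Rightarrow> fm \<Rightarrow> fm" where "literal b \<phi> = (if b then \<phi> else Neg \<phi>)"

text \<open>
  The atomic diagram of the values of \<open>e\<close> at the listed variables.
\<close>
definition diag :: "'a struc \<Rightarrow> (nat \<Rightarrow> 'a) \<Rightarrow> nat list \<Rightarrow> fm" where
  "diag M e is = conjs (concat (map (\<lambda>i. concat (map (\<lambda>j. literal (e i = e j) (Eq i j) #
     map (\<lambda>p. literal (rel M p (e i) (e j)) (Atom p i j)) [Rp, Sp, Tp]) is)) is))"

definition same_type :: "'a struc \<Rightarrow> (nat \<Rightarrow> 'a) \<Rightarrow> 'b struc \<Rightarrow> (nat \<Rightarrow> 'b) \<Rightarrow> nat set \<Rightarrow> bool" where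
  "same_type M e N e' V \<longleftrightarrow> (\<forall>i\<in>V. \<forall>j\<in>V. (e i = e j \<longleftrightarrow> e' i = e' j) \<and> (\<forall>p. rel M p (e i) (e j) \<longleftrightarrow> rel N p (e' i) (e' j)))"

lemma sat_conjs: "sat M e (conjs \<phi>s) \<longleftrightarrow> (\<forall>\<phi>\<in>set \<phi>s. sat M e \<phi>)"
  by (induction \<phi>s) (auto simp: conjs_def Truth_def)

lemma fv_conjs: "fv (conjs \<phi>s) = (\<Union>\<phi>\<in>set \<phi>s. fv \<phi>)"
  by (induction \<phi>s) (auto simp: conjs_def Truth_def)

lemma sat_literal: "sat M e (literal b \<phi>) \<longleftrightarrow> sat M e \<phi> = b"
  by (simp add: literal_def)

lemma fv_literal: "fv (literal b \<phi>) = fv \<phi>"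
  by (simp add: literal_def)

lemma all_pred: "(\<forall>p. Q p) \<longleftrightarrow> Q Rp \<and> Q Sp \<and> Q Tp"
  by (metis pred.exhaust)

lemma sat_diag: "sat N e' (diag M e is) \<longleftrightarrow> same_type M e N e' (set is)"
  unfolding diag_def sat_conjs same_type_def all_pred
  by (simp add: sat_literal ball_Un image_Un) blast

lemma fv_diag: "fv (diag M e is) \<subseteq> set is"
  unfolding diag_def fv_conjs by (auto simp: fv_literal)

lemma fv_Exs: "fv (Exs is \<phi>) = fv \<phi> - set is"
  by (induction "is") (auto simp: Exs_def)

lemma sat_Exs: "sat M e (Exs is \<phi>) \<longleftrightarrow>
   (\<exists>e'. (\<forall>i. i \<notin> set is \<longrightarrow> e' i = e i) \<and> (\<forall>i\<in>set is. e' i \<in> carrier M) \<and> sat M e' \<phi>)"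
proof (induction "is" arbitrary: e)
  case Nil
  have "e' = e" if "\<forall>i. e' i = e i" for e' :: "nat \<Rightarrow> 'a" using that by auto
  then show ?case by (auto simp: Exs_def)
next
  case (Cons k "is")
  have "sat M e (Exs (k # is) \<phi>) \<longleftrightarrow> (\<exists>x\<in>carrier M. sat M (e(k := x)) (Exs is \<phi>))" by (simp add: Exs_def)
  also have "\<dots> \<longleftrightarrow> (\<exists>x\<in>carrier M. \<exists>e'. (\<forall>i. i \<notin> set is \<longrightarrow> e' i = (e(k := x)) i) \<and>
      (\<forall>i\<in>set is. e' i \<in> carrier M) \<and> sat M e' \<phi>)" by (simp only: Cons.IH)
  also have "\<dots> \<longleftrightarrow> (\<exists>e'. (\<forall>i. i \<notin> set (k # is) \<longrightarrow> e' i = e i) \<and> (\<forall>i\<in>set (k # is). e' i \<in> carrier M) \<and> sat M e' \<phi>)"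
  proof
    assume "\<exists>x\<in>carrier M. \<exists>e'. (\<forall>i. i \<notin> set is \<longrightarrow> e' i = (e(k := x)) i) \<and> (\<forall>i\<in>set is. e' i \<in> carrier M) \<and> sat M e' \<phi>"
    then obtain x e' where h: "x \<in> carrier M" "\<forall>i. i \<notin> set is \<longrightarrow> e' i = (e(k := x)) i" "\<forall>i\<in>set is. e' i \<in> carrier M" "sat M e' \<phi>" by blast
    have "e' k \<in> carrier M" using h by (cases "k \<in> set is") auto
    then show "\<exists>e'. (\<forall>i. i \<notin> set (k # is) \<longrightarrow> e' i = e i) \<and> (\<forall>i\<in>set (k # is). e' i \<in> carrier M) \<and> sat M e' \<phi>"
      using h by (intro exI[of _ e']) auto
  next
    assume "\<exists>e'. (\<forall>i. i \<notin> set (k # is) \<longrightarrow> e' i = e i) \<and> (\<forall>i\<in>set (k # is). e' i \<in> carrier M) \<and> sat M e' \<phi>"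
    then obtain e' where h: "\<forall>i. i \<notin> set (k # is) \<longrightarrow> e' i = e i" "\<forall>i\<in>set (k # is). e' i \<in> carrier M" "sat M e' \<phi>" by blast
    show "\<exists>x\<in>carrier M. \<exists>e'. (\<forall>i. i \<notin> set is \<longrightarrow> e' i = (e(k := x)) i) \<and> (\<forall>i\<in>set is. e' i \<in> carrier M) \<and> sat M e' \<phi>"
      by (rule bexI[of _ "e' k"], rule exI[of _ e']) (use h in auto)
  qed
  finally show ?case .
qed

lemma same_typeD:
  assumes "same_type M e N e' V" "i \<in> V" "j \<in> V"
  shows "e i = e j \<longleftrightarrow> e' i = e' j" "rel M p (e i) (e j) \<longleftrightarrow> rel N p (e' i) (e' j)"
  using assms unfolding same_type_def by blast+

lemma same_type_sym: "same_type M e N e' V \<Longrightarrow> same_type N e' M e V"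
  unfolding same_type_def by blast

lemma same_type_trans: "\<lbrakk>same_type M e N e' V; same_type N e' L e'' V\<rbrakk> \<Longrightarrow> same_type M e L e'' V"
  unfolding same_type_def by blast

lemma same_type_subset: "\<lbrakk>same_type M e N e' V; W \<subseteq> V\<rbrakk> \<Longrightarrow> same_type M e N e' W"
  unfolding same_type_def by blast

lemma same_type_cong:
  assumes "same_type M e N e' V" "\<And>i. i \<in> V \<Longrightarrow> e i = d i" "\<And>i. i \<in> V \<Longrightarrow> e' i = d' i"
  shows "same_type M d N d' V"
  using assms(1) unfolding same_type_def using assms(2,3) by simp

lemma same_type_iso:
  assumes "iso g M N" "\<And>i. i \<in> V \<Longrightarrow> e i \<in> carrier M"
  shows "same_type M e N (\<lambda>i. g (e i)) V"
proof -
  have "inj_on g (carrier M)" using assms(1) by (auto simp: iso_def bij_betw_def)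
  then show ?thesis using assms unfolding same_type_def iso_def by (auto dest: inj_onD)
qed

text \<open>
  Homogeneity in terms of valuations, whose values at different variables may coincide.
\<close>
lemma homogeneous_extend:
  assumes "homogeneous M" "finite V" "e ` V \<subseteq> carrier M" "e' ` V \<subseteq> carrier M" "same_type M e M e' V"
  shows "\<exists>g. iso g M M \<and> (\<forall>i\<in>V. g (e i) = e' i)"
proof -
  define f where "f = (\<lambda>x. e' (inv_into V e x))"
  have f: "f (e i) = e' i" if "i \<in> V" for i
  proof -
    have "inv_into V e (e i) \<in> V" "e (inv_into V e (e i)) = e i" using that by (auto intro: inv_into_into f_inv_into_f)
    then show ?thesis using same_typeD(1)[OF assms(5)] that by (auto simp: f_def)
  qed
  have "bij_betw f (e ` V) (e' ` V)" unfolding bij_betw_def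
  proof
    show "inj_on f (e ` V)" using f same_typeD(1)[OF assms(5)] by (auto simp: inj_on_def)
    show "f ` e ` V = e' ` V" using f by (auto simp: image_image)
  qed
  then have "iso f (substructure M (e ` V)) (substructure M (e' ` V))"
    using f same_typeD(2)[OF assms(5)] by (auto simp: iso_def substructure_def)
  then obtain g where "iso g M M" "\<forall>x\<in>e ` V. g x = f x"
    using assms(1-4) unfolding homogeneous_def by (metis finite_imageI)
  then show ?thesis using f by auto
qed

locale theory_model =
  fixes M :: "'a struc" and N :: "'b struc"
  assumes M_homogeneous: "homogeneous M" and M_nonempty: "carrier M \<noteq> {}"
    and N_model: "model_of N (theory_of M)"
begin

lemma sentence_transfer:
  assumes "fv \<phi> = {}" "\<And>e. range e \<subseteq> carrier M \<Longrightarrow> sat M e \<phi>" "range e \<subseteq> carrier N"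
  shows "sat N e \<phi>"
  using assms N_model by (auto simp: model_of_def theory_of_def true_in_def)

lemma N_nonempty: "carrier N \<noteq> {}"
  using N_model by (simp add: model_of_def)

lemma total:
  assumes "carrier X \<noteq> {}" "e ` V \<subseteq> carrier X"
  obtains d where "range d \<subseteq> carrier X" "\<And>i. i \<in> V \<Longrightarrow> d i = e i"
proof -
  obtain x where "x \<in> carrier X" using assms(1) by blast
  then show ?thesis using that[of "\<lambda>i. if i \<in> V then e i else x"] assms(2) by auto
qed

text \<open>
  Otherwise the sentence that excludes this finite diagram would belong to the theory.
\<close>
lemma realise_in_M:
  assumes "finite V" "e ` V \<subseteq> carrier N"
  shows "\<exists>e'. e' ` V \<subseteq> carrier M \<and> same_type N e M e' V"
proof (rule ccontr)
  assume no: "\<not> ?thesis"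
  obtain vs where vs: "set vs = V" using assms(1) finite_list by blast
  define \<sigma> where "\<sigma> = Neg (Exs vs (diag N e vs))"
  obtain d where d: "range d \<subseteq> carrier N" "\<And>i. i \<in> V \<Longrightarrow> d i = e i" by (rule total[OF N_nonempty assms(2)]) blast
  have "sat N d \<sigma>"
  proof (rule sentence_transfer[OF _ _ d(1)])
    show "fv \<sigma> = {}" using fv_diag[of N e vs] by (auto simp: \<sigma>_def fv_Exs)
    show "sat M e0 \<sigma>" for e0 using no vs by (auto simp: \<sigma>_def sat_Exs sat_diag)
  qed
  moreover have "same_type N e N d V" using d(2) by (simp add: same_type_def)
  then have "sat N d (Exs vs (diag N e vs))"
    unfolding sat_Exs sat_diag vs by (intro exI[of _ d]) (use d(1) in auto)
  ultimately show False by (simp add: \<sigma>_def)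
qed

lemma extend_in_M:
  assumes "finite V" "e ` V \<subseteq> carrier N" "e' ` V \<subseteq> carrier M" "same_type N e M e' V" "x \<in> carrier N"
  shows "\<exists>y\<in>carrier M. same_type N (e(i := x)) M (e'(i := y)) (insert i V)"
proof -
  have "finite (insert i V)" "(e(i := x)) ` insert i V \<subseteq> carrier N" using assms by auto
  then obtain d where d: "d ` insert i V \<subseteq> carrier M" "same_type N (e(i := x)) M d (insert i V)"
    using realise_in_M by blast
  have "same_type N (e(i := x)) M d (V - {i})" by (rule same_type_subset[OF d(2)]) auto
  then have "same_type N e M d (V - {i})" by (rule same_type_cong) auto
  then have "same_type M d M e' (V - {i})"
    using same_type_trans[OF same_type_sym same_type_subset[OF assms(4), of "V - {i}"]] by blast
  then obtain g where g: "iso g M M" "\<forall>j\<in>V - {i}. g (d j) = e' j"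
    using homogeneous_extend[OF M_homogeneous, of "V - {i}" d e'] assms(1,3) d(1) by auto
  have "same_type N (e(i := x)) M (\<lambda>j. g (d j)) (insert i V)"
    by (rule same_type_trans[OF d(2) same_type_iso[OF g(1)]]) (use d(1) in auto)
  then have "same_type N (e(i := x)) M (e'(i := g (d i))) (insert i V)"
    by (rule same_type_cong) (use g(2) in auto)
  moreover have "g (d i) \<in> carrier M" using g(1) d(1) by (auto simp: iso_def bij_betw_def)
  ultimately show ?thesis by blast
qed

text \<open>
  By homogeneity the extension of one realisation of the diagram in \<open>M\<close> is available for all of
  them; this is expressed by a sentence and carries over to \<open>N\<close>.
\<close>
lemma extend_in_N:
  assumes "finite V" "e ` V \<subseteq> carrier N" "e' ` V \<subseteq> carrier M" "same_type N e M e' V" "y \<in> carrier M"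
  shows "\<exists>x\<in>carrier N. same_type N (e(i := x)) M (e'(i := y)) (insert i V)"
proof -
  obtain vs where vs: "set vs = V - {i}" using assms(1) finite_list[of "V - {i}"] by blast
  define \<theta> where "\<theta> = Ex i (diag M (e'(i := y)) (i # vs))"
  define \<sigma> where "\<sigma> = Neg (Exs vs (Conj (diag M e' vs) (Neg \<theta>)))"
  obtain d where d: "range d \<subseteq> carrier N" "\<And>j. j \<in> V \<Longrightarrow> d j = e j" by (rule total[OF N_nonempty assms(2)]) blast
  have "sat N d \<sigma>"
  proof (rule sentence_transfer[OF _ _ d(1)])
    show "fv \<sigma> = {}" using fv_diag[of M e' vs] fv_diag[of M "e'(i := y)" "i # vs"] by (auto simp: \<sigma>_def \<theta>_def fv_Exs)
    have "sat M d \<theta>" if d: "\<forall>j\<in>set vs. d j \<in> carrier M" "same_type M e' M d (set vs)" for d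
    proof -
      have "e' ` set vs \<subseteq> carrier M" "d ` set vs \<subseteq> carrier M" using assms(3) d(1) vs by auto
      then obtain g where g: "iso g M M" "\<forall>j\<in>set vs. g (e' j) = d j"
        using homogeneous_extend[OF M_homogeneous finite_set _ _ d(2)] by blast
      have gy: "g y \<in> carrier M" using g(1) assms(5) by (auto simp: iso_def bij_betw_def)
      have "same_type M (e'(i := y)) M (\<lambda>j. g ((e'(i := y)) j)) (set (i # vs))"
        by (rule same_type_iso[OF g(1)]) (use assms(3,5) vs in auto)
      then have "same_type M (e'(i := y)) M (d(i := g y)) (set (i # vs))"
        by (rule same_type_cong) (use g(2) vs in auto)
      then have "sat M (d(i := g y)) (diag M (e'(i := y)) (i # vs))" by (simp only: sat_diag)
      then show ?thesis using gy unfolding \<theta>_def sat.simps by blast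
    qed
    then show "sat M e0 \<sigma>" for e0 by (auto simp: \<sigma>_def sat_Exs sat_diag)
  qed
  moreover have "same_type N d M e' (set vs)" by (rule same_type_cong[OF same_type_subset[OF assms(4)]]) (use vs d(2) in auto)
  ultimately have "sat N d \<theta>" using d(1) same_type_sym unfolding \<sigma>_def by (fastforce simp: sat_Exs sat_diag)
  then obtain x where x: "x \<in> carrier N" "same_type M (e'(i := y)) N (d(i := x)) (set (i # vs))"
    unfolding \<theta>_def sat.simps sat_diag by blast
  have "same_type N (d(i := x)) M (e'(i := y)) (insert i V)" using same_type_sym[OF x(2)] vs by (simp add: insert_absorb)
  then have "same_type N (e(i := x)) M (e'(i := y)) (insert i V)" by (rule same_type_cong) (use d(2) in auto)
  then show ?thesis using x(1) by blast
qed

lemma sat_transfer: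
  assumes "finite V" "fv \<phi> \<subseteq> V" "e ` V \<subseteq> carrier N" "e' ` V \<subseteq> carrier M" "same_type N e M e' V"
  shows "sat N e \<phi> \<longleftrightarrow> sat M e' \<phi>"
  using assms
proof (induction \<phi> arbitrary: V e e')
  case (Ex i \<phi>)
  have f: "finite (insert i V)" "fv \<phi> \<subseteq> insert i V" using Ex.prems by auto
  show ?case
  proof
    assume "sat N e (Ex i \<phi>)"
    then obtain x where x: "x \<in> carrier N" "sat N (e(i := x)) \<phi>" by auto
    obtain y where y: "y \<in> carrier M" "same_type N (e(i := x)) M (e'(i := y)) (insert i V)"
      using extend_in_M[OF Ex.prems(1,3-5) x(1)] by blast
    have "(e(i := x)) ` insert i V \<subseteq> carrier N" "(e'(i := y)) ` insert i V \<subseteq> carrier M"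
      using Ex.prems(3,4) x(1) y(1) unfolding image_subset_iff by simp_all
    then have "sat M (e'(i := y)) \<phi>" using Ex.IH[OF f _ _ y(2)] x(2) by blast
    then show "sat M e' (Ex i \<phi>)" using y(1) by auto
  next
    assume "sat M e' (Ex i \<phi>)"
    then obtain y where y: "y \<in> carrier M" "sat M (e'(i := y)) \<phi>" by auto
    obtain x where x: "x \<in> carrier N" "same_type N (e(i := x)) M (e'(i := y)) (insert i V)"
      using extend_in_N[OF Ex.prems(1,3-5) y(1)] by blast
    have "(e(i := x)) ` insert i V \<subseteq> carrier N" "(e'(i := y)) ` insert i V \<subseteq> carrier M"
      using Ex.prems(3,4) x(1) y(1) unfolding image_subset_iff by simp_all
    then have "sat N (e(i := x)) \<phi>" using Ex.IH[OF f _ _ x(2)] y(2) by blast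
    then show "sat N e (Ex i \<phi>)" using x(1) by auto
  qed
next
  case (Conj \<phi> \<psi>)
  then show ?case using Conj.IH[of V e e'] by simp
next
  case (Neg \<phi>)
  then show ?case using Neg.IH[of V e e'] by simp
qed (auto simp: same_typeD)

text \<open>
  Both valuations have the quantifier-free type of one valuation in \<open>M\<close>, and the back-and-forth between
  \<open>N\<close> and \<open>M\<close> preserves all formulas.
\<close>
theorem quantifier_elimination:
  assumes "finite V" "fv \<phi> \<subseteq> V" "e ` V \<subseteq> carrier N" "d ` V \<subseteq> carrier N" "same_type N e N d V"
  shows "sat N e \<phi> \<longleftrightarrow> sat N d \<phi>"
proof -
  obtain e' where e': "e' ` V \<subseteq> carrier M" "same_type N d M e' V" using realise_in_M[OF assms(1,4)] by blast
  have "sat N d \<phi> \<longleftrightarrow> sat M e' \<phi>" by (rule sat_transfer[OF assms(1,2,4) e'])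
  moreover have "sat N e \<phi> \<longleftrightarrow> sat M e' \<phi>"
    by (rule sat_transfer[OF assms(1,2,3) e'(1) same_type_trans[OF assms(5) e'(2)]])
  ultimately show ?thesis by simp
qed

end

text \<open>
  The quantifier-free type of a pair.
\<close>
definition kind :: "'a struc \<Rightarrow> 'a \<Rightarrow> 'a \<Rightarrow> bool \<times> bool \<times> bool \<times> bool" where
  "kind M x y = (x = y, rel M Rp x y, rel M Sp x y, rel M Tp x y)"

lemma same_type_kind: "same_type M e N e' V \<longleftrightarrow> (\<forall>i\<in>V. \<forall>j\<in>V. kind M (e i) (e j) = kind N (e' i) (e' j))"
  unfolding same_type_def kind_def all_pred by auto

text \<open>
  Ramsey's theorem thins the witnesses of the order property so that the quantifier-free type of
  \<open>(a i, b j)\<close> depends only on whether \<open>i < j\<close> or \<open>j < i\<close>.  By quantifier elimination the two types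
  differ, hence differ at two coordinates.  These cannot both belong to \<open>a\<close> or both to \<open>b\<close>, where
  the type involves a single index.
\<close>
lemma long_kind_half_graphs:
  fixes M :: "'a struc"
  assumes M: "homogeneous M" "carrier M \<noteq> {}" and unst: "\<not> stable_theory TYPE('u::infinite) (theory_of M)"
  shows "\<exists>t t'. t \<noteq> t' \<and> (\<forall>n. \<exists>x y :: nat \<Rightarrow> 'a. (\<forall>i<n. x i \<in> carrier M \<and> y i \<in> carrier M) \<and>
     (\<forall>i<n. \<forall>j<n. (i < j \<longrightarrow> kind M (x i) (y j) = t) \<and> (j < i \<longrightarrow> kind M (x i) (y j) = t')))"
proof -
  obtain N :: "'u struc" and \<phi> n m where N: "model_of N (theory_of M)" "partitioned \<phi> n m" "order_property N \<phi> n m"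
    using unst unfolding stable_theory_def by blast
  interpret theory_model M N by unfold_locales (use M N in auto)
  obtain a b where ab: "\<And>i. a i \<in> tuples N n" "\<And>i. b i \<in> tuples N m" "\<And>i j. holds N \<phi> (a i) (b j) \<longleftrightarrow> i < (j :: nat)"
    using N(3) unfolding order_property_def by blast
  define c where "c = (\<lambda>i j r. (a i @ b j) ! r)"
  have la: "length (a i) = n" "length (b i) = m" "set (a i) \<subseteq> carrier N" "set (b i) \<subseteq> carrier N" for i
    using ab(1,2)[of i] by (auto simp: tuples_def)
  have cN: "c i j r \<in> carrier N" if "r < n + m" for i j r
  proof -
    have "c i j r \<in> set (a i @ b j)" unfolding c_def by (rule nth_mem) (use that la in simp)
    then show ?thesis using la(3)[of i] la(4)[of j] by auto
  qed
  define TT where "TT = (\<lambda>i j. map (\<lambda>r. map (\<lambda>s. kind N (c i j r) (c i j s)) [0..<n+m]) [0..<n+m])"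
  define SS where "SS = {xs :: (bool \<times> bool \<times> bool \<times> bool) list. length xs = n+m}"
  define LL where "LL = {xs. set xs \<subseteq> SS \<and> length xs = n+m}"
  have "finite SS" using finite_lists_length_eq[of "UNIV :: (bool \<times> bool \<times> bool \<times> bool) set"] by (simp add: SS_def)
  then have fL: "finite LL" unfolding LL_def by (rule finite_lists_length_eq)
  have TL: "TT i j \<in> LL" for i j by (auto simp: TT_def LL_def SS_def)
  have "finite (LL \<times> LL)" using fL by simp
  then obtain code :: "(bool \<times> bool \<times> bool \<times> bool) list list \<times> (bool \<times> bool \<times> bool \<times> bool) list list \<Rightarrow> nat" and k
    where code: "code ` (LL \<times> LL) = {i. i < k}" "inj_on code (LL \<times> LL)"
    using finite_imp_inj_to_nat_seg by metis
  define col where "col = (\<lambda>X. code (TT (Min X) (Max X), TT (Max X) (Min X)))"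
  have "\<exists>Y t. Y \<subseteq> UNIV \<and> infinite Y \<and> t < k \<and> (\<forall>x\<in>Y. \<forall>y\<in>Y. x \<noteq> y \<longrightarrow> col {x, y} = t)"
  proof (rule Ramsey2)
    have "col X < k" for X
    proof -
      have "col X \<in> code ` (LL \<times> LL)" unfolding col_def by (rule imageI) (simp add: TL)
      then show ?thesis unfolding code(1) by simp
    qed
    then show "\<forall>x\<in>UNIV. \<forall>y\<in>UNIV. x \<noteq> y \<longrightarrow> col {x, y} < k" by blast
  qed simp
  then obtain Z t where Z0: "Z \<subseteq> UNIV \<and> infinite Z \<and> t < k \<and> (\<forall>x\<in>Z. \<forall>y\<in>Z. x \<noteq> y \<longrightarrow> col {x, y} = t)"
    by (elim exE)
  then have Z: "infinite Z" "\<And>x y. \<lbrakk>x \<in> Z; y \<in> Z; x \<noteq> y\<rbrakk> \<Longrightarrow> col {x, y} = t" by simp_all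
  define z where "z = enumerate Z"
  have zZ: "z i \<in> Z" for i unfolding z_def by (rule enumerate_in_set[OF Z(1)])
  have zm: "z i < z j" if "i < j" for i j unfolding z_def by (rule enumerate_mono[OF that Z(1)])
  have const: "TT (z i) (z j) = TT (z i') (z j') \<and> TT (z j) (z i) = TT (z j') (z i')" if "i < j" "i' < j'" for i j i' j'
  proof -
    have "z i < z j" "z i' < z j'" using that zm by auto
    then have "col {z i, z j} = code (TT (z i) (z j), TT (z j) (z i))" "col {z i', z j'} = code (TT (z i') (z j'), TT (z j') (z i'))"
      by (auto simp: col_def)
    moreover have "col {z i, z j} = col {z i', z j'}" using Z(2) zZ \<open>z i < z j\<close> \<open>z i' < z j'\<close> by auto
    ultimately show ?thesis using inj_onD[OF code(2)] TL by fastforce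
  qed
  have TTk: "TT i j = TT i' j' \<longleftrightarrow> (\<forall>r<n+m. \<forall>s<n+m. kind N (c i j r) (c i j s) = kind N (c i' j' r) (c i' j' s))" for i j i' j'
    by (auto simp: TT_def)
  have "TT (z 0) (z 1) \<noteq> TT (z 1) (z 0)"
  proof
    assume eq: "TT (z 0) (z 1) = TT (z 1) (z 0)"
    have st: "same_type N (c (z 0) (z 1)) N (c (z 1) (z 0)) {..<n+m}" unfolding same_type_kind using eq[unfolded TTk] by auto
    have "sat N (c (z 0) (z 1)) \<phi> \<longleftrightarrow> sat N (c (z 1) (z 0)) \<phi>"
      by (rule quantifier_elimination[OF _ _ _ _ st]) (use N(2) cN in \<open>auto simp: partitioned_def\<close>)
    then have "holds N \<phi> (a (z 0)) (b (z 1)) \<longleftrightarrow> holds N \<phi> (a (z 1)) (b (z 0))" by (simp add: holds_def c_def)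
    then show False using ab(3) zm[of 0 1] by auto
  qed
  then obtain r s where rs: "r < n+m" "s < n+m" "kind N (c (z 0) (z 1) r) (c (z 0) (z 1) s) \<noteq> kind N (c (z 1) (z 0) r) (c (z 1) (z 0) s)"
    unfolding TTk by blast
  define t1 where "t1 = kind N (c (z 0) (z 1) r) (c (z 0) (z 1) s)"
  define t2 where "t2 = kind N (c (z 1) (z 0) r) (c (z 1) (z 0) s)"
  have k1: "kind N (c (z i) (z j) r) (c (z i) (z j) s) = t1" if "i < j" for i j
    using const[OF that, of 0 1] rs(1,2) unfolding TTk t1_def by simp
  have k2: "kind N (c (z j) (z i) r) (c (z j) (z i) s) = t2" if "i < j" for i j
    using const[OF that, of 0 1] rs(1,2) unfolding TTk t2_def by simp
  have ca: "c i j r = a i ! r" if "r < n" for i j r using that la by (simp add: c_def nth_append)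
  have cb: "c i j r = b j ! (r - n)" if "\<not> r < n" for i j r using that la by (simp add: c_def nth_append)
  have "\<exists>X Y t t'. t \<noteq> t' \<and> (\<forall>i. X i \<in> carrier N \<and> Y i \<in> carrier N) \<and>
     (\<forall>i j. i < j \<longrightarrow> kind N (X i) (Y j) = t) \<and> (\<forall>i j. j < i \<longrightarrow> kind N (X i) (Y (j::nat)) = t')"
  proof -
    consider "r < n" "s < n" | "\<not> r < n" "\<not> s < n" | "r < n" "\<not> s < n" | "\<not> r < n" "s < n" by blast
    then show ?thesis
    proof cases
      case 1
      have "t1 = kind N (a (z 1) ! r) (a (z 1) ! s)" using k1[of 1 2] ca[OF 1(1)] ca[OF 1(2)] by simp
      moreover have "t2 = kind N (a (z 1) ! r) (a (z 1) ! s)" using k2[of 0 1] ca[OF 1(1)] ca[OF 1(2)] by simp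
      ultimately show ?thesis using rs(3) by (simp add: t1_def t2_def)
    next
      case 2
      have "t1 = kind N (b (z 1) ! (r - n)) (b (z 1) ! (s - n))" using k1[of 0 1] cb[OF 2(1)] cb[OF 2(2)] by simp
      moreover have "t2 = kind N (b (z 1) ! (r - n)) (b (z 1) ! (s - n))" using k2[of 1 2] cb[OF 2(1)] cb[OF 2(2)] by simp
      ultimately show ?thesis using rs(3) by (simp add: t1_def t2_def)
    next
      case 3
      show ?thesis
        by (rule exI[of _ "\<lambda>i. a (z i) ! r"], rule exI[of _ "\<lambda>i. b (z i) ! (s - n)"], rule exI[of _ t1], rule exI[of _ t2])
          (use k1 k2 ca[OF 3(1)] cb[OF 3(2)] rs cN t1_def t2_def in metis)
    next
      case 4
      show ?thesis
        by (rule exI[of _ "\<lambda>i. b (z i) ! (r - n)"], rule exI[of _ "\<lambda>i. a (z i) ! s"], rule exI[of _ t2], rule exI[of _ t1])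
          (use k1 k2 ca[OF 4(2)] cb[OF 4(1)] rs cN t1_def t2_def in metis)
    qed
  qed
  then obtain X Y t t' where XY0: "t \<noteq> t' \<and> (\<forall>i. X i \<in> carrier N \<and> Y i \<in> carrier N) \<and>
     (\<forall>i j. i < j \<longrightarrow> kind N (X i) (Y j) = t) \<and> (\<forall>i j. j < i \<longrightarrow> kind N (X i) (Y (j::nat)) = t')"
    by (elim exE)
  then have XY: "t \<noteq> t'" "\<And>i. X i \<in> carrier N" "\<And>i. Y i \<in> carrier N"
     "\<And>i j. i < j \<Longrightarrow> kind N (X i) (Y j) = t" "\<And>i j. j < i \<Longrightarrow> kind N (X i) (Y j) = t'" by simp_all
  have ex: "\<exists>x y :: nat \<Rightarrow> 'a. (\<forall>i<k. x i \<in> carrier M \<and> y i \<in> carrier M) \<and>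
     (\<forall>i<k. \<forall>j<k. (i < j \<longrightarrow> kind M (x i) (y j) = t) \<and> (j < i \<longrightarrow> kind M (x i) (y j) = t'))" for k
  proof -
    define e where "e = (\<lambda>i. if i < k then X i else Y (i - k))"
    have "e ` {..<2*k} \<subseteq> carrier N" using XY by (auto simp: e_def)
    then obtain e' where e': "e' ` {..<2*k} \<subseteq> carrier M" "same_type N e M e' {..<2*k}" using realise_in_M by blast
    have kd: "kind M (e' i) (e' (k + j)) = kind N (X i) (Y j)" if "i < k" "j < k" for i j
    proof -
      have "i \<in> {..<2*k}" "k + j \<in> {..<2*k}" using that by auto
      then have "kind N (e i) (e (k + j)) = kind M (e' i) (e' (k + j))" using e'(2) unfolding same_type_kind by blast
      then show ?thesis using that by (simp add: e_def)
    qed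
    have 1: "\<forall>i<k. e' i \<in> carrier M \<and> e' (k + i) \<in> carrier M"
    proof (intro allI impI)
      fix i assume "i < k"
      then have "i \<in> {..<2*k}" "k + i \<in> {..<2*k}" by simp_all
      then show "e' i \<in> carrier M \<and> e' (k + i) \<in> carrier M" using e'(1) by blast
    qed
    have 2: "\<forall>i<k. \<forall>j<k. (i < j \<longrightarrow> kind M (e' i) (e' (k + j)) = t) \<and> (j < i \<longrightarrow> kind M (e' i) (e' (k + j)) = t')"
      using kd XY(4,5) by simp
    show ?thesis by (rule exI[of _ e'], rule exI[of _ "\<lambda>i. e' (k + i)"], rule conjI[OF 1 2])
  qed
  show ?thesis by (rule exI[of _ t], rule exI[of _ t'], rule conjI[OF XY(1)], rule allI, rule ex)
qed

section \<open>Random covers\<close>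

definition random_cover :: "'a struc \<Rightarrow> bool" where
  "random_cover M \<longleftrightarrow> three_graph M \<and>
     (\<forall>x\<in>carrier M. \<exists>y\<in>carrier M. rel M Rp x y) \<and>
     (\<forall>x\<in>carrier M. \<forall>y\<in>carrier M. \<forall>z\<in>carrier M. rel M Rp x y \<and> rel M Rp x z \<longrightarrow> y = z) \<and>
     (\<forall>x\<in>carrier M. \<forall>y\<in>carrier M. \<forall>z\<in>carrier M. rel M Rp y z \<and> x \<noteq> y \<and> x \<noteq> z \<longrightarrow> (rel M Sp x y \<longleftrightarrow> \<not> rel M Sp x z)) \<and>
     (\<forall>A \<epsilon>. finite A \<and> A \<subseteq> carrier M \<and> (\<forall>x\<in>A. \<forall>y\<in>A. \<not> rel M Rp x y) \<longrightarrow>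
        (\<exists>z\<in>carrier M. \<forall>a\<in>A. z \<noteq> a \<and> \<not> rel M Rp z a \<and> (rel M Sp z a \<longleftrightarrow> \<epsilon> a)))"

locale three_graph_struc =
  fixes M :: "'a struc"
  assumes tg: "three_graph M"
begin

lemma irrefl: "x \<in> carrier M \<Longrightarrow> \<not> rel M p x x"
  using tg by (auto simp: three_graph_def)

lemma rel_sym: "\<lbrakk>x \<in> carrier M; y \<in> carrier M\<rbrakk> \<Longrightarrow> rel M p x y \<longleftrightarrow> rel M p y x"
  using tg unfolding three_graph_def by blast

lemma rel_cases:
  assumes "x \<in> carrier M" "y \<in> carrier M"
  obtains "x = y" "\<not> rel M Rp x y" "\<not> rel M Sp x y" "\<not> rel M Tp x y"
    | "x \<noteq> y" "rel M Rp x y" "\<not> rel M Sp x y" "\<not> rel M Tp x y"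
    | "x \<noteq> y" "\<not> rel M Rp x y" "rel M Sp x y" "\<not> rel M Tp x y"
    | "x \<noteq> y" "\<not> rel M Rp x y" "\<not> rel M Sp x y" "rel M Tp x y"
proof (cases "x = y")
  case True then show ?thesis using irrefl assms that(1) by blast
next
  case False
  then obtain p where p: "rel M p x y" "\<And>q. rel M q x y \<Longrightarrow> q = p"
    using tg assms unfolding three_graph_def by metis
  have "rel M q x y \<longleftrightarrow> q = p" for q using p by blast
  then show ?thesis using that(2-4) False by (cases p) simp_all
qed

lemma rel_T: "\<lbrakk>x \<in> carrier M; y \<in> carrier M\<rbrakk> \<Longrightarrow> rel M Tp x y \<longleftrightarrow> x \<noteq> y \<and> \<not> rel M Rp x y \<and> \<not> rel M Sp x y"
  by (erule rel_cases[of x y]) auto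

lemma rel_R_not: "\<lbrakk>x \<in> carrier M; y \<in> carrier M; rel M Rp x y\<rbrakk> \<Longrightarrow> x \<noteq> y \<and> \<not> rel M Sp x y"
  by (erule rel_cases[of x y]) auto

end

lemma kind_eqI:
  assumes "three_graph M" "three_graph N" "x \<in> carrier M" "y \<in> carrier M" "x' \<in> carrier N" "y' \<in> carrier N"
    "x = y \<longleftrightarrow> x' = y'" "rel M Rp x y \<longleftrightarrow> rel N Rp x' y'" "rel M Sp x y \<longleftrightarrow> rel N Sp x' y'"
  shows "kind M x y = kind N x' y'"
proof -
  interpret M: three_graph_struc M by unfold_locales fact
  interpret N: three_graph_struc N by unfold_locales fact
  show ?thesis using assms M.rel_T[OF assms(3,4)] N.rel_T[OF assms(5,6)] by (simp add: kind_def)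
qed

lemma kind_eqD:
  assumes "kind M x y = kind N x' y'"
  shows "x = y \<longleftrightarrow> x' = y'" "rel M p x y \<longleftrightarrow> rel N p x' y'"
proof -
  show "x = y \<longleftrightarrow> x' = y'" using assms by (simp add: kind_def)
  show "rel M p x y \<longleftrightarrow> rel N p x' y'" by (cases p) (use assms in \<open>simp_all add: kind_def\<close>)
qed

locale random_cover_struc =
  fixes M :: "'a struc"
  assumes cover: "random_cover M"

sublocale random_cover_struc \<subseteq> three_graph_struc
  using cover by unfold_locales (simp add: random_cover_def)

context random_cover_struc begin

lemma mate_ex: "x \<in> carrier M \<Longrightarrow> \<exists>y\<in>carrier M. rel M Rp x y"
  using cover by (simp add: random_cover_def)

lemma mate_unique: "\<lbrakk>x \<in> carrier M; y \<in> carrier M; z \<in> carrier M; rel M Rp x y; rel M Rp x z\<rbrakk> \<Longrightarrow> y = z"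
  using cover by (simp add: random_cover_def)

lemma S_mate:
  "\<lbrakk>x \<in> carrier M; y \<in> carrier M; z \<in> carrier M; rel M Rp y z; x \<noteq> y; x \<noteq> z\<rbrakk> \<Longrightarrow> rel M Sp x y \<longleftrightarrow> \<not> rel M Sp x z"
proof -
  have "\<forall>x\<in>carrier M. \<forall>y\<in>carrier M. \<forall>z\<in>carrier M. rel M Rp y z \<and> x \<noteq> y \<and> x \<noteq> z \<longrightarrow> (rel M Sp x y \<longleftrightarrow> \<not> rel M Sp x z)"
    using cover unfolding random_cover_def by (elim conjE)
  then show "\<lbrakk>x \<in> carrier M; y \<in> carrier M; z \<in> carrier M; rel M Rp y z; x \<noteq> y; x \<noteq> z\<rbrakk> \<Longrightarrow> rel M Sp x y \<longleftrightarrow> \<not> rel M Sp x z"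
    by simp
qed

lemma extension:
  assumes "finite A" "A \<subseteq> carrier M" "\<And>x y. \<lbrakk>x \<in> A; y \<in> A\<rbrakk> \<Longrightarrow> \<not> rel M Rp x y"
  shows "\<exists>z\<in>carrier M. \<forall>a\<in>A. z \<noteq> a \<and> \<not> rel M Rp z a \<and> (rel M Sp z a \<longleftrightarrow> \<epsilon> a)"
proof -
  have "\<forall>A \<epsilon>. finite A \<and> A \<subseteq> carrier M \<and> (\<forall>x\<in>A. \<forall>y\<in>A. \<not> rel M Rp x y) \<longrightarrow>
        (\<exists>z\<in>carrier M. \<forall>a\<in>A. z \<noteq> a \<and> \<not> rel M Rp z a \<and> (rel M Sp z a \<longleftrightarrow> \<epsilon> a))"
    using cover unfolding random_cover_def by (elim conjE)
  from this[THEN spec[of _ A], THEN spec[of _ \<epsilon>]] show ?thesis using assms by simp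
qed

text \<open>
  A pattern that treats mates oppositely is determined by its values on one member of each pair.
\<close>
lemma signed_extension:
  assumes "finite Y" "Y \<subseteq> carrier M" and con: "\<And>y y'. \<lbrakk>y \<in> Y; y' \<in> Y; rel M Rp y y'\<rbrakk> \<Longrightarrow> \<sigma> y \<noteq> \<sigma> y'"
  shows "\<exists>z\<in>carrier M. \<forall>y\<in>Y. z \<noteq> y \<and> \<not> rel M Rp z y \<and> (rel M Sp z y \<longleftrightarrow> \<sigma> y)"
proof -
  have "\<exists>A\<subseteq>Y. (\<forall>x\<in>A. \<forall>y\<in>A. \<not> rel M Rp x y) \<and> (\<forall>y\<in>Y. y \<in> A \<or> (\<exists>a\<in>A. rel M Rp y a))"
    using assms(1,2)
  proof (induction Y)
    case (insert y Y)
    then obtain A where A: "A \<subseteq> Y" "\<forall>x\<in>A. \<forall>y\<in>A. \<not> rel M Rp x y" "\<forall>y\<in>Y. y \<in> A \<or> (\<exists>a\<in>A. rel M Rp y a)" by blast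
    show ?case
    proof (cases "\<exists>a\<in>A. rel M Rp y a")
      case True
      then show ?thesis using A by (intro exI[of _ A]) blast
    next
      case False
      have "\<not> rel M Rp x z" if "x \<in> insert y A" "z \<in> insert y A" for x z
      proof -
        have "x \<in> carrier M" "z \<in> carrier M" using that insert.prems A(1) by auto
        then show ?thesis using that False A(2) irrefl rel_sym by blast
      qed
      then show ?thesis using A by (intro exI[of _ "insert y A"]) blast
    qed
  qed auto
  then obtain A where A: "A \<subseteq> Y" "\<forall>x\<in>A. \<forall>y\<in>A. \<not> rel M Rp x y" "\<forall>y\<in>Y. y \<in> A \<or> (\<exists>a\<in>A. rel M Rp y a)" by blast
  obtain z where z: "z \<in> carrier M" "\<forall>a\<in>A. z \<noteq> a \<and> \<not> rel M Rp z a \<and> (rel M Sp z a \<longleftrightarrow> \<sigma> a)"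
    using extension[of A \<sigma>] A(1,2) assms(1,2) finite_subset by blast
  have "z \<noteq> y \<and> \<not> rel M Rp z y \<and> (rel M Sp z y \<longleftrightarrow> \<sigma> y)" if y: "y \<in> Y" for y
  proof (cases "y \<in> A")
    case False
    then obtain a where a: "a \<in> A" "rel M Rp y a" using A(3) y by blast
    have c: "y \<in> carrier M" "a \<in> carrier M" using y a(1) A(1) assms(2) by auto
    have za: "z \<noteq> a" "\<not> rel M Rp z a" "rel M Sp z a \<longleftrightarrow> \<sigma> a" using z(2) a(1) by auto
    have zy: "z \<noteq> y" using za(2) a(2) by blast
    have "\<not> rel M Rp z y"
    proof
      assume "rel M Rp z y"
      then have "rel M Rp y z" using rel_sym z(1) c(1) by blast
      then have "z = a" using mate_unique[OF c(1) z(1) c(2)] a(2) by blast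
      then show False using za(1) by simp
    qed
    moreover have "rel M Sp z y \<longleftrightarrow> \<not> rel M Sp z a" by (rule S_mate[OF z(1) c a(2) zy za(1)])
    moreover have "\<sigma> y \<noteq> \<sigma> a" using con[OF y _ a(2)] a(1) A(1) by blast
    ultimately show ?thesis using zy za(3) by blast
  qed (use z(2) in blast)
  then show ?thesis using z(1) by blast
qed

lemma nonempty: "carrier M \<noteq> {}"
  using extension[of "{}" "\<lambda>_. True"] by blast

end

definition partial_iso :: "'a struc \<Rightarrow> 'b struc \<Rightarrow> ('a \<times> 'b) set \<Rightarrow> bool" where
  "partial_iso M N p \<longleftrightarrow> finite p \<and> p \<subseteq> carrier M \<times> carrier N \<and>
     (\<forall>u\<in>p. \<forall>v\<in>p. kind M (fst u) (fst v) = kind N (snd u) (snd v))"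

lemma partial_isoD:
  "\<lbrakk>partial_iso M N p; (x, y) \<in> p; (x', y') \<in> p\<rbrakk> \<Longrightarrow> kind M x x' = kind N y y'"
  unfolding partial_iso_def by force

lemma partial_iso_converse: "partial_iso M N p \<longleftrightarrow> partial_iso N M (p\<inverse>)"
proof -
  have "partial_iso N M (p\<inverse>)" if "partial_iso M N p" for M :: "'c struc" and N :: "'d struc" and p
  proof -
    have "kind N (fst u) (fst v) = kind M (snd u) (snd v)" if "u \<in> p\<inverse>" "v \<in> p\<inverse>" for u v
      using partial_isoD[OF \<open>partial_iso M N p\<close>, of "snd u" "fst u" "snd v" "fst v"] that by auto
    then show ?thesis using that unfolding partial_iso_def by auto
  qed
  from this[of M N p] this[of N M "p\<inverse>"] show ?thesis by auto
qed

text \<open>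
  One step of the back-and-forth, for relations instead of partial isomorphisms: \<open>p\<close> may relate a
  point to several points, as it does when one tuple is compared with many copies of it.
  A point close to the domain has its image dictated by one pair of \<open>p\<close>; for any other point the
  extension property supplies the image.
\<close>
lemma relation_step:
  assumes M: "random_cover M" and N: "random_cover N" and fp: "finite p" "p \<subseteq> carrier M \<times> carrier N" and a: "a \<in> carrier M"
    and con: "\<And>x y x' y'. \<lbrakk>(x, y) \<in> p; (x', y') \<in> p\<rbrakk> \<Longrightarrow> (y = y' \<longrightarrow> x = x') \<and> (rel N Rp y y' \<longrightarrow> rel M Rp x x')"
    and near: "(\<forall>(x, y)\<in>p. x \<noteq> a \<and> \<not> rel M Rp a x) \<or>
      (\<exists>(x0, y0)\<in>p. (a = x0 \<or> rel M Rp a x0) \<and> (\<forall>(x, y)\<in>p. kind M x0 x = kind N y0 y))"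
  shows "\<exists>b\<in>carrier N. \<forall>(x, y)\<in>p. kind M a x = kind N b y"
proof -
  interpret M: random_cover_struc M by unfold_locales (rule M)
  interpret N: random_cover_struc N by unfold_locales (rule N)
  have pc: "x \<in> carrier M" "y \<in> carrier N" if "(x, y) \<in> p" for x y using fp(2) that by auto
  have ins: "\<exists>b\<in>carrier N. \<forall>(x, y)\<in>p. kind M a x = kind N b y" if b: "b \<in> carrier N"
    and k: "\<And>x y. (x, y) \<in> p \<Longrightarrow> (a = x \<longleftrightarrow> b = y) \<and> (rel M Rp a x \<longleftrightarrow> rel N Rp b y) \<and> (rel M Sp a x \<longleftrightarrow> rel N Sp b y)" for b
  proof -
    have "kind M a x = kind N b y" if "(x, y) \<in> p" for x y
      by (rule kind_eqI[OF M.tg N.tg a pc(1)[OF that] b pc(2)[OF that]]) (use k[OF that] in auto)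
    then show ?thesis using b by blast
  qed
  consider x0 y0 where "(x0, y0) \<in> p" "a = x0" "\<And>x y. (x, y) \<in> p \<Longrightarrow> kind M x0 x = kind N y0 y"
    | x0 y0 where "(x0, y0) \<in> p" "rel M Rp a x0" "\<And>x y. (x, y) \<in> p \<Longrightarrow> kind M x0 x = kind N y0 y"
    | "\<And>x y. (x, y) \<in> p \<Longrightarrow> x \<noteq> a \<and> \<not> rel M Rp a x"
    using near by fast
  then show ?thesis
  proof cases
    case 1
    then show ?thesis using pc(2)[OF 1(1)] by blast
  next
    case 2
    have c0: "x0 \<in> carrier M" "y0 \<in> carrier N" using pc[OF 2(1)] by simp_all
    obtain b where b: "b \<in> carrier N" "rel N Rp y0 b" using N.mate_ex[OF c0(2)] by blast
    have bb: "rel N Rp b y0" using b N.rel_sym c0(2) by blast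
    have a0: "rel M Rp x0 a" using 2(2) M.rel_sym a c0(1) by blast
    show ?thesis
    proof (rule ins[OF b(1)])
      fix x y assume xy: "(x, y) \<in> p"
      have xc: "x \<in> carrier M" "y \<in> carrier N" using pc xy by auto
      have kk: "kind M x0 x = kind N y0 y" by (rule 2(3)[OF xy])
      have eq: "a = x \<longleftrightarrow> b = y"
        using kind_eqD(2)[OF kk, of Rp] a0 b M.mate_unique[OF c0(1) a xc(1) a0] N.mate_unique[OF c0(2) b(1) xc(2) b(2)] by blast
      have eq0: "x = x0 \<longleftrightarrow> y = y0" using kind_eqD(1)[OF kk] by auto
      have r: "rel M Rp a x \<longleftrightarrow> x = x0" "rel N Rp b y \<longleftrightarrow> y = y0"
        using M.mate_unique[OF a xc(1) c0(1)] 2(2) N.mate_unique[OF b(1) xc(2) c0(2)] bb by blast+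
      have "rel M Sp a x \<longleftrightarrow> rel N Sp b y"
      proof (cases "x = x0 \<or> x = a")
        case True
        then have "\<not> rel M Sp a x" "\<not> rel N Sp b y"
          using 2(2) bb eq eq0 M.rel_R_not[OF a c0(1)] N.rel_R_not[OF b(1) c0(2)] M.irrefl[OF a] N.irrefl[OF b(1)] by auto
        then show ?thesis by simp
      next
        case False
        have "rel M Sp x a \<longleftrightarrow> \<not> rel M Sp x x0"
          by (rule M.S_mate[OF xc(1) a c0(1) 2(2)]) (use False in auto)
        moreover have "rel N Sp y b \<longleftrightarrow> \<not> rel N Sp y y0"
          by (rule N.S_mate[OF xc(2) b(1) c0(2) bb]) (use False eq eq0 in auto)
        moreover have "rel M Sp x0 x \<longleftrightarrow> rel N Sp y0 y" by (rule kind_eqD(2)[OF kk])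
        ultimately show ?thesis
          using M.rel_sym[OF a xc(1)] M.rel_sym[OF c0(1) xc(1)] N.rel_sym[OF b(1) xc(2)] N.rel_sym[OF c0(2) xc(2)]
          by metis
      qed
      then show "(a = x \<longleftrightarrow> b = y) \<and> (rel M Rp a x \<longleftrightarrow> rel N Rp b y) \<and> (rel M Sp a x \<longleftrightarrow> rel N Sp b y)"
        using eq eq0 r by simp
    qed
  next
    case 3
    define \<sigma> where "\<sigma> = (\<lambda>y. \<exists>x. (x, y) \<in> p \<and> rel M Sp a x)"
    have \<sigma>: "\<sigma> y \<longleftrightarrow> rel M Sp a x" if xy: "(x, y) \<in> p" for x y
    proof -
      have "x' = x" if "(x', y) \<in> p" for x' using con[OF that xy] by simp
      then have "\<sigma> y \<Longrightarrow> rel M Sp a x" unfolding \<sigma>_def by metis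
      moreover have "rel M Sp a x \<Longrightarrow> \<sigma> y" unfolding \<sigma>_def using xy by blast
      ultimately show ?thesis by blast
    qed
    have "\<exists>z\<in>carrier N. \<forall>y\<in>Range p. z \<noteq> y \<and> \<not> rel N Rp z y \<and> (rel N Sp z y \<longleftrightarrow> \<sigma> y)"
    proof (rule N.signed_extension)
      show "finite (Range p)" using fp(1) by (rule finite_Range)
      show "Range p \<subseteq> carrier N" using fp(2) by blast
      fix y y' assume "y \<in> Range p" "y' \<in> Range p" and r: "rel N Rp y y'"
      then obtain x x' where x: "(x, y) \<in> p" "(x', y') \<in> p" by blast
      have "rel M Rp x x'" using con[OF x] r by simp
      then have "rel M Sp a x \<longleftrightarrow> \<not> rel M Sp a x'"
        by (intro M.S_mate[OF a pc(1)[OF x(1)] pc(1)[OF x(2)]]) (use 3[OF x(1)] 3[OF x(2)] in auto)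
      then show "\<sigma> y \<noteq> \<sigma> y'" using \<sigma>[OF x(1)] \<sigma>[OF x(2)] by simp
    qed
    then obtain b where b: "b \<in> carrier N" "\<forall>y\<in>Range p. b \<noteq> y \<and> \<not> rel N Rp b y \<and> (rel N Sp b y \<longleftrightarrow> \<sigma> y)" by blast
    show ?thesis
    proof (rule ins[OF b(1)])
      fix x y assume xy: "(x, y) \<in> p"
      then have "y \<in> Range p" by blast
      then show "(a = x \<longleftrightarrow> b = y) \<and> (rel M Rp a x \<longleftrightarrow> rel N Rp b y) \<and> (rel M Sp a x \<longleftrightarrow> rel N Sp b y)"
        using b(2) \<sigma>[OF xy] 3[OF xy] by auto
    qed
  qed
qed

lemma kind_sym:
  assumes "three_graph M" "three_graph N" "x \<in> carrier M" "x' \<in> carrier M" "y \<in> carrier N" "y' \<in> carrier N" "kind M x x' = kind N y y'"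
  shows "kind M x' x = kind N y' y"
proof -
  interpret M: three_graph_struc M by unfold_locales fact
  interpret N: three_graph_struc N by unfold_locales fact
  show ?thesis using assms(7) M.rel_sym[OF assms(3,4)] N.rel_sym[OF assms(5,6)] by (auto simp: kind_def)
qed

lemma kind_refl:
  assumes "three_graph M" "three_graph N" "x \<in> carrier M" "y \<in> carrier N"
  shows "kind M x x = kind N y y"
  using assms by (simp add: kind_def three_graph_def)

lemma partial_iso_step:
  assumes M: "random_cover M" and N: "random_cover N" and p: "partial_iso M N p" and a: "a \<in> carrier M"
  shows "\<exists>b\<in>carrier N. partial_iso M N (insert (a, b) p)"
proof -
  have tg: "three_graph M" "three_graph N" using M N by (simp_all add: random_cover_def)
  have fp: "finite p" "p \<subseteq> carrier M \<times> carrier N" using p by (auto simp: partial_iso_def)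
  have pc: "x \<in> carrier M" "y \<in> carrier N" if "(x, y) \<in> p" for x y using fp(2) that by auto
  have "\<exists>b\<in>carrier N. \<forall>(x, y)\<in>p. kind M a x = kind N b y"
  proof (rule relation_step[OF M N fp a])
    show "(y = y' \<longrightarrow> x = x') \<and> (rel N Rp y y' \<longrightarrow> rel M Rp x x')" if "(x, y) \<in> p" "(x', y') \<in> p" for x y x' y'
      using kind_eqD[OF partial_isoD[OF p that]] by blast
    show "(\<forall>(x, y)\<in>p. x \<noteq> a \<and> \<not> rel M Rp a x) \<or>
      (\<exists>(x0, y0)\<in>p. (a = x0 \<or> rel M Rp a x0) \<and> (\<forall>(x, y)\<in>p. kind M x0 x = kind N y0 y))"
      using partial_isoD[OF p] by fast
  qed
  then obtain b where b: "b \<in> carrier N" "\<And>x y. (x, y) \<in> p \<Longrightarrow> kind M a x = kind N b y" by blast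
  have k2: "kind M x a = kind N y b" if "(x, y) \<in> p" for x y
    by (rule kind_sym[OF tg a pc(1)[OF that] b(1) pc(2)[OF that] b(2)[OF that]])
  have k0: "kind M a a = kind N b b" by (rule kind_refl[OF tg a b(1)])
  have "kind M (fst u) (fst v) = kind N (snd u) (snd v)" if "u \<in> insert (a, b) p" "v \<in> insert (a, b) p" for u v
  proof -
    obtain x y x' y' where uv: "u = (x, y)" "v = (x', y')" by fastforce
    have "(x, y) = (a, b) \<or> (x, y) \<in> p" "(x', y') = (a, b) \<or> (x', y') \<in> p" using that uv by auto
    then show ?thesis using k0 b(2) k2 partial_isoD[OF p] uv by auto
  qed
  then have "partial_iso M N (insert (a, b) p)" using fp a b(1) unfolding partial_iso_def by simp
  then show ?thesis using b(1) by blast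
qed

theorem random_cover_extend:
  assumes M: "random_cover M" "countable (carrier M)" and N: "random_cover N" "countable (carrier N)" and p: "partial_iso M N p"
  shows "\<exists>g. iso g M N \<and> (\<forall>(x, y)\<in>p. g x = y)"
proof -
  interpret M: random_cover_struc M by unfold_locales (rule M)
  interpret N: random_cover_struc N by unfold_locales (rule N)
  define c where "c = from_nat_into (carrier M)"
  define d where "d = from_nat_into (carrier N)"
  have c: "range c = carrier M" using range_from_nat_into[OF M.nonempty M(2)] by (simp add: c_def)
  have d: "range d = carrier N" using range_from_nat_into[OF N.nonempty N(2)] by (simp add: d_def)
  have step: "\<exists>q'. partial_iso M N q' \<and> (q \<subseteq> q' \<and> c n \<in> Domain q' \<and> d n \<in> Range q')" if q: "partial_iso M N q" for q n
  proof -
    obtain b where b: "partial_iso M N (insert (c n, b) q)" using partial_iso_step[OF M(1) N(1) q, of "c n"] c by blast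
    have "partial_iso N M ((insert (c n, b) q)\<inverse>)" using b partial_iso_converse[of M N] by blast
    then obtain a where a: "partial_iso N M (insert (d n, a) ((insert (c n, b) q)\<inverse>))"
      using partial_iso_step[OF N(1) M(1), of _ "d n"] d by blast
    have "insert (d n, a) ((insert (c n, b) q)\<inverse>) = (insert (a, d n) (insert (c n, b) q))\<inverse>" by auto
    then have "partial_iso M N (insert (a, d n) (insert (c n, b) q))" using a partial_iso_converse[of M N] by metis
    then show ?thesis by (intro exI[of _ "insert (a, d n) (insert (c n, b) q)"]) auto
  qed
  obtain P where P: "P 0 = p" "\<And>n. partial_iso M N (P n)" "\<And>n. P n \<subseteq> P (Suc n) \<and> c n \<in> Domain (P (Suc n)) \<and> d n \<in> Range (P (Suc n))"
  proof -
    have "\<exists>P. \<forall>n. (partial_iso M N (P n) \<and> (n = 0 \<longrightarrow> P n = p)) \<and> (P n \<subseteq> P (Suc n) \<and> c n \<in> Domain (P (Suc n)) \<and> d n \<in> Range (P (Suc n)))"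
    proof (rule dependent_nat_choice)
      show "\<exists>x. partial_iso M N x \<and> (0 = 0 \<longrightarrow> x = p)" using p by auto
      show "\<exists>y. (partial_iso M N y \<and> (Suc n = 0 \<longrightarrow> y = p)) \<and> x \<subseteq> y \<and> c n \<in> Domain y \<and> d n \<in> Range y"
        if "partial_iso M N x \<and> (n = 0 \<longrightarrow> x = p)" for x n using step[of x n] that by auto
    qed
    then show ?thesis using that by blast
  qed
  have mono: "P m \<subseteq> P n" if "m \<le> n" for m n using lift_Suc_mono_le[of P] P(3) that by blast
  define U where "U = (\<Union>n. P n)"
  have Uk: "kind M x x' = kind N y y'" if xy: "(x, y) \<in> U" "(x', y') \<in> U" for x y x' y'
  proof -
    obtain m where "(x, y) \<in> P m" using xy(1) unfolding U_def by blast
    moreover obtain n where "(x', y') \<in> P n" using xy(2) unfolding U_def by blast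
    ultimately have "(x, y) \<in> P m" "(x', y') \<in> P n" by simp_all
    then have "(x, y) \<in> P (max m n)" "(x', y') \<in> P (max m n)" using mono[of m "max m n"] mono[of n "max m n"] by auto
    then show ?thesis by (rule partial_isoD[OF P(2)])
  qed
  have UC: "x \<in> carrier M \<and> y \<in> carrier N" if "(x, y) \<in> U" for x y
    using that P(2) unfolding U_def partial_iso_def by blast
  have ex: "\<exists>y. (x, y) \<in> U" if "x \<in> carrier M" for x
  proof -
    have "x \<in> range c" using that c by simp
    then obtain n where n: "x = c n" by (rule rangeE)
    have "c n \<in> Domain (P (Suc n))" using P(3)[of n] by simp
    then obtain y where "(c n, y) \<in> P (Suc n)" by (rule DomainE)
    then show ?thesis unfolding U_def n by blast
  qed
  have ey: "\<exists>x. (x, y) \<in> U" if "y \<in> carrier N" for y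
  proof -
    have "y \<in> range d" using that d by simp
    then obtain n where n: "y = d n" by (rule rangeE)
    have "d n \<in> Range (P (Suc n))" using P(3)[of n] by simp
    then obtain x where "(x, d n) \<in> P (Suc n)" by (rule RangeE)
    then show ?thesis unfolding U_def n by blast
  qed
  define g where "g = (\<lambda>x. SOME y. (x, y) \<in> U)"
  have gU: "(x, g x) \<in> U" if "x \<in> carrier M" for x unfolding g_def by (rule someI_ex[OF ex[OF that]])
  have gy: "g x = y" if "(x, y) \<in> U" for x y
  proof -
    have "x \<in> carrier M" using UC[OF that] by simp
    from kind_eqD(1)[OF Uk[OF gU[OF this] that]] show ?thesis by simp
  qed
  have "iso g M N"
    unfolding iso_def bij_betw_def
  proof (intro conjI allI ballI)
    show "inj_on g (carrier M)"
    proof (rule inj_onI)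
      fix x x' assume "x \<in> carrier M" "x' \<in> carrier M" "g x = g x'"
      then show "x = x'" using kind_eqD(1)[OF Uk[OF gU gU]] by blast
    qed
    show "g ` carrier M = carrier N"
    proof
      show "g ` carrier M \<subseteq> carrier N" using UC gU by blast
      show "carrier N \<subseteq> g ` carrier M" using ey UC gy by (metis imageI subsetI)
    qed
    show "rel M q x y \<longleftrightarrow> rel N q (g x) (g y)" if "x \<in> carrier M" "y \<in> carrier M" for q x y
      by (rule kind_eqD(2)[OF Uk[OF gU gU]]) fact+
  qed
  moreover have "g x = y" if "(x, y) \<in> p" for x y
    by (rule gy) (use that P(1) in \<open>auto simp: U_def\<close>)
  ultimately show ?thesis by blast
qed

corollary random_cover_isomorphic:
  assumes "random_cover M" "countable (carrier M)" "random_cover N" "countable (carrier N)"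
  shows "isomorphic M N"
  using random_cover_extend[OF assms, of "{}"] unfolding isomorphic_def partial_iso_def by auto

corollary random_cover_homogeneous:
  assumes "random_cover M" "countable (carrier M)"
  shows "homogeneous M"
  unfolding homogeneous_def
proof (intro conjI allI impI assms(2), elim conjE)
  fix A B f assume h: "finite A" "A \<subseteq> carrier M" "finite B" "B \<subseteq> carrier M" "iso f (substructure M A) (substructure M B)"
  have i: "inj_on f A" "f ` A = B" "\<And>p x y. \<lbrakk>x \<in> A; y \<in> A\<rbrakk> \<Longrightarrow> rel M p x y \<longleftrightarrow> rel M p (f x) (f y)"
    using h(5) by (auto simp: iso_def substructure_def bij_betw_def)
  have "partial_iso M M ((\<lambda>x. (x, f x)) ` A)"
    unfolding partial_iso_def
  proof (intro conjI ballI)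
    show "finite ((\<lambda>x. (x, f x)) ` A)" using h(1) by simp
    show "(\<lambda>x. (x, f x)) ` A \<subseteq> carrier M \<times> carrier M" using h(2,4) i(2) by auto
    fix u v assume "u \<in> (\<lambda>x. (x, f x)) ` A" "v \<in> (\<lambda>x. (x, f x)) ` A"
    then obtain x y where "x \<in> A" "y \<in> A" "u = (x, f x)" "v = (y, f y)" by blast
    then show "kind M (fst u) (fst v) = kind M (snd u) (snd v)" using i(1,3) by (auto simp: kind_def dest: inj_onD)
  qed
  from random_cover_extend[OF assms assms this]
  show "\<exists>g. iso g M M \<and> (\<forall>x\<in>A. g x = f x)" by fastforce
qed

lemma C_R_iff: "C_R i j \<longleftrightarrow> i \<noteq> j \<and> i div 2 = j div 2"
proof
  assume "C_R i j"
  then obtain n where "{i, j} = {2 * n, 2 * n + 1}" by (auto simp: C_R_def)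
  then have "(i = 2 * n \<and> j = 2 * n + 1) \<or> (i = 2 * n + 1 \<and> j = 2 * n)" by (auto simp: doubleton_eq_iff)
  then show "i \<noteq> j \<and> i div 2 = j div 2" by auto
next
  assume a: "i \<noteq> j \<and> i div 2 = j div 2"
  then have "(i = 2 * (i div 2) \<and> j = 2 * (i div 2) + 1) \<or> (j = 2 * (i div 2) \<and> i = 2 * (i div 2) + 1)" by presburger
  then have "{i, j} = {2 * (i div 2), 2 * (i div 2) + 1}" by auto
  then show "C_R i j" unfolding C_R_def by blast
qed

lemma C_R_parity: "C_R i j \<longleftrightarrow> i div 2 = j div 2 \<and> (even i \<longleftrightarrow> odd j)"
proof -
  have "i = j" if "i div 2 = j div 2" "even i = even j"
    using that div_mult_mod_eq[of i 2] div_mult_mod_eq[of j 2] by (simp add: mod_2_eq_odd)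
  then show ?thesis unfolding C_R_iff by blast
qed

lemma C_S_iff: "C_S E i j \<longleftrightarrow> i div 2 \<noteq> j div 2 \<and> ((i mod 2 = j mod 2) = E (i div 2) (j div 2))"
proof
  assume "C_S E i j"
  then obtain m n \<epsilon> \<delta> where h: "m \<noteq> n" "\<epsilon> \<in> {0, 1}" "\<delta> \<in> {0, 1}" "i = 2 * m + \<epsilon>" "j = 2 * n + \<delta>"
    "\<epsilon> = \<delta> \<and> E m n \<or> \<epsilon> \<noteq> \<delta> \<and> \<not> E m n" unfolding C_S_def by blast
  have "i div 2 = m" "j div 2 = n" "i mod 2 = \<epsilon>" "j mod 2 = \<delta>" using h(2-5) by auto
  then show "i div 2 \<noteq> j div 2 \<and> ((i mod 2 = j mod 2) = E (i div 2) (j div 2))" using h(1,6) by auto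
next
  assume h: "i div 2 \<noteq> j div 2 \<and> ((i mod 2 = j mod 2) = E (i div 2) (j div 2))"
  show "C_S E i j" unfolding C_S_def
    by (rule exI[of _ "i div 2"], rule exI[of _ "j div 2"], rule exI[of _ "i mod 2"], rule exI[of _ "j mod 2"]) (use h in auto)
qed

lemma C_graph_simps:
  "carrier (C_graph E) = UNIV" "rel (C_graph E) Rp = C_R" "rel (C_graph E) Sp = C_S E" "rel (C_graph E) Tp = C_T E"
  by (simp_all add: C_graph_def)

text \<open>
  A pattern on points without mates prescribes adjacencies of the random graph at the underlying
  vertices, with the values negated at the points of odd index.
\<close>
lemma C_graph_random_cover:
  assumes "random_graph E"
  shows "random_cover (C_graph E)"
proof -
  have E: "\<And>x. \<not> E x x" "\<And>x y. E x y = E y x" using assms unfolding random_graph_def by blast+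
  have ext: "\<exists>z. z \<notin> A \<union> B \<and> (\<forall>x\<in>A. E z x) \<and> (\<forall>x\<in>B. \<not> E z x)" if "finite A" "finite B" "A \<inter> B = {}" for A B
    using assms that unfolding random_graph_def by blast
  have RS: "\<not> (C_R x y \<and> C_S E x y)" for x y by (simp add: C_R_iff C_S_iff)
  have irr: "\<not> rel (C_graph E) p x x" for p x by (cases p) (simp_all add: C_graph_simps C_R_iff C_S_iff C_T_def)
  have sy: "rel (C_graph E) p x y \<Longrightarrow> rel (C_graph E) p y x" for p x y
  proof -
    have s: "C_R x y = C_R y x" "C_S E x y = C_S E y x" for x y using E(2) by (auto simp: C_R_iff C_S_iff)
    show "rel (C_graph E) p x y \<Longrightarrow> rel (C_graph E) p y x" by (cases p) (use s[of x y] in \<open>auto simp: C_graph_simps C_T_def\<close>)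
  qed
  have un: "\<exists>!p. rel (C_graph E) p x y" if "x \<noteq> y" for x y
  proof -
    have "C_T E x y \<longleftrightarrow> \<not> C_R x y \<and> \<not> C_S E x y" using that by (simp add: C_T_def)
    then have r: "rel (C_graph E) p x y \<longleftrightarrow> (case p of Rp \<Rightarrow> C_R x y | Sp \<Rightarrow> C_S E x y | Tp \<Rightarrow> \<not> C_R x y \<and> \<not> C_S E x y)" for p
      by (cases p) (simp_all add: C_graph_simps)
    show ?thesis
    proof (cases "C_R x y")
      case True
      then show ?thesis by (intro ex1I[of _ Rp]) (use RS[of x y] in \<open>auto simp: r split: pred.splits\<close>)
    next
      case False
      then show ?thesis by (intro ex1I[of _ "if C_S E x y then Sp else Tp"]) (auto simp: r split: pred.splits if_splits)
    qed
  qed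
  have 1: "three_graph (C_graph E)" unfolding three_graph_def using irr sy un by blast
  have 2: "\<exists>y. C_R x y" for x
  proof -
    have "x \<noteq> (if even x then x + 1 else x - 1)" "x div 2 = (if even x then x + 1 else x - 1) div 2" by (auto elim: oddE)
    then have "C_R x (if even x then x + 1 else x - 1)" unfolding C_R_iff by (rule conjI)
    then show ?thesis by (rule exI)
  qed
  have 3: "y = z" if "C_R x y" "C_R x z" for x y z
  proof (rule ccontr)
    assume "y \<noteq> z"
    then have "C_R y z" using that unfolding C_R_iff by simp
    then show False using that unfolding C_R_parity by blast
  qed
  have 4: "C_S E x y \<longleftrightarrow> \<not> C_S E x z" if "C_R y z" "x \<noteq> y" "x \<noteq> z" for x y z
  proof -
    have d: "y div 2 = z div 2" and p: "even y \<longleftrightarrow> odd z" using that(1) unfolding C_R_parity by simp_all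
    have m: "(x mod 2 = y mod 2) \<longleftrightarrow> \<not> (x mod 2 = z mod 2)" using p by (cases "even x"; cases "even z") (simp_all add: mod_2_eq_odd)
    have n: "x div 2 \<noteq> y div 2"
    proof
      assume "x div 2 = y div 2"
      then have "C_R x y" "C_R x z" using that d unfolding C_R_iff by simp_all
      then show False using p unfolding C_R_parity by blast
    qed
    show ?thesis using d m n by (auto simp: C_S_iff)
  qed
  have 5: "\<exists>z. \<forall>a\<in>A. z \<noteq> a \<and> \<not> C_R z a \<and> (C_S E z a \<longleftrightarrow> \<epsilon> a)" if A: "finite A" "\<forall>x\<in>A. \<forall>y\<in>A. \<not> C_R x y" for A \<epsilon>
  proof -
    define P where "P = {a \<in> A. even a = \<epsilon> a}"
    have inj: "x = y" if "x \<in> A" "y \<in> A" "x div 2 = y div 2" for x y using A(2) that by (auto simp: C_R_iff)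
    have "(\<lambda>a. a div 2) ` P \<inter> (\<lambda>a. a div 2) ` (A - P) = {}"
      using inj by (auto simp: P_def)
    then obtain w where w: "w \<notin> (\<lambda>a. a div 2) ` P \<union> (\<lambda>a. a div 2) ` (A - P)" "\<forall>x\<in>(\<lambda>a. a div 2) ` P. E w x"
        "\<forall>x\<in>(\<lambda>a. a div 2) ` (A - P). \<not> E w x"
      using ext[of "(\<lambda>a. a div 2) ` P" "(\<lambda>a. a div 2) ` (A - P)"] A(1) by (auto simp: P_def)
    have "2 * w \<noteq> a \<and> \<not> C_R (2 * w) a \<and> (C_S E (2 * w) a \<longleftrightarrow> \<epsilon> a)" if a: "a \<in> A" for a
    proof -
      have n: "w \<noteq> a div 2" using w(1) a by blast
      have "E w (a div 2) \<longleftrightarrow> a \<in> P" using w(2,3) a by blast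
      moreover have "(2 * w) mod 2 = a mod 2 \<longleftrightarrow> even a" by (simp add: mod_2_eq_odd)
      ultimately have "C_S E (2 * w) a \<longleftrightarrow> \<epsilon> a" using n a by (auto simp: C_S_iff P_def)
      then show ?thesis using n by (auto simp: C_R_iff)
    qed
    then show ?thesis by blast
  qed
  show ?thesis unfolding random_cover_def C_graph_simps
  proof (intro conjI ballI allI impI)
    show "three_graph (C_graph E)" by (rule 1)
    show "\<exists>y\<in>UNIV. C_R x y" for x using 2[of x] by simp
    show "y = z" if "C_R x y \<and> C_R x z" for x y z using 3 that by blast
    show "C_S E x y \<longleftrightarrow> \<not> C_S E x z" if "C_R y z \<and> x \<noteq> y \<and> x \<noteq> z" for x y z by (rule 4) (use that in simp_all)
    show "\<exists>z\<in>UNIV. \<forall>a\<in>A. z \<noteq> a \<and> \<not> C_R z a \<and> (C_S E z a \<longleftrightarrow> \<epsilon> a)"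
      if "finite A \<and> A \<subseteq> UNIV \<and> (\<forall>x\<in>A. \<forall>y\<in>A. \<not> C_R x y)" for A \<epsilon>
      using 5[of A \<epsilon>] that by simp
  qed
qed

section \<open>Traces of points on classes\<close>

locale finite_class_struc = three_graph_struc M for M :: "'a struc" +
  assumes hom: "homogeneous M"
    and R_trans: "\<lbrakk>x \<in> carrier M; y \<in> carrier M; z \<in> carrier M; rel M Rp x y; rel M Rp y z; x \<noteq> z\<rbrakk> \<Longrightarrow> rel M Rp x z"
    and finite_class: "x \<in> carrier M \<Longrightarrow> finite {y \<in> carrier M. y = x \<or> rel M Rp x y}"
    and cross: "\<lbrakk>x \<in> carrier M; y \<in> carrier M; x \<noteq> y; \<not> rel M Rp x y; p \<noteq> Rp\<rbrakk> \<Longrightarrow>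
       \<exists>u\<in>carrier M. \<exists>v\<in>carrier M. (u = x \<or> rel M Rp x u) \<and> (v = y \<or> rel M Rp y v) \<and> rel M p u v"
    and half_graphs: "\<exists>x y :: nat \<Rightarrow> 'a. (\<forall>i<n. x i \<in> carrier M \<and> y i \<in> carrier M) \<and>
       (\<forall>i<n. \<forall>j<n. (i < j \<longrightarrow> rel M Sp (x i) (y j)) \<and> (j < i \<longrightarrow> rel M Tp (x i) (y j)))"
begin

definition cl :: "'a \<Rightarrow> 'a set" where "cl x = {y \<in> carrier M. y = x \<or> rel M Rp x y}"

lemma cl_self: "x \<in> carrier M \<Longrightarrow> x \<in> cl x"
  by (simp add: cl_def)

lemma cl_sub: "cl x \<subseteq> carrier M"
  by (auto simp: cl_def)

lemma clD: "y \<in> cl x \<Longrightarrow> y \<in> carrier M"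
  by (simp add: cl_def)

lemma finite_cl: "x \<in> carrier M \<Longrightarrow> finite (cl x)"
  using finite_class by (simp add: cl_def)

lemma cl_sym: "\<lbrakk>x \<in> carrier M; y \<in> cl x\<rbrakk> \<Longrightarrow> x \<in> cl y"
  using rel_sym by (auto simp: cl_def)

lemma cl_trans: "\<lbrakk>x \<in> carrier M; y \<in> cl x; z \<in> cl y\<rbrakk> \<Longrightarrow> z \<in> cl x"
  unfolding cl_def using R_trans by blast

lemma cl_eq: "\<lbrakk>x \<in> carrier M; y \<in> cl x\<rbrakk> \<Longrightarrow> cl y = cl x"
  using cl_trans cl_sym clD by blast

lemma in_cl_rel: "\<lbrakk>x \<in> carrier M; y \<in> cl x; z \<in> cl x\<rbrakk> \<Longrightarrow> y = z \<or> rel M Rp y z"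
  using cl_eq[of x y] by (auto simp: cl_def)

lemma in_cl_not: "\<lbrakk>x \<in> carrier M; y \<in> cl x; z \<in> cl x; p \<noteq> Rp\<rbrakk> \<Longrightarrow> \<not> rel M p y z"
  using in_cl_rel[of x y z] clD[of y x] clD[of z x] rel_R_not[of y z] rel_T[of y z] irrefl[of y] by (cases p) auto

definition cross_preds :: "pred \<Rightarrow> pred \<Rightarrow> bool" where
  "cross_preds P Q \<longleftrightarrow> (P = Sp \<and> Q = Tp) \<or> (P = Tp \<and> Q = Sp)"

lemma cross_dichotomy:
  assumes "cross_preds P Q" "x \<in> carrier M" "y \<in> carrier M" "y \<notin> cl x"
  shows "rel M Q x y \<longleftrightarrow> \<not> rel M P x y"
  using assms rel_T[of x y] by (auto simp: cross_preds_def cl_def)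

lemma iso_facts:
  assumes "iso g M M"
  shows "x \<in> carrier M \<Longrightarrow> g x \<in> carrier M"
    and "\<lbrakk>x \<in> carrier M; y \<in> carrier M\<rbrakk> \<Longrightarrow> rel M p (g x) (g y) \<longleftrightarrow> rel M p x y"
    and "\<lbrakk>x \<in> carrier M; y \<in> carrier M\<rbrakk> \<Longrightarrow> g x = g y \<longleftrightarrow> x = y"
    and "x \<in> carrier M \<Longrightarrow> \<exists>y\<in>carrier M. g y = x"
proof -
  have b: "inj_on g (carrier M)" "g ` carrier M = carrier M" using assms by (auto simp: iso_def bij_betw_def)
  show "x \<in> carrier M \<Longrightarrow> g x \<in> carrier M" using b(2) by blast
  show "\<lbrakk>x \<in> carrier M; y \<in> carrier M\<rbrakk> \<Longrightarrow> rel M p (g x) (g y) \<longleftrightarrow> rel M p x y" using assms by (auto simp: iso_def)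
  show "\<lbrakk>x \<in> carrier M; y \<in> carrier M\<rbrakk> \<Longrightarrow> g x = g y \<longleftrightarrow> x = y" using b(1) by (auto dest: inj_onD)
  show "\<exists>y\<in>carrier M. g y = x" if "x \<in> carrier M"
  proof -
    have "x \<in> g ` carrier M" using b(2) that by simp
    then show ?thesis by blast
  qed
qed

lemma image_fixed: "(\<And>z. z \<in> S \<Longrightarrow> g z = z) \<Longrightarrow> g ` S = S"
  by (simp cong: image_cong)

lemma iso_inj: "\<lbrakk>iso g M M; A \<subseteq> carrier M\<rbrakk> \<Longrightarrow> inj_on g A"
  unfolding iso_def bij_betw_def by (blast intro: inj_on_subset)

lemma iso_cl: "\<lbrakk>iso g M M; x \<in> carrier M; y \<in> carrier M\<rbrakk> \<Longrightarrow> g y \<in> cl (g x) \<longleftrightarrow> y \<in> cl x"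
  using iso_facts[of g] by (simp add: cl_def)

lemma iso_cl_surj:
  assumes "iso g M M" "x \<in> carrier M" "w \<in> cl (g x)"
  shows "\<exists>y\<in>cl x. g y = w"
proof -
  obtain y where y: "y \<in> carrier M" "g y = w" using iso_facts(4)[OF assms(1) clD[OF assms(3)]] by blast
  then show ?thesis using iso_cl[OF assms(1,2) y(1)] assms(3) by blast
qed

lemma extend_map:
  assumes "finite A" "A \<subseteq> carrier M" "f ` A \<subseteq> carrier M"
    "\<And>x y. \<lbrakk>x \<in> A; y \<in> A\<rbrakk> \<Longrightarrow> (x = y \<longleftrightarrow> f x = f y) \<and> (rel M Rp x y \<longleftrightarrow> rel M Rp (f x) (f y)) \<and> (rel M Sp x y \<longleftrightarrow> rel M Sp (f x) (f y))"
  shows "\<exists>g. iso g M M \<and> (\<forall>x\<in>A. g x = f x)"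
proof -
  have k: "rel M p x y \<longleftrightarrow> rel M p (f x) (f y)" if "x \<in> A" "y \<in> A" for p x y
  proof -
    have c: "x \<in> carrier M" "y \<in> carrier M" "f x \<in> carrier M" "f y \<in> carrier M" using that assms(2,3) by auto
    have "kind M x y = kind M (f x) (f y)" by (rule kind_eqI[OF tg tg c]) (use assms(4)[OF that] in auto)
    then show ?thesis by (rule kind_eqD(2))
  qed
  have "inj_on f A" using assms(4) by (auto simp: inj_on_def)
  then have "iso f (substructure M A) (substructure M (f ` A))"
    using k by (auto simp: iso_def substructure_def bij_betw_def)
  then show ?thesis using hom assms(1-3) unfolding homogeneous_def by (metis finite_imageI)
qed

lemma extend3:
  assumes c: "x \<in> carrier M" "y \<in> carrier M" "z \<in> carrier M" "x' \<in> carrier M" "y' \<in> carrier M" "z' \<in> carrier M"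
    and k: "kind M x y = kind M x' y'" "kind M y z = kind M y' z'" "kind M x z = kind M x' z'"
  shows "\<exists>g. iso g M M \<and> g x = x' \<and> g y = y' \<and> g z = z'"
proof -
  define f where "f = (\<lambda>w. if w = x then x' else if w = y then y' else z')"
  have e: "x = y \<longleftrightarrow> x' = y'" "y = z \<longleftrightarrow> y' = z'" "x = z \<longleftrightarrow> x' = z'"
    using kind_eqD(1)[OF k(1)] kind_eqD(1)[OF k(2)] kind_eqD(1)[OF k(3)] by simp_all
  have f: "f x = x'" "f y = y'" "f z = z'" using e by (auto simp: f_def)
  have r: "rel M p x y \<longleftrightarrow> rel M p x' y'" "rel M p y z \<longleftrightarrow> rel M p y' z'" "rel M p x z \<longleftrightarrow> rel M p x' z'" for p
    using kind_eqD(2)[OF k(1)] kind_eqD(2)[OF k(2)] kind_eqD(2)[OF k(3)] by simp_all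
  have r': "rel M p y x \<longleftrightarrow> rel M p y' x'" "rel M p z y \<longleftrightarrow> rel M p z' y'" "rel M p z x \<longleftrightarrow> rel M p z' x'" for p
    using r rel_sym[OF c(1,2)] rel_sym[OF c(2,3)] rel_sym[OF c(1,3)] rel_sym[OF c(4,5)] rel_sym[OF c(5,6)] rel_sym[OF c(4,6)] by simp_all
  have i: "\<not> rel M p w w" if "w \<in> {x, y, z, x', y', z'}" for p w using irrefl[of w p] c that by blast
  have "\<exists>g. iso g M M \<and> (\<forall>w\<in>{x, y, z}. g w = f w)"
  proof (rule extend_map)
    show "f ` {x, y, z} \<subseteq> carrier M" using f c by simp
    fix u v assume "u \<in> {x, y, z}" "v \<in> {x, y, z}"
    then consider "u = x \<and> v = x" | "u = x \<and> v = y" | "u = x \<and> v = z" | "u = y \<and> v = x" | "u = y \<and> v = y" | "u = y \<and> v = z"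
      | "u = z \<and> v = x" | "u = z \<and> v = y" | "u = z \<and> v = z" by blast
    then show "(u = v \<longleftrightarrow> f u = f v) \<and> (rel M Rp u v \<longleftrightarrow> rel M Rp (f u) (f v)) \<and> (rel M Sp u v \<longleftrightarrow> rel M Sp (f u) (f v))"
      by cases (use e f r r' i in \<open>simp_all, blast+\<close>)
  qed (use c in auto)
  then show ?thesis using f by auto
qed

lemma extend2:
  assumes "x \<in> carrier M" "y \<in> carrier M" "x' \<in> carrier M" "y' \<in> carrier M" "kind M x y = kind M x' y'"
  shows "\<exists>g. iso g M M \<and> g x = x' \<and> g y = y'"
proof -
  have "kind M y y = kind M y' y'" using irrefl[OF assms(2)] irrefl[OF assms(4)] by (simp add: kind_def)
  from extend3[OF assms(1,2,2,3,4,4,5) this assms(5)] show ?thesis by blast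
qed

lemma kind_cross:
  assumes "cross_preds P Q" "x \<in> carrier M" "y \<in> carrier M" "x' \<in> carrier M" "y' \<in> carrier M" "y \<notin> cl x" "y' \<notin> cl x'"
    "rel M P x y \<longleftrightarrow> rel M P x' y'"
  shows "kind M x y = kind M x' y'"
proof (rule kind_eqI[OF tg tg assms(2-5)])
  show "x = y \<longleftrightarrow> x' = y'" "rel M Rp x y \<longleftrightarrow> rel M Rp x' y'" using assms by (auto simp: cl_def)
  show "rel M Sp x y \<longleftrightarrow> rel M Sp x' y'"
    using assms(1,8) cross_dichotomy[OF assms(1,2,3,6)] cross_dichotomy[OF assms(1,4,5,7)] by (auto simp: cross_preds_def)
qed

lemma kind_class:
  assumes "x \<in> carrier M" "y \<in> cl x" "z \<in> cl x" "x' \<in> carrier M" "y' \<in> cl x'" "z' \<in> cl x'" "y = z \<longleftrightarrow> y' = z'"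
  shows "kind M y z = kind M y' z'"
proof -
  have c: "y \<in> carrier M" "z \<in> carrier M" "y' \<in> carrier M" "z' \<in> carrier M" using assms clD by blast+
  show ?thesis
    by (rule kind_eqI[OF tg tg c]) (use assms in_cl_rel[OF assms(1-3)] in_cl_rel[OF assms(4-6)] in_cl_not[OF assms(1-3), of Sp] in_cl_not[OF assms(4-6), of Sp] irrefl c in auto)
qed

text \<open>
  The transposition of \<open>a\<close> and \<open>b\<close>, together with \<open>v\<close> fixed, is a finite partial isomorphism.
\<close>
lemma swap_in_class:
  assumes x: "x \<in> carrier M" and ab: "a \<in> cl x" "b \<in> cl x" and v: "v \<in> carrier M" "v \<notin> cl x" and e: "rel M Sp v a \<longleftrightarrow> rel M Sp v b"
  shows "\<exists>g. iso g M M \<and> g v = v \<and> g a = b \<and> g b = a \<and> (\<forall>y\<in>cl x - {a, b}. g y = y)"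
proof -
  define f where "f = (\<lambda>y. if y = a then b else if y = b then a else y)"
  have fcl: "f y \<in> cl x" if "y \<in> cl x" for y using that ab by (auto simp: f_def)
  have fv: "f v = v" using v ab by (auto simp: f_def)
  have finj: "f y = f z \<longleftrightarrow> y = z" for y z by (auto simp: f_def)
  have Sv: "rel M Sp v (f y) \<longleftrightarrow> rel M Sp v y" for y using e by (auto simp: f_def)
  have nv: "v \<noteq> y" "\<not> rel M Rp v y" "\<not> rel M Rp y v" "rel M Sp y v \<longleftrightarrow> rel M Sp v y" if "y \<in> cl x" for y
  proof -
    show "v \<noteq> y" using v(2) that by blast
    have yc: "y \<in> carrier M" using clD that by blast
    have "v \<notin> cl y" using cl_eq[OF x that] v(2) by simp
    then show "\<not> rel M Rp y v" using v(1) by (simp add: cl_def)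
    then show "\<not> rel M Rp v y" using rel_sym[OF yc v(1)] by blast
    show "rel M Sp y v \<longleftrightarrow> rel M Sp v y" by (rule rel_sym[OF yc v(1)])
  qed
  have "\<exists>g. iso g M M \<and> (\<forall>y\<in>insert v (cl x). g y = f y)"
  proof (rule extend_map)
    show "finite (insert v (cl x))" using finite_cl[OF x] by simp
    show "insert v (cl x) \<subseteq> carrier M" using v(1) cl_sub by simp
    show "f ` insert v (cl x) \<subseteq> carrier M" using fv fcl v(1) clD by auto
    fix y z assume yz: "y \<in> insert v (cl x)" "z \<in> insert v (cl x)"
    consider "y = v" "z = v" | "y = v" "z \<in> cl x" | "y \<in> cl x" "z = v" | "y \<in> cl x" "z \<in> cl x" using yz by blast
    then show "(y = z \<longleftrightarrow> f y = f z) \<and> (rel M Rp y z \<longleftrightarrow> rel M Rp (f y) (f z)) \<and> (rel M Sp y z \<longleftrightarrow> rel M Sp (f y) (f z))"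
    proof cases
      case 1 then show ?thesis using fv by simp
    next
      case 2
      show ?thesis unfolding 2(1) fv using nv[OF 2(2)] nv[OF fcl[OF 2(2)]] Sv by simp
    next
      case 3
      show ?thesis unfolding 3(2) fv using nv[OF 3(1)] nv[OF fcl[OF 3(1)]] Sv by auto
    next
      case 4
      have "kind M y z = kind M (f y) (f z)" by (rule kind_class[OF x 4 x fcl[OF 4(1)] fcl[OF 4(2)]]) (simp add: finj)
      then show ?thesis using kind_eqD[of M y z M "f y" "f z"] by blast
    qed
  qed
  then obtain g where g: "iso g M M" "\<And>y. y \<in> insert v (cl x) \<Longrightarrow> g y = f y" by blast
  have "g v = v" "g a = b" "g b = a" using g(2) fv ab by (auto simp: f_def)
  moreover have "\<forall>y\<in>cl x - {a, b}. g y = y" using g(2) by (auto simp: f_def)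
  ultimately show ?thesis using g(1) by blast
qed

text \<open>
  If \<open>v\<close> has no \<open>P\<close>-neighbour in \<open>cl x\<close>, then an automorphism that exchanges \<open>v\<close> with a point of \<open>cl x\<close>
  shows that this point has none in \<open>cl v\<close>; but every two classes contain a pair related by \<open>P\<close>.
\<close>
lemma meets_both:
  assumes x: "x \<in> carrier M" and v: "v \<in> carrier M" "v \<notin> cl x" and P: "P \<noteq> Rp"
  shows "\<exists>y\<in>cl x. rel M P v y"
proof (rule ccontr)
  assume no: "\<not> ?thesis"
  obtain Q where PQ: "cross_preds P Q" using P by (cases P) (auto simp: cross_preds_def)
  have xv: "x \<notin> cl v" using v cl_sym x by blast
  have nv: "y \<notin> cl v" if "y \<in> cl x" for y
    using that xv cl_eq[OF x that] cl_eq[OF v(1), of y] cl_self[OF x] by auto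
  have all: "\<not> rel M P y w" if y: "y \<in> cl x" and w: "w \<in> cl v" for y w
  proof -
    have yc: "y \<in> carrier M" using clD y by blast
    have vy: "v \<notin> cl y" using cl_eq[OF x y] v(2) by simp
    have "rel M P v y \<longleftrightarrow> rel M P y v" by (rule rel_sym[OF v(1) yc])
    then have "kind M v y = kind M y v" by (rule kind_cross[OF PQ v(1) yc yc v(1) nv[OF y] vy])
    then obtain g where g: "iso g M M" "g v = y" "g y = v" using extend2[OF v(1) yc yc v(1)] by blast
    have "w \<in> cl (g y)" using w g(3) by simp
    then obtain u where u: "u \<in> cl y" "g u = w" using iso_cl_surj[OF g(1) yc] by blast
    have "u \<in> cl x" using u(1) cl_eq[OF x y] by simp
    then have "\<not> rel M P v u" using no by blast
    then show ?thesis using iso_facts(2)[OF g(1) v(1) clD[OF u(1)], of P] g(2) u(2) by simp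
  qed
  have "x \<noteq> v" "\<not> rel M Rp x v" using v by (auto simp: cl_def)
  from cross[OF x v(1) this P] obtain u w where "u \<in> cl x" "w \<in> cl v" "rel M P u w"
    unfolding cl_def by blast
  then show False using all by blast
qed

lemma class_image:
  assumes "iso g M M" "x \<in> carrier M"
  shows "g ` cl x = cl (g x)"
  using iso_cl[OF assms] iso_cl_surj[OF assms] clD by blast

lemma card_cl: "\<lbrakk>x \<in> carrier M; y \<in> carrier M\<rbrakk> \<Longrightarrow> card (cl x) = card (cl y)"
proof -
  assume c: "x \<in> carrier M" "y \<in> carrier M"
  have "kind M x x = kind M y y" using irrefl c by (simp add: kind_def)
  then obtain g where g: "iso g M M" "g x = y" using extend2[of x x y y] c by blast
  have "inj_on g (cl x)" by (rule iso_inj[OF g(1) cl_sub])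
  then show ?thesis using class_image[OF g(1) c(1)] card_image g(2) by metis
qed

definition Nb :: "pred \<Rightarrow> 'a \<Rightarrow> 'a \<Rightarrow> 'a set" where "Nb P v x = {y \<in> cl x. rel M P v y}"

lemma Nb_image:
  assumes g: "iso g M M" and x: "x \<in> carrier M" and v: "v \<in> carrier M"
  shows "g ` Nb P v x = Nb P (g v) (g x)"
proof -
  have "rel M P (g v) (g y) \<longleftrightarrow> rel M P v y" if "y \<in> cl x" for y by (rule iso_facts(2)[OF g v clD[OF that]])
  note e = this
  show ?thesis unfolding Nb_def class_image[OF g x, symmetric]
  proof (intro set_eqI iffI)
    fix w assume "w \<in> g ` {y \<in> cl x. rel M P v y}"
    then obtain y where "y \<in> cl x" "rel M P v y" "w = g y" by blast
    then show "w \<in> {y \<in> g ` cl x. rel M P (g v) y}" using e[of y] by simp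
  next
    fix w assume "w \<in> {y \<in> g ` cl x. rel M P (g v) y}"
    then obtain y where "y \<in> cl x" "rel M P (g v) (g y)" "w = g y" by blast
    then show "w \<in> g ` {y \<in> cl x. rel M P v y}" using e[of y] by simp
  qed
qed

lemma card_Nb:
  assumes P: "P \<noteq> Rp" and c: "x \<in> carrier M" "v \<in> carrier M" "x' \<in> carrier M" "v' \<in> carrier M" "v \<notin> cl x" "v' \<notin> cl x'"
  shows "card (Nb P v x) = card (Nb P v' x')"
proof -
  obtain Q where PQ: "cross_preds P Q" using P by (cases P) (auto simp: cross_preds_def)
  obtain y where y: "y \<in> cl x" "rel M P v y" using meets_both[OF c(1,2,5) P] by blast
  obtain y' where y': "y' \<in> cl x'" "rel M P v' y'" using meets_both[OF c(3,4,6) P] by blast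
  have yc: "y \<in> carrier M" "y' \<in> carrier M" using y y' clD by blast+
  have "y \<notin> cl v" "y' \<notin> cl v'"
    using c(5,6) cl_sym[OF c(2)] cl_sym[OF c(4)] cl_eq[OF c(1) y(1)] cl_eq[OF c(3) y'(1)] by auto
  then have "kind M v y = kind M v' y'" using kind_cross[OF PQ c(2) yc(1) c(4) yc(2)] y(2) y'(2) by blast
  then obtain g where g: "iso g M M" "g v = v'" "g y = y'" using extend2[OF c(2) yc(1) c(4) yc(2)] by blast
  have "Nb P v x = Nb P v y" "Nb P v' x' = Nb P v' y'" using cl_eq[OF c(1) y(1)] cl_eq[OF c(3) y'(1)] by (simp_all add: Nb_def)
  moreover have "g ` Nb P v y = Nb P v' y'" using Nb_image[OF g(1) yc(1) c(2)] g(2,3) by simp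
  moreover have "inj_on g (Nb P v y)" by (rule iso_inj[OF g(1)]) (auto simp: Nb_def cl_def)
  ultimately show ?thesis using card_image by metis
qed

text \<open>
  Let \<open>A\<close> and \<open>B\<close> be the sets of \<open>S\<close>- and \<open>T\<close>-neighbours of \<open>v\<close> in \<open>cl x\<close>.  If some point of \<open>cl v\<close> does
  not distinguish \<open>a \<in> A\<close> from \<open>b \<in> B\<close>, then swapping the two fixes \<open>cl v\<close> as a set and moves \<open>v\<close> to
  a point with trace \<open>A - {a} \<union> {b}\<close>; swaps that fix \<open>v\<close> give the trace \<open>A - {a'} \<union> {b'}\<close> for all choices
  of \<open>a'\<close> and \<open>b'\<close>.  So \<open>cl v\<close> has at least \<open>|A| |B|\<close> points besides \<open>v\<close>, whereas it has
  \<open>|A| + |B|\<close> points altogether, which leaves only the case that \<open>A\<close> or \<open>B\<close> is a singleton.  If there is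
  no such point, then each point of \<open>cl v\<close> has trace \<open>A\<close> or \<open>B\<close>.
\<close>
lemma thin_or_halves:
  assumes x: "x \<in> carrier M" and v: "v \<in> carrier M" "v \<notin> cl x" and y: "y \<in> cl v"
  shows "card (Nb Sp v x) = 1 \<or> card (Nb Tp v x) = 1 \<or> Nb Sp y x = Nb Sp v x \<or> Nb Sp y x = Nb Tp v x"
proof -
  define A where "A = Nb Sp v x"
  define B where "B = Nb Tp v x"
  have xv: "z \<notin> cl w" if "w \<in> cl v" "z \<in> cl x" for z w
  proof
    assume "z \<in> cl w"
    then have "z \<in> cl v" using cl_eq[OF v(1) that(1)] by simp
    then have "v \<in> cl z" by (rule cl_sym[OF v(1)])
    then show False using cl_eq[OF x that(2)] v(2) by simp
  qed
  have vx: "w \<notin> cl x" if "w \<in> cl v" for w using xv[OF that cl_self[OF x]] cl_sym[OF x] by blast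
  have ST: "cross_preds Sp Tp" by (simp add: cross_preds_def)
  have T: "rel M Tp w z \<longleftrightarrow> \<not> rel M Sp w z" if "w \<in> cl v" "z \<in> cl x" for w z
    by (rule cross_dichotomy[OF ST clD[OF that(1)] clD[OF that(2)] xv[OF that]])
  have AB: "A \<union> B = cl x" "A \<inter> B = {}" using T[OF cl_self[OF v(1)]] by (auto simp: A_def B_def Nb_def)
  have fAB: "finite A" "finite B" using finite_cl[OF x] by (auto simp: A_def B_def Nb_def)
  have ne: "A \<noteq> {}" "B \<noteq> {}" using meets_both[OF x v, of Sp] meets_both[OF x v, of Tp] by (auto simp: A_def B_def Nb_def)
  have vv: "v \<in> cl v" by (rule cl_self[OF v(1)])
  show ?thesis
  proof (cases "\<exists>y\<in>cl v. \<exists>a\<in>A. \<exists>b\<in>B. rel M Sp y a \<longleftrightarrow> rel M Sp y b")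
    case True
    then obtain w a b where w: "w \<in> cl v" "a \<in> A" "b \<in> B" "rel M Sp w a \<longleftrightarrow> rel M Sp w b" by blast
    have abx: "a \<in> cl x" "b \<in> cl x" using w by (auto simp: A_def B_def Nb_def)
    obtain g where g: "iso g M M" "g w = w" "g a = b" "g b = a" "\<forall>z\<in>cl x - {a, b}. g z = z"
      using swap_in_class[OF x abx clD[OF w(1)] vx[OF w(1)] w(4)] by blast
    have gcl: "cl (g z) = cl z" if "iso g M M" "z \<in> carrier M" "u \<in> cl z" "g u \<in> cl z" for g z u
    proof -
      have "cl (g u) = cl (g z)" using class_image[OF that(1,2)] class_image[OF that(1) clD[OF that(3)]] cl_eq[OF that(2,3)] by simp
      then show ?thesis using cl_eq[OF that(2,4)] by simp
    qed
    have ex: "\<exists>y\<in>cl v. Nb Sp y x = insert b' (A - {a'})" if a': "a' \<in> A" and b': "b' \<in> B" for a' b'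
    proof -
      have a'x: "a' \<in> cl x" "b' \<in> cl x" using a' b' by (auto simp: A_def B_def Nb_def)
      have aS: "rel M Sp v a \<longleftrightarrow> rel M Sp v a'" using w(2) a' by (auto simp: A_def Nb_def)
      have bS: "rel M Sp v b \<longleftrightarrow> rel M Sp v b'" using w(3) b' T[OF vv] by (auto simp: B_def Nb_def)
      obtain h where h: "iso h M M" "h v = v" "h a = a'" "h a' = a" "\<forall>z\<in>cl x - {a, a'}. h z = z"
        using swap_in_class[OF x abx(1) a'x(1) v aS] by blast
      obtain k where k: "iso k M M" "k v = v" "k b = b'" "k b' = b" "\<forall>z\<in>cl x - {b, b'}. k z = z"
        using swap_in_class[OF x abx(2) a'x(2) v bS] by blast
      have gx: "cl (g x) = cl x" by (rule gcl[OF g(1) x abx(1)]) (simp add: g(3) abx(2))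
      have hx: "cl (h x) = cl x" by (rule gcl[OF h(1) x abx(1)]) (simp add: h(3) a'x(1))
      have kx: "cl (k x) = cl x" by (rule gcl[OF k(1) x abx(2)]) (simp add: k(3) a'x(2))
      have gv: "cl (g v) = cl v" by (rule gcl[OF g(1) v(1) w(1)]) (simp add: g(2) w(1))
      have Nbx: "Nb P z w = Nb P z x" if "cl w = cl x" for w P z using that by (simp add: Nb_def)
      have abne: "a \<noteq> b" "a' \<noteq> b" "a \<noteq> b'" "a' \<noteq> b'" using w a' b' AB(2) by auto
      have cs: "A \<subseteq> cl x" using AB by blast
      have bA: "b \<notin> A" "b' \<notin> A" using w b' AB(2) by auto
      have gA: "g ` A = insert b (A - {a})"
      proof -
        have "g ` (A - {a}) = A - {a}"
        proof (rule image_fixed)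
          fix z assume "z \<in> A - {a}"
          then have "z \<in> cl x - {a, b}" using cs bA(1) by blast
          then show "g z = z" by (rule bspec[OF g(5)])
        qed
        moreover have "A = insert a (A - {a})" using w(2) by blast
        ultimately show ?thesis using g(3) by (metis image_insert)
      qed
      have hA: "h ` insert b (A - {a}) = insert b (A - {a'})"
      proof -
        have "h b = b" using h(5) abx(2) abne by auto
        moreover have "h ` (A - {a}) = A - {a'}"
        proof (cases "a = a'")
          case True
          have "h z = z" if "z \<in> cl x" for z using h(3,5) that True by (cases "z = a") auto
          then have "h ` (A - {a}) = A - {a}" by (intro image_fixed) (use cs in blast)
          then show ?thesis using True by simp
        next
          case False
          have e: "A - {a} = insert a' (A - {a, a'})" "A - {a'} = insert a (A - {a, a'})" using w(2) a' False by auto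
          have "h ` (A - {a, a'}) = A - {a, a'}" by (rule image_fixed) (use h(5) cs in blast)
          then show ?thesis unfolding e using h(4) by simp
        qed
        ultimately show ?thesis by simp
      qed
      have kA: "k ` insert b (A - {a'}) = insert b' (A - {a'})"
      proof -
        have "k ` (A - {a'}) = A - {a'}"
        proof (rule image_fixed)
          fix z assume "z \<in> A - {a'}"
          then have "z \<in> cl x - {b, b'}" using cs bA by blast
          then show "k z = z" by (rule bspec[OF k(5)])
        qed
        then show ?thesis using k(3) by simp
      qed
      have 1: "Nb Sp (g v) x = insert b (A - {a})"
        using Nb_image[OF g(1) x v(1), of Sp] Nbx[OF gx] gA by (simp add: A_def)
      have gvc: "g v \<in> cl v" "g v \<in> carrier M" using gv cl_self[OF iso_facts(1)[OF g(1) v(1)]] iso_facts(1)[OF g(1) v(1)] by auto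
      have 2: "Nb Sp (h (g v)) x = insert b (A - {a'})"
        using Nb_image[OF h(1) x gvc(2), of Sp] Nbx[OF hx] 1 hA by simp
      have hgc: "h (g v) \<in> cl v" "h (g v) \<in> carrier M"
        using iso_cl[OF h(1) v(1) gvc(2)] gvc(1) h(2) iso_facts(1)[OF h(1) gvc(2)] by auto
      have 3: "Nb Sp (k (h (g v))) x = insert b' (A - {a'})"
        using Nb_image[OF k(1) x hgc(2), of Sp] Nbx[OF kx] 2 kA by simp
      have "k (h (g v)) \<in> cl v" using iso_cl[OF k(1) v(1) hgc(2)] hgc(1) k(2) by auto
      then show ?thesis using 3 by blast
    qed
    then obtain Y where Y: "\<And>a' b'. \<lbrakk>a' \<in> A; b' \<in> B\<rbrakk> \<Longrightarrow> Y a' b' \<in> cl v \<and> Nb Sp (Y a' b') x = insert b' (A - {a'})" by metis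
    have "inj_on (\<lambda>(a', b'). Y a' b') (A \<times> B)"
    proof (rule inj_onI)
      fix p q assume pq: "p \<in> A \<times> B" "q \<in> A \<times> B" and e: "(\<lambda>(a', b'). Y a' b') p = (\<lambda>(a', b'). Y a' b') q"
      obtain a1 b1 a2 b2 where d: "p = (a1, b1)" "q = (a2, b2)" by fastforce
      have m: "a1 \<in> A" "b1 \<in> B" "a2 \<in> A" "b2 \<in> B" using pq d by auto
      have eq: "insert b1 (A - {a1}) = insert b2 (A - {a2})" using Y[OF m(1,2)] Y[OF m(3,4)] e d by simp
      have n: "b1 \<notin> A" "b2 \<notin> A" "a1 \<noteq> b2" "a2 \<noteq> b1" using m AB(2) by auto
      have "b1 = b2" using eq n(1) by blast
      moreover have "a1 = a2" using eq m n by blast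
      ultimately show "p = q" using d by simp
    qed
    then have "card ((\<lambda>(a', b'). Y a' b') ` (A \<times> B)) = card A * card B" by (simp add: card_image card_cartesian_product)
    moreover have "(\<lambda>(a', b'). Y a' b') ` (A \<times> B) \<subseteq> cl v - {v}"
    proof
      fix t assume "t \<in> (\<lambda>(a', b'). Y a' b') ` (A \<times> B)"
      then obtain a' b' where t: "a' \<in> A" "b' \<in> B" "t = Y a' b'" by auto
      have "Nb Sp t x = insert b' (A - {a'})" "t \<in> cl v" using Y t by auto
      moreover have "b' \<notin> A" using t AB(2) by auto
      ultimately show "t \<in> cl v - {v}" by (auto simp: A_def)
    qed
    ultimately have "card A * card B \<le> card (cl v - {v})"
      using card_mono[of "cl v - {v}"] finite_cl[OF v(1)] by (metis finite_Diff)
    also have "\<dots> = card (cl x) - 1" using vv finite_cl[OF v(1)] card_cl[OF v(1) x] by simp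
    also have "card (cl x) = card A + card B" using card_Un_disjoint[OF fAB AB(2)] AB(1) by simp
    finally have le: "card A * card B \<le> card A + card B - 1" .
    have "card A = 1 \<or> card B = 1"
    proof (rule ccontr)
      assume "\<not> ?thesis"
      moreover have "card A \<noteq> 0" "card B \<noteq> 0" using ne fAB by auto
      ultimately have "card A \<ge> 2" "card B \<ge> 2" by linarith+
      then obtain s t where "card A = s + 2" "card B = t + 2" by (metis add.commute le_Suc_ex)
      then show False using le by (simp add: algebra_simps)
    qed
    then show ?thesis by (auto simp: A_def B_def)
  next
    case False
    have sep: "rel M Sp y a \<longleftrightarrow> \<not> rel M Sp y b" if "a \<in> A" "b \<in> B" for a b using False y that by blast
    obtain a b where ab: "a \<in> A" "b \<in> B" using ne by blast
    have "Nb Sp y x = {z \<in> A \<union> B. rel M Sp y z}" by (simp add: Nb_def AB(1))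
    also have "\<dots> = A \<or> \<dots> = B" using sep ab AB(2) by blast
    finally show ?thesis by (simp add: A_def B_def)
  qed
qed

lemma cl_disjoint: "\<lbrakk>x \<in> carrier M; v \<in> carrier M; v \<notin> cl x; w \<in> cl v; z \<in> cl x\<rbrakk> \<Longrightarrow> z \<notin> cl w"
  using cl_eq[of v w] cl_eq[of x z] cl_sym[of v z] by auto

text \<open>
  Reading the half graphs backwards exchanges the roles of the two relations.
\<close>
lemma half_graphs_cross:
  assumes "cross_preds P Q"
  shows "\<exists>x y :: nat \<Rightarrow> 'a. (\<forall>i<n. x i \<in> carrier M \<and> y i \<in> carrier M) \<and>
       (\<forall>i<n. \<forall>j<n. (i < j \<longrightarrow> rel M P (x i) (y j)) \<and> (j < i \<longrightarrow> rel M Q (x i) (y j)))"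
proof -
  obtain x y :: "nat \<Rightarrow> 'a" where xy: "\<forall>i<n. x i \<in> carrier M \<and> y i \<in> carrier M"
       "\<forall>i<n. \<forall>j<n. (i < j \<longrightarrow> rel M Sp (x i) (y j)) \<and> (j < i \<longrightarrow> rel M Tp (x i) (y j))"
    using half_graphs[of n] by (elim exE conjE)
  from assms consider "P = Sp" "Q = Tp" | "P = Tp" "Q = Sp" by (auto simp: cross_preds_def)
  then show ?thesis
  proof cases
    case 1
    show ?thesis unfolding 1 by (rule exI[of _ x], rule exI[of _ y], rule conjI[OF xy])
  next
    case 2
    have r: "n - 1 - i < n" if "i < n" for i using that by simp
    have "\<forall>i<n. x (n - 1 - i) \<in> carrier M \<and> y (n - 1 - i) \<in> carrier M" using xy(1) r by simp
    moreover have "\<forall>i<n. \<forall>j<n. (i < j \<longrightarrow> rel M Tp (x (n - 1 - i)) (y (n - 1 - j))) \<and> (j < i \<longrightarrow> rel M Sp (x (n - 1 - i)) (y (n - 1 - j)))"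
    proof (intro allI impI conjI)
      fix i j assume "i < n" "j < n" "i < j"
      then have "n - 1 - j < n - 1 - i" by linarith
      then show "rel M Tp (x (n - 1 - i)) (y (n - 1 - j))" using xy(2) r \<open>i < n\<close> \<open>j < n\<close> by blast
    next
      fix i j assume "i < n" "j < n" "j < i"
      then have "n - 1 - i < n - 1 - j" by linarith
      then show "rel M Sp (x (n - 1 - i)) (y (n - 1 - j))" using xy(2) r \<open>i < n\<close> \<open>j < n\<close> by blast
    qed
    ultimately show ?thesis unfolding 2
      by (intro exI[of _ "\<lambda>i. x (n - 1 - i)"] exI[of _ "\<lambda>i. y (n - 1 - i)"] conjI)
  qed
qed

text \<open>
  The relation \<open>P\<close> is a perfect matching between any two classes.  It is transitive: if
  \<open>x P y P z\<close> but not \<open>x P z\<close>, follow the matchings from \<open>z\<close> to \<open>x'\<close> in the class of \<open>x\<close> and on to \<open>y'\<close>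
  in the class of \<open>y\<close>.  An automorphism that fixes \<open>x\<close> fixes its partner \<open>y\<close> if it preserves
  the three classes, and then \<open>z\<close>, \<open>x'\<close> and \<open>y'\<close> in turn; but in classes with a third point there is one that
  moves \<open>y'\<close>.  A transitive symmetric relation contains no half graph.
\<close>
lemma matching_small:
  assumes PQ: "cross_preds P Q" and one: "\<And>x v. \<lbrakk>x \<in> carrier M; v \<in> carrier M; v \<notin> cl x\<rbrakk> \<Longrightarrow> card (Nb P v x) = 1"
    and big: "\<And>x. x \<in> carrier M \<Longrightarrow> card (cl x) \<ge> 3"
  shows False
proof -
  have PR: "P \<noteq> Rp" "Q \<noteq> Rp" using PQ by (auto simp: cross_preds_def)
  have sym: "rel M P u w \<longleftrightarrow> rel M P w u" if "u \<in> carrier M" "w \<in> carrier M" for u w by (rule rel_sym[OF that])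
  have nin: "w \<notin> cl u" if "u \<in> carrier M" "rel M P u w" for u w
    using in_cl_not[OF that(1) cl_self[OF that(1)], of w P] that PR by blast
  have uniq: "z = z'" if "x \<in> carrier M" "v \<in> carrier M" "v \<notin> cl x" "z \<in> cl x" "z' \<in> cl x" "rel M P v z" "rel M P v z'" for x v z z'
  proof -
    have "card (Nb P v x) = 1" by (rule one[OF that(1-3)])
    then obtain t where "Nb P v x = {t}" by (auto simp: card_1_singleton_iff)
    moreover have "z \<in> Nb P v x" "z' \<in> Nb P v x" using that by (auto simp: Nb_def)
    ultimately show ?thesis by simp
  qed
  have pick: "\<exists>t\<in>cl x. t \<noteq> u \<and> t \<noteq> w" if "x \<in> carrier M" for x u w
  proof (rule ccontr)
    assume "\<not> ?thesis"
    then have "cl x \<subseteq> {u, w}" by blast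
    then have "card (cl x) \<le> card {u, w}" by (rule card_mono[rotated]) simp
    also have "\<dots> \<le> 2" by (cases "u = w") auto
    finally show False using big[OF that] by simp
  qed
  have trans: "rel M P x z" if c: "x \<in> carrier M" "y \<in> carrier M" "z \<in> carrier M" and p: "rel M P x y" "rel M P y z" "x \<noteq> z" for x y z
  proof (rule ccontr)
    assume no: "\<not> rel M P x z"
    have yx: "y \<notin> cl x" by (rule nin[OF c(1) p(1)])
    have zy: "z \<notin> cl y" by (rule nin[OF c(2) p(2)])
    have pyx: "rel M P y x" "rel M P z y" using sym[OF c(1,2)] sym[OF c(2,3)] p by simp_all
    have zx: "z \<notin> cl x" using uniq[OF c(1,2) yx cl_self[OF c(1)], of z] pyx(1) p(2,3) by blast
    have xz: "x \<notin> cl z" "x \<notin> cl y" "y \<notin> cl z" using zx yx zy cl_sym c by blast+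
    obtain x' where x': "x' \<in> cl x" "rel M P z x'" using meets_both[OF c(1,3) zx PR(1)] by blast
    have x'c: "x' \<in> carrier M" using clD x' by blast
    have x'x: "x' \<noteq> x" using x'(2) sym[OF c(3,1)] no by blast
    have yx': "x' \<notin> cl y" by (rule cl_disjoint[OF c(1,2) yx cl_self[OF c(2)] x'(1)])
    obtain y' where y': "y' \<in> cl y" "rel M P x' y'" using meets_both[OF c(2) x'c yx' PR(1)] by blast
    have y'c: "y' \<in> carrier M" using clD y' by blast
    have y'y: "y' \<noteq> y"
    proof
      assume "y' = y"
      then have "rel M P y x'" using y'(2) sym[OF x'c c(2)] by simp
      then have "x' = x" by (intro uniq[OF c(1,2) yx x'(1) cl_self[OF c(1)]]) (use pyx in simp_all)
      then show False using x'x by simp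
    qed
    \<comment> \<open>This is where a third point in each class is used.\<close>
    obtain y2 where y2: "y2 \<in> cl y" "y2 \<noteq> y" "y2 \<noteq> y'" using pick[OF c(2), of y y'] by blast
    have nonP: "\<not> rel M P x w" if "w \<in> cl y" "w \<noteq> y" for w
      using uniq[OF c(2,1) xz(2) that(1) cl_self[OF c(2)]] p(1) that(2) by blast
    have third: "\<exists>t\<in>cl z. \<not> rel M P x t \<and> \<not> rel M P w t" if w: "w \<in> cl y" for w
    proof -
      have wc: "w \<in> carrier M" using clD w by blast
      have wz: "w \<notin> cl z" by (rule cl_disjoint[OF c(2,3) zy cl_self[OF c(3)] w])
      obtain t1 where t1: "t1 \<in> cl z" "rel M P x t1" using meets_both[OF c(3,1) xz(1) PR(1)] by blast
      obtain t2 where t2: "t2 \<in> cl z" "rel M P w t2" using meets_both[OF c(3) wc wz PR(1)] by blast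
      obtain t where t: "t \<in> cl z" "t \<noteq> t1" "t \<noteq> t2" using pick[OF c(3), of t1 t2] by blast
      have "\<not> rel M P x t" using uniq[OF c(3,1) xz(1) t(1) t1(1) _ t1(2)] t(2) by blast
      moreover have "\<not> rel M P w t" using uniq[OF c(3) wc wz t(1) t2(1) _ t2(2)] t(3) by blast
      ultimately show ?thesis using t(1) by blast
    qed
    obtain t where t: "t \<in> cl z" "\<not> rel M P x t" "\<not> rel M P y' t" using third[OF y'(1)] by blast
    obtain t2 where t2: "t2 \<in> cl z" "\<not> rel M P x t2" "\<not> rel M P y2 t2" using third[OF y2(1)] by blast
    have tc: "t \<in> carrier M" "t2 \<in> carrier M" "y2 \<in> carrier M" using t t2 y2 clD by blast+
    have nxy: "w \<notin> cl x" if "w \<in> cl y" for w by (rule cl_disjoint[OF c(2,1) xz(2) cl_self[OF c(1)] that])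
    have nxz: "w \<notin> cl x" if "w \<in> cl z" for w by (rule cl_disjoint[OF c(3,1) xz(1) cl_self[OF c(1)] that])
    have nyz: "w \<notin> cl u" if "w \<in> cl z" "u \<in> cl y" for w u by (rule cl_disjoint[OF c(3,2) xz(3) that(2,1)])
    have k1: "kind M x y' = kind M x y2"
      by (rule kind_cross[OF PQ c(1) y'c c(1) tc(3) nxy[OF y'(1)] nxy[OF y2(1)]]) (use nonP[OF y'(1) y'y] nonP[OF y2(1,2)] in simp)
    have k2: "kind M y' t = kind M y2 t2"
      by (rule kind_cross[OF PQ y'c tc(1) tc(3) tc(2) nyz[OF t(1) y'(1)] nyz[OF t2(1) y2(1)]]) (use t t2 in simp)
    have k3: "kind M x t = kind M x t2"
      by (rule kind_cross[OF PQ c(1) tc(1) c(1) tc(2) nxz[OF t(1)] nxz[OF t2(1)]]) (use t t2 in simp)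
    obtain g where g: "iso g M M" "g x = x" "g y' = y2" "g t = t2"
      using extend3[OF c(1) y'c tc(1) c(1) tc(3) tc(2) k1 k2 k3] by blast
    have gcy: "g w \<in> cl y" if "w \<in> cl y" for w
    proof -
      have "g ` cl y' = cl y2" using class_image[OF g(1) y'c] g(3) by simp
      then show ?thesis using that cl_eq[OF c(2) y'(1)] cl_eq[OF c(2) y2(1)] by blast
    qed
    have gcz: "g w \<in> cl z" if "w \<in> cl z" for w
    proof -
      have "g ` cl t = cl t2" using class_image[OF g(1) tc(1)] g(4) by simp
      then show ?thesis using that cl_eq[OF c(3) t(1)] cl_eq[OF c(3) t2(1)] by blast
    qed
    have gcx: "g w \<in> cl x" if "w \<in> cl x" for w using class_image[OF g(1) c(1)] g(2) that by auto
    have "rel M P x (g y)" using iso_facts(2)[OF g(1) c(1,2), of P] g(2) p(1) by simp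
    then have gy: "g y = y" by (intro uniq[OF c(2,1) xz(2) gcy[OF cl_self[OF c(2)]] cl_self[OF c(2)]]) (use p(1) in simp_all)
    have "rel M P y (g z)" using iso_facts(2)[OF g(1) c(2,3), of P] gy p(2) by simp
    then have gz: "g z = z" by (intro uniq[OF c(3,2) xz(3) gcz[OF cl_self[OF c(3)]] cl_self[OF c(3)]]) (use p(2) in simp_all)
    have "rel M P z (g x')" using iso_facts(2)[OF g(1) c(3) x'c, of P] gz x'(2) by simp
    then have gx': "g x' = x'" by (intro uniq[OF c(1,3) zx gcx[OF x'(1)] x'(1)]) (use x'(2) in simp_all)
    have "rel M P x' (g y')" using iso_facts(2)[OF g(1) x'c y'c, of P] gx' y'(2) by simp
    then have "g y' = y'" by (intro uniq[OF c(2) x'c yx' gcy[OF y'(1)] y'(1)]) (use y'(2) in simp_all)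
    then show False using g(3) y2(3) by simp
  qed
  obtain x y :: "nat \<Rightarrow> 'a" where xy: "\<forall>i<4. x i \<in> carrier M \<and> y i \<in> carrier M"
       "\<forall>i<4. \<forall>j<4. (i < j \<longrightarrow> rel M P (x i) (y j)) \<and> (j < i \<longrightarrow> rel M Q (x i) (y j))"
    using half_graphs_cross[OF PQ, of 4] by (elim exE conjE)
  have c: "x 0 \<in> carrier M" "x 2 \<in> carrier M" "y 1 \<in> carrier M" "y 3 \<in> carrier M" using xy(1) by simp_all
  have P: "rel M P (x 0) (y 1)" "rel M P (x 0) (y 3)" "rel M P (x 2) (y 3)" and Q: "rel M Q (x 2) (y 1)" using xy(2) by simp_all
  have n: "x 2 \<noteq> y 1" "\<not> rel M P (x 2) (y 1)"
    using Q irrefl[OF c(2)] rel_T[OF c(2,3)] PQ by (auto simp: cross_preds_def)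
  have y30: "rel M P (y 3) (x 0)" using P(2) sym[OF c(1,4)] by simp
  have "x 2 = x 0 \<or> rel M P (x 2) (x 0)" using trans[OF c(2,4,1) P(3) y30] by blast
  then show False using n P(1) trans[OF c(2,1,3) _ P(1)] by auto
qed

end

section \<open>Classes are pairs, and the pairs form a random cover\<close>

context finite_class_struc begin

lemma infinitely_many: "infinite (carrier M)"
proof
  assume fin: "finite (carrier M)"
  define m where "m = Suc (card (carrier M))"
  obtain x y :: "nat \<Rightarrow> 'a" where xy: "\<forall>i<2*m. x i \<in> carrier M \<and> y i \<in> carrier M"
       "\<forall>i<2*m. \<forall>j<2*m. (i < j \<longrightarrow> rel M Sp (x i) (y j)) \<and> (j < i \<longrightarrow> rel M Tp (x i) (y j))"
    using half_graphs[of "2*m"] by (elim exE conjE)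
  have ne: "x (2*i) \<noteq> x (2*j)" if "i < j" "j < m" for i j
  proof
    assume e: "x (2*i) = x (2*j)"
    have "2*i < 2*i+1" "2*i+1 < 2*j" "2*i+1 < 2*m" "2*i < 2*m" "2*j < 2*m" using that by linarith+
    then have "rel M Sp (x (2*i)) (y (2*i+1))" "rel M Tp (x (2*j)) (y (2*i+1))" "x (2*j) \<in> carrier M" "y (2*i+1) \<in> carrier M"
      using xy by blast+
    then show False using rel_T e by simp
  qed
  have "inj_on (\<lambda>i. x (2*i)) {..<m}"
  proof (rule inj_onI)
    fix i j assume "i \<in> {..<m}" "j \<in> {..<m}" "x (2*i) = x (2*j)"
    then show "i = j" using ne[of i j] ne[of j i] by (cases i j rule: linorder_cases) auto
  qed
  moreover have "(\<lambda>i. x (2*i)) ` {..<m} \<subseteq> carrier M" using xy(1) by auto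
  ultimately have "card {..<m} \<le> card (carrier M)" using fin by (rule card_inj_on_le)
  then show False by (simp add: m_def)
qed

lemma outside_class: "x \<in> carrier M \<Longrightarrow> \<exists>v\<in>carrier M. v \<notin> cl x"
  using infinitely_many finite_cl[of x] finite_subset[of "carrier M" "cl x"] by blast

lemma swap_only:
  assumes x: "x \<in> carrier M" and ab: "a \<in> cl x" "b \<in> cl x"
  shows "\<exists>g. iso g M M \<and> g a = b \<and> g b = a \<and> (\<forall>y\<in>cl x - {a, b}. g y = y)"
proof -
  define f where "f = (\<lambda>y. if y = a then b else if y = b then a else y)"
  have fcl: "f y \<in> cl x" if "y \<in> cl x" for y using that ab by (auto simp: f_def)
  have finj: "f y = f z \<longleftrightarrow> y = z" for y z by (auto simp: f_def)
  have "\<exists>g. iso g M M \<and> (\<forall>y\<in>cl x. g y = f y)"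
  proof (rule extend_map)
    show "finite (cl x)" by (rule finite_cl[OF x])
    show "cl x \<subseteq> carrier M" by (rule cl_sub)
    show "f ` cl x \<subseteq> carrier M" using fcl clD by blast
    fix y z assume yz: "y \<in> cl x" "z \<in> cl x"
    have "kind M y z = kind M (f y) (f z)" by (rule kind_class[OF x yz x fcl[OF yz(1)] fcl[OF yz(2)]]) (simp add: finj)
    then show "(y = z \<longleftrightarrow> f y = f z) \<and> (rel M Rp y z \<longleftrightarrow> rel M Rp (f y) (f z)) \<and> (rel M Sp y z \<longleftrightarrow> rel M Sp (f y) (f z))"
      using kind_eqD[of M y z M "f y" "f z"] by blast
  qed
  then obtain g where g: "iso g M M" "\<And>y. y \<in> cl x \<Longrightarrow> g y = f y" by blast
  have "g a = b" "g b = a" using g(2) ab by (auto simp: f_def)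
  moreover have "\<forall>y\<in>cl x - {a, b}. g y = y" using g(2) by (auto simp: f_def)
  ultimately show ?thesis using g(1) by blast
qed

lemma T_iff: "\<lbrakk>x \<in> carrier M; v \<in> carrier M; v \<notin> cl x; w \<in> cl v; z \<in> cl x\<rbrakk> \<Longrightarrow> rel M Tp w z \<longleftrightarrow> \<not> rel M Sp w z"
  using cross_dichotomy[of Sp Tp w z] cl_disjoint[of x v w z] clD by (auto simp: cross_preds_def)

lemma Nb_T: "\<lbrakk>x \<in> carrier M; v \<in> carrier M; v \<notin> cl x\<rbrakk> \<Longrightarrow> Nb Tp v x = cl x - Nb Sp v x"
  using T_iff[of x v v] cl_self[of v] by (auto simp: Nb_def)

text \<open>
  Infinitely many points induce only finitely many partitions of \<open>cl x\<close>, so two classes, of \<open>y\<close>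
  and \<open>z\<close>, induce the same partition \<open>{A, B}\<close>.  A transposition moves \<open>y\<close> to a point \<open>w\<close> with another partition.
  By homogeneity no point of \<open>cl z\<close> has the same relations to \<open>y\<close> and to a point \<open>u \<in> A\<close> as some point
  of \<open>cl w\<close> has (\<open>key\<close> in the proof).  Two points of \<open>A\<close> that \<open>w\<close> separates then determine the relation of \<open>y\<close> to
  all points of \<open>cl z\<close>, which would make it constant.
\<close>
lemma no_halves:
  assumes two: "\<And>x v. \<lbrakk>x \<in> carrier M; v \<in> carrier M; v \<notin> cl x\<rbrakk> \<Longrightarrow> card (Nb Sp v x) \<ge> 2"
    and halves: "\<And>x v y. \<lbrakk>x \<in> carrier M; v \<in> carrier M; v \<notin> cl x; y \<in> cl v\<rbrakk> \<Longrightarrow> Nb Sp y x = Nb Sp v x \<or> Nb Sp y x = Nb Tp v x"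
  shows False
proof -
  obtain x where x: "x \<in> carrier M" using infinitely_many by fastforce
  have inf: "infinite (carrier M - cl x)" using infinitely_many finite_cl[OF x] by (rule Diff_infinite_finite[rotated])
  have "finite ((\<lambda>w. Nb Sp w x) ` (carrier M - cl x))"
    by (rule finite_subset[of _ "Pow (cl x)"]) (use finite_cl[OF x] in \<open>auto simp: Nb_def\<close>)
  from pigeonhole_infinite[OF inf this]
  obtain y where y: "y \<in> carrier M - cl x" "infinite {w \<in> carrier M - cl x. Nb Sp w x = Nb Sp y x}" by blast
  have yc: "y \<in> carrier M" "y \<notin> cl x" using y(1) by simp_all
  have "\<not> {w \<in> carrier M - cl x. Nb Sp w x = Nb Sp y x} \<subseteq> cl y" using y(2) finite_cl[OF yc(1)] finite_subset by blast
  then obtain z where z: "z \<in> carrier M" "z \<notin> cl x" "Nb Sp z x = Nb Sp y x" "z \<notin> cl y" by blast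
  define A where "A = Nb Sp y x"
  define B where "B = cl x - A"
  have NT: "Nb Tp y x = B" "Nb Tp z x = B" using Nb_T[OF x yc] Nb_T[OF x z(1,2)] z(3) by (simp_all add: A_def B_def)
  have Acl: "A \<subseteq> cl x" by (auto simp: A_def Nb_def)
  have Acard: "card A \<ge> 2" using two[OF x yc] by (simp add: A_def)
  then obtain a a2 where a: "a \<in> A" "a2 \<in> A" "a \<noteq> a2"
    by (metis One_nat_def Suc_1 card_le_Suc0_iff_eq card.infinite not_less_eq_eq zero_le)
  have "B \<noteq> {}" using meets_both[OF x yc, of Tp] NT(1) by (auto simp: Nb_def)
  then obtain b where b: "b \<in> B" by blast
  have abx: "a \<in> cl x" "b \<in> cl x" "a2 \<in> cl x" using a b Acl by (auto simp: B_def)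
  have bA: "b \<notin> A" using b by (simp add: B_def)
  obtain h where h: "iso h M M" "h a = b" "h b = a" "\<forall>t\<in>cl x - {a, b}. h t = t" using swap_only[OF x abx(1,2)] by blast
  have hcl: "cl (h x) = cl x"
  proof -
    have "cl (h a) = cl (h x)" using class_image[OF h(1) x] class_image[OF h(1) clD[OF abx(1)]] cl_eq[OF x abx(1)] by simp
    then show ?thesis using h(2) cl_eq[OF x abx(2)] by simp
  qed
  define w where "w = h y"
  have wc: "w \<in> carrier M" unfolding w_def by (rule iso_facts(1)[OF h(1) yc(1)])
  have wx: "w \<notin> cl x" using iso_cl[OF h(1) x yc(1)] yc(2) hcl by (simp add: w_def)
  define C where "C = insert b (A - {a})"
  have NC: "Nb Sp w x = C"
  proof -
    have "h ` Nb Sp y x = Nb Sp w (h x)" unfolding w_def by (rule Nb_image[OF h(1) x yc(1)])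
    also have "\<dots> = Nb Sp w x" using hcl by (simp add: Nb_def)
    finally have 1: "Nb Sp w x = h ` A" by (simp add: A_def)
    have "h ` (A - {a}) = A - {a}"
    proof (rule image_fixed)
      fix t assume "t \<in> A - {a}"
      then have "t \<in> cl x - {a, b}" using Acl bA by blast
      then show "h t = t" by (rule bspec[OF h(4)])
    qed
    moreover have "A = insert a (A - {a})" using a(1) by blast
    ultimately show ?thesis using 1 h(2) unfolding C_def by (metis image_insert)
  qed
  have CA: "a \<notin> C" "a2 \<in> C" "C \<subseteq> cl x" using a bA abx Acl by (auto simp: C_def)
  have CAB: "C \<noteq> A" "C \<noteq> B" using CA a by (auto simp: B_def)
  have DAB: "cl x - C \<noteq> A" "cl x - C \<noteq> B" using CA a bA abx by (auto simp: B_def C_def)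
  have NTw: "Nb Tp w x = cl x - C" using Nb_T[OF x wc wx] NC by simp
  have hz: "Nb Sp s x = A \<or> Nb Sp s x = B" if "s \<in> cl z" for s using halves[OF x z(1,2) that] NT z(3) by (simp add: A_def)
  have hw: "Nb Sp s x = C \<or> Nb Sp s x = cl x - C" if "s \<in> cl w" for s using halves[OF x wc wx that] NTw NC by simp
  have hy: "Nb Sp s x = A \<or> Nb Sp s x = B" if "s \<in> cl y" for s using halves[OF x yc that] NT by (simp add: A_def)
  have wy: "w \<notin> cl y" using hy[of w] NC CAB by auto
  have key: "rel M Sp y s \<longleftrightarrow> \<not> rel M Sp y s'"
    if u: "u \<in> A" and s: "s \<in> cl z" "s' \<in> cl w" and e: "rel M Sp u s \<longleftrightarrow> rel M Sp u s'" for u s s'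
  proof (rule ccontr)
    assume "\<not> ?thesis"
    then have ys: "rel M Sp y s \<longleftrightarrow> rel M Sp y s'" by blast
    have ux: "u \<in> cl x" using u Acl by blast
    have c: "u \<in> carrier M" "s \<in> carrier M" "s' \<in> carrier M" using clD ux s by blast+
    have cu: "cl u = cl x" by (rule cl_eq[OF x ux])
    have ST: "cross_preds Sp Tp" by (simp add: cross_preds_def)
    have zu: "z \<notin> cl u" "w \<notin> cl u" using z(2) wx cu by simp_all
    have uz: "u \<notin> cl z" "u \<notin> cl w" using zu cl_sym c(1) z(1) wc by blast+
    have yz: "y \<notin> cl z" "y \<notin> cl w" using z(4) wy cl_sym z(1) wc by blast+
    have n1: "s \<notin> cl u" by (rule cl_disjoint[OF z(1) c(1) uz(1) cl_self[OF c(1)] s(1)])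
    have n2: "s' \<notin> cl u" by (rule cl_disjoint[OF wc c(1) uz(2) cl_self[OF c(1)] s(2)])
    have n3: "s \<notin> cl y" by (rule cl_disjoint[OF z(1) yc(1) yz(1) cl_self[OF yc(1)] s(1)])
    have n4: "s' \<notin> cl y" by (rule cl_disjoint[OF wc yc(1) yz(2) cl_self[OF yc(1)] s(2)])
    have k1: "kind M y s = kind M y s'" by (rule kind_cross[OF ST yc(1) c(2) yc(1) c(3) n3 n4 ys])
    have k2: "kind M u s = kind M u s'" by (rule kind_cross[OF ST c(1,2,1,3) n1 n2 e])
    obtain g where g: "iso g M M" "g u = u" "g y = y" "g s = s'"
      using extend3[OF c(1) yc(1) c(2) c(1) yc(1) c(3) refl k1 k2] by blast
    have N: "Nb P v u = Nb P v x" for P v using cu by (simp add: Nb_def)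
    have gN: "g ` Nb P v x = Nb P (g v) x" if "v \<in> carrier M" for P v
      using Nb_image[OF g(1) c(1) that, of P] g(2) N by simp
    have "g ` A = A" "g ` B = B" using gN[OF yc(1), of Sp] gN[OF yc(1), of Tp] g(3) NT(1) by (simp_all add: A_def)
    moreover have "g ` Nb Sp s x = Nb Sp s' x" using gN[OF c(2), of Sp] g(4) by simp
    ultimately have "Nb Sp s' x = A \<or> Nb Sp s' x = B" using hz[OF s(1)] by auto
    then show False using hw[OF s(2)] CAB DAB by auto
  qed
  have sy: "rel M Sp s t \<longleftrightarrow> rel M Sp t s" if "s \<in> carrier M" "t \<in> carrier M" for s t by (rule rel_sym[OF that])
  have inN: "rel M Sp t s \<longleftrightarrow> t \<in> Nb Sp s x" if "t \<in> cl x" "s \<in> carrier M" for s t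
    using that sy[OF clD[OF that(1)] that(2)] by (simp add: Nb_def)
  have Z: "rel M Sp a s \<longleftrightarrow> rel M Sp a2 s" if "s \<in> cl z" for s
    using inN[OF abx(1) clD[OF that]] inN[OF abx(3) clD[OF that]] hz[OF that] a by (auto simp: B_def)
  have W: "rel M Sp a s \<longleftrightarrow> \<not> rel M Sp a2 s" if "s \<in> cl w" for s
    using inN[OF abx(1) clD[OF that]] inN[OF abx(3) clD[OF that]] hw[OF that] CA abx by auto
  have a2c: "a2 \<in> carrier M" by (rule clD[OF abx(3)])
  have a2w: "a2 \<notin> cl w" using cl_sym[OF wc, of a2] cl_eq[OF x abx(3)] wx by auto
  obtain p where p: "p \<in> cl w" "rel M Sp a2 p" using meets_both[OF wc a2c a2w, of Sp] by auto
  obtain q where q: "q \<in> cl w" "rel M Tp a2 q" using meets_both[OF wc a2c a2w, of Tp] by auto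
  have q2: "\<not> rel M Sp a2 q" using q(2) rel_T[OF a2c clD[OF q(1)]] by simp
  have const: "rel M Sp y s \<longleftrightarrow> \<not> rel M Sp y q" if s: "s \<in> cl z" for s
  proof (cases "rel M Sp a2 s")
    case True
    then have "rel M Sp a s \<longleftrightarrow> rel M Sp a q" using Z[OF s] W[OF q(1)] q2 by simp
    then show ?thesis by (rule key[OF a(1) s q(1)])
  next
    case False
    then show ?thesis using key[OF a(2) s q(1)] q2 by simp
  qed
  have yz: "y \<notin> cl z" using z(4) cl_sym[OF z(1)] by blast
  obtain s where s: "s \<in> cl z" "rel M Sp y s" using meets_both[OF z(1) yc(1) yz, of Sp] by auto
  obtain t where t: "t \<in> cl z" "rel M Tp y t" using meets_both[OF z(1) yc(1) yz, of Tp] by auto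
  have "\<not> rel M Sp y t" using t(2) rel_T[OF yc(1) clD[OF t(1)]] by simp
  then show False using const[OF s(1)] const[OF t(1)] s(2) by simp
qed

text \<open>
  Both numbers of neighbours that a point has in another class are the same for all such
  configurations, so if a class has three or more points, then either a cross relation is a
  matching throughout or the partition case occurs throughout.
\<close>
theorem classes_are_pairs:
  assumes "x \<in> carrier M"
  shows "card (cl x) = 2"
proof (rule ccontr)
  assume ne: "card (cl x) \<noteq> 2"
  obtain v where v: "v \<in> carrier M" "v \<notin> cl x" using outside_class[OF assms] by blast
  have pos: "card (Nb P w z) \<noteq> 0" if "z \<in> carrier M" "w \<in> carrier M" "w \<notin> cl z" "P \<noteq> Rp" for P w z
    using meets_both[OF that] finite_cl[OF that(1)] by (auto simp: Nb_def)
  have "card (cl x) = card (Nb Sp v x) + card (Nb Tp v x)"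
  proof -
    have "Nb Sp v x \<subseteq> cl x" by (auto simp: Nb_def)
    then show ?thesis using Nb_T[OF assms v] finite_cl[OF assms] card_Diff_subset[of "Nb Sp v x" "cl x"]
        card_mono[of "cl x" "Nb Sp v x"] finite_subset by fastforce
  qed
  then have three: "card (cl z) \<ge> 3" if "z \<in> carrier M" for z
    using pos[OF assms v, of Sp] pos[OF assms v, of Tp] ne card_cl[OF that assms] by simp
  have thick: "card (Nb P w z) \<ge> 2" if "cross_preds P Q" "z \<in> carrier M" "w \<in> carrier M" "w \<notin> cl z" for P Q w z
  proof (rule ccontr)
    have PR: "P \<noteq> Rp" using that(1) by (auto simp: cross_preds_def)
    assume "\<not> ?thesis"
    then have c1: "card (Nb P w z) = 1" using pos[OF that(2-4) PR] by simp
    have "card (Nb P w' z') = 1" if z': "z' \<in> carrier M" "w' \<in> carrier M" "w' \<notin> cl z'" for w' z'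
      using card_Nb[OF PR z'(1,2) \<open>z \<in> carrier M\<close> \<open>w \<in> carrier M\<close> z'(3) \<open>w \<notin> cl z\<close>] c1 by simp
    then show False by (rule matching_small[OF that(1) _ three])
  qed
  have two: "card (Nb Sp w z) \<ge> 2" "card (Nb Tp w z) \<ge> 2" if "z \<in> carrier M" "w \<in> carrier M" "w \<notin> cl z" for w z
    using thick[of Sp Tp z w] thick[of Tp Sp z w] that by (auto simp: cross_preds_def)
  have hv: "Nb Sp y z = Nb Sp w z \<or> Nb Sp y z = Nb Tp w z" if "z \<in> carrier M" "w \<in> carrier M" "w \<notin> cl z" "y \<in> cl w" for z w y
    using thin_or_halves[OF that] two[OF that(1-3)] by auto
  show False by (rule no_halves[OF two(1) hv])
qed

lemma mate:
  assumes "x \<in> carrier M"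
  shows "\<exists>y\<in>carrier M. rel M Rp x y"
proof (rule ccontr)
  assume "\<not> ?thesis"
  then have "cl x \<subseteq> {x}" by (auto simp: cl_def)
  then have "card (cl x) \<le> card {x}" by (rule card_mono[rotated]) simp
  then show False using classes_are_pairs[OF assms] by simp
qed

lemma mate_unique:
  assumes "x \<in> carrier M" "y \<in> carrier M" "z \<in> carrier M" "rel M Rp x y" "rel M Rp x z"
  shows "y = z"
proof (rule ccontr)
  assume "y \<noteq> z"
  moreover have "x \<noteq> y" "x \<noteq> z" using rel_R_not assms by blast+
  ultimately have "card {x, y, z} = 3" by simp
  moreover have "{x, y, z} \<subseteq> cl x" using assms by (auto simp: cl_def)
  ultimately have "3 \<le> card (cl x)" using card_mono[OF finite_cl[OF assms(1)], of "{x, y, z}"] by simp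
  then show False using classes_are_pairs[OF assms(1)] by simp
qed

definition mt :: "'a \<Rightarrow> 'a" where "mt x = (SOME y. y \<in> carrier M \<and> rel M Rp x y)"

lemma mt: "x \<in> carrier M \<Longrightarrow> mt x \<in> carrier M" "x \<in> carrier M \<Longrightarrow> rel M Rp x (mt x)"
  unfolding mt_def using someI_ex[of "\<lambda>y. y \<in> carrier M \<and> rel M Rp x y"] mate[of x] by blast+

lemma cl_mt: "x \<in> carrier M \<Longrightarrow> cl x = {x, mt x}"
  using mt[of x] mate_unique[of x] unfolding cl_def by blast

lemma cl_of_mt: "x \<in> carrier M \<Longrightarrow> cl (mt x) = cl x"
  by (rule cl_eq) (simp_all add: cl_mt)

lemma S_flip:
  assumes "x \<in> carrier M" "y \<in> carrier M" "x \<notin> cl y"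
  shows "rel M Sp x (mt y) \<longleftrightarrow> \<not> rel M Sp x y"
proof -
  have T: "rel M Tp x z \<longleftrightarrow> \<not> rel M Sp x z" if "z \<in> cl y" for z
    by (rule T_iff[OF assms(2,1,3) cl_self[OF assms(1)] that])
  obtain s where "s \<in> cl y" "rel M Sp x s" using meets_both[OF assms(2,1,3), of Sp] by auto
  moreover obtain t where "t \<in> cl y" "rel M Tp x t" using meets_both[OF assms(2,1,3), of Tp] by auto
  ultimately show ?thesis using T cl_mt[OF assms(2)] by auto
qed

lemma S_flip':
  assumes "x \<in> carrier M" "y \<in> carrier M" "x \<notin> cl y"
  shows "rel M Sp (mt y) x \<longleftrightarrow> \<not> rel M Sp y x"
  using S_flip[OF assms] rel_sym[OF assms(1,2), of Sp] rel_sym[OF assms(1) mt(1)[OF assms(2)], of Sp] by simp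

text \<open>
  The \<open>S\<close>-graphs induced on finite sets that contain at most one point of each pair.
\<close>
definition age :: "nat set \<Rightarrow> (nat \<Rightarrow> nat \<Rightarrow> bool) \<Rightarrow> bool" where
  "age V E \<longleftrightarrow> finite V \<and> symm V E \<and> (\<exists>f. (\<forall>i\<in>V. f i \<in> carrier M) \<and>
     (\<forall>i\<in>V. \<forall>j\<in>V. i \<noteq> j \<longrightarrow> f j \<notin> cl (f i) \<and> (E i j \<longleftrightarrow> rel M Sp (f i) (f j))))"

lemma age_embed:
  assumes "age V E" "inj_on f W" "f ` W \<subseteq> V"
    "\<And>x y. \<lbrakk>x \<in> W; y \<in> W; x \<noteq> y\<rbrakk> \<Longrightarrow> F x y = (E (f x) (f y) \<noteq> ((s :: nat \<Rightarrow> bool) x \<noteq> s y))"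
  shows "age W F"
proof -
  obtain h where h: "finite V" "symm V E" "\<forall>i\<in>V. h i \<in> carrier M"
     "\<forall>i\<in>V. \<forall>j\<in>V. i \<noteq> j \<longrightarrow> h j \<notin> cl (h i) \<and> (E i j \<longleftrightarrow> rel M Sp (h i) (h j))"
    using assms(1) unfolding age_def by blast
  define k where "k = (\<lambda>i. if s i then mt (h (f i)) else h (f i))"
  have hc: "h (f i) \<in> carrier M" if "i \<in> W" for i using h(3) assms(3) that by blast
  have kc: "k i \<in> carrier M" "cl (k i) = cl (h (f i))" if "i \<in> W" for i
    using hc[OF that] mt(1) cl_of_mt by (auto simp: k_def)
  have main: "k j \<notin> cl (k i) \<and> (F i j \<longleftrightarrow> rel M Sp (k i) (k j))" if ij: "i \<in> W" "j \<in> W" "i \<noteq> j" for i j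
  proof -
    have fij: "f i \<in> V" "f j \<in> V" "f i \<noteq> f j" using assms(2,3) ij by (auto dest: inj_onD)
    have c: "h (f i) \<in> carrier M" "h (f j) \<in> carrier M" using hc ij by blast+
    have n: "h (f j) \<notin> cl (h (f i))" "E (f i) (f j) \<longleftrightarrow> rel M Sp (h (f i)) (h (f j))" using h(4) fij by blast+
    have n': "h (f i) \<notin> cl (h (f j))" using n(1) cl_sym c by blast
    have "k j \<notin> cl (h (f i))"
    proof
      assume "k j \<in> cl (h (f i))"
      then have "cl (k j) = cl (h (f i))" by (rule cl_eq[OF c(1)])
      then show False using n(1) kc(2)[OF ij(2)] cl_self[OF c(2)] by simp
    qed
    then have nk: "k j \<notin> cl (k i)" using kc(2)[OF ij(1)] by simp
    have 1: "rel M Sp (h (f i)) (k j) \<longleftrightarrow> (rel M Sp (h (f i)) (h (f j)) \<noteq> s j)"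
      using S_flip[OF c n'] by (simp add: k_def)
    have "rel M Sp (k i) (k j) \<longleftrightarrow> (rel M Sp (h (f i)) (k j) \<noteq> s i)"
    proof (cases "s i")
      case True
      then have "k i = mt (h (f i))" by (simp add: k_def)
      then show ?thesis using S_flip'[OF kc(1)[OF ij(2)] c(1) \<open>k j \<notin> cl (h (f i))\<close>] True by simp
    next
      case False
      then have "k i = h (f i)" by (simp add: k_def)
      then show ?thesis using False by simp
    qed
    then show ?thesis using nk 1 n(2) assms(4)[OF ij] by auto
  qed
  have "symm W F"
  proof (rule symmI)
    fix i j assume ij: "i \<in> W" "j \<in> W"
    show "F i j = F j i"
    proof (cases "i = j")
      case False
      then have "F i j \<longleftrightarrow> rel M Sp (k i) (k j)" "F j i \<longleftrightarrow> rel M Sp (k j) (k i)" using main ij by auto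
      then show ?thesis using rel_sym kc(1) ij by blast
    qed simp
  qed
  moreover have "finite W" using h(1) assms(2,3) by (meson finite_imageD finite_subset)
  ultimately show ?thesis unfolding age_def using main kc(1) by (intro conjI exI[of _ k]) blast+
qed

text \<open>
  Homogeneity moves one embedding of \<open>A\<close> onto the other.  The images of \<open>b\<close> and \<open>c\<close> could only lie in one
  pair if they were equal or mates, and then \<open>b\<close> and \<open>c\<close> would be twins or antitwins.
\<close>
lemma age_amalg:
  assumes b: "age (insert b A) E" and c: "age (insert c A) E" and n: "b \<notin> A" "c \<notin> A" "b \<noteq> c" and tw: "untwinned A E b c"
  shows "\<exists>E'. agree (insert b A) E E' \<and> agree (insert c A) E E' \<and> age (insert b (insert c A)) E'"
proof -
  obtain f where f: "finite (insert b A)" "\<forall>i\<in>insert b A. f i \<in> carrier M"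
     "\<forall>i\<in>insert b A. \<forall>j\<in>insert b A. i \<noteq> j \<longrightarrow> f j \<notin> cl (f i) \<and> (E i j \<longleftrightarrow> rel M Sp (f i) (f j))"
    using b unfolding age_def by blast
  obtain h where h: "\<forall>i\<in>insert c A. h i \<in> carrier M"
     "\<forall>i\<in>insert c A. \<forall>j\<in>insert c A. i \<noteq> j \<longrightarrow> h j \<notin> cl (h i) \<and> (E i j \<longleftrightarrow> rel M Sp (h i) (h j))"
    using c unfolding age_def by blast
  have ST: "cross_preds Sp Tp" by (simp add: cross_preds_def)
  have "same_type M h M f A" unfolding same_type_kind
  proof (intro ballI)
    fix i j assume ij: "i \<in> A" "j \<in> A"
    have cc: "h i \<in> carrier M" "h j \<in> carrier M" "f i \<in> carrier M" "f j \<in> carrier M" using f(2) h(1) ij by blast+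
    show "kind M (h i) (h j) = kind M (f i) (f j)"
    proof (cases "i = j")
      case True then show ?thesis using irrefl cc by (simp add: kind_def)
    next
      case False
      then show ?thesis using f(3) h(2) ij by (intro kind_cross[OF ST cc]) blast+
    qed
  qed
  then obtain g where g: "iso g M M" "\<forall>i\<in>A. g (h i) = f i"
    using homogeneous_extend[OF hom, of A h f] f(1,2) h(1) by auto
  define k where "k = g (h c)"
  have hc: "h c \<in> carrier M" "\<And>i. i \<in> A \<Longrightarrow> h i \<in> carrier M" using h(1) by blast+
  have fc: "f b \<in> carrier M" "\<And>i. i \<in> A \<Longrightarrow> f i \<in> carrier M" using f(2) by blast+
  have kc: "k \<in> carrier M" unfolding k_def by (rule iso_facts(1)[OF g(1) hc(1)])
  have kA: "k \<notin> cl (f i)" "rel M Sp k (f i) \<longleftrightarrow> E c i" if i: "i \<in> A" for i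
  proof -
    have ci: "i \<noteq> c" using i n by blast
    have "h c \<notin> cl (h i)" "E c i \<longleftrightarrow> rel M Sp (h c) (h i)"
      using h(2)[rule_format, of i c] h(2)[rule_format, of c i] i ci by simp_all
    moreover have "g (h i) = f i" using g(2) i by blast
    ultimately show "k \<notin> cl (f i)" "rel M Sp k (f i) \<longleftrightarrow> E c i"
      using iso_cl[OF g(1) hc(2)[OF i] hc(1)] iso_facts(2)[OF g(1) hc(1) hc(2)[OF i], of Sp] by (simp_all add: k_def)
  qed
  have fb: "rel M Sp (f b) (f i) \<longleftrightarrow> E b i" if "i \<in> A" for i
    using f(3)[rule_format, of b i] that n by auto
  have kb: "k \<notin> cl (f b)"
  proof
    assume "k \<in> cl (f b)"
    then consider "k = f b" | "k = mt (f b)" using cl_mt[OF fc(1)] by blast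
    then show False
    proof cases
      case 1
      then have eq: "E c i = E b i" if "i \<in> A" for i using kA(2)[OF that] fb[OF that] by simp
      obtain i where "i \<in> A" "E b i \<noteq> E c i" using tw unfolding untwinned_def by blast
      then show False using eq by simp
    next
      case 2
      have neq: "E c i \<noteq> E b i" if "i \<in> A" for i
      proof -
        have "f i \<notin> cl (f b)" using f(3)[rule_format, of b i] that n by auto
        then show ?thesis using kA(2)[OF that] fb[OF that] S_flip'[OF fc(2)[OF that] fc(1)] 2 by simp
      qed
      obtain i where "i \<in> A" "E b i = E c i" using tw unfolding untwinned_def by blast
      then show False using neq[of i] by simp
    qed
  qed
  define F where "F = f(c := k)"
  have Fc: "F c = k" "\<And>i. i \<in> insert b A \<Longrightarrow> F i = f i" using n by (auto simp: F_def)
  define E' where "E' = (\<lambda>i j. rel M Sp (F i) (F j))"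
  define W where "W = insert b (insert c A)"
  have FC: "F i \<in> carrier M" if "i \<in> W" for i using that Fc f(2) kc unfolding W_def by (cases "i = c") auto
  have kn: "k \<notin> cl (f i)" if "i \<in> insert b A" for i using that kb kA(1) by blast
  have sep: "F j \<notin> cl (F i)" if ij: "i \<in> W" "j \<in> W" "i \<noteq> j" for i j
  proof -
    consider "i \<in> insert b A" "j \<in> insert b A" | "i = c" "j \<in> insert b A" | "i \<in> insert b A" "j = c"
      using ij unfolding W_def by blast
    then show ?thesis
    proof cases
      case 1 then show ?thesis using f(3)[rule_format, OF 1 ij(3)] Fc(2)[OF 1(1)] Fc(2)[OF 1(2)] by simp
    next
      case 2
      have "f j \<notin> cl k" using kn[OF 2(2)] cl_sym[OF kc, of "f j"] by blast
      then show ?thesis using 2 Fc by simp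
    next
      case 3 then show ?thesis using kn Fc by simp
    qed
  qed
  have "agree (insert b A) E E'"
  proof (rule agreeI)
    fix i j assume ij: "i \<in> insert b A" "j \<in> insert b A" "i \<noteq> j"
    show "E i j = E' i j" using f(3)[rule_format, OF ij] Fc(2)[OF ij(1)] Fc(2)[OF ij(2)] by (simp add: E'_def)
  qed
  moreover have "agree (insert c A) E E'"
  proof (rule agreeI)
    fix i j assume ij: "i \<in> insert c A" "j \<in> insert c A" "i \<noteq> j"
    have e: "F i = (if i \<in> A then f i else k)" if "i \<in> insert c A" for i using that Fc by auto
    have FA: "F i = g (h i)" if "i \<in> insert c A" for i
      using that Fc g(2) by (auto simp: k_def)
    have "h i \<in> carrier M" "h j \<in> carrier M" using h(1) ij by blast+
    then have "E' i j \<longleftrightarrow> rel M Sp (h i) (h j)" using iso_facts(2)[OF g(1)] FA ij by (simp add: E'_def)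
    then show "E i j = E' i j" using h(2)[rule_format, OF ij] by simp
  qed
  moreover have "age W E'"
    unfolding age_def
  proof (intro conjI exI[of _ F] ballI impI)
    show "finite W" using f(1) by (simp add: W_def)
    show "symm W E'" by (rule symmI) (use rel_sym FC in \<open>simp add: E'_def\<close>)
  qed (use FC sep in \<open>simp_all add: E'_def\<close>)
  ultimately show ?thesis unfolding W_def by blast
qed

lemma age_switching_class: "switching_class age"
proof (rule switching_class.intro)
  show "finite V" if "age V E" for V E using that by (simp add: age_def)
  show "symm V E" if "age V E" for V E using that by (simp add: age_def)
  show "age W F" if "age V E" "inj_on f W" "f ` W \<subseteq> V"
    "\<And>x y. \<lbrakk>x \<in> W; y \<in> W; x \<noteq> y\<rbrakk> \<Longrightarrow> F x y = (E (f x) (f y) \<noteq> (s x \<noteq> s y))" for V E f W F and s :: "nat \<Rightarrow> bool"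
    by (rule age_embed[where f=f and s=s, OF that(1-3)]) (rule that(4))
  show "\<exists>E'. agree (insert b A) E E' \<and> agree (insert c A) E E' \<and> age (insert b (insert c A)) E'"
    if "age (insert b A) E" "age (insert c A) E" "b \<notin> A" "c \<notin> A" "b \<noteq> c" "untwinned A E b c" for b A E c
    by (rule age_amalg[OF that])
qed

lemma transversal:
  assumes "finite Y" "Y \<subseteq> carrier M"
  shows "\<exists>A\<subseteq>Y. (\<forall>x\<in>A. \<forall>y\<in>A. x \<noteq> y \<longrightarrow> y \<notin> cl x) \<and> card Y \<le> 2 * card A"
proof -
  have "\<exists>A\<subseteq>Y. (\<forall>x\<in>A. \<forall>y\<in>A. x \<noteq> y \<longrightarrow> y \<notin> cl x) \<and> Y \<subseteq> A \<union> mt ` A"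
    using assms
  proof (induction Y)
    case (insert y Y)
    then obtain A where A: "A \<subseteq> Y" "\<forall>x\<in>A. \<forall>y\<in>A. x \<noteq> y \<longrightarrow> y \<notin> cl x" "Y \<subseteq> A \<union> mt ` A" by blast
    show ?case
    proof (cases "\<exists>a\<in>A. y \<in> cl a")
      case True
      then obtain a where a: "a \<in> A" "y \<in> cl a" by blast
      have "a \<in> carrier M" using a(1) A(1) insert.prems by blast
      then have "y \<in> {a, mt a}" using cl_mt a(2) by simp
      then have "y \<in> A \<union> mt ` A" using a(1) by blast
      then show ?thesis using A by (intro exI[of _ A]) blast
    next
      case False
      have yc: "y \<in> carrier M" using insert.prems by simp
      have "z \<notin> cl x" if "x \<in> insert y A" "z \<in> insert y A" "x \<noteq> z" for x z
      proof -
        have c: "x \<in> carrier M" "z \<in> carrier M" using that insert.prems A(1) by auto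
        show ?thesis using that False A(2) cl_sym[OF yc, of z] by blast
      qed
      then show ?thesis using A by (intro exI[of _ "insert y A"]) blast
    qed
  qed auto
  then obtain A where A: "A \<subseteq> Y" "\<forall>x\<in>A. \<forall>y\<in>A. x \<noteq> y \<longrightarrow> y \<notin> cl x" "Y \<subseteq> A \<union> mt ` A" by blast
  have fA: "finite A" using A(1) assms(1) finite_subset by blast
  have "card Y \<le> card (A \<union> mt ` A)" by (rule card_mono) (use fA A(3) in auto)
  also have "\<dots> \<le> card A + card (mt ` A)" by (rule card_Un_le)
  also have "\<dots> \<le> 2 * card A" using card_image_le[OF fA, of mt] by simp
  finally show ?thesis using A by blast
qed

text \<open>
  The points \<open>x i\<close> of a long half graph contain, by Ramsey's theorem, a large set of one
  colour; a point \<open>y j\<close> with \<open>j\<close> in the middle of it splits it into two long parts.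
\<close>
lemma age_mixed:
  "\<exists>c J v E. v \<notin> J \<and> age (insert v J) E \<and> clq c J E \<and> mixed n E v J"
proof -
  define N where "N = Suc n"
  obtain r where r0: "\<forall>(V :: nat set) E. finite V \<and> r \<le> card V \<longrightarrow>
        (\<exists>R\<subseteq>V. card R = 2*N \<and> clique R E \<or> card R = 2*N \<and> indep R E)"
    using ramsey2[of "2*N" "2*N"] by (elim exE conjE)
  define K where "K = 2*r"
  obtain x y :: "nat \<Rightarrow> 'a" where xy: "\<forall>i<2*K. x i \<in> carrier M \<and> y i \<in> carrier M"
       "\<forall>i<2*K. \<forall>j<2*K. (i < j \<longrightarrow> rel M Sp (x i) (y j)) \<and> (j < i \<longrightarrow> rel M Tp (x i) (y j))"
    using half_graphs[of "2*K"] by (elim exE conjE)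
  define X where "X = (\<lambda>i. x (2*i))"
  have Xc: "X i \<in> carrier M" if "i < K" for i using xy(1) that by (simp add: X_def)
  have yc: "y (2*t+1) \<in> carrier M" if "t < K" for t using xy(1) that by simp
  have XS: "rel M Sp (X i) (y (2*t+1))" if "i \<le> t" "t < K" for i t
  proof -
    have "2*i < 2*t+1" "2*i < 2*K" "2*t+1 < 2*K" using that by linarith+
    then show ?thesis using xy(2) unfolding X_def by blast
  qed
  have XT: "rel M Tp (X i) (y (2*t+1))" if "t < i" "i < K" for i t
  proof -
    have "2*t+1 < 2*i" "2*i < 2*K" "2*t+1 < 2*K" using that by linarith+
    then show ?thesis using xy(2) unfolding X_def by blast
  qed
  have ST: "\<not> (rel M Sp (X i) (y (2*t+1)) \<and> rel M Tp (X i) (y (2*t+1)))" if "i < K" "t < K" for i t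
    using rel_T[OF Xc[OF that(1)] yc[OF that(2)]] by blast
  have ne: "X i \<noteq> X j" if "i < j" "j < K" for i j
  proof
    assume e: "X i = X j"
    have "rel M Sp (X i) (y (2*i+1))" by (rule XS) (use that in simp_all)
    moreover have "rel M Tp (X j) (y (2*i+1))" by (rule XT) (use that in simp_all)
    ultimately show False using ST[of j i] e that by simp
  qed
  have inj: "inj_on X {..<K}"
  proof (rule inj_onI)
    fix i j assume "i \<in> {..<K}" "j \<in> {..<K}" "X i = X j"
    then show "i = j" using ne[of i j] ne[of j i] by (cases i j rule: linorder_cases) auto
  qed
  have "finite (X ` {..<K})" "X ` {..<K} \<subseteq> carrier M" using Xc by auto
  from transversal[OF this] obtain A where A: "A \<subseteq> X ` {..<K}" "\<forall>u\<in>A. \<forall>w\<in>A. u \<noteq> w \<longrightarrow> w \<notin> cl u" "card (X ` {..<K}) \<le> 2 * card A"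
    by (elim exE conjE)
  have cA: "r \<le> card A" using A(3) card_image[OF inj] by (simp add: K_def)
  define I where "I = {i. i < K \<and> X i \<in> A}"
  have fI: "finite I" by (simp add: I_def)
  have "X ` I = A" using A(1) by (auto simp: I_def)
  then have cI: "r \<le> card I" using cA card_image_le[OF fI, of X] by simp
  define ES where "ES = {{i, j} |i j. i \<in> I \<and> j \<in> I \<and> rel M Sp (X i) (X j)}"
  obtain R where R: "R \<subseteq> I" "card R = 2*N" "clique R ES \<or> indep R ES" using r0[THEN spec[of _ I], THEN spec[of _ ES]] fI cI by blast
  have IK: "i < K" "X i \<in> A" if "i \<in> I" for i using that by (simp_all add: I_def)
  have RK: "i < K" "X i \<in> A" "i \<in> I" if "i \<in> R" for i using that R(1) IK by blast+
  have ES: "{i, j} \<in> ES \<longleftrightarrow> rel M Sp (X i) (X j)" if "i \<in> R" "j \<in> R" for i j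
  proof -
    have "rel M Sp (X j) (X i) \<longleftrightarrow> rel M Sp (X i) (X j)" by (rule rel_sym[OF Xc Xc]) (use RK that in blast)+
    then show ?thesis using RK(3) that by (auto simp: ES_def doubleton_eq_iff)
  qed
  obtain c where c: "\<And>i j. \<lbrakk>i \<in> R; j \<in> R; i \<noteq> j\<rbrakk> \<Longrightarrow> rel M Sp (X i) (X j) = c"
    using R(3)
  proof
    assume "clique R ES"
    then have "rel M Sp (X i) (X j) = True" if "i \<in> R" "j \<in> R" "i \<noteq> j" for i j
      using that ES unfolding clique_def by blast
    then show ?thesis by (rule that)
  next
    assume "indep R ES"
    then have "rel M Sp (X i) (X j) = False" if "i \<in> R" "j \<in> R" "i \<noteq> j" for i j
      using that ES unfolding indep_def by blast
    then show ?thesis by (rule that)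
  qed
  have fR: "finite R" using R(1) fI finite_subset by blast
  define low where "low = (\<lambda>t. {i\<in>R. i \<le> t})"
  have "low K = R" using RK(1) by (auto simp: low_def intro: less_imp_le)
  then have ex: "\<exists>t. N \<le> card (low t)" using R(2) by (intro exI[of _ K]) simp
  \<comment> \<open>The position that cuts the set \<open>R\<close> into two parts of about equal size.\<close>
  define t where "t = (LEAST t. N \<le> card (low t))"
  have t: "N \<le> card (low t)" unfolding t_def by (rule LeastI_ex[OF ex])
  have tl: "\<not> N \<le> card (low s)" if "s < t" for s using not_less_Least that unfolding t_def by blast
  have before: "card {i\<in>R. i < t} < N"
  proof (cases t)
    case 0 then show ?thesis by (simp add: N_def)
  next
    case (Suc s)
    then have "{i\<in>R. i < t} = low s" by (auto simp: low_def)
    then show ?thesis using tl[of s] Suc by simp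
  qed
  have tR: "t \<in> R"
  proof (rule ccontr)
    assume "t \<notin> R"
    then have "low t = {i\<in>R. i < t}" by (auto simp: low_def order.order_iff_strict)
    then show False using before t by simp
  qed
  have "low t = insert t {i\<in>R. i < t}" using tR by (auto simp: low_def)
  then have lt: "card (low t) \<le> N" using before card_insert_le_m1 fR by (simp add: card_insert_if)
  define up where "up = {i\<in>R. t < i}"
  have "R = low t \<union> up" "low t \<inter> up = {}" by (auto simp: low_def up_def)
  then have "card R = card (low t) + card up" using fR by (metis card_Un_disjoint finite_Un)
  then have cu: "N \<le> card up" using lt R(2) by simp
  define f where "f = (\<lambda>i. if i = K then y (2*t+1) else X i)"
  define E where "E = (\<lambda>i j. rel M Sp (f i) (f j))"
  have tK: "t < K" by (rule RK(1)[OF tR])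
  have KR: "K \<notin> R" using RK(1) by blast
  have f: "f K = y (2*t+1)" "\<And>i. i \<in> R \<Longrightarrow> f i = X i" using KR by (auto simp: f_def)
  have fc: "f i \<in> carrier M" if "i \<in> insert K R" for i using that f yc[OF tK] Xc RK(1) by auto
  have yn: "y (2*t+1) \<notin> cl (X i)" if i: "i \<in> R" for i
  proof
    assume m: "y (2*t+1) \<in> cl (X i)"
    have iK: "i < K" by (rule RK(1)[OF i])
    have "\<not> rel M p (X i) (y (2*t+1))" if "p \<noteq> Rp" for p
      by (rule in_cl_not[OF Xc[OF iK] cl_self[OF Xc[OF iK]] m that])
    then show False using XS[of i t] XT[of t i] tK iK by (cases "i \<le> t") auto
  qed
  have sep: "f j \<notin> cl (f i)" if ij: "i \<in> insert K R" "j \<in> insert K R" "i \<noteq> j" for i j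
  proof -
    consider "i = K" "j \<in> R" | "i \<in> R" "j = K" | "i \<in> R" "j \<in> R" using ij by blast
    then show ?thesis
    proof cases
      case 1
      then have "X j \<notin> cl (y (2*t+1))" using yn[OF 1(2)] cl_sym[OF yc[OF tK]] by blast
      then show ?thesis using 1 f by simp
    next
      case 2 then show ?thesis using yn f by simp
    next
      case 3
      then have "X i \<noteq> X j" using inj RK(1) ij(3) by (auto dest: inj_onD)
      then show ?thesis using 3 f A(2) RK(2) by simp
    qed
  qed
  have "age (insert K R) E"
    unfolding age_def
  proof (intro conjI exI[of _ f] ballI impI)
    show "finite (insert K R)" using fR by simp
    show "symm (insert K R) E" by (rule symmI) (use rel_sym fc in \<open>simp add: E_def\<close>)
  qed (use fc sep in \<open>simp_all add: E_def\<close>)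
  moreover have "clq c R E" by (rule clqI) (use c f in \<open>simp add: E_def\<close>)
  moreover have "mixed N E K R"
  proof (rule mixedI[OF fR, of "low t" up N _ _ True])
    show "low t \<subseteq> R" "up \<subseteq> R" by (auto simp: low_def up_def)
    have s: "E K i \<longleftrightarrow> rel M Sp (X i) (y (2*t+1))" if "i \<in> R" for i
      using that f rel_sym[OF yc[OF tK] Xc[OF RK(1)[OF that]]] by (simp add: E_def)
    show "E K i = True" if "i \<in> low t" for i using s[of i] XS[of i t] tK that by (simp add: low_def)
    show "E K i = (\<not> True)" if "i \<in> up" for i
      using s[of i] XT[of t i] ST[of i t] tK RK(1)[of i] that by (simp add: up_def)
  qed (use t cu in simp_all)
  then have "mixed n E K R" by (rule mixed_mono) (simp add: N_def)
  ultimately show ?thesis using KR by blast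
qed

lemma age_stars: "\<exists>c. \<forall>v E. star age c {v} E"
proof -
  interpret switching_class age by (rule age_switching_class)
  define Q where "Q = (\<lambda>c n. \<exists>J v E. v \<notin> J \<and> age (insert v J) E \<and> clq c J E \<and> mixed n E v J)"
  have Qmono: "Q c m" if "Q c n" "m \<le> n" for c m n using that mixed_mono unfolding Q_def by blast
  have Qex: "\<exists>c. Q c n" for n using age_mixed unfolding Q_def by blast
  have "\<exists>c. \<forall>n. Q c n"
  proof (rule ccontr)
    assume "\<not> ?thesis"
    then obtain n1 n2 where n: "\<not> Q True n1" "\<not> Q False n2" by blast
    obtain c where c: "Q c (max n1 n2)" using Qex by blast
    have "Q c n1" "Q c n2" using Qmono[OF c] by simp_all
    then show False using n by (cases c) simp_all
  qed
  then obtain c where c: "\<And>n. Q c n" by blast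
  have "star age c {v} E" for v E by (rule stars_if_mixed) (rule c[unfolded Q_def])
  then show ?thesis by blast
qed

text \<open>
  The extension property asks for a finite graph with one extra vertex; this graph is in the age,
  and homogeneity moves its copy onto the given points.
\<close>
theorem is_random_cover: "random_cover M"
proof -
  have ext: "\<exists>z\<in>carrier M. \<forall>a\<in>A. z \<noteq> a \<and> \<not> rel M Rp z a \<and> (rel M Sp z a \<longleftrightarrow> \<epsilon> a)"
    if A: "finite A" "A \<subseteq> carrier M" "\<forall>x\<in>A. \<forall>y\<in>A. \<not> rel M Rp x y" for A \<epsilon>
  proof -
    obtain f where f: "bij_betw f {..<card A} A" using ex_bij_betw_nat_finite[OF A(1)] by (auto simp: atLeast0LessThan)
    define n where "n = card A"
    have fA: "f i \<in> A" if "i < n" for i using f that unfolding n_def by (auto simp: bij_betw_def)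
    have finj: "f i = f j \<longleftrightarrow> i = j" if "i < n" "j < n" for i j using f that unfolding n_def by (auto simp: bij_betw_def dest: inj_onD)
    define E where "E = (\<lambda>i j. if i = n \<and> j = n then False else if i = n then \<epsilon> (f j) else if j = n then \<epsilon> (f i) else rel M Sp (f i) (f j))"
    have "symm {..n} E"
    proof (rule symmI)
      fix i j assume "i \<in> {..n}" "j \<in> {..n}"
      then have "rel M Sp (f i) (f j) = rel M Sp (f j) (f i)" if "i \<noteq> n" "j \<noteq> n"
        using rel_sym fA A(2) that by (metis atMost_iff le_neq_implies_less subsetD)
      then show "E i j = E j i" by (auto simp: E_def)
    qed
    then have "age {..n} E" by (intro switching_class_universal[OF age_switching_class age_stars]) simp_all
    then obtain h where h: "\<forall>i\<in>{..n}. h i \<in> carrier M"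
      "\<forall>i\<in>{..n}. \<forall>j\<in>{..n}. i \<noteq> j \<longrightarrow> h j \<notin> cl (h i) \<and> (E i j \<longleftrightarrow> rel M Sp (h i) (h j))" unfolding age_def by blast
    have ST: "cross_preds Sp Tp" by (simp add: cross_preds_def)
    have hc: "h i \<in> carrier M" if "i \<le> n" for i using h(1) that by simp
    have fc: "f i \<in> carrier M" if "i < n" for i using fA A(2) that by blast
    have "same_type M h M f {..<n}" unfolding same_type_kind
    proof (intro ballI)
      fix i j assume "i \<in> {..<n}" "j \<in> {..<n}"
      then have ij: "i < n" "j < n" by simp_all
      have cc: "h i \<in> carrier M" "h j \<in> carrier M" "f i \<in> carrier M" "f j \<in> carrier M" using hc fc ij by simp_all
      show "kind M (h i) (h j) = kind M (f i) (f j)"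
      proof (cases "i = j")
        case True then show ?thesis using irrefl cc by (simp add: kind_def)
      next
        case False
        have "f j \<noteq> f i" "\<not> rel M Rp (f i) (f j)" using finj[OF ij] False A(3) fA ij by auto
        then have "f j \<notin> cl (f i)" by (simp add: cl_def)
        moreover have "h j \<notin> cl (h i)" "E i j \<longleftrightarrow> rel M Sp (h i) (h j)" using h(2)[rule_format, of i j] ij False by simp_all
        moreover have "E i j \<longleftrightarrow> rel M Sp (f i) (f j)" using ij by (simp add: E_def)
        ultimately show ?thesis by (intro kind_cross[OF ST cc]) simp_all
      qed
    qed
    moreover have "h ` {..<n} \<subseteq> carrier M" "f ` {..<n} \<subseteq> carrier M"
      using hc fc unfolding image_subset_iff by simp_all
    ultimately obtain g where g: "iso g M M" "\<forall>i\<in>{..<n}. g (h i) = f i"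
      using homogeneous_extend[OF hom, of "{..<n}" h f] by blast
    define z where "z = g (h n)"
    have zc: "z \<in> carrier M" unfolding z_def by (rule iso_facts(1)[OF g(1) hc]) simp
    have "z \<noteq> a \<and> \<not> rel M Rp z a \<and> (rel M Sp z a \<longleftrightarrow> \<epsilon> a)" if "a \<in> A" for a
    proof -
      have "a \<in> f ` {..<n}" using f that unfolding n_def by (simp add: bij_betw_def)
      then obtain i where i: "i < n" "a = f i" by blast
      have gi: "g (h i) = a" using g(2) i by simp
      have c: "h n \<in> carrier M" "h i \<in> carrier M" using hc i(1) by simp_all
      have hh: "h i \<notin> cl (h n)" "E n i \<longleftrightarrow> rel M Sp (h n) (h i)" using h(2)[rule_format, of n i] i(1) by simp_all
      have "E n i \<longleftrightarrow> \<epsilon> a" using i by (simp add: E_def)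
      moreover have "a \<notin> cl z" using iso_cl[OF g(1) c] hh(1) gi by (simp add: z_def)
      moreover have "rel M Sp z a \<longleftrightarrow> rel M Sp (h n) (h i)" using iso_facts(2)[OF g(1) c, of Sp] gi by (simp add: z_def)
      moreover have "a \<in> carrier M" using that A(2) by blast
      ultimately show ?thesis using hh(2) by (auto simp: cl_def)
    qed
    then show ?thesis using zc by blast
  qed
  have sm: "rel M Sp x y \<longleftrightarrow> \<not> rel M Sp x z"
    if c: "x \<in> carrier M" "y \<in> carrier M" "z \<in> carrier M" and r: "rel M Rp y z" "x \<noteq> y" "x \<noteq> z" for x y z
  proof -
    have "z = mt y" by (rule mate_unique[OF c(2,3) mt(1)[OF c(2)] r(1) mt(2)[OF c(2)]])
    moreover from this have "x \<notin> cl y" using cl_mt[OF c(2)] r by simp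
    ultimately show ?thesis using S_flip[OF c(1,2)] by simp
  qed
  show ?thesis unfolding random_cover_def
  proof (intro conjI ballI allI impI)
    show "three_graph M" by (rule tg)
    show "\<exists>y\<in>carrier M. rel M Rp x y" if "x \<in> carrier M" for x by (rule mate[OF that])
    show "y = z" if "x \<in> carrier M" "y \<in> carrier M" "z \<in> carrier M" "rel M Rp x y \<and> rel M Rp x z" for x y z
      by (rule mate_unique[OF that(1-3)]) (use that(4) in simp_all)
    show "rel M Sp x y \<longleftrightarrow> \<not> rel M Sp x z"
      if "x \<in> carrier M" "y \<in> carrier M" "z \<in> carrier M" "rel M Rp y z \<and> x \<noteq> y \<and> x \<noteq> z" for x y z
      by (rule sm[OF that(1-3)]) (use that(4) in simp_all)
    show "\<exists>z\<in>carrier M. \<forall>a\<in>A. z \<noteq> a \<and> \<not> rel M Rp z a \<and> (rel M Sp z a \<longleftrightarrow> \<epsilon> a)"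
      if "finite A \<and> A \<subseteq> carrier M \<and> (\<forall>x\<in>A. \<forall>y\<in>A. \<not> rel M Rp x y)" for A \<epsilon>
      by (rule ext) (use that in simp_all)
  qed
qed

end

section \<open>Random covers do not have the tree property\<close>

context random_cover_struc begin

definition close :: "'a \<Rightarrow> 'a \<Rightarrow> bool" where
  "close x y \<longleftrightarrow> x = y \<or> rel M Rp x y"

lemma close_sym: "\<lbrakk>x \<in> carrier M; y \<in> carrier M; close x y\<rbrakk> \<Longrightarrow> close y x"
  using rel_sym unfolding close_def by blast

lemma close_trans:
  assumes "x \<in> carrier M" "y \<in> carrier M" "z \<in> carrier M" "close x y" "close y z"
  shows "close x z"
proof (cases "x = y \<or> y = z")
  case False
  then have "rel M Rp y x" "rel M Rp y z" using assms rel_sym[OF assms(1,2)] by (auto simp: close_def)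
  then have "x = z" using mate_unique assms(1-3) by blast
  then show ?thesis by (simp add: close_def)
qed (use assms in \<open>auto simp: close_def\<close>)

lemma finite_close:
  assumes "v \<in> carrier M"
  shows "finite {y \<in> carrier M. close v y}"
proof -
  obtain w where w: "w \<in> carrier M" "rel M Rp v w" using mate_ex assms by blast
  have "{y \<in> carrier M. close v y} \<subseteq> {v, w}" using mate_unique[OF assms _ w(1) _ w(2)] by (auto simp: close_def)
  then show ?thesis using finite_subset by blast
qed

lemma close_kind: "kind M x y = kind M x' y' \<Longrightarrow> close x y \<longleftrightarrow> close x' y'"
  unfolding close_def kind_def by simp

text \<open>
  The rows \<open>d i\<close> for \<open>i \<in> Z\<close> are constant at the positions in \<open>P\<close>; at any other position below \<open>m\<close> no
  pair of mates is met infinitely often.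
\<close>
definition sunflower :: "(nat \<Rightarrow> nat \<Rightarrow> 'a) \<Rightarrow> nat \<Rightarrow> nat set \<Rightarrow> nat set \<Rightarrow> bool" where
  "sunflower d m Z P \<longleftrightarrow> infinite Z \<and>
     (\<forall>r\<in>P. \<forall>i\<in>Z. \<forall>i'\<in>Z. d i r = d i' r) \<and>
     (\<forall>r<m. r \<notin> P \<longrightarrow> (\<forall>v\<in>carrier M. finite {i \<in> Z. close v (d i r)}))"

lemma sunflower_infinite: "sunflower d m Z P \<Longrightarrow> infinite Z"
  unfolding sunflower_def by (elim conjE)

lemma sunflower_kernel:
  assumes "sunflower d m Z P" "r \<in> P" "i \<in> Z" "i' \<in> Z"
  shows "d i r = d i' r"
proof -
  have "\<forall>r\<in>P. \<forall>i\<in>Z. \<forall>i'\<in>Z. d i r = d i' r" using assms(1) unfolding sunflower_def by (elim conjE)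
  from this[THEN bspec[OF _ assms(2)], THEN bspec[OF _ assms(3)], THEN bspec[OF _ assms(4)]] show ?thesis .
qed

lemma sunflower_finite:
  assumes "sunflower d m Z P" "r < m" "r \<notin> P" "v \<in> carrier M"
  shows "finite {i \<in> Z. close v (d i r)}"
proof -
  have "\<forall>r<m. r \<notin> P \<longrightarrow> (\<forall>v\<in>carrier M. finite {i \<in> Z. close v (d i r)})"
    using assms(1) unfolding sunflower_def by (elim conjE)
  from this[rule_format, OF assms(2-4)] show ?thesis .
qed

lemma sunflowerI:
  assumes "infinite Z" "\<And>r i i'. \<lbrakk>r \<in> P; i \<in> Z; i' \<in> Z\<rbrakk> \<Longrightarrow> d i r = d i' r"
    "\<And>r v. \<lbrakk>r < m; r \<notin> P; v \<in> carrier M\<rbrakk> \<Longrightarrow> finite {i \<in> Z. close v (d i r)}"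
  shows "sunflower d m Z P"
  unfolding sunflower_def by (intro conjI allI impI ballI) (rule assms; assumption)+

lemma sunflower_subset:
  assumes sf: "sunflower d m Z P" and "infinite Z'" "Z' \<subseteq> Z"
  shows "sunflower d m Z' P"
proof (rule sunflowerI[OF assms(2)])
  show "d i r = d i' r" if "r \<in> P" "i \<in> Z'" "i' \<in> Z'" for r i i'
    by (rule sunflower_kernel[OF sf that(1)]) (use that assms(3) in blast)+
  show "finite {i \<in> Z'. close v (d i r)}" if "r < m" "r \<notin> P" "v \<in> carrier M" for r v
    by (rule finite_subset[OF _ sunflower_finite[OF sf that]]) (use assms(3) in blast)
qed

text \<open>
  Position by position: either each pair is met finitely often, or some pair is met
  infinitely often, and then one of its two points is.
\<close>
lemma sunflower_ex:
  assumes "\<And>i r. r < m \<Longrightarrow> d i r \<in> carrier M"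
  shows "\<exists>Z P. sunflower d m Z P"
  using assms
proof (induction m)
  case 0
  have "sunflower d 0 UNIV {}" by (simp add: sunflower_def)
  then show ?case by blast
next
  case (Suc m)
  have "\<exists>Z P. sunflower d m Z P" by (rule Suc.IH) (simp add: Suc.prems)
  then obtain Z P where Z: "sunflower d m Z P" by (elim exE)
  show ?case
  proof (cases "\<forall>v\<in>carrier M. finite {i \<in> Z. close v (d i m)}")
    case True
    have "sunflower d (Suc m) Z P"
    proof (rule sunflowerI[OF sunflower_infinite[OF Z]])
      show "d i r = d i' r" if "r \<in> P" "i \<in> Z" "i' \<in> Z" for r i i' by (rule sunflower_kernel[OF Z that])
      show "finite {i \<in> Z. close v (d i r)}" if r: "r < Suc m" "r \<notin> P" "v \<in> carrier M" for r v
      proof (cases "r = m")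
        case rm: True
        show ?thesis using bspec[OF True r(3)] unfolding rm .
      next
        case False
        then have "r < m" using r(1) by simp
        then show ?thesis by (rule sunflower_finite[OF Z _ r(2,3)])
      qed
    qed
    then show ?thesis by blast
  next
    case False
    then obtain v where v: "v \<in> carrier M" "infinite {i \<in> Z. close v (d i m)}" by blast
    have "finite ((\<lambda>i. d i m) ` {i \<in> Z. close v (d i m)})"
      by (rule finite_subset[OF _ finite_close[OF v(1)]]) (use Suc.prems in auto)
    then obtain i0 where i0: "infinite {i \<in> {i \<in> Z. close v (d i m)}. d i m = d i0 m}"
      using pigeonhole_infinite[OF v(2), of "\<lambda>i. d i m"] by blast
    define Z' where "Z' = {i \<in> {i \<in> Z. close v (d i m)}. d i m = d i0 m}"
    have "Z' \<subseteq> Z" by (auto simp: Z'_def)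
    then have Z': "sunflower d m Z' P" using sunflower_subset[OF Z] i0 unfolding Z'_def by blast
    have "sunflower d (Suc m) Z' (insert m P)"
    proof (rule sunflowerI[OF sunflower_infinite[OF Z']])
      show "d i r = d i' r" if h: "r \<in> insert m P" "i \<in> Z'" "i' \<in> Z'" for r i i'
      proof (cases "r = m")
        case True
        have "d i m = d i0 m" "d i' m = d i0 m" using h(2,3) unfolding Z'_def by simp_all
        then show ?thesis using True by simp
      next
        case False
        then have "r \<in> P" using h(1) by simp
        then show ?thesis by (rule sunflower_kernel[OF Z' _ h(2,3)])
      qed
      show "finite {i \<in> Z'. close v (d i r)}" if r: "r < Suc m" "r \<notin> insert m P" "v \<in> carrier M" for r v
        by (rule sunflower_finite[OF Z' _ _ r(3)]) (use r in auto)
    qed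
    then show ?thesis by blast
  qed
qed

definition uniform :: "(nat \<Rightarrow> nat \<Rightarrow> 'a) \<Rightarrow> nat \<Rightarrow> nat set \<Rightarrow> bool" where
  "uniform d m Z \<longleftrightarrow> (\<forall>i\<in>Z. \<forall>i'\<in>Z. \<forall>r<m. \<forall>s<m. kind M (d i r) (d i s) = kind M (d i' r) (d i' s))"

lemma uniformD: "\<lbrakk>uniform d m Z; i \<in> Z; i' \<in> Z; r < m; s < m\<rbrakk> \<Longrightarrow> kind M (d i r) (d i s) = kind M (d i' r) (d i' s)"
  unfolding uniform_def by blast

lemma uniform_sunflower_ex:
  assumes "\<And>i r. r < m \<Longrightarrow> d i r \<in> carrier M"
  shows "\<exists>Z P. sunflower d m Z P \<and> uniform d m Z"
proof -
  obtain Z P where Z: "sunflower d m Z P" using sunflower_ex assms by blast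
  define TT where "TT = (\<lambda>i. map (\<lambda>r. map (\<lambda>s. kind M (d i r) (d i s)) [0..<m]) [0..<m])"
  define SS where "SS = {xs :: (bool \<times> bool \<times> bool \<times> bool) list. length xs = m}"
  have "finite SS" using finite_lists_length_eq[of "UNIV :: (bool \<times> bool \<times> bool \<times> bool) set"] by (simp add: SS_def)
  then have "finite {xs. set xs \<subseteq> SS \<and> length xs = m}" by (rule finite_lists_length_eq)
  then have "finite (TT ` Z)" by (rule rev_finite_subset) (auto simp: TT_def SS_def)
  then obtain i0 where i0: "infinite {i \<in> Z. TT i = TT i0}"
    using pigeonhole_infinite[OF sunflower_infinite[OF Z], of TT] by blast
  define Z' where "Z' = {i \<in> Z. TT i = TT i0}"
  have sub: "Z' \<subseteq> Z" by (auto simp: Z'_def)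
  then have "sunflower d m Z' P" using sunflower_subset[OF Z] i0 unfolding Z'_def by blast
  moreover have "uniform d m Z'" unfolding uniform_def
  proof (intro ballI allI impI)
    fix i i' r s assume "i \<in> Z'" "i' \<in> Z'" and rs: "r < m" "s < m"
    then have "TT i = TT i'" by (simp add: Z'_def)
    then have "TT i ! r ! s = TT i' ! r ! s" by simp
    then show "kind M (d i r) (d i s) = kind M (d i' r) (d i' s)" using rs by (simp add: TT_def)
  qed
  ultimately show ?thesis by blast
qed

text \<open>
  In a uniform sunflower a constant point that is once close to a varying one is so in every row.
\<close>
lemma kernel_far:
  assumes "sunflower d m Z P" "uniform d m Z" "\<And>i r. r < m \<Longrightarrow> d i r \<in> carrier M"
    "r \<in> P" "r < m" "s < m" "s \<notin> P" "i \<in> Z"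
  shows "\<not> close (d i r) (d i s)"
proof
  assume c: "close (d i r) (d i s)"
  have "close (d i r) (d i' s)" if i': "i' \<in> Z" for i'
  proof -
    have "kind M (d i r) (d i s) = kind M (d i' r) (d i' s)"
      by (rule uniformD[OF assms(2)]) (use assms(5,6,8) i' in simp_all)
    then have "close (d i r) (d i s) \<longleftrightarrow> close (d i' r) (d i' s)" by (rule close_kind)
    moreover have "d i r = d i' r" by (rule sunflower_kernel[OF assms(1,4,8) i'])
    ultimately show ?thesis using c by simp
  qed
  then have "Z = {i' \<in> Z. close (d i r) (d i' s)}" by auto
  moreover have "finite {i' \<in> Z. close (d i r) (d i' s)}"
    by (rule sunflower_finite[OF assms(1,6,7)]) (rule assms(3)[OF assms(5)])
  ultimately show False using sunflower_infinite[OF assms(1)] by simp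
qed

lemma avoid:
  assumes "sunflower d m Z P" "finite F" "F \<subseteq> carrier M"
  shows "infinite {i \<in> Z. \<forall>r<m. r \<notin> P \<longrightarrow> (\<forall>v\<in>F. \<not> close v (d i r))}"
proof
  define B where "B = (\<Union>r\<in>{..<m} - P. \<Union>v\<in>F. {i \<in> Z. close v (d i r)})"
  assume "finite {i \<in> Z. \<forall>r<m. r \<notin> P \<longrightarrow> (\<forall>v\<in>F. \<not> close v (d i r))}"
  moreover have "finite B" unfolding B_def
  proof (intro finite_UN_I)
    fix r v assume h: "r \<in> {..<m} - P" "v \<in> F"
    have "r < m" "r \<notin> P" "v \<in> carrier M" using h assms(3) by auto
    then show "finite {i \<in> Z. close v (d i r)}" by (rule sunflower_finite[OF assms(1)])
  qed (use assms(2) in simp_all)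
  moreover have "Z \<subseteq> {i \<in> Z. \<forall>r<m. r \<notin> P \<longrightarrow> (\<forall>v\<in>F. \<not> close v (d i r))} \<union> B"
    unfolding B_def by auto
  ultimately have "finite Z" by (meson finite_UnI finite_subset)
  then show False using sunflower_infinite[OF assms(1)] by simp
qed

text \<open>
  Rows are chosen one after the other, each away from the finitely many points used before.
\<close>
lemma far_petals:
  assumes sf: "sunflower d m Z P" and un: "uniform d m Z" and dc: "\<And>i r. r < m \<Longrightarrow> d i r \<in> carrier M"
  shows "\<exists>I\<subseteq>Z. finite I \<and> card I = k \<and>
    (\<forall>i\<in>I. \<forall>i'\<in>I. i \<noteq> i' \<longrightarrow> (\<forall>r<m. \<forall>s<m. r \<notin> P \<longrightarrow> \<not> close (d i r) (d i' s)))"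
proof (induction k)
  case 0
  show ?case by (rule exI[of _ "{}"]) simp
next
  case (Suc k)
  then obtain I where I: "I \<subseteq> Z" "finite I" "card I = k"
    "\<And>i i' r s. \<lbrakk>i \<in> I; i' \<in> I; i \<noteq> i'; r < m; s < m; r \<notin> P\<rbrakk> \<Longrightarrow> \<not> close (d i r) (d i' s)" by blast
  define F where "F = (\<Union>i\<in>I. (\<lambda>s. d i s) ` {..<m})"
  have F: "finite F" "F \<subseteq> carrier M" using I(2) dc by (auto simp: F_def)
  have "infinite ({i \<in> Z. \<forall>r<m. r \<notin> P \<longrightarrow> (\<forall>v\<in>F. \<not> close v (d i r))} - I)"
    using avoid[OF sf F] I(2) by simp
  then obtain j where j0: "j \<in> {i \<in> Z. \<forall>r<m. r \<notin> P \<longrightarrow> (\<forall>v\<in>F. \<not> close v (d i r))} - I"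
    using infinite_imp_nonempty by blast
  then have j: "j \<in> Z" "j \<notin> I" "\<And>r v. \<lbrakk>r < m; r \<notin> P; v \<in> F\<rbrakk> \<Longrightarrow> \<not> close v (d j r)" by auto
  have dF: "d i s \<in> F" if "i \<in> I" "s < m" for i s using that by (auto simp: F_def)
  have 1: "\<not> close (d j r) (d i s)" if "i \<in> I" "r < m" "s < m" "r \<notin> P" for i r s
    using j(3)[OF that(2,4) dF[OF that(1,3)]] close_sym dc that by blast
  have 2: "\<not> close (d i r) (d j s)" if h: "i \<in> I" "r < m" "s < m" "r \<notin> P" for i r s
  proof (cases "s \<in> P")
    case True
    have iZ: "i \<in> Z" using I(1) h(1) by blast
    have "d j s = d i s" by (rule sunflower_kernel[OF sf True j(1) iZ])
    moreover have "\<not> close (d i s) (d i r)" by (rule kernel_far[OF sf un dc True h(3,2,4) iZ])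
    ultimately show ?thesis using close_sym dc h(2,3) by metis
  next
    case False
    then show ?thesis using j(3)[OF h(3) _ dF[OF h(1,2)]] by blast
  qed
  have "\<not> close (d i r) (d i' s)" if "i \<in> insert j I" "i' \<in> insert j I" "i \<noteq> i'" "r < m" "s < m" "r \<notin> P" for i i' r s
    using that(1,2) that(3) I(4)[of i i' r s] 1[of i' r s] 2[of i r s] that(4-6) by auto
  moreover have "card (insert j I) = Suc k" "insert j I \<subseteq> Z" "finite (insert j I)" using I(1-3) j(1,2) by auto
  ultimately show ?case by blast
qed

text \<open>
  The tuple \<open>a\<close>, given in its relation to the row \<open>i0\<close>, is copied coordinate by coordinate so that the
  copy has this relation to every row in \<open>I\<close> at once.  The conditions from different rows are
  compatible, because points of different rows are close only at constant positions.
\<close>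
lemma copy_tuple:
  fixes n :: nat
  assumes sf: "sunflower d m Z P" and un: "uniform d m Z" and dc: "\<And>i r. r < m \<Longrightarrow> d i r \<in> carrier M"
    and i0: "i0 \<in> Z" and I: "I \<subseteq> Z" "finite I"
    and far: "\<And>i i' r s. \<lbrakk>i \<in> I; i' \<in> I; i \<noteq> i'; r < m; s < m; r \<notin> P\<rbrakk> \<Longrightarrow> \<not> close (d i r) (d i' s)"
    and a: "\<And>u. u < n \<Longrightarrow> a u \<in> carrier M"
    and new: "\<And>u r. \<lbrakk>u < n; r < m; r \<notin> P\<rbrakk> \<Longrightarrow> \<not> close (a u) (d i0 r)"
  shows "\<exists>b. (\<forall>u<n. b u \<in> carrier M) \<and> (\<forall>u<n. \<forall>v<n. kind M (a u) (a v) = kind M (b u) (b v)) \<and>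
    (\<forall>u<n. \<forall>i\<in>I. \<forall>r<m. kind M (a u) (d i0 r) = kind M (b u) (d i r))"
  using a new
proof (induction n)
  case (Suc n)
  have an: "a n \<in> carrier M" and ac: "\<And>u. u < n \<Longrightarrow> a u \<in> carrier M" using Suc.prems(1) by simp_all
  have "\<exists>b. (\<forall>u<n. b u \<in> carrier M) \<and> (\<forall>u<n. \<forall>v<n. kind M (a u) (a v) = kind M (b u) (b v)) \<and>
    (\<forall>u<n. \<forall>i\<in>I. \<forall>r<m. kind M (a u) (d i0 r) = kind M (b u) (d i r))"
    by (rule Suc.IH) (simp_all add: Suc.prems)
  then obtain b where b: "\<And>u. u < n \<Longrightarrow> b u \<in> carrier M" "\<And>u v. \<lbrakk>u < n; v < n\<rbrakk> \<Longrightarrow> kind M (a u) (a v) = kind M (b u) (b v)"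
    "\<And>u i r. \<lbrakk>u < n; i \<in> I; r < m\<rbrakk> \<Longrightarrow> kind M (a u) (d i0 r) = kind M (b u) (d i r)" by blast
  have b': "kind M (d i0 r) (a u) = kind M (d i r) (b u)" if "u < n" "i \<in> I" "r < m" for u i r
    by (rule kind_sym[OF tg tg ac[OF that(1)] dc[OF that(3)] b(1)[OF that(1)] dc[OF that(3)] b(3)[OF that]])
  have dd: "kind M (d i0 r) (d i0 s) = kind M (d i r) (d i s)" if "i \<in> I" "r < m" "s < m" for i r s
    by (rule uniformD[OF un i0 _ that(2,3)]) (use that I in blast)
  have con: "d i r = d i' r" if "r \<in> P" "i \<in> Z" "i' \<in> Z" for r i i'
    by (rule sunflower_kernel[OF sf that])
  define p where "p = (\<lambda>u. (a u, b u)) ` {..<n} \<union> (\<lambda>(i, r). (d i0 r, d i r)) ` (I \<times> {..<m})"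
  have pE: "(\<exists>u<n. x = a u \<and> y = b u) \<or> (\<exists>i\<in>I. \<exists>r<m. x = d i0 r \<and> y = d i r)" if "(x, y) \<in> p" for x y
    using that unfolding p_def by auto
  have ppd: "(d i r = d i' s \<longrightarrow> d i0 r = d i0 s) \<and> (rel M Rp (d i r) (d i' s) \<longrightarrow> rel M Rp (d i0 r) (d i0 s))"
    if h: "i \<in> I" "i' \<in> I" "r < m" "s < m" for i i' r s
  proof (cases "i = i'")
    case True
    then show ?thesis using kind_eqD[OF dd[OF h(1,3,4)]] by simp
  next
    case False
    have Z: "i \<in> Z" "i' \<in> Z" using h I by auto
    show ?thesis
    proof (cases "r \<in> P \<and> s \<in> P")
      case True
      then have "d i r = d i0 r" "d i' s = d i0 s" using con Z i0 by blast+
      then show ?thesis by simp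
    next
      case nP: False
      have "\<not> close (d i r) (d i' s)"
        using nP far[OF h(1,2) False h(3,4)] far[OF h(2,1) False[symmetric] h(4,3)] close_sym dc h(3,4) by blast
      then show ?thesis unfolding close_def by blast
    qed
  qed
  have "\<exists>z\<in>carrier M. \<forall>(x, y)\<in>p. kind M (a n) x = kind M z y"
  proof (rule relation_step[OF cover cover])
    show "finite p" using I(2) by (simp add: p_def)
    show "p \<subseteq> carrier M \<times> carrier M" using ac b(1) dc by (auto simp: p_def)
    show "a n \<in> carrier M" by (rule an)
    show "(y = y' \<longrightarrow> x = x') \<and> (rel M Rp y y' \<longrightarrow> rel M Rp x x')" if h: "(x, y) \<in> p" "(x', y') \<in> p" for x y x' y'
    proof -
      consider u v where "u < n" "v < n" "x = a u" "y = b u" "x' = a v" "y' = b v"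
        | u i r where "u < n" "i \<in> I" "r < m" "x = a u" "y = b u" "x' = d i0 r" "y' = d i r"
        | u i r where "u < n" "i \<in> I" "r < m" "x' = a u" "y' = b u" "x = d i0 r" "y = d i r"
        | i r i' s where "i \<in> I" "i' \<in> I" "r < m" "s < m" "x = d i0 r" "y = d i r" "x' = d i0 s" "y' = d i' s"
        using pE[OF h(1)] pE[OF h(2)] by (elim disjE exE conjE bexE)
      then show ?thesis
      proof cases
        case 1 then show ?thesis using kind_eqD[OF b(2)[OF 1(1,2)]] by simp
      next
        case 2 then show ?thesis using kind_eqD[OF b(3)[OF 2(1-3)]] by simp
      next
        case 3 then show ?thesis using kind_eqD[OF b'[OF 3(1-3)]] by simp
      next
        case 4 then show ?thesis using ppd[OF 4(1-4)] by simp
      qed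
    qed
    show "(\<forall>(x, y)\<in>p. x \<noteq> a n \<and> \<not> rel M Rp (a n) x) \<or>
      (\<exists>(x0, y0)\<in>p. (a n = x0 \<or> rel M Rp (a n) x0) \<and> (\<forall>(x, y)\<in>p. kind M x0 x = kind M y0 y))"
    proof (cases "\<exists>(x, y)\<in>p. close (a n) x")
      case False
      then show ?thesis unfolding close_def by fast
    next
      case True
      then obtain x0 y0 where x0: "(x0, y0) \<in> p" "close (a n) x0" by blast
      have "kind M x0 x = kind M y0 y" if xy: "(x, y) \<in> p" for x y
      proof -
        consider u where "u < n" "x0 = a u" "y0 = b u" | i r where "i \<in> I" "r < m" "x0 = d i0 r" "y0 = d i r"
          using pE[OF x0(1)] by blast
        then show ?thesis
        proof cases
          case 1
          then show ?thesis using pE[OF xy] b(2,3) by auto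
        next
          case 2
          have rP: "r \<in> P" using Suc.prems(2)[of n r] x0(2) 2 by auto
          have "kind M (d i0 r) (d i0 s) = kind M (d i r) (d i' s)" if h: "i' \<in> I" "s < m" for i' s
          proof -
            have "d i r = d i' r" by (rule con[OF rP]) (use 2(1) h(1) I(1) in auto)
            then show ?thesis using dd[OF h(1) 2(2) h(2)] by simp
          qed
          then show ?thesis using pE[OF xy] b'[OF _ 2(1,2)] 2(3,4) by auto
        qed
      qed
      then show ?thesis using x0 unfolding close_def by blast
    qed
  qed
  then obtain z where z: "z \<in> carrier M" "\<And>x y. (x, y) \<in> p \<Longrightarrow> kind M (a n) x = kind M z y" by blast
  have z1: "kind M (a n) (a u) = kind M z (b u)" if "u < n" for u
    by (rule z(2)) (use that in \<open>simp add: p_def\<close>)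
  have z2: "kind M (a n) (d i0 r) = kind M z (d i r)" if "i \<in> I" "r < m" for i r
    by (rule z(2)) (use that in \<open>auto simp: p_def\<close>)
  have z3: "kind M (a u) (a n) = kind M (b u) z" if "u < n" for u
    by (rule kind_sym[OF tg tg an ac[OF that] z(1) b(1)[OF that] z1[OF that]])
  have z4: "kind M (a n) (a n) = kind M z z" by (rule kind_refl[OF tg tg an z(1)])
  show ?case
    by (rule exI[of _ "b(n := z)"]) (use z(1) z1 z2 z3 z4 b in \<open>simp add: less_Suc_eq\<close>)
qed simp

text \<open>
  A solution of a branch that avoids the varying coordinates on some level is copied to a common
  solution of \<open>k\<close> siblings on that level.
\<close>
theorem no_tree_property:
  assumes qe: "\<And>e d. \<lbrakk>e ` {..<n+m} \<subseteq> carrier M; d ` {..<n+m} \<subseteq> carrier M; same_type M e M d {..<n+m}\<rbrakk>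
      \<Longrightarrow> sat M e \<phi> \<longleftrightarrow> sat M d \<phi>"
  shows "\<not> tree_property M \<phi> n m"
proof (unfold tree_property_def, intro notI, elim exE conjE)
  fix k :: nat and c :: "nat list \<Rightarrow> 'a list"
  assume kc: "\<forall>s. c s \<in> tuples M m"
    "\<forall>s I. finite I \<and> card I = k \<longrightarrow> \<not> (\<exists>a\<in>tuples M n. \<forall>i\<in>I. holds M \<phi> a (c (s @ [i])))"
    "\<forall>\<sigma> l. \<exists>a\<in>tuples M n. \<forall>j\<in>{1..l}. holds M \<phi> a (c (map \<sigma> [0..<j]))"
  have c: "c s \<in> tuples M m" for s by (rule kc(1)[rule_format])
  have inc: "\<not> (\<exists>a\<in>tuples M n. \<forall>i\<in>I. holds M \<phi> a (c (s @ [i])))" if "finite I" "card I = k" for s I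
    by (rule mp[OF kc(2)[THEN spec[of _ s], THEN spec[of _ I]] conjI[OF that]])
  have con: "\<exists>a\<in>tuples M n. \<forall>j\<in>{1..l}. holds M \<phi> a (c (map \<sigma> [0..<j]))" for \<sigma> l
    using kc(3)[THEN spec[of _ \<sigma>], THEN spec[of _ l]] .
  define d where "d = (\<lambda>s (i :: nat) r. c (s @ [i]) ! r)"
  have lc: "length (c s) = m" "set (c s) \<subseteq> carrier M" for s using c[of s] by (auto simp: tuples_def)
  have dset: "d s i r \<in> set (c (s @ [i]))" if "r < m" for s i r unfolding d_def by (rule nth_mem) (use that lc in simp)
  then have dc: "d s i r \<in> carrier M" if "r < m" for s i r using that lc(2) by blast
  have "\<forall>s. \<exists>ZP. sunflower (d s) m (fst ZP) (snd ZP) \<and> uniform (d s) m (fst ZP)"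
  proof
    fix s
    obtain Z P where "sunflower (d s) m Z P" "uniform (d s) m Z" using uniform_sunflower_ex[of m "d s"] dc by blast
    then show "\<exists>ZP. sunflower (d s) m (fst ZP) (snd ZP) \<and> uniform (d s) m (fst ZP)" by (intro exI[of _ "(Z, P)"]) simp
  qed
  then obtain ZP where ZP: "\<And>s. sunflower (d s) m (fst (ZP s)) (snd (ZP s))" "\<And>s. uniform (d s) m (fst (ZP s))"
    using choice[of "\<lambda>s zp. sunflower (d s) m (fst zp) (snd zp) \<and> uniform (d s) m (fst zp)"] by blast
  define Z where "Z = (\<lambda>s. fst (ZP s))"
  define P where "P = (\<lambda>s. snd (ZP s))"
  have sf: "sunflower (d s) m (Z s) (P s)" and un: "uniform (d s) m (Z s)" for s using ZP by (simp_all add: Z_def P_def)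
  \<comment> \<open>The parameters met on the way to the node \<open>s\<close>.\<close>
  define F where "F = (\<lambda>s. \<Union>j\<in>{..length s}. set (c (take j s)))"
  have F: "finite (F s)" "F s \<subseteq> carrier M" for s using lc(2) by (auto simp: F_def)
  define G where "G = (\<lambda>s. {i \<in> Z s. \<forall>r<m. r \<notin> P s \<longrightarrow> (\<forall>v\<in>F s. \<not> close v (d s i r))})"
  define nxt where "nxt = (\<lambda>s. SOME i. i \<in> G s)"
  have nG: "nxt s \<in> G s" for s
  proof -
    have "G s \<noteq> {}" unfolding G_def by (rule infinite_imp_nonempty[OF avoid[OF sf F]])
    then show ?thesis unfolding nxt_def by (rule some_in_eq[THEN iffD2])
  qed
  have nxt: "nxt s \<in> Z s" "\<lbrakk>r < m; r \<notin> P s; v \<in> F s\<rbrakk> \<Longrightarrow> \<not> close v (d s (nxt s) r)" for s r v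
    using nG[of s] unfolding G_def by simp_all
  define p where "p = rec_nat [] (\<lambda>_ q. q @ [nxt q])"
  have p0: "p 0 = []" and pS: "p (Suc j) = p j @ [nxt (p j)]" for j by (simp_all add: p_def)
  have pmap: "map (\<lambda>j. nxt (p j)) [0..<j] = p j" for j by (induction j) (simp_all add: p0 pS)
  have lp: "length (p j) = j" for j using arg_cong[OF pmap[of j], of length] by simp
  have ptake: "take j (p l) = p j" if "j \<le> l" for j l
  proof -
    have "take j (map (\<lambda>j. nxt (p j)) [0..<l]) = map (\<lambda>j. nxt (p j)) [0..<j]" using that by (simp add: take_map)
    then show ?thesis unfolding pmap .
  qed
  have "\<exists>a\<in>tuples M n. \<forall>j\<in>{1..Suc n}. holds M \<phi> a (c (p j))"
    using con[where \<sigma> = "\<lambda>j. nxt (p j)" and l = "Suc n"] unfolding pmap .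
  then obtain a where a: "a \<in> tuples M n" "\<And>j. j \<in> {1..Suc n} \<Longrightarrow> holds M \<phi> a (c (p j))" by blast
  have la: "length a = n" "set a \<subseteq> carrier M" using a(1) by (auto simp: tuples_def)
  have ac: "a ! u \<in> carrier M" if "u < n" for u using that la nth_mem by blast
  \<comment> \<open>There are \<open>n + 1\<close> levels, and a coordinate of \<open>a\<close> is close to new parameters on at most one of them: new parameters of a later level are not close to those of an earlier one.\<close>
  have "\<exists>j\<le>n. \<forall>u<n. \<forall>r<m. r \<notin> P (p j) \<longrightarrow> \<not> close (a ! u) (d (p j) (nxt (p j)) r)"
  proof (rule ccontr)
    assume "\<not> ?thesis"
    then have "\<forall>j\<in>{..n}. \<exists>u. u < n \<and> (\<exists>r<m. r \<notin> P (p j) \<and> close (a ! u) (d (p j) (nxt (p j)) r))" by auto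
    from bchoice[OF this] obtain h where
      h: "\<forall>j\<in>{..n}. h j < n \<and> (\<exists>r<m. r \<notin> P (p j) \<and> close (a ! h j) (d (p j) (nxt (p j)) r))" by (elim exE)
    have "h ` {..n} \<subseteq> {..<n}" using h by auto
    then have "card (h ` {..n}) \<le> n" using card_mono[of "{..<n}"] by fastforce
    then have "\<not> inj_on h {..n}" using pigeonhole[of h "{..n}"] by simp
    then obtain j j' where jj: "j \<le> n" "j' \<le> n" "h j = h j'" "j < j'"
      unfolding inj_on_def by (metis atMost_iff linorder_neqE_nat)
    obtain r where r: "r < m" "close (a ! h j) (d (p j) (nxt (p j)) r)" using bspec[OF h, of j] jj(1) by auto
    obtain r' where r': "r' < m" "r' \<notin> P (p j')" "close (a ! h j) (d (p j') (nxt (p j')) r')" using bspec[OF h, of j'] jj(2,3) by auto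
    have hn: "h j < n" using h jj(1) by simp
    have cl: "close (d (p j) (nxt (p j)) r) (d (p j') (nxt (p j')) r')"
      by (rule close_trans[OF dc[OF r(1)] ac[OF hn] dc[OF r'(1)] close_sym[OF ac[OF hn] dc[OF r(1)] r(2)] r'(3)])
    have "d (p j) (nxt (p j)) r \<in> set (c (take (Suc j) (p j')))"
      using dset[OF r(1)] ptake[of "Suc j" j'] jj(4) by (simp add: pS)
    then have "d (p j) (nxt (p j)) r \<in> F (p j')" using jj(4) unfolding F_def lp by (intro UN_I[of "Suc j"]) auto
    then show False using nxt(2)[OF r'(1,2)] cl by blast
  qed
  then obtain j where j: "j \<le> n" "\<And>u r. \<lbrakk>u < n; r < m; r \<notin> P (p j)\<rbrakk> \<Longrightarrow> \<not> close (a ! u) (d (p j) (nxt (p j)) r)" by blast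
  define s where "s = p j"
  define i0 where "i0 = nxt s"
  have ha: "holds M \<phi> a (c (s @ [i0]))" using a(2)[of "Suc j"] j(1) by (simp add: pS s_def i0_def)
  have i0: "i0 \<in> Z s" by (simp add: i0_def nxt(1))
  have "\<exists>I\<subseteq>Z s. finite I \<and> card I = k \<and>
    (\<forall>i\<in>I. \<forall>i'\<in>I. i \<noteq> i' \<longrightarrow> (\<forall>r<m. \<forall>t<m. r \<notin> P s \<longrightarrow> \<not> close (d s i r) (d s i' t)))"
    by (rule far_petals[OF sf un dc])
  then obtain I where I: "I \<subseteq> Z s" "finite I" "card I = k"
    "\<And>i i' r t. \<lbrakk>i \<in> I; i' \<in> I; i \<noteq> i'; r < m; t < m; r \<notin> P s\<rbrakk> \<Longrightarrow> \<not> close (d s i r) (d s i' t)" by blast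
  have "\<exists>b. (\<forall>u<n. b u \<in> carrier M) \<and> (\<forall>u<n. \<forall>v<n. kind M (a ! u) (a ! v) = kind M (b u) (b v)) \<and>
    (\<forall>u<n. \<forall>i\<in>I. \<forall>r<m. kind M (a ! u) (d s i0 r) = kind M (b u) (d s i r))"
    by (rule copy_tuple[OF sf un dc i0 I(1,2,4) ac]) (use j(2) in \<open>simp_all add: s_def i0_def\<close>)
  then obtain b where b: "\<And>u. u < n \<Longrightarrow> b u \<in> carrier M" "\<And>u v. \<lbrakk>u < n; v < n\<rbrakk> \<Longrightarrow> kind M (a ! u) (a ! v) = kind M (b u) (b v)"
    "\<And>u i r. \<lbrakk>u < n; i \<in> I; r < m\<rbrakk> \<Longrightarrow> kind M (a ! u) (d s i0 r) = kind M (b u) (d s i r)" by blast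
  have b': "kind M (d s i0 r) (a ! u) = kind M (d s i r) (b u)" if "u < n" "i \<in> I" "r < m" for u i r
    by (rule kind_sym[OF tg tg ac[OF that(1)] dc[OF that(3)] b(1)[OF that(1)] dc[OF that(3)] b(3)[OF that]])
  define B where "B = map b [0..<n]"
  have B: "B \<in> tuples M n" "length B = n" using b(1) by (auto simp: B_def tuples_def)
  have "holds M \<phi> B (c (s @ [i]))" if i: "i \<in> I" for i
  proof -
    have e1: "(a @ c (s @ [i0])) ! q = (if q < n then a ! q else d s i0 (q - n))" for q
      using la(1) by (simp add: nth_append d_def)
    have e2: "(B @ c (s @ [i])) ! q = (if q < n then b q else d s i (q - n))" for q
      using B(2) by (simp add: nth_append d_def B_def)
    have dd: "kind M (d s i0 r) (d s i0 t) = kind M (d s i r) (d s i t)" if "r < m" "t < m" for r t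
      by (rule uniformD[OF un i0 _ that]) (use i I(1) in blast)
    have "sat M (\<lambda>q. (a @ c (s @ [i0])) ! q) \<phi> \<longleftrightarrow> sat M (\<lambda>q. (B @ c (s @ [i])) ! q) \<phi>"
    proof (rule qe)
      show "(\<lambda>q. (a @ c (s @ [i0])) ! q) ` {..<n+m} \<subseteq> carrier M"
        unfolding e1 using ac dc by auto
      show "(\<lambda>q. (B @ c (s @ [i])) ! q) ` {..<n+m} \<subseteq> carrier M"
        unfolding e2 using b(1) dc by auto
      show "same_type M (\<lambda>q. (a @ c (s @ [i0])) ! q) M (\<lambda>q. (B @ c (s @ [i])) ! q) {..<n+m}"
        unfolding same_type_kind e1 e2 using b(2) b(3)[OF _ i] b'[OF _ i] dd by auto
    qed
    then show ?thesis using ha unfolding holds_def by blast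
  qed
  then show False using inc[OF I(2,3)] B(1) by blast
qed

end

section \<open>Models of the theory, instability, and the hypotheses on classes\<close>

text \<open>
  All clauses concern finitely many points, and the existential ones transfer because extensions
  of finite types do.
\<close>
lemma model_random_cover:
  assumes M: "random_cover M" "countable (carrier M)" and N: "model_of N (theory_of M)"
  shows "random_cover N"
proof -
  interpret M: random_cover_struc M by unfold_locales (rule M)
  interpret theory_model M N
    by unfold_locales (use random_cover_homogeneous[OF M] M.nonempty N in auto)
  have three: "\<exists>x'\<in>carrier M. \<exists>y'\<in>carrier M. \<exists>z'\<in>carrier M. kind N x x = kind M x' x' \<and> kind N x y = kind M x' y' \<and>
      kind N y x = kind M y' x' \<and> kind N x z = kind M x' z' \<and> kind N y z = kind M y' z'"
    if c: "x \<in> carrier N" "y \<in> carrier N" "z \<in> carrier N" for x y z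
  proof -
    define e where "e = (\<lambda>i::nat. if i = 0 then x else if i = 1 then y else z)"
    have "e ` {0, 1, 2} \<subseteq> carrier N" using c by (simp add: e_def)
    then obtain e' where e': "e' ` {0, 1, 2} \<subseteq> carrier M" "same_type N e M e' {0, 1, 2}"
      using realise_in_M[of "{0, 1, 2}" e] by auto
    show ?thesis
      by (rule bexI[of _ "e' 0"], rule bexI[of _ "e' 1"], rule bexI[of _ "e' 2"])
        (use e' in \<open>simp_all add: same_type_kind e_def\<close>)
  qed
  have tgN: "three_graph N" unfolding three_graph_def
  proof (intro conjI allI ballI impI)
    fix p x assume x: "x \<in> carrier N"
    obtain x' where "x' \<in> carrier M" "kind N x x = kind M x' x'" using three[OF x x x] by blast
    then show "\<not> rel N p x x" using kind_eqD(2)[of N x x M x' x' p] M.irrefl by blast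
  next
    fix p x y assume x: "x \<in> carrier N" "y \<in> carrier N" "rel N p x y"
    obtain x' y' where "x' \<in> carrier M" "y' \<in> carrier M" "kind N x y = kind M x' y'" "kind N y x = kind M y' x'"
      using three[OF x(1,2,2)] by blast
    then show "rel N p y x"
      using kind_eqD(2)[of N x y M x' y' p] kind_eqD(2)[of N y x M y' x' p] M.rel_sym[of x' y' p] x(3) by blast
  next
    fix x y assume x: "x \<in> carrier N" "y \<in> carrier N" "x \<noteq> y"
    obtain x' y' where c: "x' \<in> carrier M" "y' \<in> carrier M" "kind N x y = kind M x' y'"
      using three[OF x(1,2,2)] by blast
    have "x' \<noteq> y'" using kind_eqD(1)[OF c(3)] x(3) by simp
    then have "\<exists>!p. rel M p x' y'" using M.tg c unfolding three_graph_def by blast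
    then show "\<exists>!p. rel N p x y" using kind_eqD(2)[OF c(3)] by simp
  qed
  interpret N: three_graph_struc N by unfold_locales (rule tgN)
  have mate: "\<exists>y\<in>carrier N. rel N Rp x y" if x: "x \<in> carrier N" for x
  proof -
    obtain e' where e': "e' ` {0} \<subseteq> carrier M" "same_type N (\<lambda>_. x) M e' {0}"
      using realise_in_M[of "{0}" "\<lambda>_. x"] x by auto
    obtain y where y: "y \<in> carrier M" "rel M Rp (e' 0) y" using M.mate_ex e'(1) by blast
    obtain z where z: "z \<in> carrier N" "same_type N ((\<lambda>_. x)(1 := z)) M (e'(1 := y)) (insert 1 {0})"
      using extend_in_N[OF _ _ e' y(1), of 1] x by auto
    have "kind N x z = kind M (e' 0) y" using z(2) unfolding same_type_kind by simp
    then show ?thesis using z(1) y(2) kind_eqD(2)[of N x z M "e' 0" y Rp] by blast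
  qed
  have uniq: "y = z" if c: "x \<in> carrier N" "y \<in> carrier N" "z \<in> carrier N" "rel N Rp x y \<and> rel N Rp x z" for x y z
  proof -
    obtain x' y' z' where k: "x' \<in> carrier M" "y' \<in> carrier M" "z' \<in> carrier M" "kind N x y = kind M x' y'"
      "kind N x z = kind M x' z'" "kind N y z = kind M y' z'"
      using three[OF c(1-3)] by blast
    show ?thesis
      using kind_eqD(2)[OF k(4), of Rp] kind_eqD(2)[OF k(5), of Rp] kind_eqD(1)[OF k(6)] M.mate_unique[OF k(1-3)] c(4) by simp
  qed
  have Smate: "rel N Sp x y \<longleftrightarrow> \<not> rel N Sp x z"
    if c: "x \<in> carrier N" "y \<in> carrier N" "z \<in> carrier N" "rel N Rp y z \<and> x \<noteq> y \<and> x \<noteq> z" for x y z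
  proof -
    obtain x' y' z' where k: "x' \<in> carrier M" "y' \<in> carrier M" "z' \<in> carrier M" "kind N x y = kind M x' y'"
      "kind N x z = kind M x' z'" "kind N y z = kind M y' z'"
      using three[OF c(1-3)] by blast
    show ?thesis
      using kind_eqD(1)[OF k(4)] kind_eqD(1)[OF k(5)] kind_eqD(2)[OF k(4), of Sp] kind_eqD(2)[OF k(5), of Sp] kind_eqD(2)[OF k(6), of Rp] M.S_mate[OF k(1-3)] c(4) by simp
  qed
  have ext: "\<exists>z\<in>carrier N. \<forall>a\<in>A. z \<noteq> a \<and> \<not> rel N Rp z a \<and> (rel N Sp z a \<longleftrightarrow> \<epsilon> a)"
    if A: "finite A" "A \<subseteq> carrier N" "\<forall>x\<in>A. \<forall>y\<in>A. \<not> rel N Rp x y" for A \<epsilon>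
  proof -
    obtain f and n :: nat where f: "A = f ` {i. i < n}" "inj_on f {i. i < n}"
      using finite_imp_nat_seg_image_inj_on[OF A(1)] by blast
    have fc: "f ` {i. i < n} \<subseteq> carrier N" using A(2) f(1) by blast
    obtain e where e: "e ` {i. i < n} \<subseteq> carrier M" "same_type N f M e {i. i < n}"
      using realise_in_M[OF _ fc] by auto
    have ke: "kind N (f i) (f j) = kind M (e i) (e j)" if "i < n" "j < n" for i j
      using e(2) that unfolding same_type_kind by simp
    \<comment> \<open>The pattern on \<open>A\<close> carried over to its copy in \<open>M\<close>.\<close>
    define \<delta> where "\<delta> = (\<lambda>a. \<exists>i<n. e i = a \<and> \<epsilon> (f i))"
    have \<delta>: "\<delta> (e i) \<longleftrightarrow> \<epsilon> (f i)" if i: "i < n" for i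
    proof -
      have "j = i" if "j < n" "e j = e i" for j
        using kind_eqD(1)[OF ke[OF that(1) i]] that inj_onD[OF f(2), of j i] i by simp
      then show ?thesis unfolding \<delta>_def using i by blast
    qed
    have "\<not> rel M Rp x y" if "x \<in> e ` {i. i < n}" "y \<in> e ` {i. i < n}" for x y
    proof -
      obtain i j where ij: "i < n" "j < n" "x = e i" "y = e j" using \<open>x \<in> _\<close> \<open>y \<in> _\<close> by auto
      then show ?thesis using kind_eqD(2)[OF ke[OF ij(1,2)], of Rp] A(3) f(1) by auto
    qed
    then obtain y where y: "y \<in> carrier M" "\<forall>a\<in>e ` {i. i < n}. y \<noteq> a \<and> \<not> rel M Rp y a \<and> (rel M Sp y a \<longleftrightarrow> \<delta> a)"
      using M.extension[OF _ e(1), of \<delta>] by auto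
    obtain z where z: "z \<in> carrier N" "same_type N (f(n := z)) M (e(n := y)) (insert n {i. i < n})"
      using extend_in_N[OF _ fc e y(1), of n] by auto
    have "z \<noteq> f i \<and> \<not> rel N Rp z (f i) \<and> (rel N Sp z (f i) \<longleftrightarrow> \<epsilon> (f i))" if i: "i < n" for i
    proof -
      have k: "kind N z (f i) = kind M y (e i)" using z(2) i unfolding same_type_kind by simp
      have "y \<noteq> e i \<and> \<not> rel M Rp y (e i) \<and> (rel M Sp y (e i) \<longleftrightarrow> \<delta> (e i))" using y(2) i by simp
      then show ?thesis using kind_eqD[OF k] \<delta>[OF i] by simp
    qed
    then show ?thesis using z(1) f(1) by blast
  qed
  show ?thesis unfolding random_cover_def
    by (intro conjI ballI allI impI)
      ((rule tgN) | (rule mate, assumption) | (rule uniq, assumption+) | (rule Smate, assumption+)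
        | (elim conjE, rule ext, assumption+))+
qed

lemma sat_iso:
  assumes "iso g M N" "range e \<subseteq> carrier M"
  shows "sat N (\<lambda>i. g (e i)) \<phi> \<longleftrightarrow> sat M e \<phi>"
  using assms(2)
proof (induction \<phi> arbitrary: e)
  case (Eq i j)
  have "inj_on g (carrier M)" using assms(1) by (simp add: iso_def bij_betw_def)
  then show ?case using Eq by (simp add: inj_on_eq_iff image_subset_iff)
next
  case (Atom p i j)
  then show ?case using assms(1) by (simp add: iso_def image_subset_iff)
next
  case (Ex i \<phi>)
  have surj: "g ` carrier M = carrier N" using assms(1) by (simp add: iso_def bij_betw_def)
  have "sat N ((\<lambda>j. g (e j))(i := g x)) \<phi> \<longleftrightarrow> sat M (e(i := x)) \<phi>" if "x \<in> carrier M" for x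
  proof -
    have "(\<lambda>j. g (e j))(i := g x) = (\<lambda>j. g ((e(i := x)) j))" by auto
    moreover have "range (e(i := x)) \<subseteq> carrier M" using Ex.prems that by auto
    ultimately show ?thesis using Ex.IH[of "e(i := x)"] by (simp only:)
  qed
  then show ?case unfolding sat.simps surj[symmetric] by blast
qed simp_all

lemma model_of_iso:
  assumes g: "iso g M N" and ne: "carrier M \<noteq> {}"
  shows "model_of N (theory_of M)"
proof -
  have surj: "g ` carrier M = carrier N" using g by (simp add: iso_def bij_betw_def)
  have "sat N e \<phi>" if \<phi>: "\<phi> \<in> theory_of M" and e: "range e \<subseteq> carrier N" for \<phi> e
  proof -
    define d where "d = (\<lambda>i. inv_into (carrier M) g (e i))"
    have "e i \<in> g ` carrier M" for i using e surj by auto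
    then have d: "\<forall>i. d i \<in> carrier M \<and> g (d i) = e i"
      unfolding d_def by (simp add: inv_into_into f_inv_into_f)
    then have rd: "range d \<subseteq> carrier M" unfolding image_subset_iff by simp
    have "true_in M \<phi>" using \<phi> by (simp add: theory_of_def)
    then have "sat M d \<phi>" using rd unfolding true_in_def by simp
    moreover have "e = (\<lambda>i. g (d i))" using d by (intro ext) simp
    ultimately show ?thesis using sat_iso[OF g rd, of \<phi>] by simp
  qed
  then show ?thesis using ne surj unfolding model_of_def true_in_def by blast
qed

context random_cover_struc begin

text \<open>
  A sequence is built in which every term is chosen over all earlier ones; its even terms form \<open>x\<close>
  and its odd terms \<open>y\<close>.
\<close>
lemma infinite_half_graph:
  "\<exists>x y :: nat \<Rightarrow> 'a. range x \<subseteq> carrier M \<and> range y \<subseteq> carrier M \<and> (\<forall>i j. rel M Sp (x i) (y j) \<longleftrightarrow> i < j)"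
proof -
  define P where "P = (\<lambda>(f :: nat \<Rightarrow> 'a) k r. r \<in> carrier M \<and>
    (\<forall>l<k. r \<noteq> f l \<and> \<not> rel M Rp r (f l) \<and> (rel M Sp r (f l) \<longleftrightarrow> odd k \<and> l div 2 < k div 2)))"
  have "\<exists>f. \<forall>k. P f k (f k)"
  proof (rule dependent_wellorder_choice)
    show "P f k r = P g k r" if "\<And>l. l < k \<Longrightarrow> f l = g l" for r f g k
      using that by (simp add: P_def)
    show "\<exists>r. P f k r" if prev: "\<And>l. l < k \<Longrightarrow> P f l (f l)" for k f
    proof -
      have c: "f l \<in> carrier M" if "l < k" for l using prev[OF that] by (simp add: P_def)
      have lt: "f l \<noteq> f l' \<and> \<not> rel M Rp (f l) (f l')" if "l' < l" "l < k" for l l'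
        using prev[OF that(2)] that(1) by (simp add: P_def)
      have ne: "f l \<noteq> f l' \<and> \<not> rel M Rp (f l) (f l')" if "l \<noteq> l'" "l < k" "l' < k" for l l'
        using that lt[of l' l] lt[of l l'] rel_sym[OF c[OF that(2)] c[OF that(3)]] by (cases "l' < l") auto
      have noR: "\<not> rel M Rp u v" if uv: "u \<in> f ` {..<k}" "v \<in> f ` {..<k}" for u v
      proof -
        obtain l where l: "l < k" "u = f l" using uv(1) by auto
        obtain l' where l': "l' < k" "v = f l'" using uv(2) by auto
        show ?thesis using ne[of l l'] irrefl[OF c[OF l(1)]] l l' by (cases "l = l'") auto
      qed
      define \<epsilon> where "\<epsilon> = (\<lambda>u. \<exists>l<k. f l = u \<and> odd k \<and> l div 2 < k div 2)"
      have \<epsilon>: "\<epsilon> (f l) \<longleftrightarrow> odd k \<and> l div 2 < k div 2" if l: "l < k" for l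
      proof -
        have "l' = l" if "l' < k" "f l' = f l" for l' using ne[of l' l] that l by auto
        then show ?thesis unfolding \<epsilon>_def using l by blast
      qed
      have "f ` {..<k} \<subseteq> carrier M" using c by auto
      from extension[OF _ this noR, of \<epsilon>] obtain r where r: "r \<in> carrier M"
        "\<forall>a\<in>f ` {..<k}. r \<noteq> a \<and> \<not> rel M Rp r a \<and> (rel M Sp r a \<longleftrightarrow> \<epsilon> a)" by auto
      have "P f k r" unfolding P_def using r \<epsilon> by auto
      then show ?thesis by blast
    qed
  qed
  then obtain f where f: "\<And>k. P f k (f k)" by blast
  have c: "f k \<in> carrier M" for k using f[of k] by (simp add: P_def)
  have S: "rel M Sp (f k) (f l) \<longleftrightarrow> odd k \<and> l div 2 < k div 2" if "l < k" for k l
    using f[of k] that by (simp add: P_def)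
  have "rel M Sp (f (2 * i)) (f (2 * j + 1)) \<longleftrightarrow> i < j" for i j
  proof (cases "i \<le> j")
    case True
    then have "rel M Sp (f (2 * j + 1)) (f (2 * i)) \<longleftrightarrow> i < j" using S[of "2 * i" "2 * j + 1"] by simp
    then show ?thesis using rel_sym[OF c c] by blast
  next
    case False
    then show ?thesis using S[of "2 * j + 1" "2 * i"] by simp
  qed
  then show ?thesis
    by (intro exI[of _ "\<lambda>i. f (2 * i)"] exI[of _ "\<lambda>j. f (2 * j + 1)"]) (use c in auto)
qed

text \<open>
  The half graph lives in \<open>M\<close>, and a copy of \<open>M\<close> with elements in \<open>'u\<close> is a model of its theory.
\<close>
lemma unstable:
  assumes "countable (carrier M)"
  shows "\<not> stable_theory TYPE('u::infinite) (theory_of M)"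
proof -
  obtain h :: "nat \<Rightarrow> 'u" where h: "inj h"
    using infinite_countable_subset[of "UNIV :: 'u set"] infinite_UNIV by blast
  define g where "g = (\<lambda>x. h (to_nat_on (carrier M) x))"
  have gi: "inj_on g (carrier M)"
    unfolding g_def using inj_on_to_nat_on[OF assms] h by (auto simp: inj_on_def)
  define N where "N = \<lparr>carrier = g ` carrier M,
    rel = (\<lambda>p u v. rel M p (inv_into (carrier M) g u) (inv_into (carrier M) g v))\<rparr>"
  have g: "iso g M N" using gi by (simp add: iso_def N_def inj_on_imp_bij_betw)
  have mo: "model_of N (theory_of M)" by (rule model_of_iso[OF g nonempty])
  obtain x y :: "nat \<Rightarrow> 'a" where xy: "\<And>i. x i \<in> carrier M" "\<And>i. y i \<in> carrier M"
    "\<And>i j. rel M Sp (x i) (y j) \<longleftrightarrow> i < j" using infinite_half_graph by (auto simp: image_subset_iff)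
  have "order_property N (Atom Sp 0 1) 1 1" unfolding order_property_def
  proof (intro exI conjI allI)
    show "[g (x i)] \<in> tuples N 1" "[g (y i)] \<in> tuples N 1" for i using xy by (simp_all add: tuples_def N_def)
    show "holds N (Atom Sp 0 1) [g (x i)] [g (y j)] \<longleftrightarrow> i < j" for i j
      using g xy by (simp add: holds_def iso_def)
  qed
  moreover have "partitioned (Atom Sp 0 1) 1 1" by (auto simp: partitioned_def)
  ultimately show ?thesis using mo unfolding stable_theory_def by blast
qed

lemma R_class:
  assumes "x \<in> carrier M"
  obtains x' where "x' \<in> carrier M" "rel M Rp x x'" "R_refl M `` {x} = {x, x'}"
proof -
  obtain x' where x': "x' \<in> carrier M" "rel M Rp x x'" using mate_ex assms by blast
  have "y = x'" if "y \<in> carrier M" "rel M Rp x y" for y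
    by (rule mate_unique[OF assms that(1) x'(1) that(2) x'(2)])
  then have "R_refl M `` {x} \<subseteq> {x, x'}" by (auto simp: R_refl_def)
  moreover have "{x, x'} \<subseteq> R_refl M `` {x}" using x' assms by (simp add: R_refl_def)
  ultimately have "R_refl M `` {x} = {x, x'}" by (rule subset_antisym)
  then show ?thesis by (rule that[OF x'])
qed

lemma equiv_R_refl: "equiv (carrier M) (R_refl M)"
proof (rule equivI)
  show "R_refl M \<subseteq> carrier M \<times> carrier M" by (auto simp: R_refl_def)
  show "refl_on (carrier M) (R_refl M)" by (auto simp: R_refl_def refl_on_def)
  show "sym (R_refl M)" using rel_sym unfolding R_refl_def sym_def by auto
  show "trans (R_refl M)"
  proof (rule transI)
    fix x y z assume h: "(x, y) \<in> R_refl M" "(y, z) \<in> R_refl M"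
    then have c: "x \<in> carrier M" "y \<in> carrier M" "z \<in> carrier M" by (auto simp: R_refl_def)
    show "(x, z) \<in> R_refl M"
    proof (cases "x = y \<or> y = z")
      case False
      then have "rel M Rp y x" "rel M Rp y z" using h rel_sym[OF c(1,2)] by (auto simp: R_refl_def)
      then have "x = z" by (rule mate_unique[OF c(2,1,3)])
      then show ?thesis using c by (simp add: R_refl_def)
    qed (use h in auto)
  qed
qed

lemma two_classes:
  assumes X: "X \<in> carrier M // R_refl M" and Y: "Y \<in> carrier M // R_refl M" and ne: "X \<noteq> Y"
  shows "realised_in M p (X \<union> Y)"
proof -
  obtain x y where x: "x \<in> carrier M" "X = R_refl M `` {x}" and y: "y \<in> carrier M" "Y = R_refl M `` {y}"
    using X Y by (auto elim!: quotientE)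
  obtain x' where x': "x' \<in> carrier M" "rel M Rp x x'" "R_refl M `` {x} = {x, x'}" using R_class[OF x(1)] by blast
  obtain y' where y': "y' \<in> carrier M" "rel M Rp y y'" "R_refl M `` {y} = {y, y'}" using R_class[OF y(1)] by blast
  have mem: "x \<in> X \<union> Y" "x' \<in> X \<union> Y" "y \<in> X \<union> Y" "y' \<in> X \<union> Y" using x y x' y' by auto
  have "(x, y) \<notin> R_refl M" using eq_equiv_class_iff[OF equiv_R_refl x(1) y(1)] ne x y by blast
  then have n: "x \<noteq> y" "\<not> rel M Rp x y" using x(1) y(1) by (auto simp: R_refl_def)
  have n': "x \<noteq> y'" using n y'(2) rel_sym[OF y(1) y'(1)] rel_sym[OF x(1) y(1)] by blast
  have nR: "\<not> rel M Rp x y'" using mate_unique[OF y'(1) x(1) y(1)] n(1) y'(2) rel_sym[OF y(1) y'(1)] rel_sym[OF x(1) y'(1)] by blast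
  have "rel M Sp x y \<longleftrightarrow> \<not> rel M Sp x y'" by (rule S_mate[OF x(1) y(1) y'(1,2) n(1) n'])
  then have "rel M Sp x y \<and> rel M Tp x y' \<or> rel M Sp x y' \<and> rel M Tp x y"
    using rel_T[OF x(1) y(1)] rel_T[OF x(1) y'(1)] n n' nR by blast
  then show ?thesis unfolding realised_in_def using mem x'(2) by (cases p) blast+
qed

lemma two_points: "\<exists>x\<in>carrier M. \<exists>y\<in>carrier M. x \<noteq> y \<and> \<not> rel M Rp x y"
proof -
  obtain x where x: "x \<in> carrier M" using nonempty by blast
  obtain z where "z \<in> carrier M" "\<forall>a\<in>{x}. z \<noteq> a \<and> \<not> rel M Rp z a \<and> (rel M Sp z a \<longleftrightarrow> True)"
    using extension[of "{x}" "\<lambda>_. True"] x irrefl by auto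
  then show ?thesis using x by auto
qed

lemma three_graph_properties:
  "(\<forall>p. realised_in M p (carrier M)) \<and> nontrivial_proper_equiv (carrier M) (R_refl M) \<and>
   (\<forall>X \<in> carrier M // R_refl M. finite X)"
proof -
  obtain x y where xy: "x \<in> carrier M" "y \<in> carrier M" "x \<noteq> y" "\<not> rel M Rp x y" using two_points by blast
  obtain x' where x': "x' \<in> carrier M" "rel M Rp x x'" using mate_ex xy(1) by blast
  let ?X = "R_refl M `` {x}" and ?Y = "R_refl M `` {y}"
  have X: "?X \<in> carrier M // R_refl M" "?Y \<in> carrier M // R_refl M" using xy by (auto intro: quotientI)
  have ne: "(x, y) \<notin> R_refl M" using xy by (simp add: R_refl_def)
  then have "?X \<noteq> ?Y" using eq_equiv_class_iff[OF equiv_R_refl xy(1,2)] by blast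
  then have "realised_in M p (?X \<union> ?Y)" for p by (rule two_classes[OF X])
  moreover have "?X \<union> ?Y \<subseteq> carrier M" by (auto simp: R_refl_def)
  ultimately have 1: "realised_in M p (carrier M)" for p unfolding realised_in_def by blast
  have "(x, x') \<in> R_refl M" "x \<noteq> x'" using x' xy(1) irrefl by (auto simp: R_refl_def)
  then have 2: "R_refl M \<noteq> Id_on (carrier M)" by auto
  have 3: "R_refl M \<noteq> carrier M \<times> carrier M" using ne xy(1,2) by blast
  have "finite X" if "X \<in> carrier M // R_refl M" for X
  proof -
    obtain u where u: "u \<in> carrier M" "X = R_refl M `` {u}" using \<open>X \<in> _\<close> by (rule quotientE)
    then show ?thesis using R_class[OF u(1)] by (metis finite.emptyI finite_insert)
  qed
  then show ?thesis using 1 2 3 equiv_R_refl unfolding nontrivial_proper_equiv_def by blast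
qed

end

text \<open>
  Half graphs of some two quantifier-free types exist.  Neither equality nor closeness can
  distinguish these types, since both are equivalence relations; so the types are \<open>S\<close> and \<open>T\<close> in
  one order or the other, and reversing the indices exchanges them.
\<close>
lemma half_graphs_S_T:
  fixes M :: "'a struc"
  assumes tg: "three_graph M" and hom: "homogeneous M" and ne: "carrier M \<noteq> {}" and eqv: "equiv (carrier M) (R_refl M)"
    and unst: "\<not> stable_theory TYPE('u::infinite) (theory_of M)"
  shows "\<exists>x y :: nat \<Rightarrow> 'a. (\<forall>i<n. x i \<in> carrier M \<and> y i \<in> carrier M) \<and>
       (\<forall>i<n. \<forall>j<n. (i < j \<longrightarrow> rel M Sp (x i) (y j)) \<and> (j < i \<longrightarrow> rel M Tp (x i) (y j)))"
proof -
  interpret three_graph_struc M by unfold_locales (rule tg)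
  obtain t t' where t0: "t \<noteq> t' \<and> (\<forall>n. \<exists>x y :: nat \<Rightarrow> 'a. (\<forall>i<n. x i \<in> carrier M \<and> y i \<in> carrier M) \<and>
     (\<forall>i<n. \<forall>j<n. (i < j \<longrightarrow> kind M (x i) (y j) = t) \<and> (j < i \<longrightarrow> kind M (x i) (y j) = t')))"
    using long_kind_half_graphs[OF hom ne unst] by (elim exE)
  then have tt: "t \<noteq> t'" by (rule conjunct1)
  have hg: "\<exists>x y :: nat \<Rightarrow> 'a. (\<forall>i<n. x i \<in> carrier M \<and> y i \<in> carrier M) \<and>
     (\<forall>i<n. \<forall>j<n. (i < j \<longrightarrow> kind M (x i) (y j) = t) \<and> (j < i \<longrightarrow> kind M (x i) (y j) = t'))" for n
    using t0[THEN conjunct2, THEN spec[of _ n]] .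
  obtain x y where xy: "\<forall>i<6. x i \<in> carrier M \<and> y i \<in> carrier M"
     "\<forall>i<6. \<forall>j<6. (i < j \<longrightarrow> kind M (x i) (y j) = t) \<and> (j < i \<longrightarrow> kind M (x i) (y (j::nat)) = t')"
    using hg[of 6] by (elim exE conjE)
  have k: "kind M (x i) (y j) = t" if "i < j" "j < 6" for i j using xy(2) that by auto
  have k': "kind M (x i) (y j) = t'" if "j < i" "i < 6" for i j using xy(2) that by auto
  have xc: "x i \<in> carrier M" "y i \<in> carrier M" if "i < 6" for i using xy(1) that by auto
  \<comment> \<open>The path from \<open>x 3\<close> to \<open>y 1\<close> through \<open>y 5\<close> and \<open>x 0\<close> uses the first type only but joins a pair of the second type, and the path from \<open>x 1\<close> to \<open>y 2\<close> does the converse.\<close>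
  have both: "Q t \<longleftrightarrow> Q t'" if q: "\<And>u v. \<lbrakk>u \<in> carrier M; v \<in> carrier M\<rbrakk> \<Longrightarrow> Q (kind M u v) \<longleftrightarrow> (u, v) \<in> r" and r: "equiv (carrier M) r"
    for Q r
  proof -
    have zig: "(u, v') \<in> r" if "(u, v) \<in> r" "(u', v) \<in> r" "(u', v') \<in> r" for u v u' v'
      using that r by (meson equiv_def symD transD)
    have Qt: "Q t \<longleftrightarrow> (x i, y j) \<in> r" if "i < j" "j < 6" for i j
      using q[of "x i" "y j"] xc that k[OF that] by simp
    have Qt': "Q t' \<longleftrightarrow> (x i, y j) \<in> r" if "j < i" "i < 6" for i j
      using q[of "x i" "y j"] xc that k'[OF that] by simp
    show ?thesis
      using Qt[of 3 5] Qt[of 0 5] Qt[of 0 1] Qt'[of 1 3] zig[of "x 3" "y 5" "x 0" "y 1"]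
        Qt'[of 0 1] Qt'[of 0 3] Qt'[of 2 3] Qt[of 1 2] zig[of "x 1" "y 0" "x 3" "y 2"] by auto
  qed
  have "equiv (carrier M) (Id_on (carrier M))" by (rule equivI) (auto simp: refl_on_def sym_def trans_def)
  then have 1: "fst t \<longleftrightarrow> fst t'"
    by (intro both[of fst "Id_on (carrier M)"]) (auto simp: kind_def)
  have 2: "(fst t \<or> fst (snd t)) \<longleftrightarrow> (fst t' \<or> fst (snd t'))"
    by (rule both[of "\<lambda>t. fst t \<or> fst (snd t)", OF _ eqv]) (simp add: kind_def R_refl_def)
  define S where "S = (False, False, True, False)"
  define T where "T = (False, False, False, True)"
  have four: "kind M u v \<in> {(True, False, False, False), (False, True, False, False), S, T}"
    if "u \<in> carrier M" "v \<in> carrier M" for u v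
    using that by (rule rel_cases) (simp_all add: kind_def S_def T_def)
  have "t \<in> {(True, False, False, False), (False, True, False, False), S, T}" using four[of "x 0" "y 1"] xc k[of 0 1] by simp
  moreover have "t' \<in> {(True, False, False, False), (False, True, False, False), S, T}" using four[of "x 1" "y 0"] xc k'[of 0 1] by simp
  ultimately have "t = S \<and> t' = T \<or> t = T \<and> t' = S" using 1 2 tt
    by (elim insertE emptyE) (simp_all add: S_def T_def)
  moreover have kS: "rel M Sp u v" if "kind M u v = S" for u v using that by (simp add: kind_def S_def)
  moreover have kT: "rel M Tp u v" if "kind M u v = T" for u v using that by (simp add: kind_def T_def)
  moreover obtain x y where xy: "\<forall>i<n. x i \<in> carrier M \<and> y i \<in> carrier M"
     "\<forall>i<n. \<forall>j<n. (i < j \<longrightarrow> kind M (x i) (y j) = t) \<and> (j < i \<longrightarrow> kind M (x i) (y (j::nat)) = t')"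
    using hg[of n] by (elim exE conjE)
  ultimately consider "t = S" "t' = T" | "t = T" "t' = S" by blast
  then show ?thesis
  proof cases
    case 1
    show ?thesis by (rule exI[of _ x], rule exI[of _ y]) (use xy 1 kS kT in simp)
  next
    case 2
    have rS: "rel M Sp (x (n - Suc i)) (y (n - Suc j))" if "i < j" "j < n" for i j
    proof -
      have "n - Suc j < n - Suc i" "n - Suc i < n" "n - Suc j < n" using that by auto
      then show ?thesis using xy(2) 2 kS by simp
    qed
    have rT: "rel M Tp (x (n - Suc i)) (y (n - Suc j))" if "j < i" "i < n" for i j
    proof -
      have "n - Suc i < n - Suc j" "n - Suc i < n" "n - Suc j < n" using that by auto
      then show ?thesis using xy(2) 2 kT by simp
    qed
    have rc: "x (n - Suc i) \<in> carrier M \<and> y (n - Suc i) \<in> carrier M" if "i < n" for i using xy(1) that by simp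
    show ?thesis
      by (rule exI[of _ "\<lambda>i. x (n - Suc i)"], rule exI[of _ "\<lambda>i. y (n - Suc i)"]) (simp add: rS rT rc)
  qed
qed

lemma finite_class_struc_of_theory:
  fixes M :: "'a struc"
  assumes "simple_unstable_finite_classes TYPE('u::infinite) M"
  shows "finite_class_struc M"
proof -
  have tg: "three_graph M" and hom: "homogeneous M" and re: "realised_in M Rp (carrier M)"
    and unst: "\<not> stable_theory TYPE('u) (theory_of M)" and eqv: "equiv (carrier M) (R_refl M)"
    and fin: "\<forall>X\<in>carrier M // R_refl M. finite X"
    and cr: "\<forall>X\<in>carrier M // R_refl M. \<forall>Y\<in>carrier M // R_refl M. X \<noteq> Y \<longrightarrow> (\<forall>p. realised_in M p (X \<union> Y))"
    using assms unfolding simple_unstable_finite_classes_def homogeneous_three_graph_def nontrivial_proper_equiv_def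
    by blast+
  interpret three_graph_struc M by unfold_locales (rule tg)
  have ne: "carrier M \<noteq> {}" using re by (auto simp: realised_in_def)
  have cls: "R_refl M `` {x} = {y \<in> carrier M. y = x \<or> rel M Rp x y}" if "x \<in> carrier M" for x
    using that by (auto simp: R_refl_def)
  show ?thesis
  proof unfold_locales
    show "homogeneous M" by (rule hom)
  next
    fix x y z assume h: "x \<in> carrier M" "y \<in> carrier M" "z \<in> carrier M" "rel M Rp x y" "rel M Rp y z" "x \<noteq> z"
    then have "(x, y) \<in> R_refl M" "(y, z) \<in> R_refl M" by (auto simp: R_refl_def)
    then have "(x, z) \<in> R_refl M" using eqv by (meson equiv_def transD)
    then show "rel M Rp x z" using h(6) by (simp add: R_refl_def)
  next
    fix x assume x: "x \<in> carrier M"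
    then have "finite (R_refl M `` {x})" using fin by (auto intro: quotientI)
    then show "finite {y \<in> carrier M. y = x \<or> rel M Rp x y}" unfolding cls[OF x] .
  next
    fix x y p assume h: "x \<in> carrier M" "y \<in> carrier M" "x \<noteq> y" "\<not> rel M Rp x y" "p \<noteq> Rp"
    let ?X = "R_refl M `` {x}" and ?Y = "R_refl M `` {y}"
    have "(x, y) \<notin> R_refl M" using h(3,4) by (simp add: R_refl_def)
    then have "?X \<noteq> ?Y" using eq_equiv_class_iff[OF eqv h(1,2)] by simp
    then have "realised_in M p (?X \<union> ?Y)"
      using cr[THEN bspec[OF _ quotientI[OF h(1)]], THEN bspec[OF _ quotientI[OF h(2)]]] by simp
    then obtain u v where uv: "u \<in> ?X \<union> ?Y" "v \<in> ?X \<union> ?Y" "rel M p u v" unfolding realised_in_def by blast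
    have "?X \<union> ?Y \<subseteq> carrier M" by (auto simp: R_refl_def)
    then have uvc: "u \<in> carrier M" "v \<in> carrier M" using subsetD[OF _ uv(1)] subsetD[OF _ uv(2)] by simp_all
    have "\<not> rel M Rp u v \<and> u \<noteq> v"
      using uvc(1) uvc(2) by (rule rel_cases) (use uv(3) h(5) in \<open>(cases p; simp)+\<close>)
    then have "(u, v) \<notin> R_refl M" by (simp add: R_refl_def)
    moreover have "(u, v) \<in> R_refl M" if "(w, u) \<in> R_refl M" "(w, v) \<in> R_refl M" for w
      using transD[OF _ symD[OF _ that(1)] that(2)] eqv unfolding equiv_def by blast
    ultimately have "\<not> (u \<in> ?X \<and> v \<in> ?X)" "\<not> (u \<in> ?Y \<and> v \<in> ?Y)"
      unfolding Image_singleton_iff by blast+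
    then have "u \<in> ?X \<and> v \<in> ?Y \<or> v \<in> ?X \<and> u \<in> ?Y" using uv by blast
    moreover have "rel M p v u" using uv(3) rel_sym[OF uvc] by blast
    ultimately show "\<exists>u\<in>carrier M. \<exists>v\<in>carrier M. (u = x \<or> rel M Rp x u) \<and> (v = y \<or> rel M Rp y v) \<and> rel M p u v"
      using uvc uv(3) unfolding cls[OF h(1)] cls[OF h(2)] by blast
  next
    fix n
    show "\<exists>x y :: nat \<Rightarrow> 'a. (\<forall>i<n. x i \<in> carrier M \<and> y i \<in> carrier M) \<and>
       (\<forall>i<n. \<forall>j<n. (i < j \<longrightarrow> rel M Sp (x i) (y j)) \<and> (j < i \<longrightarrow> rel M Tp (x i) (y j)))"
      by (rule half_graphs_S_T[OF tg hom ne eqv unst])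
  qed
qed

section \<open>The classification\<close>

lemma random_cover_theory:
  fixes M :: "'a struc"
  assumes M: "random_cover M" "countable (carrier M)"
  shows "simple_unstable_finite_classes TYPE('u::infinite) M"
proof -
  interpret M: random_cover_struc M by unfold_locales (rule M)
  have hom: "homogeneous M" by (rule random_cover_homogeneous[OF M])
  have "simple_theory TYPE('u) (theory_of M)" unfolding simple_theory_def
  proof (intro allI impI, elim conjE)
    fix N :: "'u struc" and \<phi> n m
    assume N: "model_of N (theory_of M)" and \<phi>: "partitioned \<phi> n m"
    interpret N: random_cover_struc N by unfold_locales (rule model_random_cover[OF M N])
    interpret theory_model M N by unfold_locales (fact hom M.nonempty N)+
    show "\<not> tree_property N \<phi> n m"
    proof (rule N.no_tree_property)
      fix e d
      assume h: "e ` {..<n+m} \<subseteq> carrier N" "d ` {..<n+m} \<subseteq> carrier N" "same_type N e N d {..<n+m}"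
      show "sat N e \<phi> \<longleftrightarrow> sat N d \<phi>"
        using \<phi> by (intro quantifier_elimination[OF _ _ h]) (simp_all add: partitioned_def)
    qed
  qed
  moreover have "\<not> stable_theory TYPE('u) (theory_of M)" by (rule M.unstable[OF M(2)])
  ultimately show ?thesis
    using M.tg hom M.three_graph_properties M.two_classes
    unfolding simple_unstable_finite_classes_def homogeneous_three_graph_def by simp
qed

theorem theorem1p21:
  fixes E :: "nat \<Rightarrow> nat \<Rightarrow> bool"
  assumes "random_graph E"
  shows "simple_unstable_finite_classes TYPE('u::infinite) (C_graph E) \<and>
    (\<forall>M :: 'a struc. simple_unstable_finite_classes TYPE('u) M \<longrightarrow>
       isomorphic M (C_graph E))"
proof (intro conjI allI impI)
  have C: "random_cover (C_graph E)" "countable (carrier (C_graph E))"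
    using C_graph_random_cover[OF assms] by simp_all
  show "simple_unstable_finite_classes TYPE('u) (C_graph E)" by (rule random_cover_theory[OF C])
  fix M :: "'a struc"
  assume M: "simple_unstable_finite_classes TYPE('u) M"
  have cM: "countable (carrier M)"
    using M by (simp add: simple_unstable_finite_classes_def homogeneous_three_graph_def homogeneous_def)
  have "random_cover M" by (rule finite_class_struc.is_random_cover[OF finite_class_struc_of_theory[OF M]])
  then show "isomorphic M (C_graph E)" by (rule random_cover_isomorphic[OF _ cM C])
qed

end
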